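(* Let $\mathfrak{g}$ be a finite-dimensional complex simple Lie algebra, let $P=P(M_\bullet)$ be an MV polytope, and let $j\in I$. Set $$m=m(j,P)=M_{\varpi_j}-M_{-s_j\varpi_j}-M_{s_j\varpi_j}.$$ Then $m\ge0$, and for every positive integer $k>m$ we have $AM_j(\widetilde f_j^{\,k}(P))=\widetilde f_j^{\,k+1}(P)$. Moreover, write $P^{(k)}=P(M^{(k)}_\bullet)=\widetilde f_j^{\,k}(P)$ and $P^{(k+1)}=P(M^{(k+1)}_\bullet)=\widetilde f_j^{\,k+1}(P)$. Then $M^{(k+1)}_\gamma=M^{(k)}_\gamma$ if $\gamma\in\Gamma^j$, and $$M^{(k+1)}_\gamma=M^{(k)}_{s_j\gamma}+c_j(P^{(k)})\langle h_j,\gamma\rangle\quad\text{if }\gamma\in\Gamma_j.$$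
   Context: Notation. $\mathfrak{g}$ has index set $I$, simple roots $\alpha_i$, simple coroots $h_i$, fundamental weights $\varpi_i$, and Cartan matrix $c_{ij}=\langle h_i,\alpha_j\rangle$. $W$ is the Weyl group, with simple reflections $s_i$ and longest element $w_0$. $\mathfrak{h}_{\mathbb{R}}$ is the real span of the coweight lattice. The chamber weights are $\Gamma=\{w\varpi_i\}$; note $-s_j\varpi_j\in\Gamma$. Let $W_j^-=\{w:s_jw<w\}$ and $W_j^+=\{w:s_jw>w\}$. Set $\Gamma^j=\{w\varpi_i: w\in W_j^-, i\in I\}$ and $\Gamma_j=\Gamma\setminus\Gamma^j$. MV polytopes. A collection of integers $M_\bullet=(M_\gamma)_{\gamma\in\Gamma}$ satisfying the edge inequalities $M_{w\varpi_i}+M_{ws_i\varpi_i}+\sum_{k\ne i}c_{ki}M_{w\varpi_k}\le0$ gives the pseudo-Weyl polytope $P(M_\bullet)=\{h\in\mathfrak{h}_{\mathbb{R}}:\langle h,\gamma\rangle\ge M_\gamma\ \forall\gamma\}$. Its GGMS datum $(\mu_w)$ is given by $\langle\mu_w,w\varpi_i\rangle=M_{w\varpi_i}$. $P(M_\bullet)$ is an MV polytope if $M_\bullet$ also satisfies Kamnitzer's tropical Plücker relations. MV polytopes are taken up to translation, with $\mu_{w_0}=0$. Kashiwara operator. $\widetilde f_j$ is the Kashiwara operator on MV polytopes (transported from Lusztig's canonical basis via Kamnitzer's bijection). It is characterized by $\widetilde f_jP(M_\bullet)=P(M'_\bullet)$, where $M'_\bullet$ is the unique MV datum with $M'_{\varpi_j}=M_{\varpi_j}-1$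 and $M'_\gamma=M_\gamma$ for $\gamma=w\varpi_i$ with $w\in W_j^-$. AM operator. Define $c_j(P)=M_{\varpi_j}-M_{s_j\varpi_j}-1$ and $r_j(x)=s_j(x)+c_j(P)h_j$. Then $AM_j(P)$ is the smallest pseudo-Weyl polytope $P'$, with GGMS datum $\mu'$, such that: (i) $\mu'_w=\mu_w$ for $w\in W_j^-$; (ii) $\mu'_e=\mu_e-h_j$; (iii) $P'\ni\mu_w$ for $w\in W_j^+$; (iv) $P'\ni r_j(\mu_w)$ for each $w\in W_j^-$ with $\langle\mu_w,\alpha_j\rangle\ge c_j(P)$. *)

theory Defs
  imports Complex_Main
begin

text \<open>The Lie algebra g is encoded by its Cartan matrix C, C i j = <h_i, alpha_j>,
  on a finite index type 'i.  Finite-dimensional complex simple Lie algebras correspond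
  (Serre, Kac Prop. 4.9) exactly to indecomposable generalized Cartan matrices of finite
  type, i.e. symmetrizable with positive definite symmetrization.\<close>

definition gen_cartan :: "('i \<Rightarrow> 'i \<Rightarrow> int) \<Rightarrow> bool" where
  "gen_cartan C \<longleftrightarrow> (\<forall>i. C i i = 2) \<and> (\<forall>i j. i \<noteq> j \<longrightarrow> C i j \<le> 0)
     \<and> (\<forall>i j. C i j = 0 \<longleftrightarrow> C j i = 0)"

definition indecomposable :: "('i \<Rightarrow> 'i \<Rightarrow> int) \<Rightarrow> bool" where
  "indecomposable C \<longleftrightarrow>
     (\<forall>J. J \<noteq> {} \<and> J \<noteq> UNIV \<longrightarrow> (\<exists>i\<in>J. \<exists>j. j \<notin> J \<and> C i j \<noteq> 0))"

definition finite_type :: "('i::finite \<Rightarrow> 'i \<Rightarrow> int) \<Rightarrow> bool" where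
  "finite_type C \<longleftrightarrow> (\<exists>d :: 'i \<Rightarrow> real. (\<forall>i. d i > 0)
      \<and> (\<forall>i j. d i * of_int (C i j) = d j * of_int (C j i))
      \<and> (\<forall>x :: 'i \<Rightarrow> real. x \<noteq> (\<lambda>_. 0) \<longrightarrow>
            (\<Sum>i\<in>UNIV. \<Sum>j\<in>UNIV. x i * d i * of_int (C i j) * x j) > 0))"

definition simple_cartan :: "('i::finite \<Rightarrow> 'i \<Rightarrow> int) \<Rightarrow> bool" where
  "simple_cartan C \<longleftrightarrow> gen_cartan C \<and> indecomposable C \<and> finite_type C"

subsection \<open>Weights (coordinates lambda_k = <h_k, lambda>) and coweights\<close>

type_synonym 'i wt = "'i \<Rightarrow> int"
type_synonym 'i cowt = "'i \<Rightarrow> real"  \<comment> \<open>h = sum_k h k * h_k, i.e. h k = <h, varpi_k>\<close>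

definition fw :: "'i \<Rightarrow> 'i wt" where "fw i = (\<lambda>k. if k = i then 1 else 0)"

definition sroot :: "('i \<Rightarrow> 'i \<Rightarrow> int) \<Rightarrow> 'i \<Rightarrow> 'i wt" where
  "sroot C j = (\<lambda>k. C k j)"

definition coroot :: "'i \<Rightarrow> 'i cowt" where "coroot j = (\<lambda>k. if k = j then 1 else 0)"

definition pair :: "'i::finite cowt \<Rightarrow> 'i wt \<Rightarrow> real" where
  "pair h lam = (\<Sum>k\<in>UNIV. h k * of_int (lam k))"

definition srefl :: "('i \<Rightarrow> 'i \<Rightarrow> int) \<Rightarrow> 'i \<Rightarrow> 'i wt \<Rightarrow> 'i wt" where
  "srefl C i lam = (\<lambda>k. lam k - lam i * C k i)"

definition csrefl :: "('i::finite \<Rightarrow> 'i \<Rightarrow> int) \<Rightarrow> 'i \<Rightarrow> 'i cowt \<Rightarrow> 'i cowt" where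
  "csrefl C i h = (\<lambda>k. h k - pair h (sroot C i) * coroot i k)"

subsection \<open>Weyl group, acting (faithfully) on weights\<close>

definition wact :: "('i \<Rightarrow> 'i \<Rightarrow> int) \<Rightarrow> 'i list \<Rightarrow> 'i wt \<Rightarrow> 'i wt" where
  "wact C ws = foldr (\<lambda>i f. srefl C i \<circ> f) ws id"

definition weyl :: "('i \<Rightarrow> 'i \<Rightarrow> int) \<Rightarrow> ('i wt \<Rightarrow> 'i wt) set" where
  "weyl C = range (wact C)"

definition wlen :: "('i \<Rightarrow> 'i \<Rightarrow> int) \<Rightarrow> ('i wt \<Rightarrow> 'i wt) \<Rightarrow> nat" where
  "wlen C w = (LEAST n. \<exists>ws. length ws = n \<and> wact C ws = w)"

definition Wminus :: "('i \<Rightarrow> 'i \<Rightarrow> int) \<Rightarrow> 'i \<Rightarrow> ('i wt \<Rightarrow> 'i wt) set" where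
  "Wminus C j = {w \<in> weyl C. wlen C (srefl C j \<circ> w) < wlen C w}"

definition Wplus :: "('i \<Rightarrow> 'i \<Rightarrow> int) \<Rightarrow> 'i \<Rightarrow> ('i wt \<Rightarrow> 'i wt) set" where
  "Wplus C j = {w \<in> weyl C. wlen C w < wlen C (srefl C j \<circ> w)}"

definition longest :: "('i \<Rightarrow> 'i \<Rightarrow> int) \<Rightarrow> ('i wt \<Rightarrow> 'i wt) \<Rightarrow> bool" where
  "longest C w \<longleftrightarrow> w \<in> weyl C \<and> (\<forall>v\<in>weyl C. wlen C v \<le> wlen C w)"

definition chamber :: "('i \<Rightarrow> 'i \<Rightarrow> int) \<Rightarrow> 'i wt set" where
  "chamber C = {w (fw i) | w i. w \<in> weyl C}"

definition chamber_up :: "('i \<Rightarrow> 'i \<Rightarrow> int) \<Rightarrow> 'i \<Rightarrow> 'i wt set" where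
  "chamber_up C j = {w (fw i) | w i. w \<in> Wminus C j}"

definition chamber_low :: "('i \<Rightarrow> 'i \<Rightarrow> int) \<Rightarrow> 'i \<Rightarrow> 'i wt set" where
  "chamber_low C j = chamber C - chamber_up C j"

text \<open>A datum M is a function on weights; only its values on Gamma matter, and we fix the
  convention that it vanishes off Gamma (so data are determined by their values on Gamma).\<close>
type_synonym 'i datum = "'i wt \<Rightarrow> int"

definition polytope :: "('i::finite \<Rightarrow> 'i \<Rightarrow> int) \<Rightarrow> 'i datum \<Rightarrow> 'i cowt set" where
  "polytope C M = {h. \<forall>\<gamma>\<in>chamber C. pair h \<gamma> \<ge> of_int (M \<gamma>)}"

text \<open>minus the left-hand side of the edge inequality at (w,i): the length of the edge
  from mu_w to mu_{w s_i} (measured in units of w h_i)\<close>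
definition edge_len :: "('i::finite \<Rightarrow> 'i \<Rightarrow> int) \<Rightarrow> 'i datum \<Rightarrow> ('i wt \<Rightarrow> 'i wt) \<Rightarrow> 'i \<Rightarrow> int" where
  "edge_len C M w i = - (M (w (fw i)) + M (w (srefl C i (fw i)))
                         + (\<Sum>k\<in>UNIV - {i}. C k i * M (w (fw k))))"

definition pw_datum :: "('i::finite \<Rightarrow> 'i \<Rightarrow> int) \<Rightarrow> 'i datum \<Rightarrow> bool" where
  "pw_datum C M \<longleftrightarrow> (\<forall>\<gamma>. \<gamma> \<notin> chamber C \<longrightarrow> M \<gamma> = 0)
      \<and> (\<forall>w\<in>weyl C. \<forall>i. edge_len C M w i \<ge> 0)"

definition ggms :: "('i::finite \<Rightarrow> 'i \<Rightarrow> int) \<Rightarrow> 'i datum \<Rightarrow> ('i wt \<Rightarrow> 'i wt) \<Rightarrow> 'i cowt" where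
  "ggms C M w = (THE h. \<forall>i. pair h (w (fw i)) = of_int (M (w (fw i))))"

text \<open>Lusztig's piecewise-linear transition maps for rank 2, i.e. the change of the
  Lusztig datum of a rank-2 MV polygon between the two reduced words of the longest
  element.  Type A2: explicit.  Type B2 (first letter i with C i j = -2): the
  Lusztig/Berenstein-Zelevinsky formula.  Type G2 (first letter i with C i j = -3):
  obtained by Lusztig's folding from D4, as a composition of A2 braid moves (True, p)
  and commutation moves (False, p) on the unfolded word (1,3,4,2,1,3,4,2,1,3,4,2).\<close>

definition a2_trans :: "int list \<Rightarrow> int list" where
  "a2_trans t = (let p = min (t!0) (t!2) in [t!1 + t!2 - p, p, t!0 + t!1 - p])"

definition b2_trans :: "int list \<Rightarrow> int list" where
  "b2_trans t = (let t1 = t!0; t2 = t!1; t3 = t!2; t4 = t!3;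
      p1 = min (t1 + t2) (min (t1 + t4) (t3 + t4));
      p2 = min (2*t1 + t2) (min (2*t1 + t4) (2*t3 + t4))
    in [t2 + 2*t3 + t4 - p2, p2 - p1, 2*p1 - p2, t1 + t2 + t3 - p1])"

fun move :: "bool \<times> nat \<Rightarrow> int list \<Rightarrow> int list" where
  "move (False, p) d = d[p := d!(p+1), p+1 := d!p]"
| "move (True, p) d = (let a = d!p; b = d!(p+1); c = d!(p+2); q = min a c
                        in d[p := b + c - q, p+1 := q, p+2 := a + b - q])"

definition g2_moves :: "(bool \<times> nat) list" where
  "g2_moves = [(False, 4), (False, 5), (False, 4), (True, 2), (True, 6), (True, 4),
     (False, 3), (False, 6), (True, 1), (True, 3), (False, 5), (True, 7), (True, 9),
     (False, 8), (True, 6), (True, 4), (False, 3), (False, 2), (False, 6), (True, 0),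
     (True, 4), (True, 2), (False, 4), (True, 8), (False, 7), (True, 5), (True, 3),
     (False, 5), (True, 7), (False, 6), (False, 5)]"

definition g2_trans :: "int list \<Rightarrow> int list" where
  "g2_trans t = (let d = fold move g2_moves
        [t!0, t!0, t!0, t!1, t!2, t!2, t!2, t!3, t!4, t!4, t!4, t!5]
     in [d!0, d!1, d!4, d!5, d!8, d!9])"

definition alt :: "'i \<Rightarrow> 'i \<Rightarrow> nat \<Rightarrow> 'i list" where
  "alt i j k = map (\<lambda>l. if even l then i else j) [0..<k]"

text \<open>Lusztig datum of the 2-face at w along the path w, w s_i, w s_i s_j, ...\<close>
definition face_datum :: "('i::finite \<Rightarrow> 'i \<Rightarrow> int) \<Rightarrow> 'i datum \<Rightarrow> ('i wt \<Rightarrow> 'i wt)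
      \<Rightarrow> 'i \<Rightarrow> 'i \<Rightarrow> nat \<Rightarrow> int list" where
  "face_datum C M w i j m =
     map (\<lambda>k. edge_len C M (w \<circ> wact C (alt i j k)) (if even k then i else j)) [0..<m]"

definition tropical_pluecker :: "('i::finite \<Rightarrow> 'i \<Rightarrow> int) \<Rightarrow> 'i datum \<Rightarrow> bool" where
  "tropical_pluecker C M \<longleftrightarrow>
     (\<forall>w\<in>weyl C. \<forall>i j. i \<noteq> j \<and> C i j \<noteq> 0 \<and> C i j \<le> C j i
        \<and> wlen C w < wlen C (w \<circ> srefl C i) \<and> wlen C w < wlen C (w \<circ> srefl C j) \<longrightarrow>
        (if C i j * C j i = 1 then face_datum C M w j i 3 = a2_trans (face_datum C M w i j 3)
         else if C i j * C j i = 2 then face_datum C M w j i 4 = b2_trans (face_datum C M w i j 4)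
         else face_datum C M w j i 6 = g2_trans (face_datum C M w i j 6)))"

text \<open>MV datum, normalized by mu_{w_0} = 0\<close>
definition mv_datum :: "('i::finite \<Rightarrow> 'i \<Rightarrow> int) \<Rightarrow> 'i datum \<Rightarrow> bool" where
  "mv_datum C M \<longleftrightarrow> pw_datum C M \<and> tropical_pluecker C M
      \<and> (\<forall>w. longest C w \<longrightarrow> (\<forall>i. M (w (fw i)) = 0))"

definition kashiwara_f :: "('i::finite \<Rightarrow> 'i \<Rightarrow> int) \<Rightarrow> 'i \<Rightarrow> 'i datum \<Rightarrow> 'i datum" where
  "kashiwara_f C j M = (THE M'. mv_datum C M' \<and> M' (fw j) = M (fw j) - 1
      \<and> (\<forall>w\<in>Wminus C j. \<forall>i. M' (w (fw i)) = M (w (fw i))))"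

definition cj :: "('i \<Rightarrow> 'i \<Rightarrow> int) \<Rightarrow> 'i \<Rightarrow> 'i datum \<Rightarrow> int" where
  "cj C j M = M (fw j) - M (srefl C j (fw j)) - 1"

definition rj :: "('i::finite \<Rightarrow> 'i \<Rightarrow> int) \<Rightarrow> 'i \<Rightarrow> 'i datum \<Rightarrow> 'i cowt \<Rightarrow> 'i cowt" where
  "rj C j M x = (\<lambda>k. csrefl C j x k + of_int (cj C j M) * coroot j k)"

definition am_cond :: "('i::finite \<Rightarrow> 'i \<Rightarrow> int) \<Rightarrow> 'i \<Rightarrow> 'i datum \<Rightarrow> 'i datum \<Rightarrow> bool" where
  "am_cond C j M M' \<longleftrightarrow> pw_datum C M'
     \<and> (\<forall>w\<in>Wminus C j. ggms C M' w = ggms C M w)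
     \<and> ggms C M' id = (\<lambda>k. ggms C M id k - coroot j k)
     \<and> (\<forall>w\<in>Wplus C j. ggms C M w \<in> polytope C M')
     \<and> (\<forall>w\<in>Wminus C j. pair (ggms C M w) (sroot C j) \<ge> of_int (cj C j M)
            \<longrightarrow> rj C j M (ggms C M w) \<in> polytope C M')"

definition am :: "('i::finite \<Rightarrow> 'i \<Rightarrow> int) \<Rightarrow> 'i \<Rightarrow> 'i datum \<Rightarrow> 'i datum" where
  "am C j M = (THE M'. am_cond C j M M'
      \<and> (\<forall>M''. am_cond C j M M'' \<longrightarrow> polytope C M' \<subseteq> polytope C M''))"

end

theory Submission
  imports Defs "HOL-Analysis.Cartesian_Space"
begin

text \<open>A datum is determined by its Lusztig datum along a single reduced word of \<open>w0\<close>, and every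
  tuple of naturals occurs: braid moves transport the tuple to all other reduced words, and this
  is independent of the chosen moves because by induction on length it reduces to the loops of
  rank three, where it follows by tropicalising identities between positive matrices.  Hence
  \<open>kashiwara_f\<close> is well defined.

  For an edge from \<open>w\<close> to \<open>w s\<^sub>i\<close> that crosses the wall of \<open>s\<^sub>j\<close>, consider the difference of the
  values at \<open>w \<varpi>\<^sub>i\<close> and \<open>w s\<^sub>i \<varpi>\<^sub>i\<close>.  Moving up along the wall through 2-faces it does not increase;
  it starts with the value \<open>M(\<varpi>\<^sub>j) - M(s\<^sub>j \<varpi>\<^sub>j)\<close> and ends with \<open>M(- s\<^sub>j \<varpi>\<^sub>j)\<close>, so \<open>m \<ge> 0\<close>.  If
  \<open>c = M(\<varpi>\<^sub>j) - M(s\<^sub>j \<varpi>\<^sub>j) - k\<close> is at most the last value, then the upper half of the polytope and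
  its mirror image under \<open>x \<mapsto> s\<^sub>j x + c h\<^sub>j\<close> fit together to a datum which satisfies the tropical
  Pluecker relations also across the wall, so this is the \<open>k\<close>-th power of \<open>kashiwara_f\<close>.  It is
  symmetric under this reflection, which gives the formula for \<open>M\<^sup>(\<^sup>k\<^sup>+\<^sup>1\<^sup>)\<close>, and every vertex of it lies
  in each polytope admitted in the definition of \<open>am\<close>.\<close>

text \<open>The tropical Pluecker relations only constrain single 2-faces, so it is not formal that
  a datum with prescribed edge lengths exists: different chains of braid moves between the same
  words must transport a tuple in the same way. This is the main obstacle. Positive definiteness
  leaves few loops to check. Three letters never form a cycle, and on a path of three letters the
  products \<open>C i j * C j i\<close> of the two bonds sum to less than 4. So a triple is either a
  product of A1 with rank two, where a commutation argument works in every type including G2, or of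
  type A3, B3 or C3. Explicit loops of words settle A3 and C3; B3 is deduced from C3 by rescaling
  the tuples.

  The second obstacle is G2, whose transition map is given as a chain of D4 moves. The wall argument
  has to know at which terms the minima are attained, hence the closed formulas.

  The number m is the value of k at which the constant of the reflection equals the last difference
  along the wall.\<close>

locale fin_cartan =
  fixes C :: "'i::finite \<Rightarrow> 'i \<Rightarrow> int"
  assumes gen_cartan: "gen_cartan C" and finite_type: "finite_type C"
begin

section \<open>Cartan matrices of finite type and their small submatrices\<close>

lemma diag [simp]: "C i i = 2"
  using gen_cartan by (simp add: gen_cartan_def)

lemma offdiag: "i \<noteq> j \<Longrightarrow> C i j \<le> 0"
  using gen_cartan by (simp add: gen_cartan_def)

lemma zero_sym: "C i j = 0 \<longleftrightarrow> C j i = 0"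
  using gen_cartan[unfolded gen_cartan_def, THEN conjunct2, THEN conjunct2] by metis

lemma form:
  obtains d :: "'i \<Rightarrow> real" where "\<And>i. d i > 0"
    "\<And>i j. d i * of_int (C i j) = d j * of_int (C j i)"
    "\<And>x. x \<noteq> (\<lambda>_. 0) \<Longrightarrow> (\<Sum>i\<in>UNIV. \<Sum>j\<in>UNIV. x i * d i * of_int (C i j) * x j) > 0"
proof -
  from finite_type[unfolded finite_type_def] obtain d :: "'i \<Rightarrow> real" where d: "\<forall>i. d i > 0"
    "\<forall>i j. d i * of_int (C i j) = d j * of_int (C j i)"
    "\<forall>x. x \<noteq> (\<lambda>_. 0) \<longrightarrow> (\<Sum>i\<in>UNIV. \<Sum>j\<in>UNIV. x i * d i * of_int (C i j) * x j) > 0"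
    by (elim exE conjE)
  show thesis by (rule that[OF d[rule_format]])
qed

lemma sum_supp:
  fixes g :: "'i \<Rightarrow> real"
  assumes "\<And>i. i \<notin> S \<Longrightarrow> g i = 0"
  shows "(\<Sum>i\<in>UNIV. g i) = (\<Sum>i\<in>S. g i)"
  by (rule sum.mono_neutral_right) (auto simp: assms)

lemma sqrt_form:
  assumes d: "\<And>i. d i > 0" "\<And>i j. d i * of_int (C i j) = d j * of_int (C j i)" and "i \<noteq> j"
  shows "d i * of_int (C i j) = - sqrt (d i) * sqrt (d j) * sqrt (of_int (C i j * C j i))"
proof -
  have "(d i * of_int (C i j))^2 = d i * d j * of_int (C i j * C j i)"
    using d(2)[of i j] by (simp add: power2_eq_square algebra_simps)
  moreover have "d i * of_int (C i j) \<le> 0"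
    using d(1)[of i] offdiag[OF assms(3)] by (simp add: mult_nonneg_nonpos)
  ultimately have "- (d i * of_int (C i j)) = sqrt (d i * d j * of_int (C i j * C j i))"
    by (metis abs_of_nonpos real_sqrt_abs)
  then show ?thesis by (simp add: real_sqrt_mult)
qed

text \<open>Rescaling the coordinates by \<open>sqrt (d p)\<close> turns the symmetrised form into
  one whose entries depend only on the products \<open>C p q * C q p\<close>. Vectors supported on
  \<open>S\<close> give the bounds for small subdiagrams.\<close>

lemma gram_pos:
  fixes y :: "'i \<Rightarrow> real"
  assumes "y \<noteq> (\<lambda>_. 0)" and S: "\<And>p. p \<notin> S \<Longrightarrow> y p = 0"
  shows "0 < (\<Sum>p\<in>S. \<Sum>q\<in>S. y p * y q * (if p = q then 2 else - sqrt (of_int (C p q * C q p))))"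
proof -
  obtain d :: "'i \<Rightarrow> real" where d: "\<And>i. d i > 0"
    "\<And>i j. d i * of_int (C i j) = d j * of_int (C j i)"
    "\<And>x. x \<noteq> (\<lambda>_. 0) \<Longrightarrow> (\<Sum>i\<in>UNIV. \<Sum>j\<in>UNIV. x i * d i * of_int (C i j) * x j) > 0"
    using form by blast
  define f where "f = (\<lambda>p. y p / sqrt (d p))"
  have y: "y p = f p * sqrt (d p)" for p using d(1)[of p] by (simp add: f_def less_imp_neq[symmetric])
  have "f \<noteq> (\<lambda>_. 0)"
  proof
    assume "f = (\<lambda>_. 0)"
    then have "y = (\<lambda>_. 0)" by (simp add: y fun_eq_iff)
    with assms(1) show False by contradiction
  qed
  then have "0 < (\<Sum>p\<in>UNIV. \<Sum>q\<in>UNIV. f p * d p * of_int (C p q) * f q)"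
    by (rule d(3))
  also have "\<dots> = (\<Sum>p\<in>S. \<Sum>q\<in>S. f p * d p * of_int (C p q) * f q)"
  proof -
    have f: "f p = 0" if "p \<notin> S" for p using S[OF that] by (simp add: f_def)
    have "(\<Sum>p\<in>UNIV. \<Sum>q\<in>UNIV. f p * d p * of_int (C p q) * f q)
      = (\<Sum>p\<in>S. \<Sum>q\<in>UNIV. f p * d p * of_int (C p q) * f q)"
      by (rule sum_supp) (simp add: f)
    also have "\<dots> = (\<Sum>p\<in>S. \<Sum>q\<in>S. f p * d p * of_int (C p q) * f q)"
      by (intro sum.cong refl sum_supp) (simp add: f)
    finally show ?thesis .
  qed
  also have "\<dots> = (\<Sum>p\<in>S. \<Sum>q\<in>S. y p * y q * (if p = q then 2 else - sqrt (of_int (C p q * C q p))))"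
  proof (intro sum.cong refl)
    fix p q
    show "f p * d p * of_int (C p q) * f q = y p * y q * (if p = q then 2 else - sqrt (of_int (C p q * C q p)))"
    proof (cases "p = q")
      case True then show ?thesis using d(1)[of q] by (simp add: y)
    next
      case False
      have "f p * d p * of_int (C p q) * f q = f p * (d p * of_int (C p q)) * f q" by simp
      also have "\<dots> = y p * y q * - sqrt (of_int (C p q * C q p))"
        by (simp only: sqrt_form[OF d(1,2) False] y) simp
      finally show ?thesis using False by simp
    qed
  qed
  finally show ?thesis .
qed

lemma rank2_bound:
  assumes "i \<noteq> j" shows "C i j * C j i < 4"
proof (rule ccontr)
  assume "\<not> ?thesis"
  then have "2 \<le> sqrt (of_int (C i j * C j i))"
    by (intro real_le_rsqrt) (simp add: of_int_le_iff[where 'a=real, of 4, simplified] del: of_int_mult)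
  \<comment> \<open>The test vector with entries 1 at \<open>i\<close> and \<open>j\<close>.\<close>
  moreover have ne: "(\<lambda>p. if p \<in> {i,j} then 1 else 0 :: real) \<noteq> (\<lambda>_. 0)"
    by (metis insertI1 zero_neq_one)
  have "0 < 4 - 2 * sqrt (of_int (C i j * C j i))"
    using gram_pos[OF ne, of "{i,j}"] assms
    by (simp add: mult.commute split: if_splits)
  ultimately show False by linarith
qed

text \<open>Half of the form of \<open>gram_pos\<close> at the vector with entries \<open>x\<close>,
  \<open>y\<close>, \<open>z\<close>; \<open>y \<noteq> 0\<close> makes this vector nonzero.\<close>

lemma rank3_bound:
  fixes x y z :: real
  assumes "i \<noteq> j" "j \<noteq> k" "i \<noteq> k" "y \<noteq> 0"
  shows "sqrt (of_int (C i j * C j i)) * x * y + sqrt (of_int (C j k * C k j)) * y * z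
    + sqrt (of_int (C i k * C k i)) * x * z < x\<^sup>2 + y\<^sup>2 + z\<^sup>2"
proof -
  have ne: "(\<lambda>p. if p = i then x else if p = j then y else if p = k then z else 0) \<noteq> (\<lambda>_. 0)"
    using assms by metis
  show ?thesis
    using gram_pos[OF ne, of "{i,j,k}"] assms
    by (simp add: power2_eq_square algebra_simps split: if_splits del: of_int_mult)
qed

lemma rank2_types:
  assumes "i \<noteq> j"
  shows "C i j = 0 \<and> C j i = 0 \<or> C i j = -1 \<and> C j i = -1 \<or> C i j = -2 \<and> C j i = -1
      \<or> C i j = -1 \<and> C j i = -2 \<or> C i j = -3 \<and> C j i = -1 \<or> C i j = -1 \<and> C j i = -3"
proof (cases "C i j = 0")
  case False
  define p q where pq: "p = - C i j" "q = - C j i"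
  have "p \<ge> 1" "q \<ge> 1"
    using False offdiag[OF assms] offdiag[OF not_sym[OF assms]] zero_sym[of i j] by (auto simp: pq)
  have "p * q < 4" using rank2_bound[OF assms] by (simp add: pq)
  moreover have "p * 1 \<le> p * q" "1 * q \<le> p * q"
    using \<open>p \<ge> 1\<close> \<open>q \<ge> 1\<close> by (intro mult_left_mono mult_right_mono; simp)+
  ultimately have "p \<le> 3" "q \<le> 3" by linarith+
  with \<open>p \<ge> 1\<close> \<open>q \<ge> 1\<close> have "p = 1 \<or> p = 2 \<or> p = 3" "q = 1 \<or> q = 2 \<or> q = 3" by linarith+
  then have "p = 1 \<and> q = 1 \<or> p = 2 \<and> q = 1 \<or> p = 1 \<and> q = 2 \<or> p = 3 \<and> q = 1 \<or> p = 1 \<and> q = 3"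
    using \<open>p * q < 4\<close> by (elim disjE) simp_all
  moreover have "C i j = - p" "C j i = - q" by (simp_all add: pq)
  ultimately show ?thesis by metis
qed (use zero_sym in blast)

lemma rank2_cases:
  assumes "i \<noteq> j"
  obtains "C i j = 0" "C j i = 0" | "C i j = -1" "C j i = -1"
    | "C i j = -2" "C j i = -1" | "C i j = -1" "C j i = -2"
    | "C i j = -3" "C j i = -1" | "C i j = -1" "C j i = -3"
  using rank2_types[OF assms] by blast

end


section \<open>Words, alternating words and the length function\<close>

lemma alt_0 [simp]: "alt i j 0 = []"
  by (simp add: alt_def)

lemma alt_Suc: "alt i j (Suc n) = i # alt j i n"
  by (rule nth_equalityI) (auto simp: alt_def nth_Cons simp del: upt_Suc split: nat.split)

lemma length_alt [simp]: "length (alt i j n) = n"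
  by (simp add: alt_def)

lemma alt_add: "alt i j (m + n) = alt i j m @ (if even m then alt i j n else alt j i n)"
  by (induction m arbitrary: i j) (auto simp: alt_Suc)

lemma wact_Nil [simp]: "wact C [] = id"
  by (simp add: wact_def)

lemma wact_Cons: "wact C (i # ws) = srefl C i \<circ> wact C ws"
  by (simp add: wact_def)

lemma wact_append: "wact C (us @ vs) = wact C us \<circ> wact C vs"
  by (induction us) (simp_all add: wact_Cons comp_assoc)

lemma wact_in_weyl [simp]: "wact C ws \<in> weyl C"
  by (simp add: weyl_def)

lemma weyl_comp [intro]: "v \<in> weyl C \<Longrightarrow> w \<in> weyl C \<Longrightarrow> v \<circ> w \<in> weyl C"
  by (auto simp: weyl_def simp flip: wact_append)

lemma id_in_weyl [simp]: "id \<in> weyl C"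
  using wact_in_weyl[of C "[]"] by simp

lemma srefl_in_weyl [simp]: "srefl C i \<in> weyl C"
  using wact_in_weyl[of C "[i]"] by (simp add: wact_Cons)

lemma wlen_wact_le: "wlen C (wact C ws) \<le> length ws"
  unfolding wlen_def by (rule Least_le) blast

lemma wlen_attained:
  assumes "w \<in> weyl C"
  obtains ws where "length ws = wlen C w" "wact C ws = w"
proof -
  have "\<exists>ws. length ws = wlen C w \<and> wact C ws = w"
    unfolding wlen_def by (rule LeastI_ex) (use assms in \<open>auto simp: weyl_def\<close>)
  then show thesis using that by blast
qed

lemma wlen_id [simp]: "wlen C id = 0"
  using wlen_wact_le[of C "[]"] by simp

lemma wlen_eq_0: "w \<in> weyl C \<Longrightarrow> wlen C w = 0 \<Longrightarrow> w = id"
  by (erule wlen_attained) auto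

lemma wlen_comp_le: "v \<in> weyl C \<Longrightarrow> w \<in> weyl C \<Longrightarrow> wlen C (v \<circ> w) \<le> wlen C v + wlen C w"
  by (metis length_append wact_append wlen_attained wlen_wact_le)

subsection \<open>The Weyl group\<close>

context fin_cartan
begin

abbreviation "s \<equiv> srefl C"
abbreviation "act \<equiv> wact C"
abbreviation "W \<equiv> weyl C"
abbreviation "len \<equiv> wlen C"

lemma s_s [simp]: "s i (s i x) = x"
  by (simp add: srefl_def fun_eq_iff algebra_simps)

lemma s_self [simp]: "s i x i = - x i"
  by (simp add: srefl_def)

lemma s_comp_s [simp]: "s i \<circ> (s i \<circ> w) = w"
  by (simp add: fun_eq_iff)

lemma act_rev_act [simp]: "act (rev ws) (act ws x) = x"
  by (induction ws arbitrary: x) (simp_all add: wact_Cons wact_append)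

lemma act_act_rev [simp]: "act ws (act (rev ws) x) = x"
  using act_rev_act[of "rev ws"] by simp

text \<open>Linearity of the action in the basis of fundamental weights. It lets an element be
  treated as the integer matrix with columns \<open>w (fw l)\<close>.\<close>

lemma act_expand: "act ws x k = (\<Sum>l\<in>UNIV. x l * act ws (fw l) k)"
proof (induction ws arbitrary: k)
  case Nil
  have "(\<Sum>l\<in>UNIV. x l * fw l k) = (\<Sum>l\<in>UNIV. if l = k then x l else 0)"
    by (intro sum.cong) (auto simp: fw_def)
  then show ?case by simp
next
  case (Cons i ws)
  have "act (i # ws) x k = act ws x k - act ws x i * C k i"
    by (simp add: wact_Cons srefl_def)
  also have "\<dots> = (\<Sum>l\<in>UNIV. x l * act ws (fw l) k - x l * act ws (fw l) i * C k i)"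
    unfolding Cons.IH[of k] Cons.IH[of i] by (simp add: sum_subtractf sum_distrib_right)
  also have "\<dots> = (\<Sum>l\<in>UNIV. x l * act (i # ws) (fw l) k)"
    by (intro sum.cong) (simp_all add: wact_Cons srefl_def algebra_simps)
  finally show ?case .
qed

lemma weyl_expand: "w \<in> W \<Longrightarrow> w x k = (\<Sum>l\<in>UNIV. x l * w (fw l) k)"
  by (auto simp: weyl_def intro: act_expand)

lemma weyl_eqI: "v \<in> W \<Longrightarrow> w \<in> W \<Longrightarrow> (\<And>k. v (fw k) = w (fw k)) \<Longrightarrow> v = w"
  by (intro ext) (simp add: weyl_expand)

text \<open>A weight shifted by a combination of two simple roots. Both reflections are affine in
  \<open>a\<close> and \<open>b\<close>, so rank two statements become linear arithmetic in each
  Cartan type.\<close>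

definition dih :: "'i \<Rightarrow> 'i \<Rightarrow> ('i \<Rightarrow> int) \<Rightarrow> int \<Rightarrow> int \<Rightarrow> 'i \<Rightarrow> int" where
  "dih i j x a b = (\<lambda>k. x k - a * C k i - b * C k j)"

lemma s_dih: "s i x = dih i j x (x i) 0" "s j x = dih i j x 0 (x j)"
  "s i (dih i j x a b) = dih i j x (x i - a - C i j * b) b"
  "s j (dih i j x a b) = dih i j x a (x j - b - C j i * a)"
  by (simp_all add: srefl_def dih_def fun_eq_iff algebra_simps)

text \<open>For distinct letters, the Coxeter exponent: the length of their braid relation.\<close>

definition cox :: "'i \<Rightarrow> 'i \<Rightarrow> nat" where
  "cox i j = (if C i j * C j i = 0 then 2 else if C i j * C j i = 1 then 3
    else if C i j * C j i = 2 then 4 else 6)"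

lemma cox_sym: "cox i j = cox j i"
  by (simp add: cox_def mult.commute)

lemma cox_ge_2: "2 \<le> cox i j"
  by (simp add: cox_def)

lemma braid:
  assumes "i \<noteq> j" shows "act (alt i j (cox i j)) = act (alt j i (cox i j))"
proof
  fix x
  have d: "s i x = dih i j x (x i) 0" "s j x = dih i j x 0 (x j)"
    "\<And>a b. s i (dih i j x a b) = dih i j x (x i - a - C i j * b) b"
    "\<And>a b. s j (dih i j x a b) = dih i j x a (x j - b - C j i * a)"
    using s_dih[where i=i and j=j and x=x] by auto
  show "act (alt i j (cox i j)) x = act (alt j i (cox i j)) x"
    using assms by (cases rule: rank2_cases)
      (simp_all add: cox_def eval_nat_numeral alt_Suc wact_Cons d, simp_all add: algebra_simps)
qed

text \<open>The rank two case of \<open>ascent_nonneg\<close>: an alternating word starting with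
  \<open>j\<close> and shorter than the braid relation is lengthened by \<open>s i\<close>.\<close>

lemma alt_nonneg:
  assumes "i \<noteq> j" "k < cox i j" "0 \<le> x i" "0 \<le> x j"
  shows "0 \<le> act (alt j i k) x i"
proof -
  have d: "s i x = dih i j x (x i) 0" "s j x = dih i j x 0 (x j)"
    "\<And>a b. s i (dih i j x a b) = dih i j x (x i - a - C i j * b) b"
    "\<And>a b. s j (dih i j x a b) = dih i j x a (x j - b - C j i * a)"
    "\<And>a b. dih i j x a b i = x i - 2 * a - b * C i j"
    using s_dih[where i=i and j=j and x=x] by (auto simp: dih_def)
  show ?thesis
    using \<open>i \<noteq> j\<close>
  proof (cases rule: rank2_cases)
    case 1 then show ?thesis using assms(2-)
      by (auto simp: cox_def eval_nat_numeral less_Suc_eq alt_Suc wact_Cons d)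
  next
    case 2 then show ?thesis using assms(2-)
      by (auto simp: cox_def eval_nat_numeral less_Suc_eq alt_Suc wact_Cons d)
  next
    case 3 then show ?thesis using assms(2-)
      by (auto simp: cox_def eval_nat_numeral less_Suc_eq alt_Suc wact_Cons d)
  next
    case 4 then show ?thesis using assms(2-)
      by (auto simp: cox_def eval_nat_numeral less_Suc_eq alt_Suc wact_Cons d)
  next
    case 5 then show ?thesis using assms(2-)
      by (auto simp: cox_def eval_nat_numeral less_Suc_eq alt_Suc wact_Cons d)
  next
    case 6 then show ?thesis using assms(2-)
      by (auto simp: cox_def eval_nat_numeral less_Suc_eq alt_Suc wact_Cons d)
  qed
qed

lemma dihedral_word:
  assumes "set u \<subseteq> {i, j}"
  shows "\<exists>n\<le>length u. act u = act (alt i j n) \<or> act u = act (alt j i n)"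
  using assms
proof (induction u)
  case (Cons a u)
  then obtain n where n: "n \<le> length u" "act u = act (alt i j n) \<or> act u = act (alt j i n)"
    by auto
  have K: "\<exists>n\<le>Suc (length u). s a \<circ> act (alt b c m) = act (alt b c n) \<or> s a \<circ> act (alt b c m) = act (alt c b n)"
    if "a \<in> {b, c}" "m \<le> length u" for b c m
  proof (cases "a = b")
    case True
    show ?thesis
    proof (cases m)
      case 0 then show ?thesis using True by (intro exI[of _ 1]) (simp add: alt_Suc wact_Cons)
    next
      case (Suc k)
      then show ?thesis using True that(2) by (intro exI[of _ k]) (simp add: alt_Suc wact_Cons)
    qed
  next
    case False
    then show ?thesis using that by (intro exI[of _ "Suc m"]) (simp add: alt_Suc wact_Cons)
  qed
  have a: "a \<in> {i, j}" "a \<in> {j, i}" using Cons.prems by auto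
  from n(2) show ?case
  proof
    assume "act u = act (alt i j n)"
    then show ?thesis using K[OF a(1) n(1)] by (simp only: wact_Cons length_Cons)
  next
    assume "act u = act (alt j i n)"
    then show ?thesis using K[OF a(2) n(1)] by (simp only: wact_Cons length_Cons disj_commute)
  qed
qed auto

lemma len_s_le: "w \<in> W \<Longrightarrow> len (s i \<circ> w) \<le> Suc (len w)"
  using wlen_comp_le[of "s i" C w] wlen_wact_le[of C "[i]"] by (simp add: wact_Cons)

lemma len_le_s: "w \<in> W \<Longrightarrow> len w \<le> Suc (len (s i \<circ> w))"
  using len_s_le[of "s i \<circ> w" i] by (simp add: weyl_comp)

text \<open>The standard argument: write \<open>w = u \<circ> v\<close> with \<open>u\<close> in the dihedral group of \<open>i\<close> and
  another letter \<open>j\<close> and \<open>v\<close> as short as possible.\<close>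

lemma ascent_nonneg:
  assumes "w \<in> W" "len w \<le> len (s i \<circ> w)"
  shows "0 \<le> w (fw k) i"
  using assms
proof (induction "len w" arbitrary: w i rule: less_induct)
  case less
  show ?case
  proof (cases "len w = 0")
    case True
    then show ?thesis using wlen_eq_0[OF less.prems(1)] by (simp add: fw_def)
  next
    case False
    obtain ws where ws: "length ws = len w" "act ws = w"
      using wlen_attained[OF less.prems(1)] by blast
    with False obtain j ws' where ws': "ws = j # ws'" by (cases ws) auto
    have "s j \<circ> w = act ws'" using ws(2)[symmetric] by (simp add: ws' wact_Cons)
    then have j: "len (s j \<circ> w) < len w"
      using wlen_wact_le[of C ws'] ws(1) by (simp add: ws')
    then have ij: "i \<noteq> j" using less.prems(2) by auto
    define Q where "Q = (\<lambda>(u, v). set u \<subseteq> {i, j} \<and> v \<in> W \<and> w = act u \<circ> v \<and> length u + len v = len w)"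
    have "Q ([j], s j \<circ> w)"
      using j len_le_s[OF less.prems(1), of j] less.prems(1) by (auto simp: Q_def wact_Cons)
    then obtain uv where uv: "Q uv" and min: "\<And>uv'. Q uv' \<Longrightarrow> len (snd uv) \<le> len (snd uv')"
      using ex_has_least_nat[of Q _ "\<lambda>uv. len (snd uv)"] by blast
    obtain u v where uv_def: "uv = (u, v)" by (cases uv)
    have u: "set u \<subseteq> {i, j}" and v: "v \<in> W" and w: "w = act u \<circ> v" and l: "length u + len v = len w"
      using uv by (auto simp: Q_def uv_def)
    have "len v < len w"
      using min[OF \<open>Q ([j], s j \<circ> w)\<close>] j by (simp add: uv_def)
    \<comment> \<open>Otherwise the letter \<open>a\<close> could be moved from \<open>v\<close> to
      \<open>u\<close>, against the minimality of \<open>v\<close>.\<close>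
    have up: "len v \<le> len (s a \<circ> v)" if a: "a \<in> {i, j}" for a
    proof (rule ccontr)
      assume "\<not> ?thesis"
      then have lt: "len (s a \<circ> v) < len v" by simp
      have eq: "w = act (u @ [a]) \<circ> (s a \<circ> v)"
        by (simp add: w wact_append wact_Cons fun_eq_iff)
      have "s a \<circ> v \<in> W" using v by (intro weyl_comp srefl_in_weyl)
      then have "len w \<le> len (act (u @ [a])) + len (s a \<circ> v)"
        unfolding eq by (rule wlen_comp_le[OF wact_in_weyl])
      with wlen_wact_le[of C "u @ [a]"] have "len w \<le> length (u @ [a]) + len (s a \<circ> v)"
        by linarith
      then have "Q (u @ [a], s a \<circ> v)"
        using lt l eq u \<open>s a \<circ> v \<in> W\<close> a by (simp add: Q_def)
      from min[OF this] lt show False by (simp add: uv_def)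
    qed
    have vnn: "0 \<le> v (fw k) i" "0 \<le> v (fw k) j"
      using less.hyps[OF \<open>len v < len w\<close> v] up by auto
    obtain n where n: "n \<le> length u" "act u = act (alt i j n) \<or> act u = act (alt j i n)"
      using dihedral_word[OF u] by blast
    have short: "length u \<le> length u'" if "act u' = act u" for u'
      using l w wlen_comp_le[OF wact_in_weyl[of C u'] v] wlen_wact_le[of C u'] that by simp
    have short': "length u \<le> length u'" if "act u' = s i \<circ> act u" for u'
      using l w wlen_comp_le[OF wact_in_weyl[of C u'] v] wlen_wact_le[of C u'] that less.prems(2)
      by (simp add: comp_assoc)
    have no_i: "act u \<noteq> act (i # u')" if "length u' < length u" for u'
    proof
      assume "act u = act (i # u')"
      then have "act u' = s i \<circ> act u" by (simp add: wact_Cons)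
      from short'[OF this] that show False by simp
    qed
    have "n = length u" using n short[of "alt i j n"] short[of "alt j i n"] by auto
    \<comment> \<open>From length \<open>cox i j\<close> on, the braid relation would rewrite
      \<open>u\<close> to start with \<open>i\<close>, and \<open>s i\<close> would then shorten
      \<open>w\<close>.\<close>
    have nlt: "n < cox i j" if "act u = act (alt j i n)"
    proof (rule ccontr)
      assume "\<not> n < cox i j"
      then obtain p where p: "n = cox i j + p" using le_Suc_ex not_less by blast
      obtain m where m: "cox i j = Suc m" using cox_ge_2[of i j] by (cases "cox i j") auto
      define r where "r = (if even (cox i j) then alt j i p else alt i j p)"
      have "act u = act (alt j i (cox i j)) \<circ> act r"
        using that unfolding p alt_add r_def by (simp add: wact_append)
      also have "\<dots> = act (alt i j (cox i j) @ r)"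
        using braid[OF ij] by (simp add: wact_append)
      also have "\<dots> = act (i # (alt j i m @ r))" by (simp add: m alt_Suc)
      finally have "act u = act (i # (alt j i m @ r))" .
      moreover have "length r = p" by (simp add: r_def)
      ultimately show False using no_i[of "alt j i m @ r"] p m \<open>n = length u\<close> by simp
    qed
    show ?thesis
    proof (cases "act u = act (alt j i n)")
      case True
      show ?thesis using alt_nonneg[OF ij nlt[OF True] vnn] True by (simp add: w)
    next
      case False
      then have "act u = act (alt i j n)" using n by simp
      moreover from this False obtain m where "n = Suc m" by (cases n) auto
      ultimately show ?thesis using no_i[of "alt j i m"] \<open>n = length u\<close> by (simp add: alt_Suc)
    qed
  qed
qed

text \<open>Left descents. By \<open>desc_iff\<close> they are visible in the signs of the
  coordinates \<open>w (fw k) i\<close>, the coefficients of the coroot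
  \<open>w^-1 h_i\<close>.\<close>

definition desc :: "('i wt \<Rightarrow> 'i wt) \<Rightarrow> 'i \<Rightarrow> bool" where
  "desc w i \<longleftrightarrow> len (s i \<circ> w) < len w"

lemma weyl_coord_nonzero:
  assumes "w \<in> W" shows "\<exists>k. w (fw k) i \<noteq> 0"
proof (rule ccontr)
  assume "\<not> ?thesis"
  then have "w x i = 0" for x using weyl_expand[OF assms, of x i] by simp
  moreover obtain ws where "w = act ws" using assms by (auto simp: weyl_def)
  ultimately have "act ws (act (rev ws) (fw i)) i = 0" by blast
  then show False unfolding act_act_rev by (simp add: fw_def)
qed

lemma desc_nonpos: "w \<in> W \<Longrightarrow> desc w i \<Longrightarrow> w (fw k) i \<le> 0"
  using ascent_nonneg[of "s i \<circ> w" i k] by (simp add: desc_def weyl_comp srefl_def)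

lemma not_desc_nonneg: "w \<in> W \<Longrightarrow> \<not> desc w i \<Longrightarrow> 0 \<le> w (fw k) i"
  using ascent_nonneg[of w i k] by (simp add: desc_def)

lemma desc_iff: "w \<in> W \<Longrightarrow> desc w i \<longleftrightarrow> (\<forall>k. w (fw k) i \<le> 0)"
  using desc_nonpos not_desc_nonneg weyl_coord_nonzero by (metis order_antisym)

lemma not_desc_iff: "w \<in> W \<Longrightarrow> \<not> desc w i \<longleftrightarrow> (\<forall>k. 0 \<le> w (fw k) i)"
  using desc_nonpos not_desc_nonneg weyl_coord_nonzero by (metis order_antisym)

lemma desc_s: "w \<in> W \<Longrightarrow> desc (s i \<circ> w) i \<longleftrightarrow> \<not> desc w i"
  using desc_iff[of "s i \<circ> w" i] not_desc_iff[of w i] by (simp add: weyl_comp)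

lemma len_desc: "w \<in> W \<Longrightarrow> desc w i \<Longrightarrow> len w = Suc (len (s i \<circ> w))"
  using len_le_s[of w i] by (simp add: desc_def)

lemma len_not_desc: "w \<in> W \<Longrightarrow> \<not> desc w i \<Longrightarrow> len (s i \<circ> w) = Suc (len w)"
  using len_desc[of "s i \<circ> w" i] desc_s[of w i] by (simp add: weyl_comp)

end


subsection \<open>Reduced words\<close>

context fin_cartan
begin

text \<open>Reversed words represent inverses; \<open>act (rev p)\<close> plays the role of the
  inverse of \<open>act p\<close> from here on.\<close>

lemma len_rev_le: "len (act (rev ws)) \<le> len (act ws)"
proof -
  obtain us where us: "length us = len (act ws)" "act us = act ws"
    using wlen_attained[OF wact_in_weyl[of C ws]] by blast
  have "act (rev ws) = act (rev us)"
  proof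
    fix x
    have "act ws (act (rev us) x) = x" by (simp flip: us(2))
    then show "act (rev ws) x = act (rev us) x" by (metis act_rev_act)
  qed
  then show ?thesis using wlen_wact_le[of C "rev us"] us(1) by simp
qed

lemma len_rev: "len (act (rev ws)) = len (act ws)"
  using len_rev_le[of ws] len_rev_le[of "rev ws"] by simp

definition reduced :: "'i list \<Rightarrow> bool" where
  "reduced ws \<longleftrightarrow> len (act ws) = length ws"

lemma reduced_Nil [simp]: "reduced []"
  by (simp add: reduced_def)

lemma reduced_rev: "reduced (rev ws) = reduced ws"
  by (simp add: reduced_def len_rev)

lemma reduced_appendD: "reduced (u @ v) \<Longrightarrow> reduced u \<and> reduced v"
  using wlen_comp_le[of "act u" C "act v"] wlen_wact_le[of C u] wlen_wact_le[of C v]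
  by (simp add: reduced_def wact_append)

lemma reduced_ConsD: "reduced (i # v) \<Longrightarrow> reduced v"
  using reduced_appendD[of "[i]" v] by simp

lemma act_tail: "s i \<circ> act (i # v) = act v"
  by (simp add: wact_Cons)

lemma reduced_Cons_iff: "reduced (i # v) \<longleftrightarrow> reduced v \<and> desc (act (i # v)) i"
proof
  assume r: "reduced (i # v)"
  then have "reduced v" by (rule reduced_ConsD)
  then show "reduced v \<and> desc (act (i # v)) i" using r by (simp add: desc_def act_tail reduced_def)
next
  assume a: "reduced v \<and> desc (act (i # v)) i"
  then have "len (act (i # v)) = Suc (len (act v))"
    using len_desc[of "act (i # v)" i] by (simp add: act_tail)
  then show "reduced (i # v)" using a by (simp add: reduced_def)
qed

lemma reduced_Cons_iff': "reduced (i # v) \<longleftrightarrow> reduced v \<and> \<not> desc (act v) i"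
  using reduced_Cons_iff[of i v] desc_s[of "act v" i] by (simp add: wact_Cons)

lemma reduced_word_ex:
  assumes "w \<in> W" obtains r where "reduced r" "act r = w"
  using wlen_attained[OF assms] by (metis reduced_def)

text \<open>A descent test for a whole word: if it holds at \<open>v (fw k)\<close> for all
  \<open>k\<close>, the letters of \<open>p\<close> are successive left descents, so
  \<open>p\<close> begins a reduced word of \<open>v\<close>. Reducedness thus becomes a sign
  computation.\<close>

fun negs :: "'i list \<Rightarrow> 'i wt \<Rightarrow> bool" where
  "negs [] x = True"
| "negs (i # p) x = (x i \<le> 0 \<and> negs p (s i x))"

lemma negs_word:
  assumes "v \<in> W" "\<And>k. negs p (v (fw k))"
  obtains r where "reduced (p @ r)" "act (p @ r) = v"
  using assms
proof (induction p arbitrary: v thesis)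
  case Nil
  then show ?case using reduced_word_ex by (metis append_Nil)
next
  case (Cons i p)
  have "s i \<circ> v \<in> W" using Cons.prems by (intro weyl_comp) auto
  moreover have "negs p ((s i \<circ> v) (fw k))" for k using Cons.prems(3)[of k] by simp
  ultimately obtain r where r: "reduced (p @ r)" "act (p @ r) = s i \<circ> v"
    using Cons.IH by blast
  have eq: "act (i # p @ r) = v" by (simp add: wact_Cons r(2))
  have "desc v i" unfolding desc_iff[OF Cons.prems(2)] using Cons.prems(3) by simp
  then have "reduced (i # p @ r)" by (simp add: reduced_Cons_iff r(1) eq)
  then show ?case using Cons.prems(1)[of r] eq by simp
qed

lemma alt_negs:
  assumes "i \<noteq> j" "x i \<le> 0" "x j \<le> 0" shows "negs (alt i j (cox i j)) x"
proof -
  have d: "s i x = dih i j x (x i) 0" "s j x = dih i j x 0 (x j)"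
    "\<And>a b. s i (dih i j x a b) = dih i j x (x i - a - C i j * b) b"
    "\<And>a b. s j (dih i j x a b) = dih i j x a (x j - b - C j i * a)"
    "\<And>a b. dih i j x a b i = x i - 2 * a - b * C i j"
    "\<And>a b. dih i j x a b j = x j - a * C j i - 2 * b"
    using s_dih[where i=i and j=j and x=x] by (auto simp: dih_def)
  show ?thesis
    using \<open>i \<noteq> j\<close> by (cases rule: rank2_cases)
      (use assms(2-) in \<open>simp_all add: cox_def eval_nat_numeral alt_Suc d\<close>)
qed

text \<open>With two left descents the longest element of their dihedral group splits off on the
  left; its two spellings share the rest \<open>r\<close>.\<close>

lemma desc_dihedral:
  assumes "v \<in> W" "i \<noteq> j" "desc v i" "desc v j"
  obtains r where "reduced (alt i j (cox i j) @ r)" "act (alt i j (cox i j) @ r) = v"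
    "reduced (alt j i (cox i j) @ r)" "act (alt j i (cox i j) @ r) = v"
proof -
  obtain r where r: "reduced (alt i j (cox i j) @ r)" "act (alt i j (cox i j) @ r) = v"
    by (rule negs_word[OF assms(1) alt_negs[OF assms(2) desc_nonpos[OF assms(1,3)] desc_nonpos[OF assms(1,4)]]])
  moreover have "act (alt j i (cox i j) @ r) = v"
    using r(2) braid[OF assms(2)] by (simp add: wact_append)
  ultimately show thesis using that by (simp add: reduced_def)
qed

lemma reduced_swap:
  assumes "i \<noteq> j"
  shows "act (p @ alt i j (cox i j) @ r) = act (p @ alt j i (cox i j) @ r)"
    "reduced (p @ alt i j (cox i j) @ r) \<longleftrightarrow> reduced (p @ alt j i (cox i j) @ r)"
proof -
  show "act (p @ alt i j (cox i j) @ r) = act (p @ alt j i (cox i j) @ r)"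
    using braid[OF assms] by (simp add: wact_append)
  then show "reduced (p @ alt i j (cox i j) @ r) \<longleftrightarrow> reduced (p @ alt j i (cox i j) @ r)"
    by (simp add: reduced_def)
qed

lemma reduced_snoc_nonneg: "reduced (p @ [i]) \<Longrightarrow> 0 \<le> act (rev p) (fw l) i"
  using reduced_rev[of "p @ [i]"] reduced_Cons_iff'[of i "rev p"] not_desc_nonneg by simp

definition nonpos :: "('i wt \<Rightarrow> 'i wt) \<Rightarrow> bool" where
  "nonpos w \<longleftrightarrow> (\<forall>i k. w (fw k) i \<le> 0)"

text \<open>The inverse of \<open>p\<close> shortens \<open>w\<close> letter by letter. For a
  reduced \<open>p @ [i]\<close> the inverse of \<open>p\<close> has nonnegative
  \<open>i\<close>-coordinates on fundamental weights, and \<open>w (fw k)\<close> is antidominant,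
  so \<open>i\<close> is still a descent.\<close>

lemma nonpos_extend:
  assumes "w \<in> W" "nonpos w" "reduced p"
  shows "len (act (rev p) \<circ> w) + length p = len w"
  using assms(3)
proof (induction p rule: rev_induct)
  case (snoc i p)
  have "reduced p" using snoc.prems reduced_appendD by blast
  have "desc (act (rev p) \<circ> w) i"
    unfolding desc_iff[OF weyl_comp[OF wact_in_weyl assms(1)]]
  proof
    fix k
    have "act (rev p) (w (fw k)) i = (\<Sum>l\<in>UNIV. w (fw k) l * act (rev p) (fw l) i)"
      by (rule act_expand)
    also have "\<dots> \<le> 0"
      using assms(2) reduced_snoc_nonneg[OF snoc.prems]
      by (intro sum_nonpos mult_nonpos_nonneg) (auto simp: nonpos_def)
    finally show "(act (rev p) \<circ> w) (fw k) i \<le> 0" by simp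
  qed
  from len_desc[OF weyl_comp[OF wact_in_weyl assms(1)] this] snoc.IH[OF \<open>reduced p\<close>]
  show ?case
    by (simp only: rev_append rev.simps append.simps wact_Cons wact_Nil comp_assoc length_append list.size)
qed simp

lemma nonpos_longest: "w \<in> W \<Longrightarrow> nonpos w \<Longrightarrow> longest C w"
  unfolding longest_def by (metis le_add2 nonpos_extend reduced_def reduced_word_ex)

lemma longest_nonpos: "longest C w \<Longrightarrow> nonpos w"
  unfolding longest_def nonpos_def
  by (metis desc_nonpos len_not_desc not_less_eq_eq order_refl srefl_in_weyl weyl_comp)

lemma longest_unique:
  assumes "longest C v" "longest C w" shows "v = w"
proof -
  have W: "v \<in> W" "w \<in> W" and "len v = len w"
    using assms by (auto simp: longest_def intro: le_antisym)
  obtain p where p: "reduced p" "act p = v" using reduced_word_ex[OF W(1)] .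
  have "len (act (rev p) \<circ> w) = 0"
    using nonpos_extend[OF W(2) longest_nonpos[OF assms(2)] p(1)] p \<open>len v = len w\<close>
    by (simp add: reduced_def)
  then have "act (rev p) \<circ> w = id" by (intro wlen_eq_0[of _ C] weyl_comp W(2)) simp_all
  then have "act (rev p) (w x) = x" for x by (metis comp_apply id_apply)
  then have "w x = act p x" for x by (metis act_act_rev)
  then show ?thesis using p by (simp add: fun_eq_iff)
qed

text \<open>Strip off left descents \<open>i\<close> of \<open>w\<close>. The
  \<open>i\<close>-coordinate of \<open>w (fw k) = fw k\<close> is nonpositive, so \<open>i\<close>
  differs from \<open>k\<close>, and \<open>s i\<close> fixes \<open>fw k\<close> too.\<close>

lemma stabilizer:
  assumes "w \<in> W" "w (fw k) = fw k"
  obtains zs where "k \<notin> set zs" "act zs = w"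
  using assms
proof (induction "len w" arbitrary: w thesis)
  case 0
  then show ?case using wlen_eq_0[of w C] by (metis empty_iff empty_set wact_Nil)
next
  case (Suc n)
  obtain ws where ws: "reduced ws" "act ws = w" using reduced_word_ex[OF Suc.prems(2)] .
  with Suc.hyps(2) obtain i ws' where i: "ws = i # ws'" by (cases ws) (auto simp: reduced_def)
  have d: "desc w i" using ws i reduced_Cons_iff by blast
  then have "i \<noteq> k" using desc_nonpos[OF Suc.prems(2) d, of k] Suc.prems(3) by (auto simp: fw_def)
  then have "s i (fw k) = fw k" by (simp add: srefl_def fw_def fun_eq_iff)
  then have "(s i \<circ> w) (fw k) = fw k" using Suc.prems(3) by simp
  moreover have "s i \<circ> w \<in> W" using Suc.prems(2) by (intro weyl_comp) auto
  moreover have "n = len (s i \<circ> w)" using len_desc[OF Suc.prems(2) d] Suc.hyps(2) by simp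
  ultimately obtain zs where "k \<notin> set zs" "act zs = s i \<circ> w" using Suc.hyps(1) by blast
  then show ?case using Suc.prems(1)[of "i # zs"] \<open>i \<noteq> k\<close> by (simp add: wact_Cons)
qed

lemma fw_coset:
  assumes "v \<in> W" "w \<in> W" "v (fw k) = w (fw k)"
  obtains zs where "k \<notin> set zs" "w = v \<circ> act zs"
proof -
  obtain p where p: "act p = v" using assms(1) by (auto simp: weyl_def)
  have "(act (rev p) \<circ> w) (fw k) = fw k"
    using assms(3)[symmetric] by (simp flip: p)
  then obtain zs where zs: "k \<notin> set zs" "act zs = act (rev p) \<circ> w"
    using stabilizer[of "act (rev p) \<circ> w"] weyl_comp[OF wact_in_weyl assms(2)] by blast
  have "w = v \<circ> act zs" by (rule ext) (simp add: zs(2) flip: p)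
  with zs(1) show thesis by (rule that)
qed

subsection \<open>Finiteness of the Weyl group\<close>

text \<open>Positive definiteness makes the Cartan matrix injective, hence surjective. The invariant
  form lives on combinations of simple roots, so fundamental weights have to be expressed in
  them.\<close>

lemma fw_root_coords:
  "\<exists>y :: 'i \<Rightarrow> real. \<forall>i. (\<Sum>j\<in>UNIV. of_int (C i j) * y j) = of_int (fw k i)"
proof -
  obtain d :: "'i \<Rightarrow> real" where d: "\<And>i. d i > 0"
    "\<And>i j. d i * of_int (C i j) = d j * of_int (C j i)"
    "\<And>x. x \<noteq> (\<lambda>_. 0) \<Longrightarrow> (\<Sum>i\<in>UNIV. \<Sum>j\<in>UNIV. x i * d i * of_int (C i j) * x j) > 0"
    using form by blast
  define A :: "real^'i^'i" where "A = (\<chi> i j. of_int (C i j))"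
  have "inj ((*v) A)"
  proof (rule linear_injective_0[OF matrix_vector_mul_linear, THEN iffD2], intro allI impI)
    fix x :: "real^'i" assume 0: "A *v x = 0"
    have Ax: "(\<Sum>j\<in>UNIV. of_int (C i j) * x $ j) = 0" for i
      using arg_cong[OF 0, of "\<lambda>v. v $ i"] by (simp add: matrix_vector_mult_def A_def)
    have "(\<Sum>i\<in>UNIV. \<Sum>j\<in>UNIV. x $ i * d i * of_int (C i j) * x $ j)
      = (\<Sum>i\<in>UNIV. x $ i * d i * (\<Sum>j\<in>UNIV. of_int (C i j) * x $ j))"
      by (simp add: sum_distrib_left mult.assoc)
    then have "\<not> (\<Sum>i\<in>UNIV. \<Sum>j\<in>UNIV. x $ i * d i * of_int (C i j) * x $ j) > 0"
      by (simp add: Ax)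
    then have "(\<lambda>i. x $ i) = (\<lambda>_. 0)" using d(3) by blast
    then show "x = 0" by (simp add: vec_eq_iff fun_eq_iff)
  qed
  then have "surj ((*v) A)" by (intro linear_inj_imp_surj matrix_vector_mul_linear)
  then obtain y where y: "A *v y = (\<chi> i. of_int (fw k i))" by (metis surjD)
  show ?thesis
    using arg_cong[OF y, of "\<lambda>v. v $ _"] by (intro exI[of _ "\<lambda>j. y $ j"]) (simp add: matrix_vector_mult_def A_def)
qed

text \<open>The quadratic form \<open>q\<close> on root coordinates is invariant under reflections,
  so it is constant on the orbit; being nonnegative along each root line it bounds every
  coordinate.\<close>

lemma orbit_bounded: "\<exists>K. \<forall>ws l. \<bar>act ws (fw k) l\<bar> \<le> K"
proof -
  obtain d :: "'i \<Rightarrow> real" where d: "\<And>i. d i > 0"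
    "\<And>i j. d i * of_int (C i j) = d j * of_int (C j i)"
    "\<And>x. x \<noteq> (\<lambda>_. 0) \<Longrightarrow> (\<Sum>i\<in>UNIV. \<Sum>j\<in>UNIV. x i * d i * of_int (C i j) * x j) > 0"
    using form by blast
  define m where "m = (\<lambda>(x :: 'i \<Rightarrow> real) i. \<Sum>j\<in>UNIV. of_int (C i j) * x j)"
  define q where "q = (\<lambda>x. \<Sum>i\<in>UNIV. d i * x i * m x i)"
  define sh where "sh = (\<lambda>x t l (i::'i). x i - (if i = l then t else 0) :: real)"
  have q_nonneg: "0 \<le> q x" for x
  proof (cases "x = (\<lambda>_. 0)")
    case False
    have "q x = (\<Sum>i\<in>UNIV. \<Sum>j\<in>UNIV. x i * d i * of_int (C i j) * x j)"
      by (simp add: q_def m_def sum_distrib_left mult_ac)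
    then show ?thesis using d(3)[OF False] by simp
  qed (simp add: q_def)
  have m_sh: "m (sh x t l) i = m x i - t * of_int (C i l)" for x t l i
  proof -
    have "m (sh x t l) i = (\<Sum>j\<in>UNIV. of_int (C i j) * x j - (if j = l then of_int (C i j) * t else 0))"
      unfolding m_def sh_def by (intro sum.cong) (auto simp: algebra_simps)
    then show ?thesis by (simp add: sum_subtractf m_def mult.commute)
  qed
  have q_sh: "q (sh x t l) = q x - 2 * t * d l * m x l + 2 * t\<^sup>2 * d l" for x t l
  proof -
    have "q (sh x t l) = (\<Sum>i\<in>UNIV. d i * x i * m x i - t * d l * (of_int (C l i) * x i)
      - (if i = l then t * d i * (m x i - t * of_int (C i l)) else 0))"
      unfolding q_def m_sh
    proof (intro sum.cong refl)
      fix i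
      have "d i * x i * (t * of_int (C i l)) = t * (d i * of_int (C i l)) * x i" by simp
      also have "\<dots> = t * d l * (of_int (C l i) * x i)" by (simp only: d(2)[of i l])
      finally have e: "d i * x i * (t * of_int (C i l)) = t * d l * (of_int (C l i) * x i)" .
      show "d i * sh x t l i * (m x i - t * of_int (C i l)) = d i * x i * m x i - t * d l * (of_int (C l i) * x i)
        - (if i = l then t * d i * (m x i - t * of_int (C i l)) else 0)"
        by (simp only: e[symmetric]) (simp add: sh_def algebra_simps)
    qed
    also have "\<dots> = q x - t * d l * m x l - t * d l * (m x l - t * 2)"
      by (simp add: sum_subtractf q_def m_def sum_distrib_left)
    finally show ?thesis by (simp add: power2_eq_square algebra_simps)
  qed
  obtain y where y: "\<And>i. m y i = of_int (fw k i)"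
    using fw_root_coords[of k] unfolding m_def by metis
  have orbit: "\<exists>x. (\<forall>i. m x i = of_int (act ws (fw k) i)) \<and> q x = q y" for ws
  proof (induction ws)
    case Nil show ?case using y by auto
  next
    case (Cons l ws)
    then obtain x where x: "\<forall>i. m x i = of_int (act ws (fw k) i)" "q x = q y" by blast
    show ?case
      by (rule exI[of _ "sh x (m x l) l"])
        (use x in \<open>simp add: m_sh q_sh wact_Cons srefl_def power2_eq_square\<close>)
  qed
  define K where "K = (\<Sum>l\<in>UNIV. 2 * q y / d l)"
  have "\<bar>act ws (fw k) l\<bar> \<le> \<lceil>K\<rceil> + 1" for ws l
  proof -
    obtain x where x: "\<forall>i. m x i = of_int (act ws (fw k) i)" "q x = q y" using orbit by blast
    define a where "a = act ws (fw k) l"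
    \<comment> \<open>\<open>m x l / 2\<close> is the shift along the \<open>l\<close>-th simple
      root that minimises \<open>q\<close>; the minimum is
      \<open>q x - d l * (m x l)\<^sup>2 / 2\<close>.\<close>
    have "0 \<le> q (sh x (m x l / 2) l)" by (rule q_nonneg)
    then have "(m x l)\<^sup>2 * d l \<le> 2 * q y" by (simp add: q_sh x(2) power2_eq_square field_simps)
    then have "(m x l)\<^sup>2 \<le> 2 * q y / d l" using d(1)[of l] by (simp add: field_simps)
    also have "\<dots> \<le> K" unfolding K_def
      by (rule member_le_sum) (auto simp: q_nonneg d(1) less_imp_le)
    finally have "of_int (a\<^sup>2) \<le> K" using x(1) by (simp add: a_def)
    then have "a\<^sup>2 \<le> \<lceil>K\<rceil>" by linarith
    moreover have "\<bar>a\<bar> \<le> a\<^sup>2"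
    proof (cases "a = 0")
      case False
      then have "\<bar>a\<bar> * 1 \<le> \<bar>a\<bar> * \<bar>a\<bar>" by (intro mult_left_mono) linarith+
      then show ?thesis by (simp add: power2_eq_square)
    qed simp
    ultimately have "\<bar>a\<bar> \<le> \<lceil>K\<rceil> + 1" by linarith
    then show ?thesis by (simp only: a_def)
  qed
  then show ?thesis by blast
qed

text \<open>Elements are determined by their integer matrices, whose entries are uniformly
  bounded.\<close>

lemma finite_weyl: "finite W"
proof -
  obtain K where K: "\<And>k ws l. \<bar>act ws (fw k) l\<bar> \<le> K k" using orbit_bounded by metis
  define K' where "K' = (\<Sum>k\<in>UNIV. \<bar>K k\<bar>)"
  have K': "\<bar>act ws (fw k) l\<bar> \<le> K'" for ws k l
  proof -
    have "\<bar>K k\<bar> \<le> K'" unfolding K'_def by (rule member_le_sum) auto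
    then show ?thesis using K[of ws k l] by simp
  qed
  define f where "f = (\<lambda>(w :: 'i wt \<Rightarrow> 'i wt) (k, l). w (fw k) l)"
  have "f ` W \<subseteq> (UNIV \<rightarrow>\<^sub>E {-K'..K'})"
    using K' by (auto simp: f_def weyl_def abs_le_iff minus_le_iff)
  then have "finite (f ` W)" by (rule finite_subset) (intro finite_PiE finite; simp)
  moreover have "inj_on f W"
  proof (rule inj_onI)
    fix v w assume vw: "v \<in> W" "w \<in> W" "f v = f w"
    have "v (fw k) = w (fw k)" for k
    proof
      fix l show "v (fw k) l = w (fw k) l" using fun_cong[OF vw(3), of "(k, l)"] by (simp add: f_def)
    qed
    then show "v = w" by (intro weyl_eqI vw)
  qed
  ultimately show ?thesis by (rule finite_imageD)
qed

lemma longest_ex: "\<exists>w. longest C w"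
proof -
  have fin: "finite (len ` W)" using finite_weyl by (rule finite_imageI)
  moreover have "len ` W \<noteq> {}" using imageI[OF id_in_weyl[of C], of len] by (metis empty_iff)
  ultimately have "Max (len ` W) \<in> len ` W" by (rule Max_in)
  then obtain w where "w \<in> W" "len w = Max (len ` W)" by auto
  then have "longest C w" using Max_ge[OF fin] by (simp add: longest_def)
  then show ?thesis by (intro exI[of _ w])
qed

definition w0 :: "'i wt \<Rightarrow> 'i wt" where "w0 = (SOME w. longest C w)"

lemma longest_w0: "longest C w0"
  unfolding w0_def using longest_ex by (rule someI_ex)

lemma longest_iff: "longest C w \<longleftrightarrow> w = w0"
  using longest_unique longest_w0 by blast

lemma w0_in_weyl [simp]: "w0 \<in> W"
  using longest_w0 by (simp add: longest_def)

lemma reduced_extend: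
  assumes "reduced p"
  obtains r where "reduced (p @ r)" "act (p @ r) = w0"
proof -
  obtain r where r: "reduced r" "act r = act (rev p) \<circ> w0"
    using reduced_word_ex[OF weyl_comp[OF wact_in_weyl w0_in_weyl]] .
  have "act (p @ r) = w0" by (simp add: wact_append r(2) fun_eq_iff)
  moreover have "len w0 = length (p @ r)"
    using nonpos_extend[OF w0_in_weyl longest_nonpos[OF longest_w0] assms] r by (simp add: reduced_def)
  ultimately show thesis using that by (simp add: reduced_def)
qed

end


subsection \<open>Rank two transition maps\<close>

text \<open>The minima \<open>P5\<close>, \<open>P7\<close>, \<open>P8\<close>, \<open>P10\<close> are the tropical polynomials in the closed formula of
  Berenstein and Zelevinsky for the transition map of type G2.\<close>

lemma g2_moves_forward:
  fixes t1 t2 t3 t4 t5 t6 :: int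
  assumes "P5 = Min {t1 + t2 + 2 * t3 + t4, t1 + t2 + 2 * t3 + t6, t1 + t2 + 2 * t5 + t6, t1 + t4 + 2 * t5 + t6, t3 + t4 + 2 * t5 + t6}"
      and "P7 = Min {2 * t1 + 2 * t2 + 3 * t3 + t4, 2 * t1 + 2 * t2 + 3 * t3 + t6, 2 * t1 + 2 * t2 + 3 * t5 + t6, 2 * t1 + 2 * t4 + 3 * t5 + t6, 2 * t3 + 2 * t4 + 3 * t5 + t6}"
      and "P8 = Min {3 * t1 + 2 * t2 + 3 * t3 + t4, 3 * t1 + 2 * t2 + 3 * t3 + t6, 3 * t1 + 2 * t2 + 3 * t5 + t6, 3 * t1 + 2 * t4 + 3 * t5 + t6, 2 * t1 + t2 + 2 * t3 + t4 + 2 * t5 + t6, 3 * t3 + 2 * t4 + 3 * t5 + t6}"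
      and "P10 = Min {3 * t1 + 3 * t2 + 6 * t3 + 2 * t4, 3 * t1 + 3 * t2 + 6 * t3 + 2 * t6, 3 * t1 + 3 * t2 + 6 * t5 + 2 * t6, 3 * t1 + 3 * t4 + 6 * t5 + 2 * t6, 2 * t1 + t2 + 3 * t3 + 2 * t4 + 4 * t5 + 2 * t6, 2 * t1 + t2 + t3 + 2 * t4 + 6 * t5 + 2 * t6, 3 * t3 + 3 * t4 + 6 * t5 + 2 * t6}"
  shows "fold move g2_moves [t1, t1, t1, t2, t3, t3, t3, t4, t5, t5, t5, t6] =
    [t2 + 3 * t3 + 2 * t4 + 3 * t5 + t6 - P8, P8 - P7, P8 - P7, P8 - P7, 3 * P7 - P8 - P10, P10 - P5 - P7, P10 - P5 - P7, P10 - P5 - P7, 3 * P5 - P10, t1 + t2 + 2 * t3 + t4 + t5 - P5, t1 + t2 + 2 * t3 + t4 + t5 - P5, t1 + t2 + 2 * t3 + t4 + t5 - P5]"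
proof -
  \<comment> \<open>These are the tropical polynomials met on the way. With them the minimum taken
    in each of the sixteen A2 moves of \<open>g2_moves\<close> becomes a signed sum of the
    \<open>P\<close>s; this is the content of \<open>r0\<close> to \<open>r15\<close>.\<close>
  define P0 where "P0 = Min {t1, t3}"
  define P1 where "P1 = Min {t3, t5}"
  define P2 where "P2 = Min {t1 + t2 + t3, t1 + t2 + t5, t1 + t4 + t5, t3 + t4 + t5}"
  define P3 where "P3 = Min {2 * t1 + t2 + t3, 2 * t1 + t2 + t5, 2 * t1 + t4 + t5, 2 * t3 + t4 + t5}"
  define P4 where "P4 = Min {t1 + t2 + 2 * t3, t1 + t2 + 2 * t5, t1 + t4 + 2 * t5, t3 + t4 + 2 * t5}"
  define P6 where "P6 = Min {2 * t1 + 2 * t2 + 4 * t3 + t4, 2 * t1 + 2 * t2 + 4 * t3 + t6, 2 * t1 + 2 * t2 + 3 * t3 + t4 + t5, 2 * t1 + 2 * t2 + 4 * t5 + t6, 2 * t1 + t2 + t3 + t4 + 3 * t5 + t6, 2 * t1 + 2 * t4 + 4 * t5 + t6, t1 + t2 + 2 * t3 + t4 + 3 * t5 + t6, 2 * t3 + 2 * t4 + 4 * t5 + t6}"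
  define P9 where "P9 = Min {2 * t1 + t2 + 2 * t3 + t4, 2 * t1 + t2 + 2 * t3 + t6, 2 * t1 + t2 + 2 * t5 + t6, 2 * t1 + t4 + 2 * t5 + t6, t1 + t2 + 3 * t3 + t4, t1 + t2 + 3 * t3 + t6, t1 + t2 + 3 * t5 + t6, t1 + t4 + 3 * t5 + t6, 2 * t3 + t4 + 2 * t5 + t6, t3 + t4 + 3 * t5 + t6}"
  have l0: "P0 \<le> t1" "P0 \<le> t3"
    unfolding P0_def by (rule Min_le, simp only: finite_insert finite.emptyI, (rule insertI1 | rule insertI2)+)+
  have "P0 \<in> {t1, t3}"
    unfolding P0_def by (rule Min_in) (simp_all only: finite_insert finite.emptyI insert_not_empty simp_thms)
  then have c0: "P0 = t1 \<or> P0 = t3"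
    by (simp only: insert_iff empty_iff simp_thms)
  have l1: "P1 \<le> t3" "P1 \<le> t5"
    unfolding P1_def by (rule Min_le, simp only: finite_insert finite.emptyI, (rule insertI1 | rule insertI2)+)+
  have "P1 \<in> {t3, t5}"
    unfolding P1_def by (rule Min_in) (simp_all only: finite_insert finite.emptyI insert_not_empty simp_thms)
  then have c1: "P1 = t3 \<or> P1 = t5"
    by (simp only: insert_iff empty_iff simp_thms)
  have l2: "P2 \<le> t1 + t2 + t3" "P2 \<le> t1 + t2 + t5" "P2 \<le> t1 + t4 + t5" "P2 \<le> t3 + t4 + t5"
    unfolding P2_def by (rule Min_le, simp only: finite_insert finite.emptyI, (rule insertI1 | rule insertI2)+)+
  have "P2 \<in> {t1 + t2 + t3, t1 + t2 + t5, t1 + t4 + t5, t3 + t4 + t5}"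
    unfolding P2_def by (rule Min_in) (simp_all only: finite_insert finite.emptyI insert_not_empty simp_thms)
  then have c2: "P2 = t1 + t2 + t3 \<or> P2 = t1 + t2 + t5 \<or> P2 = t1 + t4 + t5 \<or> P2 = t3 + t4 + t5"
    by (simp only: insert_iff empty_iff simp_thms)
  have l3: "P3 \<le> 2 * t1 + t2 + t3" "P3 \<le> 2 * t1 + t2 + t5" "P3 \<le> 2 * t1 + t4 + t5" "P3 \<le> 2 * t3 + t4 + t5"
    unfolding P3_def by (rule Min_le, simp only: finite_insert finite.emptyI, (rule insertI1 | rule insertI2)+)+
  have "P3 \<in> {2 * t1 + t2 + t3, 2 * t1 + t2 + t5, 2 * t1 + t4 + t5, 2 * t3 + t4 + t5}"
    unfolding P3_def by (rule Min_in) (simp_all only: finite_insert finite.emptyI insert_not_empty simp_thms)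
  then have c3: "P3 = 2 * t1 + t2 + t3 \<or> P3 = 2 * t1 + t2 + t5 \<or> P3 = 2 * t1 + t4 + t5 \<or> P3 = 2 * t3 + t4 + t5"
    by (simp only: insert_iff empty_iff simp_thms)
  have l4: "P4 \<le> t1 + t2 + 2 * t3" "P4 \<le> t1 + t2 + 2 * t5" "P4 \<le> t1 + t4 + 2 * t5" "P4 \<le> t3 + t4 + 2 * t5"
    unfolding P4_def by (rule Min_le, simp only: finite_insert finite.emptyI, (rule insertI1 | rule insertI2)+)+
  have "P4 \<in> {t1 + t2 + 2 * t3, t1 + t2 + 2 * t5, t1 + t4 + 2 * t5, t3 + t4 + 2 * t5}"
    unfolding P4_def by (rule Min_in) (simp_all only: finite_insert finite.emptyI insert_not_empty simp_thms)
  then have c4: "P4 = t1 + t2 + 2 * t3 \<or> P4 = t1 + t2 + 2 * t5 \<or> P4 = t1 + t4 + 2 * t5 \<or> P4 = t3 + t4 + 2 * t5"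
    by (simp only: insert_iff empty_iff simp_thms)
  have l5: "P5 \<le> t1 + t2 + 2 * t3 + t4" "P5 \<le> t1 + t2 + 2 * t3 + t6" "P5 \<le> t1 + t2 + 2 * t5 + t6" "P5 \<le> t1 + t4 + 2 * t5 + t6" "P5 \<le> t3 + t4 + 2 * t5 + t6"
    unfolding assms(1) by (rule Min_le, simp only: finite_insert finite.emptyI, (rule insertI1 | rule insertI2)+)+
  have "P5 \<in> {t1 + t2 + 2 * t3 + t4, t1 + t2 + 2 * t3 + t6, t1 + t2 + 2 * t5 + t6, t1 + t4 + 2 * t5 + t6, t3 + t4 + 2 * t5 + t6}"
    unfolding assms(1) by (rule Min_in) (simp_all only: finite_insert finite.emptyI insert_not_empty simp_thms)
  then have c5: "P5 = t1 + t2 + 2 * t3 + t4 \<or> P5 = t1 + t2 + 2 * t3 + t6 \<or> P5 = t1 + t2 + 2 * t5 + t6 \<or> P5 = t1 + t4 + 2 * t5 + t6 \<or> P5 = t3 + t4 + 2 * t5 + t6"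
    by (simp only: insert_iff empty_iff simp_thms)
  have l6: "P6 \<le> 2 * t1 + 2 * t2 + 4 * t3 + t4" "P6 \<le> 2 * t1 + 2 * t2 + 4 * t3 + t6" "P6 \<le> 2 * t1 + 2 * t2 + 3 * t3 + t4 + t5" "P6 \<le> 2 * t1 + 2 * t2 + 4 * t5 + t6" "P6 \<le> 2 * t1 + t2 + t3 + t4 + 3 * t5 + t6" "P6 \<le> 2 * t1 + 2 * t4 + 4 * t5 + t6" "P6 \<le> t1 + t2 + 2 * t3 + t4 + 3 * t5 + t6" "P6 \<le> 2 * t3 + 2 * t4 + 4 * t5 + t6"
    unfolding P6_def by (rule Min_le, simp only: finite_insert finite.emptyI, (rule insertI1 | rule insertI2)+)+
  have "P6 \<in> {2 * t1 + 2 * t2 + 4 * t3 + t4, 2 * t1 + 2 * t2 + 4 * t3 + t6, 2 * t1 + 2 * t2 + 3 * t3 + t4 + t5, 2 * t1 + 2 * t2 + 4 * t5 + t6, 2 * t1 + t2 + t3 + t4 + 3 * t5 + t6, 2 * t1 + 2 * t4 + 4 * t5 + t6, t1 + t2 + 2 * t3 + t4 + 3 * t5 + t6, 2 * t3 + 2 * t4 + 4 * t5 + t6}"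
    unfolding P6_def by (rule Min_in) (simp_all only: finite_insert finite.emptyI insert_not_empty simp_thms)
  then have c6: "P6 = 2 * t1 + 2 * t2 + 4 * t3 + t4 \<or> P6 = 2 * t1 + 2 * t2 + 4 * t3 + t6 \<or> P6 = 2 * t1 + 2 * t2 + 3 * t3 + t4 + t5 \<or> P6 = 2 * t1 + 2 * t2 + 4 * t5 + t6 \<or> P6 = 2 * t1 + t2 + t3 + t4 + 3 * t5 + t6 \<or> P6 = 2 * t1 + 2 * t4 + 4 * t5 + t6 \<or> P6 = t1 + t2 + 2 * t3 + t4 + 3 * t5 + t6 \<or> P6 = 2 * t3 + 2 * t4 + 4 * t5 + t6"
    by (simp only: insert_iff empty_iff simp_thms)
  have l7: "P7 \<le> 2 * t1 + 2 * t2 + 3 * t3 + t4" "P7 \<le> 2 * t1 + 2 * t2 + 3 * t3 + t6" "P7 \<le> 2 * t1 + 2 * t2 + 3 * t5 + t6" "P7 \<le> 2 * t1 + 2 * t4 + 3 * t5 + t6" "P7 \<le> 2 * t3 + 2 * t4 + 3 * t5 + t6"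
    unfolding assms(2) by (rule Min_le, simp only: finite_insert finite.emptyI, (rule insertI1 | rule insertI2)+)+
  have "P7 \<in> {2 * t1 + 2 * t2 + 3 * t3 + t4, 2 * t1 + 2 * t2 + 3 * t3 + t6, 2 * t1 + 2 * t2 + 3 * t5 + t6, 2 * t1 + 2 * t4 + 3 * t5 + t6, 2 * t3 + 2 * t4 + 3 * t5 + t6}"
    unfolding assms(2) by (rule Min_in) (simp_all only: finite_insert finite.emptyI insert_not_empty simp_thms)
  then have c7: "P7 = 2 * t1 + 2 * t2 + 3 * t3 + t4 \<or> P7 = 2 * t1 + 2 * t2 + 3 * t3 + t6 \<or> P7 = 2 * t1 + 2 * t2 + 3 * t5 + t6 \<or> P7 = 2 * t1 + 2 * t4 + 3 * t5 + t6 \<or> P7 = 2 * t3 + 2 * t4 + 3 * t5 + t6"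
    by (simp only: insert_iff empty_iff simp_thms)
  have l8: "P8 \<le> 3 * t1 + 2 * t2 + 3 * t3 + t4" "P8 \<le> 3 * t1 + 2 * t2 + 3 * t3 + t6" "P8 \<le> 3 * t1 + 2 * t2 + 3 * t5 + t6" "P8 \<le> 3 * t1 + 2 * t4 + 3 * t5 + t6" "P8 \<le> 2 * t1 + t2 + 2 * t3 + t4 + 2 * t5 + t6" "P8 \<le> 3 * t3 + 2 * t4 + 3 * t5 + t6"
    unfolding assms(3) by (rule Min_le, simp only: finite_insert finite.emptyI, (rule insertI1 | rule insertI2)+)+
  have "P8 \<in> {3 * t1 + 2 * t2 + 3 * t3 + t4, 3 * t1 + 2 * t2 + 3 * t3 + t6, 3 * t1 + 2 * t2 + 3 * t5 + t6, 3 * t1 + 2 * t4 + 3 * t5 + t6, 2 * t1 + t2 + 2 * t3 + t4 + 2 * t5 + t6, 3 * t3 + 2 * t4 + 3 * t5 + t6}"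
    unfolding assms(3) by (rule Min_in) (simp_all only: finite_insert finite.emptyI insert_not_empty simp_thms)
  then have c8: "P8 = 3 * t1 + 2 * t2 + 3 * t3 + t4 \<or> P8 = 3 * t1 + 2 * t2 + 3 * t3 + t6 \<or> P8 = 3 * t1 + 2 * t2 + 3 * t5 + t6 \<or> P8 = 3 * t1 + 2 * t4 + 3 * t5 + t6 \<or> P8 = 2 * t1 + t2 + 2 * t3 + t4 + 2 * t5 + t6 \<or> P8 = 3 * t3 + 2 * t4 + 3 * t5 + t6"
    by (simp only: insert_iff empty_iff simp_thms)
  have l9: "P9 \<le> 2 * t1 + t2 + 2 * t3 + t4" "P9 \<le> 2 * t1 + t2 + 2 * t3 + t6" "P9 \<le> 2 * t1 + t2 + 2 * t5 + t6" "P9 \<le> 2 * t1 + t4 + 2 * t5 + t6" "P9 \<le> t1 + t2 + 3 * t3 + t4" "P9 \<le> t1 + t2 + 3 * t3 + t6" "P9 \<le> t1 + t2 + 3 * t5 + t6" "P9 \<le> t1 + t4 + 3 * t5 + t6" "P9 \<le> 2 * t3 + t4 + 2 * t5 + t6" "P9 \<le> t3 + t4 + 3 * t5 + t6"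
    unfolding P9_def by (rule Min_le, simp only: finite_insert finite.emptyI, (rule insertI1 | rule insertI2)+)+
  have "P9 \<in> {2 * t1 + t2 + 2 * t3 + t4, 2 * t1 + t2 + 2 * t3 + t6, 2 * t1 + t2 + 2 * t5 + t6, 2 * t1 + t4 + 2 * t5 + t6, t1 + t2 + 3 * t3 + t4, t1 + t2 + 3 * t3 + t6, t1 + t2 + 3 * t5 + t6, t1 + t4 + 3 * t5 + t6, 2 * t3 + t4 + 2 * t5 + t6, t3 + t4 + 3 * t5 + t6}"
    unfolding P9_def by (rule Min_in) (simp_all only: finite_insert finite.emptyI insert_not_empty simp_thms)
  then have c9: "P9 = 2 * t1 + t2 + 2 * t3 + t4 \<or> P9 = 2 * t1 + t2 + 2 * t3 + t6 \<or> P9 = 2 * t1 + t2 + 2 * t5 + t6 \<or> P9 = 2 * t1 + t4 + 2 * t5 + t6 \<or> P9 = t1 + t2 + 3 * t3 + t4 \<or> P9 = t1 + t2 + 3 * t3 + t6 \<or> P9 = t1 + t2 + 3 * t5 + t6 \<or> P9 = t1 + t4 + 3 * t5 + t6 \<or> P9 = 2 * t3 + t4 + 2 * t5 + t6 \<or> P9 = t3 + t4 + 3 * t5 + t6"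
    by (simp only: insert_iff empty_iff simp_thms)
  have l10: "P10 \<le> 3 * t1 + 3 * t2 + 6 * t3 + 2 * t4" "P10 \<le> 3 * t1 + 3 * t2 + 6 * t3 + 2 * t6" "P10 \<le> 3 * t1 + 3 * t2 + 6 * t5 + 2 * t6" "P10 \<le> 3 * t1 + 3 * t4 + 6 * t5 + 2 * t6" "P10 \<le> 2 * t1 + t2 + 3 * t3 + 2 * t4 + 4 * t5 + 2 * t6" "P10 \<le> 2 * t1 + t2 + t3 + 2 * t4 + 6 * t5 + 2 * t6" "P10 \<le> 3 * t3 + 3 * t4 + 6 * t5 + 2 * t6"
    unfolding assms(4) by (rule Min_le, simp only: finite_insert finite.emptyI, (rule insertI1 | rule insertI2)+)+
  have "P10 \<in> {3 * t1 + 3 * t2 + 6 * t3 + 2 * t4, 3 * t1 + 3 * t2 + 6 * t3 + 2 * t6, 3 * t1 + 3 * t2 + 6 * t5 + 2 * t6, 3 * t1 + 3 * t4 + 6 * t5 + 2 * t6, 2 * t1 + t2 + 3 * t3 + 2 * t4 + 4 * t5 + 2 * t6, 2 * t1 + t2 + t3 + 2 * t4 + 6 * t5 + 2 * t6, 3 * t3 + 3 * t4 + 6 * t5 + 2 * t6}"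
    unfolding assms(4) by (rule Min_in) (simp_all only: finite_insert finite.emptyI insert_not_empty simp_thms)
  then have c10: "P10 = 3 * t1 + 3 * t2 + 6 * t3 + 2 * t4 \<or> P10 = 3 * t1 + 3 * t2 + 6 * t3 + 2 * t6 \<or> P10 = 3 * t1 + 3 * t2 + 6 * t5 + 2 * t6 \<or> P10 = 3 * t1 + 3 * t4 + 6 * t5 + 2 * t6 \<or> P10 = 2 * t1 + t2 + 3 * t3 + 2 * t4 + 4 * t5 + 2 * t6 \<or> P10 = 2 * t1 + t2 + t3 + 2 * t4 + 6 * t5 + 2 * t6 \<or> P10 = 3 * t3 + 3 * t4 + 6 * t5 + 2 * t6"
    by (simp only: insert_iff empty_iff simp_thms)
  \<comment> \<open>In these identities a minimum that must be bounded from above enters through its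
    bounds \<open>l\<close>, one that must be bounded from below through the cases \<open>c\<close>
    of where it is attained. Every case is linear.\<close>
  have r0: "min (t1) (t3) = P0"
  proof (rule antisym)
    show "min (t1) (t3) \<le> P0"
    proof (rule ccontr)
      assume "\<not> ?thesis"
      then have *: "P0 < t1" "P0 < t3" by (simp_all only: min_le_iff_disj de_Morgan_disj not_le)
      show False using *  c0 by - (elim disjE; linarith)
    qed
    have "P0 \<le> t1" using l0 by linarith
    moreover have "P0 \<le> t3" using l0 by linarith
    ultimately show "P0 \<le> min (t1) (t3)" by (rule min.boundedI)
  qed
  have r1: "min (t3) (t5) = P1"
  proof (rule antisym)
    show "min (t3) (t5) \<le> P1"
    proof (rule ccontr)
      assume "\<not> ?thesis"
      then have *: "P1 < t3" "P1 < t5" by (simp_all only: min_le_iff_disj de_Morgan_disj not_le)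
      show False using *  c1 by - (elim disjE; linarith)
    qed
    have "P1 \<le> t3" using l1 by linarith
    moreover have "P1 \<le> t5" using l1 by linarith
    ultimately show "P1 \<le> min (t3) (t5)" by (rule min.boundedI)
  qed
  have r2: "min (t1 + t2 - P0) (t4 + t5 - P1) = P2 - P0 - P1"
  proof (rule antisym)
    show "min (t1 + t2 - P0) (t4 + t5 - P1) \<le> P2 - P0 - P1"
    proof (rule ccontr)
      assume "\<not> ?thesis"
      then have *: "P2 - P0 - P1 < t1 + t2 - P0" "P2 - P0 - P1 < t4 + t5 - P1" by (simp_all only: min_le_iff_disj de_Morgan_disj not_le)
      show False using * l0 l1 c2 by - (elim disjE; linarith)
    qed
    have "P2 - P0 - P1 \<le> t1 + t2 - P0" using l2 c1 by - (elim disjE; linarith)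
    moreover have "P2 - P0 - P1 \<le> t4 + t5 - P1" using l2 c0 by - (elim disjE; linarith)
    ultimately show "P2 - P0 - P1 \<le> min (t1 + t2 - P0) (t4 + t5 - P1)" by (rule min.boundedI)
  qed
  have r3: "min (t1) (t3 + t4 + t5 + P0 - P2) = P3 - P2"
  proof (rule antisym)
    show "min (t1) (t3 + t4 + t5 + P0 - P2) \<le> P3 - P2"
    proof (rule ccontr)
      assume "\<not> ?thesis"
      then have *: "P3 - P2 < t1" "P3 - P2 < t3 + t4 + t5 + P0 - P2" by (simp_all only: min_le_iff_disj de_Morgan_disj not_le)
      show False using * l0 l2 c3 by - (elim disjE; linarith)
    qed
    have "P3 - P2 \<le> t1" using l3 c2 by - (elim disjE; linarith)
    moreover have "P3 - P2 \<le> t3 + t4 + t5 + P0 - P2" using l3 c0 by - (elim disjE; linarith)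
    ultimately show "P3 - P2 \<le> min (t1) (t3 + t4 + t5 + P0 - P2)" by (rule min.boundedI)
  qed
  have r4: "min (t1 + t2 + t3 + P2 - P0 - P3) (P2 - P0 - P1) = 2 * P2 - P1 - P3"
  proof (rule antisym)
    show "min (t1 + t2 + t3 + P2 - P0 - P3) (P2 - P0 - P1) \<le> 2 * P2 - P1 - P3"
    proof (rule ccontr)
      assume "\<not> ?thesis"
      then have *: "2 * P2 - P1 - P3 < t1 + t2 + t3 + P2 - P0 - P3" "2 * P2 - P1 - P3 < P2 - P0 - P1" by (simp_all only: min_le_iff_disj de_Morgan_disj not_le)
      show False using * l1 l3 c0 c2 by - (elim disjE; linarith)
    qed
    have "2 * P2 - P1 - P3 \<le> t1 + t2 + t3 + P2 - P0 - P3" using l0 l2 c1 by - (elim disjE; linarith)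
    moreover have "2 * P2 - P1 - P3 \<le> P2 - P0 - P1" using l0 l2 c3 by - (elim disjE; linarith)
    ultimately show "2 * P2 - P1 - P3 \<le> min (t1 + t2 + t3 + P2 - P0 - P3) (P2 - P0 - P1)" by (rule min.boundedI)
  qed
  have r5: "min (t1 + t2 + t3 + P1 - P2) (t5) = P4 - P2"
  proof (rule antisym)
    show "min (t1 + t2 + t3 + P1 - P2) (t5) \<le> P4 - P2"
    proof (rule ccontr)
      assume "\<not> ?thesis"
      then have *: "P4 - P2 < t1 + t2 + t3 + P1 - P2" "P4 - P2 < t5" by (simp_all only: min_le_iff_disj de_Morgan_disj not_le)
      show False using * l1 l2 c4 by - (elim disjE; linarith)
    qed
    have "P4 - P2 \<le> t1 + t2 + t3 + P1 - P2" using l4 c1 by - (elim disjE; linarith)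
    moreover have "P4 - P2 \<le> t5" using l4 c2 by - (elim disjE; linarith)
    ultimately show "P4 - P2 \<le> min (t1 + t2 + t3 + P1 - P2) (t5)" by (rule min.boundedI)
  qed
  have r6: "min (t1 + t2 + 2 * t3 + t4 - P4) (t6) = P5 - P4"
  proof (rule antisym)
    show "min (t1 + t2 + 2 * t3 + t4 - P4) (t6) \<le> P5 - P4"
    proof (rule ccontr)
      assume "\<not> ?thesis"
      then have *: "P5 - P4 < t1 + t2 + 2 * t3 + t4 - P4" "P5 - P4 < t6" by (simp_all only: min_le_iff_disj de_Morgan_disj not_le)
      show False using * l4 c5 by - (elim disjE; linarith)
    qed
    have "P5 - P4 \<le> t1 + t2 + 2 * t3 + t4 - P4" using l5 by linarith
    moreover have "P5 - P4 \<le> t6" using l5 c4 by - (elim disjE; linarith)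
    ultimately show "P5 - P4 \<le> min (t1 + t2 + 2 * t3 + t4 - P4) (t6)" by (rule min.boundedI)
  qed
  have r7: "min (t1 + t2 + t3 + P1 - P2) (t5 + t6 + P4 - P5) = P6 - P2 - P5"
  proof (rule antisym)
    show "min (t1 + t2 + t3 + P1 - P2) (t5 + t6 + P4 - P5) \<le> P6 - P2 - P5"
    proof (rule ccontr)
      assume "\<not> ?thesis"
      then have *: "P6 - P2 - P5 < t1 + t2 + t3 + P1 - P2" "P6 - P2 - P5 < t5 + t6 + P4 - P5" by (simp_all only: min_le_iff_disj de_Morgan_disj not_le)
      show False using * l1 l2 l4 l5 c6 by - (elim disjE; linarith)
    qed
    have "P6 - P2 - P5 \<le> t1 + t2 + t3 + P1 - P2" using l6 c1 c5 by - (elim disjE; linarith)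
    moreover have "P6 - P2 - P5 \<le> t5 + t6 + P4 - P5" using l6 c2 c4 by - (elim disjE; linarith)
    ultimately show "P6 - P2 - P5 \<le> min (t1 + t2 + t3 + P1 - P2) (t5 + t6 + P4 - P5)" by (rule min.boundedI)
  qed
  have r8: "min (2 * P2 - P1 - P3) (t3 + t4 + 2 * t5 + t6 + 2 * P2 - P1 - P6) = 2 * P2 + P7 - P3 - P6"
  proof (rule antisym)
    show "min (2 * P2 - P1 - P3) (t3 + t4 + 2 * t5 + t6 + 2 * P2 - P1 - P6) \<le> 2 * P2 + P7 - P3 - P6"
    proof (rule ccontr)
      assume "\<not> ?thesis"
      then have *: "2 * P2 + P7 - P3 - P6 < 2 * P2 - P1 - P3" "2 * P2 + P7 - P3 - P6 < t3 + t4 + 2 * t5 + t6 + 2 * P2 - P1 - P6" by (simp_all only: min_le_iff_disj de_Morgan_disj not_le)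
      show False using * l3 l6 c1 c7 by - (elim disjE; linarith)
    qed
    have "2 * P2 + P7 - P3 - P6 \<le> 2 * P2 - P1 - P3" using l1 l7 c6 by - (elim disjE; linarith)
    moreover have "2 * P2 + P7 - P3 - P6 \<le> t3 + t4 + 2 * t5 + t6 + 2 * P2 - P1 - P6" using l1 l7 c3 by - (elim disjE; linarith)
    ultimately show "2 * P2 + P7 - P3 - P6 \<le> min (2 * P2 - P1 - P3) (t3 + t4 + 2 * t5 + t6 + 2 * P2 - P1 - P6)" by (rule min.boundedI)
  qed
  have r9: "min (t1) (t3 + t4 + 2 * t5 + t6 + P3 - P7) = P8 - P7"
  proof (rule antisym)
    show "min (t1) (t3 + t4 + 2 * t5 + t6 + P3 - P7) \<le> P8 - P7"
    proof (rule ccontr)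
      assume "\<not> ?thesis"
      then have *: "P8 - P7 < t1" "P8 - P7 < t3 + t4 + 2 * t5 + t6 + P3 - P7" by (simp_all only: min_le_iff_disj de_Morgan_disj not_le)
      show False using * l3 l7 c8 by - (elim disjE; linarith)
    qed
    have "P8 - P7 \<le> t1" using l8 c7 by - (elim disjE; linarith)
    moreover have "P8 - P7 \<le> t3 + t4 + 2 * t5 + t6 + P3 - P7" using l8 c3 by - (elim disjE; linarith)
    ultimately show "P8 - P7 \<le> min (t1) (t3 + t4 + 2 * t5 + t6 + P3 - P7)" by (rule min.boundedI)
  qed
  have r10: "min (P3 - P2) (P6 - P2 - P5) = P9 - P5"
  proof (rule antisym)
    show "min (P3 - P2) (P6 - P2 - P5) \<le> P9 - P5"
    proof (rule ccontr)
      assume "\<not> ?thesis"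
      then have *: "P9 - P5 < P3 - P2" "P9 - P5 < P6 - P2 - P5" by (simp_all only: min_le_iff_disj de_Morgan_disj not_le)
      show False using * l3 l5 l6 c2 c9 by - (elim disjE; linarith)
    qed
    have "P9 - P5 \<le> P3 - P2" using l2 l9 c3 c5 by - (elim disjE; linarith)
    moreover have "P9 - P5 \<le> P6 - P2 - P5" using l2 l9 c6 by - (elim disjE; linarith)
    ultimately show "P9 - P5 \<le> min (P3 - P2) (P6 - P2 - P5)" by (rule min.boundedI)
  qed
  have r11: "min (t1 + t2 + 2 * t3 + t4 + t5 + P7 - P3 - P8) (P2 + P7 - P3 - P9) = 2 * P7 - P8 - P9"
  proof (rule antisym)
    show "min (t1 + t2 + 2 * t3 + t4 + t5 + P7 - P3 - P8) (P2 + P7 - P3 - P9) \<le> 2 * P7 - P8 - P9"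
    proof (rule ccontr)
      assume "\<not> ?thesis"
      then have *: "2 * P7 - P8 - P9 < t1 + t2 + 2 * t3 + t4 + t5 + P7 - P3 - P8" "2 * P7 - P8 - P9 < P2 + P7 - P3 - P9" by (simp_all only: min_le_iff_disj de_Morgan_disj not_le)
      show False using * l2 l8 l9 c3 c7 by - (elim disjE; linarith)
    qed
    have "2 * P7 - P8 - P9 \<le> t1 + t2 + 2 * t3 + t4 + t5 + P7 - P3 - P8" using l3 l7 c9 by - (elim disjE; linarith)
    moreover have "2 * P7 - P8 - P9 \<le> P2 + P7 - P3 - P9" using l3 l7 c2 c8 by - (elim disjE; linarith)
    ultimately show "2 * P7 - P8 - P9 \<le> min (t1 + t2 + 2 * t3 + t4 + t5 + P7 - P3 - P8) (P2 + P7 - P3 - P9)" by (rule min.boundedI)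
  qed
  have r12: "min (t1 + t2 + 2 * t3 + t4 + t5 + P2 + P5 - P4 - P6) (P5 - P4) = 2 * P5 - P6"
  proof (rule antisym)
    show "min (t1 + t2 + 2 * t3 + t4 + t5 + P2 + P5 - P4 - P6) (P5 - P4) \<le> 2 * P5 - P6"
    proof (rule ccontr)
      assume "\<not> ?thesis"
      then have *: "2 * P5 - P6 < t1 + t2 + 2 * t3 + t4 + t5 + P2 + P5 - P4 - P6" "2 * P5 - P6 < P5 - P4" by (simp_all only: min_le_iff_disj de_Morgan_disj not_le)
      show False using * l2 l6 c4 c5 by - (elim disjE; linarith)
    qed
    have "2 * P5 - P6 \<le> t1 + t2 + 2 * t3 + t4 + t5 + P2 + P5 - P4 - P6" using l4 l5 c2 by - (elim disjE; linarith)
    moreover have "2 * P5 - P6 \<le> P5 - P4" using l4 l5 c6 by - (elim disjE; linarith)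
    ultimately show "2 * P5 - P6 \<le> min (t1 + t2 + 2 * t3 + t4 + t5 + P2 + P5 - P4 - P6) (P5 - P4)" by (rule min.boundedI)
  qed
  have r13: "min (t1 + t2 + 2 * t3 + t4 + t5 + P9 - P2 - P7) (P6 - P2 - P5) = P10 - P5 - P7"
  proof (rule antisym)
    show "min (t1 + t2 + 2 * t3 + t4 + t5 + P9 - P2 - P7) (P6 - P2 - P5) \<le> P10 - P5 - P7"
    proof (rule ccontr)
      assume "\<not> ?thesis"
      then have *: "P10 - P5 - P7 < t1 + t2 + 2 * t3 + t4 + t5 + P9 - P2 - P7" "P10 - P5 - P7 < P6 - P2 - P5" by (simp_all only: min_le_iff_disj de_Morgan_disj not_le)
      show False using * l5 l6 l7 l9 c2 c10 by - (elim disjE; linarith)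
    qed
    have "P10 - P5 - P7 \<le> t1 + t2 + 2 * t3 + t4 + t5 + P9 - P2 - P7" using l2 l10 c5 c9 by - (elim disjE; linarith)
    moreover have "P10 - P5 - P7 \<le> P6 - P2 - P5" using l2 l10 c6 c7 by - (elim disjE; linarith)
    ultimately show "P10 - P5 - P7 \<le> min (t1 + t2 + 2 * t3 + t4 + t5 + P9 - P2 - P7) (P6 - P2 - P5)" by (rule min.boundedI)
  qed
  have r14: "min (2 * P7 - P8 - P9) (P5 + 2 * P7 - P9 - P10) = 3 * P7 - P8 - P10"
  proof (rule antisym)
    show "min (2 * P7 - P8 - P9) (P5 + 2 * P7 - P9 - P10) \<le> 3 * P7 - P8 - P10"
    proof (rule ccontr)
      assume "\<not> ?thesis"
      then have *: "3 * P7 - P8 - P10 < 2 * P7 - P8 - P9" "3 * P7 - P8 - P10 < P5 + 2 * P7 - P9 - P10" by (simp_all only: min_le_iff_disj de_Morgan_disj not_le)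
      show False using * l5 l8 l10 c7 c9 by - (elim disjE; linarith)
    qed
    have "3 * P7 - P8 - P10 \<le> 2 * P7 - P8 - P9" using l7 l9 c10 by - (elim disjE; linarith)
    moreover have "3 * P7 - P8 - P10 \<le> P5 + 2 * P7 - P9 - P10" using l7 l9 c5 c8 by - (elim disjE; linarith)
    ultimately show "3 * P7 - P8 - P10 \<le> min (2 * P7 - P8 - P9) (P5 + 2 * P7 - P9 - P10)" by (rule min.boundedI)
  qed
  have r15: "min (t1 + t2 + 2 * t3 + t4 + t5 + 2 * P5 + P7 - P6 - P10) (2 * P5 - P6) = 3 * P5 - P10"
  proof (rule antisym)
    show "min (t1 + t2 + 2 * t3 + t4 + t5 + 2 * P5 + P7 - P6 - P10) (2 * P5 - P6) \<le> 3 * P5 - P10"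
    proof (rule ccontr)
      assume "\<not> ?thesis"
      then have *: "3 * P5 - P10 < t1 + t2 + 2 * t3 + t4 + t5 + 2 * P5 + P7 - P6 - P10" "3 * P5 - P10 < 2 * P5 - P6" by (simp_all only: min_le_iff_disj de_Morgan_disj not_le)
      show False using * l7 l10 c5 c6 by - (elim disjE; linarith)
    qed
    have "3 * P5 - P10 \<le> t1 + t2 + 2 * t3 + t4 + t5 + 2 * P5 + P7 - P6 - P10" using l5 l6 c7 by - (elim disjE; linarith)
    moreover have "3 * P5 - P10 \<le> 2 * P5 - P6" using l5 l6 c10 by - (elim disjE; linarith)
    ultimately show "3 * P5 - P10 \<le> min (t1 + t2 + 2 * t3 + t4 + t5 + 2 * P5 + P7 - P6 - P10) (2 * P5 - P6)" by (rule min.boundedI)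
  qed
  \<comment> \<open>With index n, the letters \<open>x\<close>, \<open>q\<close>, \<open>z\<close>
    name the left, middle and right output of the n-th A2 move.\<close>
  define q0 where "q0 = min t1 t3"
  define x0 where "x0 = t2 + t3 - q0"
  define z0 where "z0 = t1 + t2 - q0"
  define q1 where "q1 = min t3 t5"
  define x1 where "x1 = t4 + t5 - q1"
  define z1 where "z1 = t3 + t4 - q1"
  define q2 where "q2 = min z0 x1"
  define x2 where "x2 = t3 + x1 - q2"
  define z2 where "z2 = z0 + t3 - q2"
  define q3 where "q3 = min t1 x2"
  define x3 where "x3 = x0 + x2 - q3"
  define z3 where "z3 = t1 + x0 - q3"
  define q4 where "q4 = min z3 q2"
  define x4 where "x4 = q0 + q2 - q4"
  define z4 where "z4 = z3 + q0 - q4"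
  define q5 where "q5 = min z2 t5"
  define x5 where "x5 = z1 + t5 - q5"
  define z5 where "z5 = z2 + z1 - q5"
  define q6 where "q6 = min z5 t6"
  define x6 where "x6 = t5 + t6 - q6"
  define z6 where "z6 = z5 + t5 - q6"
  define q7 where "q7 = min z4 x6"
  define x7 where "x7 = x5 + x6 - q7"
  define z7 where "z7 = z4 + x5 - q7"
  define q8 where "q8 = min q4 x7"
  define x8 where "x8 = q1 + x7 - q8"
  define z8 where "z8 = q4 + q1 - q8"
  define q9 where "q9 = min t1 x8"
  define x9 where "x9 = x3 + x8 - q9"
  define z9 where "z9 = t1 + x3 - q9"
  define q10 where "q10 = min x4 q7"
  define x10 where "x10 = q8 + q7 - q10"
  define z10 where "z10 = x4 + q8 - q10"
  define q11 where "q11 = min z9 x10"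
  define x11 where "x11 = q3 + x10 - q11"
  define z11 where "z11 = z9 + q3 - q11"
  define q12 where "q12 = min z7 q6"
  define x12 where "x12 = q5 + q6 - q12"
  define z12 where "z12 = z7 + q5 - q12"
  define q13 where "q13 = min z11 x12"
  define x13 where "x13 = z10 + x12 - q13"
  define z13 where "z13 = z11 + z10 - q13"
  define q14 where "q14 = min q11 x13"
  define x14 where "x14 = q10 + x13 - q14"
  define z14 where "z14 = q11 + q10 - q14"
  define q15 where "q15 = min z13 q12"
  define x15 where "x15 = z8 + q12 - q15"
  define z15 where "z15 = z13 + z8 - q15"
  have "fold move g2_moves [t1, t1, t1, t2, t3, t3, t3, t4, t5, t5, t5, t6] = [x9, q9, x11, x14, q14, x15, q13, z14, q15, z15, z12, z6]"
    by (simp add: g2_moves_def Let_def flip: q0_def x0_def z0_def q1_def x1_def z1_def q2_def x2_def z2_def q3_def x3_def z3_def q4_def x4_def z4_def q5_def x5_def z5_def q6_def x6_def z6_def q7_def x7_def z7_def q8_def x8_def z8_def q9_def x9_def z9_def q10_def x10_def z10_def q11_def x11_def z11_def q12_def x12_def z12_def q13_def x13_def z13_def q14_def x14_def z14_def q15_def x15_def z15_def)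
  moreover have q0c: "q0 = P0" unfolding q0_def using r0   by (simp only:)
  moreover have x0c: "x0 = t2 + t3 - P0" unfolding x0_def using q0c   by linarith
  moreover have z0c: "z0 = t1 + t2 - P0" unfolding z0_def using q0c   by linarith
  moreover have q1c: "q1 = P1" unfolding q1_def using r1   by (simp only:)
  moreover have x1c: "x1 = t4 + t5 - P1" unfolding x1_def using q1c   by linarith
  moreover have z1c: "z1 = t3 + t4 - P1" unfolding z1_def using q1c   by linarith
  moreover have q2c: "q2 = P2 - P0 - P1" unfolding q2_def using r2 z0c x1c by (simp only:)
  moreover have x2c: "x2 = t3 + t4 + t5 + P0 - P2" unfolding x2_def using q2c  x1c by linarith
  moreover have z2c: "z2 = t1 + t2 + t3 + P1 - P2" unfolding z2_def using q2c z0c  by linarith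
  moreover have q3c: "q3 = P3 - P2" unfolding q3_def using r3  x2c by (simp only:)
  moreover have x3c: "x3 = t2 + 2 * t3 + t4 + t5 - P3" unfolding x3_def using q3c x0c x2c by linarith
  moreover have z3c: "z3 = t1 + t2 + t3 + P2 - P0 - P3" unfolding z3_def using q3c  x0c by linarith
  moreover have q4c: "q4 = 2 * P2 - P1 - P3" unfolding q4_def using r4 z3c q2c by (simp only:)
  moreover have x4c: "x4 = P3 - P2" unfolding x4_def using q4c q0c q2c by linarith
  moreover have z4c: "z4 = t1 + t2 + t3 + P1 - P2" unfolding z4_def using q4c z3c q0c by linarith
  moreover have q5c: "q5 = P4 - P2" unfolding q5_def using r5 z2c  by (simp only:)
  moreover have x5c: "x5 = t3 + t4 + t5 + P2 - P1 - P4" unfolding x5_def using q5c z1c  by linarith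
  moreover have z5c: "z5 = t1 + t2 + 2 * t3 + t4 - P4" unfolding z5_def using q5c z2c z1c by linarith
  moreover have q6c: "q6 = P5 - P4" unfolding q6_def using r6 z5c  by (simp only:)
  moreover have x6c: "x6 = t5 + t6 + P4 - P5" unfolding x6_def using q6c   by linarith
  moreover have z6c: "z6 = t1 + t2 + 2 * t3 + t4 + t5 - P5" unfolding z6_def using q6c z5c  by linarith
  moreover have q7c: "q7 = P6 - P2 - P5" unfolding q7_def using r7 z4c x6c by (simp only:)
  moreover have x7c: "x7 = t3 + t4 + 2 * t5 + t6 + 2 * P2 - P1 - P6" unfolding x7_def using q7c x5c x6c by linarith
  moreover have z7c: "z7 = t1 + t2 + 2 * t3 + t4 + t5 + P2 + P5 - P4 - P6" unfolding z7_def using q7c z4c x5c by linarith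
  moreover have q8c: "q8 = 2 * P2 + P7 - P3 - P6" unfolding q8_def using r8 q4c x7c by (simp only:)
  moreover have x8c: "x8 = t3 + t4 + 2 * t5 + t6 + P3 - P7" unfolding x8_def using q8c q1c x7c by linarith
  moreover have z8c: "z8 = P6 - P7" unfolding z8_def using q8c q4c q1c by linarith
  moreover have q9c: "q9 = P8 - P7" unfolding q9_def using r9  x8c by (simp only:)
  moreover have x9c: "x9 = t2 + 3 * t3 + 2 * t4 + 3 * t5 + t6 - P8" unfolding x9_def using q9c x3c x8c by linarith
  moreover have z9c: "z9 = t1 + t2 + 2 * t3 + t4 + t5 + P7 - P3 - P8" unfolding z9_def using q9c  x3c by linarith
  moreover have q10c: "q10 = P9 - P5" unfolding q10_def using r10 x4c q7c by (simp only:)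
  moreover have x10c: "x10 = P2 + P7 - P3 - P9" unfolding x10_def using q10c q8c q7c by linarith
  moreover have z10c: "z10 = P2 + P5 + P7 - P6 - P9" unfolding z10_def using q10c x4c q8c by linarith
  moreover have q11c: "q11 = 2 * P7 - P8 - P9" unfolding q11_def using r11 z9c x10c by (simp only:)
  moreover have x11c: "x11 = P8 - P7" unfolding x11_def using q11c q3c x10c by linarith
  moreover have z11c: "z11 = t1 + t2 + 2 * t3 + t4 + t5 + P9 - P2 - P7" unfolding z11_def using q11c z9c q3c by linarith
  moreover have q12c: "q12 = 2 * P5 - P6" unfolding q12_def using r12 z7c q6c by (simp only:)
  moreover have x12c: "x12 = P6 - P2 - P5" unfolding x12_def using q12c q5c q6c by linarith
  moreover have z12c: "z12 = t1 + t2 + 2 * t3 + t4 + t5 - P5" unfolding z12_def using q12c z7c q5c by linarith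
  moreover have q13c: "q13 = P10 - P5 - P7" unfolding q13_def using r13 z11c x12c by (simp only:)
  moreover have x13c: "x13 = P5 + 2 * P7 - P9 - P10" unfolding x13_def using q13c z10c x12c by linarith
  moreover have z13c: "z13 = t1 + t2 + 2 * t3 + t4 + t5 + 2 * P5 + P7 - P6 - P10" unfolding z13_def using q13c z11c z10c by linarith
  moreover have q14c: "q14 = 3 * P7 - P8 - P10" unfolding q14_def using r14 q11c x13c by (simp only:)
  moreover have x14c: "x14 = P8 - P7" unfolding x14_def using q14c q10c x13c by linarith
  moreover have z14c: "z14 = P10 - P5 - P7" unfolding z14_def using q14c q11c q10c by linarith
  moreover have q15c: "q15 = 3 * P5 - P10" unfolding q15_def using r15 z13c q12c by (simp only:)
  moreover have x15c: "x15 = P10 - P5 - P7" unfolding x15_def using q15c z8c q12c by linarith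
  moreover have z15c: "z15 = t1 + t2 + 2 * t3 + t4 + t5 - P5" unfolding z15_def using q15c z13c z8c by linarith
  ultimately show ?thesis by (simp only:)
qed

text \<open>The moves undone, starting from an unfolded tuple for the other word. The four minima
  are those of the forward formula with the arguments in reverse order; this identifies the inverse
  of \<open>g2_trans\<close> with its conjugate under reversal.\<close>

lemma g2_moves_backward:
  fixes t1 t2 t3 t4 t5 t6 :: int
  assumes "P5 = Min {t3 + 2 * t4 + t5 + t6, t1 + 2 * t4 + t5 + t6, t1 + 2 * t2 + t5 + t6, t1 + 2 * t2 + t3 + t6, t1 + 2 * t2 + t3 + t4}"
      and "P7 = Min {t3 + 3 * t4 + 2 * t5 + 2 * t6, t1 + 3 * t4 + 2 * t5 + 2 * t6, t1 + 3 * t2 + 2 * t5 + 2 * t6, t1 + 3 * t2 + 2 * t3 + 2 * t6, t1 + 3 * t2 + 2 * t3 + 2 * t4}"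
      and "P8 = Min {t3 + 3 * t4 + 2 * t5 + 3 * t6, t1 + 3 * t4 + 2 * t5 + 3 * t6, t1 + 3 * t2 + 2 * t5 + 3 * t6, t1 + 3 * t2 + 2 * t3 + 3 * t6, t1 + 2 * t2 + t3 + 2 * t4 + t5 + 2 * t6, t1 + 3 * t2 + 2 * t3 + 3 * t4}"
      and "P10 = Min {2 * t3 + 6 * t4 + 3 * t5 + 3 * t6, 2 * t1 + 6 * t4 + 3 * t5 + 3 * t6, 2 * t1 + 6 * t2 + 3 * t5 + 3 * t6, 2 * t1 + 6 * t2 + 3 * t3 + 3 * t6, 2 * t1 + 4 * t2 + 2 * t3 + 3 * t4 + t5 + 2 * t6, 2 * t1 + 6 * t2 + 2 * t3 + t4 + t5 + 2 * t6, 2 * t1 + 6 * t2 + 3 * t3 + 3 * t4}"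
  shows "fold move (rev g2_moves) [t1, t2, t2, t2, t3, t4, t4, t4, t5, t6, t6, t6] =
    [t2 + t3 + 2 * t4 + t5 + t6 - P5, t2 + t3 + 2 * t4 + t5 + t6 - P5, t2 + t3 + 2 * t4 + t5 + t6 - P5, 3 * P5 - P10, P10 - P5 - P7, P10 - P5 - P7, P10 - P5 - P7, 3 * P7 - P8 - P10, P8 - P7, P8 - P7, P8 - P7, t1 + 3 * t2 + 2 * t3 + 3 * t4 + t5 - P8]"
proof -
  define P0 where "P0 = Min {t4, t6}"
  define P1 where "P1 = Min {t2, t4}"
  define P2 where "P2 = Min {t2 + t3 + t4, t2 + t3 + t6, t2 + t5 + t6, t4 + t5 + t6}"
  define P3 where "P3 = Min {t2 + t3 + 2 * t4, t2 + t3 + 2 * t6, t2 + t5 + 2 * t6, t4 + t5 + 2 * t6}"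
  define P4 where "P4 = Min {2 * t2 + t3 + t4, 2 * t2 + t3 + t6, 2 * t2 + t5 + t6, 2 * t4 + t5 + t6}"
  define P6 where "P6 = Min {t1 + 3 * t2 + t3 + t4, t1 + 3 * t2 + t3 + t6, t1 + 3 * t2 + t5 + t6, t1 + 2 * t2 + t3 + 2 * t4, t1 + 2 * t2 + t3 + 2 * t6, t1 + 2 * t2 + t5 + 2 * t6, t1 + 3 * t4 + t5 + t6, t1 + 2 * t4 + t5 + 2 * t6, t3 + 3 * t4 + t5 + t6, t3 + 2 * t4 + t5 + 2 * t6}"
  define P9 where "P9 = Min {t1 + 4 * t2 + 2 * t3 + 2 * t4, t1 + 4 * t2 + 2 * t3 + 2 * t6, t1 + 4 * t2 + 2 * t5 + 2 * t6, t1 + 4 * t4 + 2 * t5 + 2 * t6, t2 + t3 + 3 * t4 + 2 * t5 + 2 * t6, t3 + 4 * t4 + 2 * t5 + 2 * t6}"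
  have l0: "P0 \<le> t4" "P0 \<le> t6"
    unfolding P0_def by (rule Min_le, simp only: finite_insert finite.emptyI, (rule insertI1 | rule insertI2)+)+
  have "P0 \<in> {t4, t6}"
    unfolding P0_def by (rule Min_in) (simp_all only: finite_insert finite.emptyI insert_not_empty simp_thms)
  then have c0: "P0 = t4 \<or> P0 = t6"
    by (simp only: insert_iff empty_iff simp_thms)
  have l1: "P1 \<le> t2" "P1 \<le> t4"
    unfolding P1_def by (rule Min_le, simp only: finite_insert finite.emptyI, (rule insertI1 | rule insertI2)+)+
  have "P1 \<in> {t2, t4}"
    unfolding P1_def by (rule Min_in) (simp_all only: finite_insert finite.emptyI insert_not_empty simp_thms)
  then have c1: "P1 = t2 \<or> P1 = t4"
    by (simp only: insert_iff empty_iff simp_thms)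
  have l2: "P2 \<le> t2 + t3 + t4" "P2 \<le> t2 + t3 + t6" "P2 \<le> t2 + t5 + t6" "P2 \<le> t4 + t5 + t6"
    unfolding P2_def by (rule Min_le, simp only: finite_insert finite.emptyI, (rule insertI1 | rule insertI2)+)+
  have "P2 \<in> {t2 + t3 + t4, t2 + t3 + t6, t2 + t5 + t6, t4 + t5 + t6}"
    unfolding P2_def by (rule Min_in) (simp_all only: finite_insert finite.emptyI insert_not_empty simp_thms)
  then have c2: "P2 = t2 + t3 + t4 \<or> P2 = t2 + t3 + t6 \<or> P2 = t2 + t5 + t6 \<or> P2 = t4 + t5 + t6"
    by (simp only: insert_iff empty_iff simp_thms)
  have l3: "P3 \<le> t2 + t3 + 2 * t4" "P3 \<le> t2 + t3 + 2 * t6" "P3 \<le> t2 + t5 + 2 * t6" "P3 \<le> t4 + t5 + 2 * t6"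
    unfolding P3_def by (rule Min_le, simp only: finite_insert finite.emptyI, (rule insertI1 | rule insertI2)+)+
  have "P3 \<in> {t2 + t3 + 2 * t4, t2 + t3 + 2 * t6, t2 + t5 + 2 * t6, t4 + t5 + 2 * t6}"
    unfolding P3_def by (rule Min_in) (simp_all only: finite_insert finite.emptyI insert_not_empty simp_thms)
  then have c3: "P3 = t2 + t3 + 2 * t4 \<or> P3 = t2 + t3 + 2 * t6 \<or> P3 = t2 + t5 + 2 * t6 \<or> P3 = t4 + t5 + 2 * t6"
    by (simp only: insert_iff empty_iff simp_thms)
  have l4: "P4 \<le> 2 * t2 + t3 + t4" "P4 \<le> 2 * t2 + t3 + t6" "P4 \<le> 2 * t2 + t5 + t6" "P4 \<le> 2 * t4 + t5 + t6"
    unfolding P4_def by (rule Min_le, simp only: finite_insert finite.emptyI, (rule insertI1 | rule insertI2)+)+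
  have "P4 \<in> {2 * t2 + t3 + t4, 2 * t2 + t3 + t6, 2 * t2 + t5 + t6, 2 * t4 + t5 + t6}"
    unfolding P4_def by (rule Min_in) (simp_all only: finite_insert finite.emptyI insert_not_empty simp_thms)
  then have c4: "P4 = 2 * t2 + t3 + t4 \<or> P4 = 2 * t2 + t3 + t6 \<or> P4 = 2 * t2 + t5 + t6 \<or> P4 = 2 * t4 + t5 + t6"
    by (simp only: insert_iff empty_iff simp_thms)
  have l5: "P5 \<le> t3 + 2 * t4 + t5 + t6" "P5 \<le> t1 + 2 * t4 + t5 + t6" "P5 \<le> t1 + 2 * t2 + t5 + t6" "P5 \<le> t1 + 2 * t2 + t3 + t6" "P5 \<le> t1 + 2 * t2 + t3 + t4"
    unfolding assms(1) by (rule Min_le, simp only: finite_insert finite.emptyI, (rule insertI1 | rule insertI2)+)+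
  have "P5 \<in> {t3 + 2 * t4 + t5 + t6, t1 + 2 * t4 + t5 + t6, t1 + 2 * t2 + t5 + t6, t1 + 2 * t2 + t3 + t6, t1 + 2 * t2 + t3 + t4}"
    unfolding assms(1) by (rule Min_in) (simp_all only: finite_insert finite.emptyI insert_not_empty simp_thms)
  then have c5: "P5 = t3 + 2 * t4 + t5 + t6 \<or> P5 = t1 + 2 * t4 + t5 + t6 \<or> P5 = t1 + 2 * t2 + t5 + t6 \<or> P5 = t1 + 2 * t2 + t3 + t6 \<or> P5 = t1 + 2 * t2 + t3 + t4"
    by (simp only: insert_iff empty_iff simp_thms)
  have l6: "P6 \<le> t1 + 3 * t2 + t3 + t4" "P6 \<le> t1 + 3 * t2 + t3 + t6" "P6 \<le> t1 + 3 * t2 + t5 + t6" "P6 \<le> t1 + 2 * t2 + t3 + 2 * t4" "P6 \<le> t1 + 2 * t2 + t3 + 2 * t6" "P6 \<le> t1 + 2 * t2 + t5 + 2 * t6" "P6 \<le> t1 + 3 * t4 + t5 + t6" "P6 \<le> t1 + 2 * t4 + t5 + 2 * t6" "P6 \<le> t3 + 3 * t4 + t5 + t6" "P6 \<le> t3 + 2 * t4 + t5 + 2 * t6"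
    unfolding P6_def by (rule Min_le, simp only: finite_insert finite.emptyI, (rule insertI1 | rule insertI2)+)+
  have "P6 \<in> {t1 + 3 * t2 + t3 + t4, t1 + 3 * t2 + t3 + t6, t1 + 3 * t2 + t5 + t6, t1 + 2 * t2 + t3 + 2 * t4, t1 + 2 * t2 + t3 + 2 * t6, t1 + 2 * t2 + t5 + 2 * t6, t1 + 3 * t4 + t5 + t6, t1 + 2 * t4 + t5 + 2 * t6, t3 + 3 * t4 + t5 + t6, t3 + 2 * t4 + t5 + 2 * t6}"
    unfolding P6_def by (rule Min_in) (simp_all only: finite_insert finite.emptyI insert_not_empty simp_thms)
  then have c6: "P6 = t1 + 3 * t2 + t3 + t4 \<or> P6 = t1 + 3 * t2 + t3 + t6 \<or> P6 = t1 + 3 * t2 + t5 + t6 \<or> P6 = t1 + 2 * t2 + t3 + 2 * t4 \<or> P6 = t1 + 2 * t2 + t3 + 2 * t6 \<or> P6 = t1 + 2 * t2 + t5 + 2 * t6 \<or> P6 = t1 + 3 * t4 + t5 + t6 \<or> P6 = t1 + 2 * t4 + t5 + 2 * t6 \<or> P6 = t3 + 3 * t4 + t5 + t6 \<or> P6 = t3 + 2 * t4 + t5 + 2 * t6"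
    by (simp only: insert_iff empty_iff simp_thms)
  have l7: "P7 \<le> t3 + 3 * t4 + 2 * t5 + 2 * t6" "P7 \<le> t1 + 3 * t4 + 2 * t5 + 2 * t6" "P7 \<le> t1 + 3 * t2 + 2 * t5 + 2 * t6" "P7 \<le> t1 + 3 * t2 + 2 * t3 + 2 * t6" "P7 \<le> t1 + 3 * t2 + 2 * t3 + 2 * t4"
    unfolding assms(2) by (rule Min_le, simp only: finite_insert finite.emptyI, (rule insertI1 | rule insertI2)+)+
  have "P7 \<in> {t3 + 3 * t4 + 2 * t5 + 2 * t6, t1 + 3 * t4 + 2 * t5 + 2 * t6, t1 + 3 * t2 + 2 * t5 + 2 * t6, t1 + 3 * t2 + 2 * t3 + 2 * t6, t1 + 3 * t2 + 2 * t3 + 2 * t4}"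
    unfolding assms(2) by (rule Min_in) (simp_all only: finite_insert finite.emptyI insert_not_empty simp_thms)
  then have c7: "P7 = t3 + 3 * t4 + 2 * t5 + 2 * t6 \<or> P7 = t1 + 3 * t4 + 2 * t5 + 2 * t6 \<or> P7 = t1 + 3 * t2 + 2 * t5 + 2 * t6 \<or> P7 = t1 + 3 * t2 + 2 * t3 + 2 * t6 \<or> P7 = t1 + 3 * t2 + 2 * t3 + 2 * t4"
    by (simp only: insert_iff empty_iff simp_thms)
  have l8: "P8 \<le> t3 + 3 * t4 + 2 * t5 + 3 * t6" "P8 \<le> t1 + 3 * t4 + 2 * t5 + 3 * t6" "P8 \<le> t1 + 3 * t2 + 2 * t5 + 3 * t6" "P8 \<le> t1 + 3 * t2 + 2 * t3 + 3 * t6" "P8 \<le> t1 + 2 * t2 + t3 + 2 * t4 + t5 + 2 * t6" "P8 \<le> t1 + 3 * t2 + 2 * t3 + 3 * t4"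
    unfolding assms(3) by (rule Min_le, simp only: finite_insert finite.emptyI, (rule insertI1 | rule insertI2)+)+
  have "P8 \<in> {t3 + 3 * t4 + 2 * t5 + 3 * t6, t1 + 3 * t4 + 2 * t5 + 3 * t6, t1 + 3 * t2 + 2 * t5 + 3 * t6, t1 + 3 * t2 + 2 * t3 + 3 * t6, t1 + 2 * t2 + t3 + 2 * t4 + t5 + 2 * t6, t1 + 3 * t2 + 2 * t3 + 3 * t4}"
    unfolding assms(3) by (rule Min_in) (simp_all only: finite_insert finite.emptyI insert_not_empty simp_thms)
  then have c8: "P8 = t3 + 3 * t4 + 2 * t5 + 3 * t6 \<or> P8 = t1 + 3 * t4 + 2 * t5 + 3 * t6 \<or> P8 = t1 + 3 * t2 + 2 * t5 + 3 * t6 \<or> P8 = t1 + 3 * t2 + 2 * t3 + 3 * t6 \<or> P8 = t1 + 2 * t2 + t3 + 2 * t4 + t5 + 2 * t6 \<or> P8 = t1 + 3 * t2 + 2 * t3 + 3 * t4"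
    by (simp only: insert_iff empty_iff simp_thms)
  have l9: "P9 \<le> t1 + 4 * t2 + 2 * t3 + 2 * t4" "P9 \<le> t1 + 4 * t2 + 2 * t3 + 2 * t6" "P9 \<le> t1 + 4 * t2 + 2 * t5 + 2 * t6" "P9 \<le> t1 + 4 * t4 + 2 * t5 + 2 * t6" "P9 \<le> t2 + t3 + 3 * t4 + 2 * t5 + 2 * t6" "P9 \<le> t3 + 4 * t4 + 2 * t5 + 2 * t6"
    unfolding P9_def by (rule Min_le, simp only: finite_insert finite.emptyI, (rule insertI1 | rule insertI2)+)+
  have "P9 \<in> {t1 + 4 * t2 + 2 * t3 + 2 * t4, t1 + 4 * t2 + 2 * t3 + 2 * t6, t1 + 4 * t2 + 2 * t5 + 2 * t6, t1 + 4 * t4 + 2 * t5 + 2 * t6, t2 + t3 + 3 * t4 + 2 * t5 + 2 * t6, t3 + 4 * t4 + 2 * t5 + 2 * t6}"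
    unfolding P9_def by (rule Min_in) (simp_all only: finite_insert finite.emptyI insert_not_empty simp_thms)
  then have c9: "P9 = t1 + 4 * t2 + 2 * t3 + 2 * t4 \<or> P9 = t1 + 4 * t2 + 2 * t3 + 2 * t6 \<or> P9 = t1 + 4 * t2 + 2 * t5 + 2 * t6 \<or> P9 = t1 + 4 * t4 + 2 * t5 + 2 * t6 \<or> P9 = t2 + t3 + 3 * t4 + 2 * t5 + 2 * t6 \<or> P9 = t3 + 4 * t4 + 2 * t5 + 2 * t6"
    by (simp only: insert_iff empty_iff simp_thms)
  have l10: "P10 \<le> 2 * t3 + 6 * t4 + 3 * t5 + 3 * t6" "P10 \<le> 2 * t1 + 6 * t4 + 3 * t5 + 3 * t6" "P10 \<le> 2 * t1 + 6 * t2 + 3 * t5 + 3 * t6" "P10 \<le> 2 * t1 + 6 * t2 + 3 * t3 + 3 * t6" "P10 \<le> 2 * t1 + 4 * t2 + 2 * t3 + 3 * t4 + t5 + 2 * t6" "P10 \<le> 2 * t1 + 6 * t2 + 2 * t3 + t4 + t5 + 2 * t6" "P10 \<le> 2 * t1 + 6 * t2 + 3 * t3 + 3 * t4"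
    unfolding assms(4) by (rule Min_le, simp only: finite_insert finite.emptyI, (rule insertI1 | rule insertI2)+)+
  have "P10 \<in> {2 * t3 + 6 * t4 + 3 * t5 + 3 * t6, 2 * t1 + 6 * t4 + 3 * t5 + 3 * t6, 2 * t1 + 6 * t2 + 3 * t5 + 3 * t6, 2 * t1 + 6 * t2 + 3 * t3 + 3 * t6, 2 * t1 + 4 * t2 + 2 * t3 + 3 * t4 + t5 + 2 * t6, 2 * t1 + 6 * t2 + 2 * t3 + t4 + t5 + 2 * t6, 2 * t1 + 6 * t2 + 3 * t3 + 3 * t4}"
    unfolding assms(4) by (rule Min_in) (simp_all only: finite_insert finite.emptyI insert_not_empty simp_thms)
  then have c10: "P10 = 2 * t3 + 6 * t4 + 3 * t5 + 3 * t6 \<or> P10 = 2 * t1 + 6 * t4 + 3 * t5 + 3 * t6 \<or> P10 = 2 * t1 + 6 * t2 + 3 * t5 + 3 * t6 \<or> P10 = 2 * t1 + 6 * t2 + 3 * t3 + 3 * t6 \<or> P10 = 2 * t1 + 4 * t2 + 2 * t3 + 3 * t4 + t5 + 2 * t6 \<or> P10 = 2 * t1 + 6 * t2 + 2 * t3 + t4 + t5 + 2 * t6 \<or> P10 = 2 * t1 + 6 * t2 + 3 * t3 + 3 * t4"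
    by (simp only: insert_iff empty_iff simp_thms)
  have r0: "min (t4) (t6) = P0"
  proof (rule antisym)
    show "min (t4) (t6) \<le> P0"
    proof (rule ccontr)
      assume "\<not> ?thesis"
      then have *: "P0 < t4" "P0 < t6" by (simp_all only: min_le_iff_disj de_Morgan_disj not_le)
      show False using *  c0 by - (elim disjE; linarith)
    qed
    have "P0 \<le> t4" using l0 by linarith
    moreover have "P0 \<le> t6" using l0 by linarith
    ultimately show "P0 \<le> min (t4) (t6)" by (rule min.boundedI)
  qed
  have r1: "min (t2) (t4) = P1"
  proof (rule antisym)
    show "min (t2) (t4) \<le> P1"
    proof (rule ccontr)
      assume "\<not> ?thesis"
      then have *: "P1 < t2" "P1 < t4" by (simp_all only: min_le_iff_disj de_Morgan_disj not_le)
      show False using *  c1 by - (elim disjE; linarith)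
    qed
    have "P1 \<le> t2" using l1 by linarith
    moreover have "P1 \<le> t4" using l1 by linarith
    ultimately show "P1 \<le> min (t2) (t4)" by (rule min.boundedI)
  qed
  have r2: "min (t2 + t3 - P1) (t5 + t6 - P0) = P2 - P0 - P1"
  proof (rule antisym)
    show "min (t2 + t3 - P1) (t5 + t6 - P0) \<le> P2 - P0 - P1"
    proof (rule ccontr)
      assume "\<not> ?thesis"
      then have *: "P2 - P0 - P1 < t2 + t3 - P1" "P2 - P0 - P1 < t5 + t6 - P0" by (simp_all only: min_le_iff_disj de_Morgan_disj not_le)
      show False using * l0 l1 c2 by - (elim disjE; linarith)
    qed
    have "P2 - P0 - P1 \<le> t2 + t3 - P1" using l2 c0 by - (elim disjE; linarith)
    moreover have "P2 - P0 - P1 \<le> t5 + t6 - P0" using l2 c1 by - (elim disjE; linarith)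
    ultimately show "P2 - P0 - P1 \<le> min (t2 + t3 - P1) (t5 + t6 - P0)" by (rule min.boundedI)
  qed
  have r3: "min (t2 + t3 + t4 + P0 - P2) (t6) = P3 - P2"
  proof (rule antisym)
    show "min (t2 + t3 + t4 + P0 - P2) (t6) \<le> P3 - P2"
    proof (rule ccontr)
      assume "\<not> ?thesis"
      then have *: "P3 - P2 < t2 + t3 + t4 + P0 - P2" "P3 - P2 < t6" by (simp_all only: min_le_iff_disj de_Morgan_disj not_le)
      show False using * l0 l2 c3 by - (elim disjE; linarith)
    qed
    have "P3 - P2 \<le> t2 + t3 + t4 + P0 - P2" using l3 c0 by - (elim disjE; linarith)
    moreover have "P3 - P2 \<le> t6" using l3 c2 by - (elim disjE; linarith)
    ultimately show "P3 - P2 \<le> min (t2 + t3 + t4 + P0 - P2) (t6)" by (rule min.boundedI)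
  qed
  have r4: "min (t2) (t4 + t5 + t6 + P1 - P2) = P4 - P2"
  proof (rule antisym)
    show "min (t2) (t4 + t5 + t6 + P1 - P2) \<le> P4 - P2"
    proof (rule ccontr)
      assume "\<not> ?thesis"
      then have *: "P4 - P2 < t2" "P4 - P2 < t4 + t5 + t6 + P1 - P2" by (simp_all only: min_le_iff_disj de_Morgan_disj not_le)
      show False using * l1 l2 c4 by - (elim disjE; linarith)
    qed
    have "P4 - P2 \<le> t2" using l4 c2 by - (elim disjE; linarith)
    moreover have "P4 - P2 \<le> t4 + t5 + t6 + P1 - P2" using l4 c1 by - (elim disjE; linarith)
    ultimately show "P4 - P2 \<le> min (t2) (t4 + t5 + t6 + P1 - P2)" by (rule min.boundedI)
  qed
  have r5: "min (t2 + t3 + t4 + P2 - P1 - P4) (P2 - P0 - P1) = 2 * P2 - P0 - P4"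
  proof (rule antisym)
    show "min (t2 + t3 + t4 + P2 - P1 - P4) (P2 - P0 - P1) \<le> 2 * P2 - P0 - P4"
    proof (rule ccontr)
      assume "\<not> ?thesis"
      then have *: "2 * P2 - P0 - P4 < t2 + t3 + t4 + P2 - P1 - P4" "2 * P2 - P0 - P4 < P2 - P0 - P1" by (simp_all only: min_le_iff_disj de_Morgan_disj not_le)
      show False using * l0 l4 c1 c2 by - (elim disjE; linarith)
    qed
    have "2 * P2 - P0 - P4 \<le> t2 + t3 + t4 + P2 - P1 - P4" using l1 l2 c0 by - (elim disjE; linarith)
    moreover have "2 * P2 - P0 - P4 \<le> P2 - P0 - P1" using l1 l2 c4 by - (elim disjE; linarith)
    ultimately show "2 * P2 - P0 - P4 \<le> min (t2 + t3 + t4 + P2 - P1 - P4) (P2 - P0 - P1)" by (rule min.boundedI)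
  qed
  have r6: "min (t1) (t3 + 2 * t4 + t5 + t6 - P4) = P5 - P4"
  proof (rule antisym)
    show "min (t1) (t3 + 2 * t4 + t5 + t6 - P4) \<le> P5 - P4"
    proof (rule ccontr)
      assume "\<not> ?thesis"
      then have *: "P5 - P4 < t1" "P5 - P4 < t3 + 2 * t4 + t5 + t6 - P4" by (simp_all only: min_le_iff_disj de_Morgan_disj not_le)
      show False using * l4 c5 by - (elim disjE; linarith)
    qed
    have "P5 - P4 \<le> t1" using l5 c4 by - (elim disjE; linarith)
    moreover have "P5 - P4 \<le> t3 + 2 * t4 + t5 + t6 - P4" using l5 by linarith
    ultimately show "P5 - P4 \<le> min (t1) (t3 + 2 * t4 + t5 + t6 - P4)" by (rule min.boundedI)
  qed
  have r7: "min (t1 + t2 + P4 - P5) (P0) = P6 - P5"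
  proof (rule antisym)
    show "min (t1 + t2 + P4 - P5) (P0) \<le> P6 - P5"
    proof (rule ccontr)
      assume "\<not> ?thesis"
      then have *: "P6 - P5 < t1 + t2 + P4 - P5" "P6 - P5 < P0" by (simp_all only: min_le_iff_disj de_Morgan_disj not_le)
      show False using * l0 l4 l5 c6 by - (elim disjE; linarith)
    qed
    have "P6 - P5 \<le> t1 + t2 + P4 - P5" using l6 c4 by - (elim disjE; linarith)
    moreover have "P6 - P5 \<le> P0" using l6 c0 c5 by - (elim disjE; linarith)
    ultimately show "P6 - P5 \<le> min (t1 + t2 + P4 - P5) (P0)" by (rule min.boundedI)
  qed
  have r8: "min (t1 + t2 + 2 * P2 - P0 - P6) (t4 + t5 + t6 + P2 - P0 - P3) = P2 + P7 - P3 - P6"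
  proof (rule antisym)
    show "min (t1 + t2 + 2 * P2 - P0 - P6) (t4 + t5 + t6 + P2 - P0 - P3) \<le> P2 + P7 - P3 - P6"
    proof (rule ccontr)
      assume "\<not> ?thesis"
      then have *: "P2 + P7 - P3 - P6 < t1 + t2 + 2 * P2 - P0 - P6" "P2 + P7 - P3 - P6 < t4 + t5 + t6 + P2 - P0 - P3" by (simp_all only: min_le_iff_disj de_Morgan_disj not_le)
      show False using * l2 l3 l6 c0 c7 by - (elim disjE; linarith)
    qed
    have "P2 + P7 - P3 - P6 \<le> t1 + t2 + 2 * P2 - P0 - P6" using l0 l7 c2 c3 by - (elim disjE; linarith)
    moreover have "P2 + P7 - P3 - P6 \<le> t4 + t5 + t6 + P2 - P0 - P3" using l0 l7 c6 by - (elim disjE; linarith)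
    ultimately show "P2 + P7 - P3 - P6 \<le> min (t1 + t2 + 2 * P2 - P0 - P6) (t4 + t5 + t6 + P2 - P0 - P3)" by (rule min.boundedI)
  qed
  have r9: "min (t1 + 2 * t2 + t3 + t4 + P3 - P7) (t6) = P8 - P7"
  proof (rule antisym)
    show "min (t1 + 2 * t2 + t3 + t4 + P3 - P7) (t6) \<le> P8 - P7"
    proof (rule ccontr)
      assume "\<not> ?thesis"
      then have *: "P8 - P7 < t1 + 2 * t2 + t3 + t4 + P3 - P7" "P8 - P7 < t6" by (simp_all only: min_le_iff_disj de_Morgan_disj not_le)
      show False using * l3 l7 c8 by - (elim disjE; linarith)
    qed
    have "P8 - P7 \<le> t1 + 2 * t2 + t3 + t4 + P3 - P7" using l8 c3 by - (elim disjE; linarith)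
    moreover have "P8 - P7 \<le> t6" using l8 c7 by - (elim disjE; linarith)
    ultimately show "P8 - P7 \<le> min (t1 + 2 * t2 + t3 + t4 + P3 - P7) (t6)" by (rule min.boundedI)
  qed
  have r10: "min (P2 + P7 - P3 - P6) (t2 + t3 + 2 * t4 + t5 + t6 + P7 - P3 - P8) = 2 * P7 - P6 - P8"
  proof (rule antisym)
    show "min (P2 + P7 - P3 - P6) (t2 + t3 + 2 * t4 + t5 + t6 + P7 - P3 - P8) \<le> 2 * P7 - P6 - P8"
    proof (rule ccontr)
      assume "\<not> ?thesis"
      then have *: "2 * P7 - P6 - P8 < P2 + P7 - P3 - P6" "2 * P7 - P6 - P8 < t2 + t3 + 2 * t4 + t5 + t6 + P7 - P3 - P8" by (simp_all only: min_le_iff_disj de_Morgan_disj not_le)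
      show False using * l2 l6 l8 c3 c7 by - (elim disjE; linarith)
    qed
    have "2 * P7 - P6 - P8 \<le> P2 + P7 - P3 - P6" using l3 l7 c2 c8 by - (elim disjE; linarith)
    moreover have "2 * P7 - P6 - P8 \<le> t2 + t3 + 2 * t4 + t5 + t6 + P7 - P3 - P8" using l3 l7 c6 by - (elim disjE; linarith)
    ultimately show "2 * P7 - P6 - P8 \<le> min (P2 + P7 - P3 - P6) (t2 + t3 + 2 * t4 + t5 + t6 + P7 - P3 - P8)" by (rule min.boundedI)
  qed
  have r11: "min (P4 - P2) (t2 + t3 + 2 * t4 + t5 + t6 + P6 - P2 - P7) = P9 - P7"
  proof (rule antisym)
    show "min (P4 - P2) (t2 + t3 + 2 * t4 + t5 + t6 + P6 - P2 - P7) \<le> P9 - P7"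
    proof (rule ccontr)
      assume "\<not> ?thesis"
      then have *: "P9 - P7 < P4 - P2" "P9 - P7 < t2 + t3 + 2 * t4 + t5 + t6 + P6 - P2 - P7" by (simp_all only: min_le_iff_disj de_Morgan_disj not_le)
      show False using * l4 l6 l7 c2 c9 by - (elim disjE; linarith)
    qed
    have "P9 - P7 \<le> P4 - P2" using l2 l9 c4 c7 by - (elim disjE; linarith)
    moreover have "P9 - P7 \<le> t2 + t3 + 2 * t4 + t5 + t6 + P6 - P2 - P7" using l2 l9 c6 by - (elim disjE; linarith)
    ultimately show "P9 - P7 \<le> min (P4 - P2) (t2 + t3 + 2 * t4 + t5 + t6 + P6 - P2 - P7)" by (rule min.boundedI)
  qed
  have r12: "min (P5 - P4) (t2 + t3 + 2 * t4 + t5 + t6 + P2 + P5 - P4 - P9) = 2 * P5 - P9"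
  proof (rule antisym)
    show "min (P5 - P4) (t2 + t3 + 2 * t4 + t5 + t6 + P2 + P5 - P4 - P9) \<le> 2 * P5 - P9"
    proof (rule ccontr)
      assume "\<not> ?thesis"
      then have *: "2 * P5 - P9 < P5 - P4" "2 * P5 - P9 < t2 + t3 + 2 * t4 + t5 + t6 + P2 + P5 - P4 - P9" by (simp_all only: min_le_iff_disj de_Morgan_disj not_le)
      show False using * l2 l9 c4 c5 by - (elim disjE; linarith)
    qed
    have "2 * P5 - P9 \<le> P5 - P4" using l4 l5 c9 by - (elim disjE; linarith)
    moreover have "2 * P5 - P9 \<le> t2 + t3 + 2 * t4 + t5 + t6 + P2 + P5 - P4 - P9" using l4 l5 c2 by - (elim disjE; linarith)
    ultimately show "2 * P5 - P9 \<le> min (P5 - P4) (t2 + t3 + 2 * t4 + t5 + t6 + P2 + P5 - P4 - P9)" by (rule min.boundedI)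
  qed
  have r13: "min (P9 - P2 - P5) (t2 + t3 + 2 * t4 + t5 + t6 + P6 - P2 - P7) = P10 - P5 - P7"
  proof (rule antisym)
    show "min (P9 - P2 - P5) (t2 + t3 + 2 * t4 + t5 + t6 + P6 - P2 - P7) \<le> P10 - P5 - P7"
    proof (rule ccontr)
      assume "\<not> ?thesis"
      then have *: "P10 - P5 - P7 < P9 - P2 - P5" "P10 - P5 - P7 < t2 + t3 + 2 * t4 + t5 + t6 + P6 - P2 - P7" by (simp_all only: min_le_iff_disj de_Morgan_disj not_le)
      show False using * l5 l6 l7 l9 c2 c10 by - (elim disjE; linarith)
    qed
    have "P10 - P5 - P7 \<le> P9 - P2 - P5" using l2 l10 c7 c9 by - (elim disjE; linarith)
    moreover have "P10 - P5 - P7 \<le> t2 + t3 + 2 * t4 + t5 + t6 + P6 - P2 - P7" using l2 l10 c5 c6 by - (elim disjE; linarith)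
    ultimately show "P10 - P5 - P7 \<le> min (P9 - P2 - P5) (t2 + t3 + 2 * t4 + t5 + t6 + P6 - P2 - P7)" by (rule min.boundedI)
  qed
  have r14: "min (P5 + 2 * P7 - P6 - P10) (2 * P7 - P6 - P8) = 3 * P7 - P8 - P10"
  proof (rule antisym)
    show "min (P5 + 2 * P7 - P6 - P10) (2 * P7 - P6 - P8) \<le> 3 * P7 - P8 - P10"
    proof (rule ccontr)
      assume "\<not> ?thesis"
      then have *: "3 * P7 - P8 - P10 < P5 + 2 * P7 - P6 - P10" "3 * P7 - P8 - P10 < 2 * P7 - P6 - P8" by (simp_all only: min_le_iff_disj de_Morgan_disj not_le)
      show False using * l5 l8 l10 c6 c7 by - (elim disjE; linarith)
    qed
    have "3 * P7 - P8 - P10 \<le> P5 + 2 * P7 - P6 - P10" using l6 l7 c5 c8 by - (elim disjE; linarith)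
    moreover have "3 * P7 - P8 - P10 \<le> 2 * P7 - P6 - P8" using l6 l7 c10 by - (elim disjE; linarith)
    ultimately show "3 * P7 - P8 - P10 \<le> min (P5 + 2 * P7 - P6 - P10) (2 * P7 - P6 - P8)" by (rule min.boundedI)
  qed
  have r15: "min (2 * P5 - P9) (t2 + t3 + 2 * t4 + t5 + t6 + 2 * P5 + P7 - P9 - P10) = 3 * P5 - P10"
  proof (rule antisym)
    show "min (2 * P5 - P9) (t2 + t3 + 2 * t4 + t5 + t6 + 2 * P5 + P7 - P9 - P10) \<le> 3 * P5 - P10"
    proof (rule ccontr)
      assume "\<not> ?thesis"
      then have *: "3 * P5 - P10 < 2 * P5 - P9" "3 * P5 - P10 < t2 + t3 + 2 * t4 + t5 + t6 + 2 * P5 + P7 - P9 - P10" by (simp_all only: min_le_iff_disj de_Morgan_disj not_le)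
      show False using * l7 l10 c5 c9 by - (elim disjE; linarith)
    qed
    have "3 * P5 - P10 \<le> 2 * P5 - P9" using l5 l9 c10 by - (elim disjE; linarith)
    moreover have "3 * P5 - P10 \<le> t2 + t3 + 2 * t4 + t5 + t6 + 2 * P5 + P7 - P9 - P10" using l5 l9 c7 by - (elim disjE; linarith)
    ultimately show "3 * P5 - P10 \<le> min (2 * P5 - P9) (t2 + t3 + 2 * t4 + t5 + t6 + 2 * P5 + P7 - P9 - P10)" by (rule min.boundedI)
  qed
  define q0 where "q0 = min t4 t6"
  define x0 where "x0 = t5 + t6 - q0"
  define z0 where "z0 = t4 + t5 - q0"
  define q1 where "q1 = min t2 t4"
  define x1 where "x1 = t3 + t4 - q1"
  define z1 where "z1 = t2 + t3 - q1"
  define q2 where "q2 = min z1 x0"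
  define x2 where "x2 = t4 + x0 - q2"
  define z2 where "z2 = z1 + t4 - q2"
  define q3 where "q3 = min z2 t6"
  define x3 where "x3 = z0 + t6 - q3"
  define z3 where "z3 = z2 + z0 - q3"
  define q4 where "q4 = min t2 x2"
  define x4 where "x4 = x1 + x2 - q4"
  define z4 where "z4 = t2 + x1 - q4"
  define q5 where "q5 = min z4 q2"
  define x5 where "x5 = q1 + q2 - q5"
  define z5 where "z5 = z4 + q1 - q5"
  define q6 where "q6 = min t1 x4"
  define x6 where "x6 = t2 + x4 - q6"
  define z6 where "z6 = t1 + t2 - q6"
  define q7 where "q7 = min z6 q0"
  define x7 where "x7 = q5 + q0 - q7"
  define z7 where "z7 = z6 + q5 - q7"
  define q8 where "q8 = min z7 x3"
  define x8 where "x8 = z5 + x3 - q8"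
  define z8 where "z8 = z7 + z5 - q8"
  define q9 where "q9 = min z8 t6"
  define x9 where "x9 = z3 + t6 - q9"
  define z9 where "z9 = z8 + z3 - q9"
  define q10 where "q10 = min q8 x9"
  define x10 where "x10 = q3 + x9 - q10"
  define z10 where "z10 = q8 + q3 - q10"
  define q11 where "q11 = min x5 x8"
  define x11 where "x11 = x7 + x8 - q11"
  define z11 where "z11 = x5 + x7 - q11"
  define q12 where "q12 = min q6 x11"
  define x12 where "x12 = q4 + x11 - q12"
  define z12 where "z12 = q6 + q4 - q12"
  define q13 where "q13 = min z12 x10"
  define x13 where "x13 = z11 + x10 - q13"
  define z13 where "z13 = z12 + z11 - q13"
  define q14 where "q14 = min z13 q10"
  define x14 where "x14 = q7 + q10 - q14"
  define z14 where "z14 = z13 + q7 - q14"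
  define q15 where "q15 = min q12 x13"
  define x15 where "x15 = q11 + x13 - q15"
  define z15 where "z15 = q12 + q11 - q15"
  have "fold move (rev g2_moves) [t1, t2, t2, t2, t3, t4, t4, t4, t5, t6, t6, t6] = [x6, x12, x15, q15, x14, q13, z15, q14, z14, z10, q9, z9]"
    by (simp add: g2_moves_def Let_def flip: q0_def x0_def z0_def q1_def x1_def z1_def q2_def x2_def z2_def q3_def x3_def z3_def q4_def x4_def z4_def q5_def x5_def z5_def q6_def x6_def z6_def q7_def x7_def z7_def q8_def x8_def z8_def q9_def x9_def z9_def q10_def x10_def z10_def q11_def x11_def z11_def q12_def x12_def z12_def q13_def x13_def z13_def q14_def x14_def z14_def q15_def x15_def z15_def)
  moreover have q0c: "q0 = P0" unfolding q0_def using r0   by (simp only:)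
  moreover have x0c: "x0 = t5 + t6 - P0" unfolding x0_def using q0c   by linarith
  moreover have z0c: "z0 = t4 + t5 - P0" unfolding z0_def using q0c   by linarith
  moreover have q1c: "q1 = P1" unfolding q1_def using r1   by (simp only:)
  moreover have x1c: "x1 = t3 + t4 - P1" unfolding x1_def using q1c   by linarith
  moreover have z1c: "z1 = t2 + t3 - P1" unfolding z1_def using q1c   by linarith
  moreover have q2c: "q2 = P2 - P0 - P1" unfolding q2_def using r2 z1c x0c by (simp only:)
  moreover have x2c: "x2 = t4 + t5 + t6 + P1 - P2" unfolding x2_def using q2c  x0c by linarith
  moreover have z2c: "z2 = t2 + t3 + t4 + P0 - P2" unfolding z2_def using q2c z1c  by linarith
  moreover have q3c: "q3 = P3 - P2" unfolding q3_def using r3 z2c  by (simp only:)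
  moreover have x3c: "x3 = t4 + t5 + t6 + P2 - P0 - P3" unfolding x3_def using q3c z0c  by linarith
  moreover have z3c: "z3 = t2 + t3 + 2 * t4 + t5 - P3" unfolding z3_def using q3c z2c z0c by linarith
  moreover have q4c: "q4 = P4 - P2" unfolding q4_def using r4  x2c by (simp only:)
  moreover have x4c: "x4 = t3 + 2 * t4 + t5 + t6 - P4" unfolding x4_def using q4c x1c x2c by linarith
  moreover have z4c: "z4 = t2 + t3 + t4 + P2 - P1 - P4" unfolding z4_def using q4c  x1c by linarith
  moreover have q5c: "q5 = 2 * P2 - P0 - P4" unfolding q5_def using r5 z4c q2c by (simp only:)
  moreover have x5c: "x5 = P4 - P2" unfolding x5_def using q5c q1c q2c by linarith
  moreover have z5c: "z5 = t2 + t3 + t4 + P0 - P2" unfolding z5_def using q5c z4c q1c by linarith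
  moreover have q6c: "q6 = P5 - P4" unfolding q6_def using r6  x4c by (simp only:)
  moreover have x6c: "x6 = t2 + t3 + 2 * t4 + t5 + t6 - P5" unfolding x6_def using q6c  x4c by linarith
  moreover have z6c: "z6 = t1 + t2 + P4 - P5" unfolding z6_def using q6c   by linarith
  moreover have q7c: "q7 = P6 - P5" unfolding q7_def using r7 z6c q0c by (simp only:)
  moreover have x7c: "x7 = 2 * P2 + P5 - P4 - P6" unfolding x7_def using q7c q5c q0c by linarith
  moreover have z7c: "z7 = t1 + t2 + 2 * P2 - P0 - P6" unfolding z7_def using q7c z6c q5c by linarith
  moreover have q8c: "q8 = P2 + P7 - P3 - P6" unfolding q8_def using r8 z7c x3c by (simp only:)
  moreover have x8c: "x8 = t2 + t3 + 2 * t4 + t5 + t6 + P6 - P2 - P7" unfolding x8_def using q8c z5c x3c by linarith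
  moreover have z8c: "z8 = t1 + 2 * t2 + t3 + t4 + P3 - P7" unfolding z8_def using q8c z7c z5c by linarith
  moreover have q9c: "q9 = P8 - P7" unfolding q9_def using r9 z8c  by (simp only:)
  moreover have x9c: "x9 = t2 + t3 + 2 * t4 + t5 + t6 + P7 - P3 - P8" unfolding x9_def using q9c z3c  by linarith
  moreover have z9c: "z9 = t1 + 3 * t2 + 2 * t3 + 3 * t4 + t5 - P8" unfolding z9_def using q9c z8c z3c by linarith
  moreover have q10c: "q10 = 2 * P7 - P6 - P8" unfolding q10_def using r10 q8c x9c by (simp only:)
  moreover have x10c: "x10 = t2 + t3 + 2 * t4 + t5 + t6 + P6 - P2 - P7" unfolding x10_def using q10c q3c x9c by linarith
  moreover have z10c: "z10 = P8 - P7" unfolding z10_def using q10c q8c q3c by linarith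
  moreover have q11c: "q11 = P9 - P7" unfolding q11_def using r11 x5c x8c by (simp only:)
  moreover have x11c: "x11 = t2 + t3 + 2 * t4 + t5 + t6 + P2 + P5 - P4 - P9" unfolding x11_def using q11c x7c x8c by linarith
  moreover have z11c: "z11 = P2 + P5 + P7 - P6 - P9" unfolding z11_def using q11c x5c x7c by linarith
  moreover have q12c: "q12 = 2 * P5 - P9" unfolding q12_def using r12 q6c x11c by (simp only:)
  moreover have x12c: "x12 = t2 + t3 + 2 * t4 + t5 + t6 - P5" unfolding x12_def using q12c q4c x11c by linarith
  moreover have z12c: "z12 = P9 - P2 - P5" unfolding z12_def using q12c q6c q4c by linarith
  moreover have q13c: "q13 = P10 - P5 - P7" unfolding q13_def using r13 z12c x10c by (simp only:)
  moreover have x13c: "x13 = t2 + t3 + 2 * t4 + t5 + t6 + 2 * P5 + P7 - P9 - P10" unfolding x13_def using q13c z11c x10c by linarith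
  moreover have z13c: "z13 = P5 + 2 * P7 - P6 - P10" unfolding z13_def using q13c z12c z11c by linarith
  moreover have q14c: "q14 = 3 * P7 - P8 - P10" unfolding q14_def using r14 z13c q10c by (simp only:)
  moreover have x14c: "x14 = P10 - P5 - P7" unfolding x14_def using q14c q7c q10c by linarith
  moreover have z14c: "z14 = P8 - P7" unfolding z14_def using q14c z13c q7c by linarith
  moreover have q15c: "q15 = 3 * P5 - P10" unfolding q15_def using r15 q12c x13c by (simp only:)
  moreover have x15c: "x15 = t2 + t3 + 2 * t4 + t5 + t6 - P5" unfolding x15_def using q15c q11c x13c by linarith
  moreover have z15c: "z15 = P10 - P5 - P7" unfolding z15_def using q15c q12c q11c by linarith
  ultimately show ?thesis by (simp only:)
qed


lemma list_2: "length t = 2 \<longleftrightarrow> (\<exists>a b. t = [a, b])"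
  and list_3: "length t = 3 \<longleftrightarrow> (\<exists>a b c. t = [a, b, c])"
  and list_4: "length t = 4 \<longleftrightarrow> (\<exists>a b c d. t = [a, b, c, d])"
  and list_6: "length t = 6 \<longleftrightarrow> (\<exists>a b c d e f. t = [a, b, c, d, e, f])"
  by (auto simp: length_Suc_conv eval_nat_numeral)

lemma move_append:
  "move (True, length xs) (xs @ a # b # c # ys) = xs @ (b + c - min a c) # min a c # (a + b - min a c) # ys"
  "move (False, length xs) (xs @ a # b # c # ys) = xs @ b # a # c # ys"
  by (simp_all add: Let_def nth_append list_update_append)

text \<open>The bound \<open>p + 2\<close> is also imposed on commutation moves, which touch two
  entries only, so that both kinds of move share one normal form.\<close>

lemma move_cases:
  assumes "p + 2 < length d"
  obtains xs a b c ys where "d = xs @ a # b # c # ys" "p = length xs"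
proof -
  have "d = take p d @ d ! p # d ! Suc p # d ! Suc (Suc p) # drop (Suc (Suc (Suc p))) d"
    using assms by (simp add: Cons_nth_drop_Suc)
  then show thesis using that[of "take p d"] assms by simp
qed

lemma move_move:
  assumes "snd m + 2 < length d" shows "move m (move m d) = d"
proof -
  obtain e p where m: "m = (e, p)" by (cases m)
  obtain xs a b c ys where d: "d = xs @ a # b # c # ys" "p = length xs"
    using move_cases[of p d] assms unfolding m snd_conv by blast
  \<comment> \<open>The minimum of the second A2 move is the old middle entry, so the move is an
    involution.\<close>
  have "min (b + c - min a c) (a + b - min a c) = b" by linarith
  then show ?thesis by (cases e) (simp_all only: m d move_append, simp_all)
qed

lemma length_move [simp]: "length (move m d) = length d"
  by (cases m; cases "fst m") (auto simp: Let_def)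

lemma length_fold_move [simp]: "length (fold move ms d) = length d"
  by (induction ms arbitrary: d) simp_all

lemma fold_move_inverse:
  assumes "\<forall>m\<in>set ms. snd m + 2 < length d"
  shows "fold move (rev ms) (fold move ms d) = d"
  using assms by (induction ms arbitrary: d) (simp_all add: move_move)

lemma move_nonneg:
  assumes "\<forall>x\<in>set d. 0 \<le> x" "snd m + 2 < length d" shows "\<forall>x\<in>set (move m d). 0 \<le> x"
proof -
  obtain e p where m: "m = (e, p)" by (cases m)
  obtain xs a b c ys where d: "d = xs @ a # b # c # ys" "p = length xs"
    using move_cases[of p d] assms(2) unfolding m snd_conv by blast
  show ?thesis using assms(1) by (cases e) (simp_all only: m d move_append, auto simp: min_def)
qed

lemma fold_move_nonneg:
  assumes "\<forall>x\<in>set d. 0 \<le> x" "\<forall>m\<in>set ms. snd m + 2 < length d"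
  shows "\<forall>x\<in>set (fold move ms d). 0 \<le> x"
  using assms
proof (induction ms arbitrary: d)
  case (Cons m ms)
  have "\<forall>x\<in>set (move m d). 0 \<le> x" by (rule move_nonneg) (use Cons.prems in simp_all)
  then show ?case unfolding fold_simps by (rule Cons.IH) (use Cons.prems(2) in simp)
qed simp

text \<open>By the second part the moves end in a folded tuple again, with equal entries in each
  triple. Hence reading off six positions in \<open>g2_trans\<close> loses nothing, as the inversion
  requires.\<close>

lemma g2_trans_closed:
  fixes t1 t2 t3 t4 t5 t6 :: int
  assumes "P5 = Min {t1 + t2 + 2 * t3 + t4, t1 + t2 + 2 * t3 + t6, t1 + t2 + 2 * t5 + t6, t1 + t4 + 2 * t5 + t6, t3 + t4 + 2 * t5 + t6}"
      and "P7 = Min {2 * t1 + 2 * t2 + 3 * t3 + t4, 2 * t1 + 2 * t2 + 3 * t3 + t6, 2 * t1 + 2 * t2 + 3 * t5 + t6, 2 * t1 + 2 * t4 + 3 * t5 + t6, 2 * t3 + 2 * t4 + 3 * t5 + t6}"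
      and "P8 = Min {3 * t1 + 2 * t2 + 3 * t3 + t4, 3 * t1 + 2 * t2 + 3 * t3 + t6, 3 * t1 + 2 * t2 + 3 * t5 + t6, 3 * t1 + 2 * t4 + 3 * t5 + t6, 2 * t1 + t2 + 2 * t3 + t4 + 2 * t5 + t6, 3 * t3 + 2 * t4 + 3 * t5 + t6}"
      and "P10 = Min {3 * t1 + 3 * t2 + 6 * t3 + 2 * t4, 3 * t1 + 3 * t2 + 6 * t3 + 2 * t6, 3 * t1 + 3 * t2 + 6 * t5 + 2 * t6, 3 * t1 + 3 * t4 + 6 * t5 + 2 * t6, 2 * t1 + t2 + 3 * t3 + 2 * t4 + 4 * t5 + 2 * t6, 2 * t1 + t2 + t3 + 2 * t4 + 6 * t5 + 2 * t6, 3 * t3 + 3 * t4 + 6 * t5 + 2 * t6}"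
  shows "g2_trans [t1, t2, t3, t4, t5, t6] = [t2 + 3 * t3 + 2 * t4 + 3 * t5 + t6 - P8, P8 - P7,
      3 * P7 - P8 - P10, P10 - P5 - P7, 3 * P5 - P10, t1 + t2 + 2 * t3 + t4 + t5 - P5]"
    and "fold move g2_moves [t1, t1, t1, t2, t3, t3, t3, t4, t5, t5, t5, t6] =
      (case g2_trans [t1, t2, t3, t4, t5, t6] of [a, b, c, d, e, f] \<Rightarrow> [a, b, b, b, c, d, d, d, e, f, f, f])"
proof -
  show "g2_trans [t1, t2, t3, t4, t5, t6] = [t2 + 3 * t3 + 2 * t4 + 3 * t5 + t6 - P8, P8 - P7,
      3 * P7 - P8 - P10, P10 - P5 - P7, 3 * P5 - P10, t1 + t2 + 2 * t3 + t4 + t5 - P5]"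
    unfolding g2_trans_def Let_def nth_Cons_0 nth_Cons_numeral
    by (simp add: g2_moves_forward[OF assms] del: Min_insert)
  then show "fold move g2_moves [t1, t1, t1, t2, t3, t3, t3, t4, t5, t5, t5, t6] =
      (case g2_trans [t1, t2, t3, t4, t5, t6] of [a, b, c, d, e, f] \<Rightarrow> [a, b, b, b, c, d, d, d, e, f, f, f])"
    by (simp add: g2_moves_forward[OF assms] del: Min_insert)
qed

text \<open>Enough for \<open>tr_vert\<close>, where the values of the minima cancel.\<close>

lemma g2_trans_form:
  "\<exists>p q r u. g2_trans [t1, t2, t3, t4, t5, t6] = [t2 + 3 * t3 + 2 * t4 + 3 * t5 + t6 - p, p - q,
      3 * q - p - r, r - u - q, 3 * u - r, t1 + t2 + 2 * t3 + t4 + t5 - u]"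
  using g2_trans_closed(1)[OF refl refl refl refl] by blast

lemma length_g2_trans [simp]: "length (g2_trans t) = 6"
  by (simp add: g2_trans_def Let_def)

lemma g2_trans_nonneg:
  assumes "length t = 6" "\<forall>x\<in>set t. 0 \<le> x" shows "\<forall>x\<in>set (g2_trans t). 0 \<le> x"
proof -
  obtain a b c d e f where t: "t = [a, b, c, d, e, f]" using assms(1) by (auto simp: list_6)
  define d' where "d' = fold move g2_moves [a, a, a, b, c, c, c, d, e, e, e, f]"
  have "\<forall>x\<in>set d'. 0 \<le> x" unfolding d'_def
    by (rule fold_move_nonneg) (use assms(2) in \<open>simp_all add: t g2_moves_def\<close>)
  moreover have "length d' = 12" by (simp add: d'_def)
  ultimately have "0 \<le> d' ! i" if "i < 12" for i using that by simp
  then show ?thesis by (simp add: g2_trans_def Let_def t flip: d'_def)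
qed

lemma g2_trans_inverse:
  assumes "length t = 6" shows "rev (g2_trans (rev (g2_trans t))) = t"
proof -
  obtain t1 t2 t3 t4 t5 t6 where t: "t = [t1, t2, t3, t4, t5, t6]" using assms by (auto simp: list_6)
  obtain a b c d e f where u: "g2_trans t = [a, b, c, d, e, f]"
    using list_6[THEN iffD1, OF length_g2_trans[of t]] by blast
  have rng: "\<forall>m\<in>set g2_moves. snd m + 2 < length [t1, t1, t1, t2, t3, t3, t3, t4, t5, t5, t5, t6]"
    by (simp add: g2_moves_def)
  have "fold move g2_moves [t1, t1, t1, t2, t3, t3, t3, t4, t5, t5, t5, t6] =
      [a, b, b, b, c, d, d, d, e, f, f, f]"
    using g2_trans_closed(2)[OF refl refl refl refl, of t1 t2 t3 t4 t5 t6] u[unfolded t] by simp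
  then have "fold move (rev g2_moves) [a, b, b, b, c, d, d, d, e, f, f, f] =
      [t1, t1, t1, t2, t3, t3, t3, t4, t5, t5, t5, t6]"
    using fold_move_inverse[of g2_moves "[t1, t1, t1, t2, t3, t3, t3, t4, t5, t5, t5, t6]"] rng by simp
  note bk = this[unfolded g2_moves_backward[OF refl refl refl refl]]
  have "rev (g2_trans (rev (g2_trans t))) = rev (g2_trans [f, e, d, c, b, a])" by (simp add: u)
  also have "\<dots> = [t1, t2, t3, t4, t5, t6]"
    unfolding g2_trans_closed(1)[OF refl refl refl refl, of f e d c b a]
    using bk by (simp only: add_ac list.inject rev.simps append.simps)
  finally show ?thesis by (simp add: t)
qed

lemma b2_trans_eq:
  assumes "p = min (a + b) (min (a + d) (c + d))" "q = min (2*a + b) (min (2*a + d) (2*c + d))"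
  shows "b2_trans [a, b, c, d] = [b + 2*c + d - q, q - p, 2*p - q, a + b + c - p]"
  by (simp add: b2_trans_def assms Let_def)

lemma b2_trans_inverse:
  assumes "length t = 4" shows "rev (b2_trans (rev (b2_trans t))) = t"
proof -
  obtain a b c d where t: "t = [a, b, c, d]" using assms by (auto simp: list_4)
  define p q where p: "p = min (a + b) (min (a + d) (c + d))"
    and q: "q = min (2*a + b) (min (2*a + d) (2*c + d))"
  note u = b2_trans_eq[OF p q]
  define p' q' where p': "p' = min ((a + b + c - p) + (2*p - q)) (min ((a + b + c - p) + (b + 2*c + d - q)) ((q - p) + (b + 2*c + d - q)))"
    and q': "q' = min (2*(a + b + c - p) + (2*p - q)) (min (2*(a + b + c - p) + (b + 2*c + d - q)) (2*(q - p) + (b + 2*c + d - q)))"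
  have "p = a + b \<or> p = a + d \<or> p = c + d" "q = 2*a + b \<or> q = 2*a + d \<or> q = 2*c + d"
    "p \<le> a + b" "p \<le> a + d" "p \<le> c + d" "q \<le> 2*a + b" "q \<le> 2*a + d" "q \<le> 2*c + d"
    unfolding p q by linarith+
  then have "p' = b + c" "q' = b + 2 * c"
    unfolding p' q' by - (elim disjE; auto simp: min_def)+
  then show ?thesis unfolding t u rev.simps append.simps b2_trans_eq[OF p' q'] by simp
qed

text \<open>Once the first edge is lengthened by at least the stated amount, the minimum is attained
  at the term without this edge, and the transition map degenerates to a shift. The B2 and G2
  versions rest on the same effect.\<close>

lemma a2_wall:
  assumes "length t = 3"
  shows "0 \<le> t ! 2 - a2_trans t ! 1"
    "0 \<le> e \<Longrightarrow> a2_trans ((hd t + (t ! 2 - a2_trans t ! 1) + e) # tl t) = tl t @ [last (a2_trans t) + e]"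
  using assms by (auto simp: list_3 a2_trans_def Let_def min_def)

lemma b2_wall:
  fixes a b c d p q :: int
  assumes p: "p = min (a + b) (min (a + d) (c + d))" and q: "q = min (2*a + b) (min (2*a + d) (2*c + d))"
  shows "0 \<le> c + d - p" "0 \<le> e \<Longrightarrow> b2_trans [a + (c + d - p) + e, b, c, d] = [b, c, d, a + b + c - p + e]"
proof -
  have le: "p \<le> a + b" "p \<le> a + d" "p \<le> c + d" unfolding p by linarith+
  then show "0 \<le> c + d - p" by simp
  assume "0 \<le> e"
  define n where "n = a + (c + d - p) + e"
  have "c + d \<le> n + b" "c + d \<le> n + d" "2*c + d \<le> 2*n + b" "2*c + d \<le> 2*n + d"
    using n_def le \<open>0 \<le> e\<close> by linarith+
  then have "c + d = min (n + b) (min (n + d) (c + d))" "2*c + d = min (2*n + b) (min (2*n + d) (2*c + d))"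
    by linarith+
  from b2_trans_eq[OF this] show "b2_trans [a + (c + d - p) + e, b, c, d] = [b, c, d, a + b + c - p + e]"
    by (simp add: n_def)
qed

text \<open>For the opposite orientation the tuple is read backwards: the edge to be lengthened
  comes last, and the minima move to their first terms.\<close>

lemma b2_wall_rev:
  fixes a b c d p q :: int
  assumes p: "p = min (a + b) (min (a + d) (c + d))" and q: "q = min (2*a + b) (min (2*a + d) (2*c + d))"
  shows "0 \<le> 2*a + b - q" "0 \<le> e \<Longrightarrow> b2_trans [a, b, c, d + (2*a + b - q) + e] = [b + 2*c + d - q + e, a, b, c]"
proof -
  have le: "q \<le> 2*a + b" "q \<le> 2*a + d" "q \<le> 2*c + d" unfolding q by linarith+
  then show "0 \<le> 2*a + b - q" by simp
  assume "0 \<le> e"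
  define n where "n = d + (2*a + b - q) + e"
  have "a + b \<le> a + n" "a + b \<le> c + n" "2*a + b \<le> 2*a + n" "2*a + b \<le> 2*c + n"
    using n_def le \<open>0 \<le> e\<close> by linarith+
  then have "a + b = min (a + b) (min (a + n) (c + n))" "2*a + b = min (2*a + b) (min (2*a + n) (2*c + n))"
    by linarith+
  from b2_trans_eq[OF this] show "b2_trans [a, b, c, d + (2*a + b - q) + e] = [b + 2*c + d - q + e, a, b, c]"
    by (simp add: n_def)
qed

text \<open>The threshold is expressed by \<open>P5\<close> alone, yet beyond it all four minima of
  the closed formula are attained at their last terms, those free of the first edge.\<close>

lemma g2_wall:
  fixes t1 t2 t3 t4 t5 t6 :: int
  assumes P: "P5 = Min {t1 + t2 + 2 * t3 + t4, t1 + t2 + 2 * t3 + t6, t1 + t2 + 2 * t5 + t6, t1 + t4 + 2 * t5 + t6, t3 + t4 + 2 * t5 + t6}"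
  shows "0 \<le> t3 + t4 + 2 * t5 + t6 - P5" "0 \<le> e \<Longrightarrow> g2_trans [t1 + (t3 + t4 + 2 * t5 + t6 - P5) + e, t2, t3, t4, t5, t6] = [t2, t3, t4, t5, t6, t1 + t2 + 2 * t3 + t4 + t5 - P5 + e]"
proof -
  have le: "P5 \<le> t1 + t2 + 2 * t3 + t4" "P5 \<le> t1 + t2 + 2 * t3 + t6" "P5 \<le> t1 + t2 + 2 * t5 + t6" "P5 \<le> t1 + t4 + 2 * t5 + t6" "P5 \<le> t3 + t4 + 2 * t5 + t6"
    unfolding P by (rule Min_le, simp only: finite_insert finite.emptyI, (rule insertI1 | rule insertI2)+)+
  then show "0 \<le> t3 + t4 + 2 * t5 + t6 - P5" by simp
  assume "0 \<le> e"
  define n where "n = t1 + (t3 + t4 + 2 * t5 + t6 - P5) + e"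
  have P5: "t3 + t4 + 2 * t5 + t6 = Min {n + t2 + 2 * t3 + t4, n + t2 + 2 * t3 + t6, n + t2 + 2 * t5 + t6, n + t4 + 2 * t5 + t6, t3 + t4 + 2 * t5 + t6}"
  proof -
    have "t3 + t4 + 2 * t5 + t6 \<le> n + t2 + 2 * t3 + t4" "t3 + t4 + 2 * t5 + t6 \<le> n + t2 + 2 * t3 + t6" "t3 + t4 + 2 * t5 + t6 \<le> n + t2 + 2 * t5 + t6" "t3 + t4 + 2 * t5 + t6 \<le> n + t4 + 2 * t5 + t6"
      using n_def le \<open>0 \<le> e\<close> by linarith+
    then show ?thesis by (intro Min_eqI[symmetric]) (auto simp only: finite_insert finite.emptyI insert_iff empty_iff simp_thms)
  qed
  have P7: "2 * t3 + 2 * t4 + 3 * t5 + t6 = Min {2 * n + 2 * t2 + 3 * t3 + t4, 2 * n + 2 * t2 + 3 * t3 + t6, 2 * n + 2 * t2 + 3 * t5 + t6, 2 * n + 2 * t4 + 3 * t5 + t6, 2 * t3 + 2 * t4 + 3 * t5 + t6}"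
  proof -
    have "2 * t3 + 2 * t4 + 3 * t5 + t6 \<le> 2 * n + 2 * t2 + 3 * t3 + t4" "2 * t3 + 2 * t4 + 3 * t5 + t6 \<le> 2 * n + 2 * t2 + 3 * t3 + t6" "2 * t3 + 2 * t4 + 3 * t5 + t6 \<le> 2 * n + 2 * t2 + 3 * t5 + t6" "2 * t3 + 2 * t4 + 3 * t5 + t6 \<le> 2 * n + 2 * t4 + 3 * t5 + t6"
      using n_def le \<open>0 \<le> e\<close> by linarith+
    then show ?thesis by (intro Min_eqI[symmetric]) (auto simp only: finite_insert finite.emptyI insert_iff empty_iff simp_thms)
  qed
  have P8: "3 * t3 + 2 * t4 + 3 * t5 + t6 = Min {3 * n + 2 * t2 + 3 * t3 + t4, 3 * n + 2 * t2 + 3 * t3 + t6, 3 * n + 2 * t2 + 3 * t5 + t6, 3 * n + 2 * t4 + 3 * t5 + t6, 2 * n + t2 + 2 * t3 + t4 + 2 * t5 + t6, 3 * t3 + 2 * t4 + 3 * t5 + t6}"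
  proof -
    have "3 * t3 + 2 * t4 + 3 * t5 + t6 \<le> 3 * n + 2 * t2 + 3 * t3 + t4" "3 * t3 + 2 * t4 + 3 * t5 + t6 \<le> 3 * n + 2 * t2 + 3 * t3 + t6" "3 * t3 + 2 * t4 + 3 * t5 + t6 \<le> 3 * n + 2 * t2 + 3 * t5 + t6" "3 * t3 + 2 * t4 + 3 * t5 + t6 \<le> 3 * n + 2 * t4 + 3 * t5 + t6" "3 * t3 + 2 * t4 + 3 * t5 + t6 \<le> 2 * n + t2 + 2 * t3 + t4 + 2 * t5 + t6"
      using n_def le \<open>0 \<le> e\<close> by linarith+
    then show ?thesis by (intro Min_eqI[symmetric]) (auto simp only: finite_insert finite.emptyI insert_iff empty_iff simp_thms)
  qed
  have P10: "3 * t3 + 3 * t4 + 6 * t5 + 2 * t6 = Min {3 * n + 3 * t2 + 6 * t3 + 2 * t4, 3 * n + 3 * t2 + 6 * t3 + 2 * t6, 3 * n + 3 * t2 + 6 * t5 + 2 * t6, 3 * n + 3 * t4 + 6 * t5 + 2 * t6, 2 * n + t2 + 3 * t3 + 2 * t4 + 4 * t5 + 2 * t6, 2 * n + t2 + t3 + 2 * t4 + 6 * t5 + 2 * t6, 3 * t3 + 3 * t4 + 6 * t5 + 2 * t6}"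
  proof -
    have "3 * t3 + 3 * t4 + 6 * t5 + 2 * t6 \<le> 3 * n + 3 * t2 + 6 * t3 + 2 * t4" "3 * t3 + 3 * t4 + 6 * t5 + 2 * t6 \<le> 3 * n + 3 * t2 + 6 * t3 + 2 * t6" "3 * t3 + 3 * t4 + 6 * t5 + 2 * t6 \<le> 3 * n + 3 * t2 + 6 * t5 + 2 * t6" "3 * t3 + 3 * t4 + 6 * t5 + 2 * t6 \<le> 3 * n + 3 * t4 + 6 * t5 + 2 * t6" "3 * t3 + 3 * t4 + 6 * t5 + 2 * t6 \<le> 2 * n + t2 + 3 * t3 + 2 * t4 + 4 * t5 + 2 * t6" "3 * t3 + 3 * t4 + 6 * t5 + 2 * t6 \<le> 2 * n + t2 + t3 + 2 * t4 + 6 * t5 + 2 * t6"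
      using n_def le \<open>0 \<le> e\<close> by linarith+
    then show ?thesis by (intro Min_eqI[symmetric]) (auto simp only: finite_insert finite.emptyI insert_iff empty_iff simp_thms)
  qed
  from g2_trans_closed(1)[OF P5 P7 P8 P10] show "g2_trans [t1 + (t3 + t4 + 2 * t5 + t6 - P5) + e, t2, t3, t4, t5, t6] = [t2, t3, t4, t5, t6, t1 + t2 + 2 * t3 + t4 + t5 - P5 + e]"
    by (simp add: n_def)
qed

text \<open>The counterpart for the last edge, with a threshold given by \<open>P8\<close>: all four
  minima move to their first terms, which do not contain it.\<close>

lemma g2_wall_rev:
  fixes t1 t2 t3 t4 t5 t6 :: int
  assumes P: "P8 = Min {3 * t1 + 2 * t2 + 3 * t3 + t4, 3 * t1 + 2 * t2 + 3 * t3 + t6, 3 * t1 + 2 * t2 + 3 * t5 + t6, 3 * t1 + 2 * t4 + 3 * t5 + t6, 2 * t1 + t2 + 2 * t3 + t4 + 2 * t5 + t6, 3 * t3 + 2 * t4 + 3 * t5 + t6}"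
  shows "0 \<le> 3 * t1 + 2 * t2 + 3 * t3 + t4 - P8" "0 \<le> e \<Longrightarrow> g2_trans [t1, t2, t3, t4, t5, t6 + (3 * t1 + 2 * t2 + 3 * t3 + t4 - P8) + e] = [t2 + 3 * t3 + 2 * t4 + 3 * t5 + t6 - P8 + e, t1, t2, t3, t4, t5]"
proof -
  have le: "P8 \<le> 3 * t1 + 2 * t2 + 3 * t3 + t4" "P8 \<le> 3 * t1 + 2 * t2 + 3 * t3 + t6" "P8 \<le> 3 * t1 + 2 * t2 + 3 * t5 + t6" "P8 \<le> 3 * t1 + 2 * t4 + 3 * t5 + t6" "P8 \<le> 2 * t1 + t2 + 2 * t3 + t4 + 2 * t5 + t6" "P8 \<le> 3 * t3 + 2 * t4 + 3 * t5 + t6"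
    unfolding P by (rule Min_le, simp only: finite_insert finite.emptyI, (rule insertI1 | rule insertI2)+)+
  then show "0 \<le> 3 * t1 + 2 * t2 + 3 * t3 + t4 - P8" by simp
  assume "0 \<le> e"
  define n where "n = t6 + (3 * t1 + 2 * t2 + 3 * t3 + t4 - P8) + e"
  have P5: "t1 + t2 + 2 * t3 + t4 = Min {t1 + t2 + 2 * t3 + t4, t1 + t2 + 2 * t3 + n, t1 + t2 + 2 * t5 + n, t1 + t4 + 2 * t5 + n, t3 + t4 + 2 * t5 + n}"
  proof -
    have "t1 + t2 + 2 * t3 + t4 \<le> t1 + t2 + 2 * t3 + n" "t1 + t2 + 2 * t3 + t4 \<le> t1 + t2 + 2 * t5 + n" "t1 + t2 + 2 * t3 + t4 \<le> t1 + t4 + 2 * t5 + n" "t1 + t2 + 2 * t3 + t4 \<le> t3 + t4 + 2 * t5 + n"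
      using n_def le \<open>0 \<le> e\<close> by linarith+
    then show ?thesis by (intro Min_eqI[symmetric]) (auto simp only: finite_insert finite.emptyI insert_iff empty_iff simp_thms)
  qed
  have P7: "2 * t1 + 2 * t2 + 3 * t3 + t4 = Min {2 * t1 + 2 * t2 + 3 * t3 + t4, 2 * t1 + 2 * t2 + 3 * t3 + n, 2 * t1 + 2 * t2 + 3 * t5 + n, 2 * t1 + 2 * t4 + 3 * t5 + n, 2 * t3 + 2 * t4 + 3 * t5 + n}"
  proof -
    have "2 * t1 + 2 * t2 + 3 * t3 + t4 \<le> 2 * t1 + 2 * t2 + 3 * t3 + n" "2 * t1 + 2 * t2 + 3 * t3 + t4 \<le> 2 * t1 + 2 * t2 + 3 * t5 + n" "2 * t1 + 2 * t2 + 3 * t3 + t4 \<le> 2 * t1 + 2 * t4 + 3 * t5 + n" "2 * t1 + 2 * t2 + 3 * t3 + t4 \<le> 2 * t3 + 2 * t4 + 3 * t5 + n"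
      using n_def le \<open>0 \<le> e\<close> by linarith+
    then show ?thesis by (intro Min_eqI[symmetric]) (auto simp only: finite_insert finite.emptyI insert_iff empty_iff simp_thms)
  qed
  have P8: "3 * t1 + 2 * t2 + 3 * t3 + t4 = Min {3 * t1 + 2 * t2 + 3 * t3 + t4, 3 * t1 + 2 * t2 + 3 * t3 + n, 3 * t1 + 2 * t2 + 3 * t5 + n, 3 * t1 + 2 * t4 + 3 * t5 + n, 2 * t1 + t2 + 2 * t3 + t4 + 2 * t5 + n, 3 * t3 + 2 * t4 + 3 * t5 + n}"
  proof -
    have "3 * t1 + 2 * t2 + 3 * t3 + t4 \<le> 3 * t1 + 2 * t2 + 3 * t3 + n" "3 * t1 + 2 * t2 + 3 * t3 + t4 \<le> 3 * t1 + 2 * t2 + 3 * t5 + n" "3 * t1 + 2 * t2 + 3 * t3 + t4 \<le> 3 * t1 + 2 * t4 + 3 * t5 + n" "3 * t1 + 2 * t2 + 3 * t3 + t4 \<le> 2 * t1 + t2 + 2 * t3 + t4 + 2 * t5 + n" "3 * t1 + 2 * t2 + 3 * t3 + t4 \<le> 3 * t3 + 2 * t4 + 3 * t5 + n"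
      using n_def le \<open>0 \<le> e\<close> by linarith+
    then show ?thesis by (intro Min_eqI[symmetric]) (auto simp only: finite_insert finite.emptyI insert_iff empty_iff simp_thms)
  qed
  have P10: "3 * t1 + 3 * t2 + 6 * t3 + 2 * t4 = Min {3 * t1 + 3 * t2 + 6 * t3 + 2 * t4, 3 * t1 + 3 * t2 + 6 * t3 + 2 * n, 3 * t1 + 3 * t2 + 6 * t5 + 2 * n, 3 * t1 + 3 * t4 + 6 * t5 + 2 * n, 2 * t1 + t2 + 3 * t3 + 2 * t4 + 4 * t5 + 2 * n, 2 * t1 + t2 + t3 + 2 * t4 + 6 * t5 + 2 * n, 3 * t3 + 3 * t4 + 6 * t5 + 2 * n}"
  proof -
    have "3 * t1 + 3 * t2 + 6 * t3 + 2 * t4 \<le> 3 * t1 + 3 * t2 + 6 * t3 + 2 * n" "3 * t1 + 3 * t2 + 6 * t3 + 2 * t4 \<le> 3 * t1 + 3 * t2 + 6 * t5 + 2 * n" "3 * t1 + 3 * t2 + 6 * t3 + 2 * t4 \<le> 3 * t1 + 3 * t4 + 6 * t5 + 2 * n" "3 * t1 + 3 * t2 + 6 * t3 + 2 * t4 \<le> 2 * t1 + t2 + 3 * t3 + 2 * t4 + 4 * t5 + 2 * n" "3 * t1 + 3 * t2 + 6 * t3 + 2 * t4 \<le> 2 * t1 + t2 + t3 + 2 * t4 + 6 * t5 + 2 * n" "3 * t1 + 3 * t2 + 6 * t3 + 2 * t4 \<le> 3 * t3 + 3 * t4 + 6 * t5 + 2 * n"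
      using n_def le \<open>0 \<le> e\<close> by linarith+
    then show ?thesis by (intro Min_eqI[symmetric]) (auto simp only: finite_insert finite.emptyI insert_iff empty_iff simp_thms)
  qed
  from g2_trans_closed(1)[OF P5 P7 P8 P10] show "g2_trans [t1, t2, t3, t4, t5, t6 + (3 * t1 + 2 * t2 + 3 * t3 + t4 - P8) + e] = [t2 + 3 * t3 + 2 * t4 + 3 * t5 + t6 - P8 + e, t1, t2, t3, t4, t5]"
    by (simp add: n_def)
qed

section \<open>Transition maps between the two paths around a 2-face\<close>

context fin_cartan
begin

text \<open>The formulas for B2 and G2 fix which letter comes first. The opposite orientation reads
  the polygon from its other end, which reverses the tuple before and after.\<close>

definition tr :: "'i \<Rightarrow> 'i \<Rightarrow> int list \<Rightarrow> int list" where
  "tr i j t = (if C i j * C j i = 0 then rev t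
    else if C i j * C j i = 1 then a2_trans t
    else if C i j * C j i = 2 then (if C i j = -2 then b2_trans t else rev (b2_trans (rev t)))
    else (if C i j = -3 then g2_trans t else rev (g2_trans (rev t))))"

lemma length_tr: "length t = cox i j \<Longrightarrow> length (tr i j t) = cox i j"
  by (auto simp: tr_def cox_def a2_trans_def b2_trans_def Let_def)

lemma tr_inverse:
  assumes "i \<noteq> j" "length t = cox i j" shows "tr j i (tr i j t) = t"
  using assms(1)
proof (cases rule: rank2_cases)
  case 2
  then show ?thesis using assms(2) by (auto simp: tr_def cox_def list_3 a2_trans_def Let_def min_def)
next
  case 3
  then show ?thesis using assms(2) b2_trans_inverse[of t] by (simp add: tr_def cox_def)
next
  case 4
  then show ?thesis using assms(2) b2_trans_inverse[of "rev t"] by (simp add: tr_def cox_def rev_swap)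
next
  case 5
  then show ?thesis using assms(2) g2_trans_inverse[of t] by (simp add: tr_def cox_def)
next
  case 6
  then show ?thesis using assms(2) g2_trans_inverse[of "rev t"] by (simp add: tr_def cox_def rev_swap)
qed (simp add: tr_def)

lemma tr_nonneg:
  assumes "length t = cox i j" "\<forall>x\<in>set t. 0 \<le> x" shows "\<forall>x\<in>set (tr i j t). 0 \<le> x"
proof -
  have b2: "\<forall>x\<in>set (b2_trans u). 0 \<le> x" if u: "length u = 4" "\<forall>x\<in>set u. 0 \<le> x" for u
  proof -
    obtain a b c d where abcd: "u = [a, b, c, d]" using u(1) by (auto simp: list_4)
    define p q where p: "p = min (a + b) (min (a + d) (c + d))"
      and q: "q = min (2*a + b) (min (2*a + d) (2*c + d))"
    have "p = a + b \<or> p = a + d \<or> p = c + d" "q = 2*a + b \<or> q = 2*a + d \<or> q = 2*c + d"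
      "p \<le> a + b" "p \<le> a + d" "p \<le> c + d" "q \<le> 2*a + b" "q \<le> 2*a + d" "q \<le> 2*c + d"
      unfolding p q by linarith+
    moreover have "0 \<le> a" "0 \<le> b" "0 \<le> c" "0 \<le> d" using u(2) unfolding abcd by simp_all
    ultimately have "q \<le> b + 2*c + d" "p \<le> q" "q \<le> 2 * p" "p \<le> a + b + c"
      by (linarith, (elim disjE; linarith)+)
    then show ?thesis unfolding abcd b2_trans_eq[OF p q] by simp
  qed
  have a2: "\<forall>x\<in>set (a2_trans u). 0 \<le> x" if u: "length u = 3" "\<forall>x\<in>set u. 0 \<le> x" for u
    using that by (auto simp: list_3 a2_trans_def Let_def min_def)
  show ?thesis
    using assms a2[of t] b2[of t] b2[of "rev t"] g2_trans_nonneg[of t] g2_trans_nonneg[of "rev t"]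
    by (simp add: tr_def cox_def split: if_splits)
qed

text \<open>The linear extension of the values \<open>f\<close> at the fundamental weights,
  evaluated at the \<open>i\<close>-th simple root.\<close>

definition Af :: "'i \<Rightarrow> ('i \<Rightarrow> int) \<Rightarrow> int" where
  "Af i f = (\<Sum>k\<in>UNIV. C k i * f k)"

definition bump :: "'i \<Rightarrow> int \<Rightarrow> ('i \<Rightarrow> int) \<Rightarrow> 'i \<Rightarrow> int" where
  "bump i n f = f(i := f i - Af i f - n)"

text \<open>\<open>vert r q f\<close> recovers the values of a datum at the start of the path \<open>r\<close> from its values
  \<open>f\<close> at the end and the edge lengths \<open>q\<close>; \<open>bump\<close> goes back along one edge.\<close>

fun vert :: "'i list \<Rightarrow> int list \<Rightarrow> ('i \<Rightarrow> int) \<Rightarrow> 'i \<Rightarrow> int" where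
  "vert (i # r) (n # q) f = bump i n (vert r q f)"
| "vert _ _ f = f"

lemma vert_append: "length u = length t \<Longrightarrow> vert (u @ r) (t @ q) f = vert u t (vert r q f)"
  by (induction u t rule: list_induct2) simp_all

text \<open>Along a path in two letters only the values at \<open>i\<close> and \<open>j\<close>
  change. Tracking these changes makes \<open>vert\<close> explicit.\<close>

definition dv :: "'i \<Rightarrow> 'i \<Rightarrow> ('i \<Rightarrow> int) \<Rightarrow> int \<Rightarrow> int \<Rightarrow> 'i \<Rightarrow> int" where
  "dv i j f a b = f(i := f i + a, j := f j + b)"

lemma Af_upd: "Af i (f(l := x)) = Af i f + C l i * (x - f l)"
proof -
  have "Af i (f(l := x)) = (\<Sum>k\<in>UNIV. C k i * f k + (if k = l then C l i * (x - f l) else 0))"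
    unfolding Af_def by (intro sum.cong) (auto simp: algebra_simps)
  then show ?thesis by (simp add: sum.distrib Af_def)
qed

lemma dv_steps:
  assumes "i \<noteq> j"
  shows "bump i n (dv i j f a b) = dv i j f (- a - C j i * b - Af i f - n) b"
    "bump j n (dv i j f a b) = dv i j f a (- b - C i j * a - Af j f - n)"
    "bump i n f = dv i j f (- Af i f - n) 0"
    "bump j n f = dv i j f 0 (- Af j f - n)"
    "dv i j f a b i = f i + a" "dv i j f a b j = f j + b"
  using assms by (auto simp: bump_def dv_def Af_upd fun_eq_iff algebra_simps)

text \<open>Both paths around the polygon join the same two vertices. Only linear relations among
  the outputs of the transition map enter; the minima cancel.\<close>

lemma tr_vert:
  assumes ij: "i \<noteq> j" and "length t = cox i j"
  shows "vert (alt i j (cox i j)) t f = vert (alt j i (cox i j)) (tr i j t) f"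
proof -
  have alts: "alt i j 2 = [i, j]" "alt i j 3 = [i, j, i]" "alt i j 4 = [i, j, i, j]" "alt i j 6 = [i, j, i, j, i, j]" for i j :: 'i
    by (simp_all add: eval_nat_numeral alt_Suc)
  note S = alts cox_def tr_def dv_steps[OF ij, where f=f]
  from ij show ?thesis
  proof (cases rule: rank2_cases)
    case 1
    then show ?thesis using assms(2) by (auto simp: S list_2)
  next
    case 2
    then obtain a b c where t: "t = [a, b, c]" using assms(2) by (auto simp: cox_def list_3)
    show ?thesis using 2
      by (simp add: S t a2_trans_def Let_def) (rule arg_cong2[where f="dv i j f"]; linarith)
  next
    case 3
    then obtain a b c d where t: "t = [a, b, c, d]" using assms(2) by (auto simp: cox_def list_4)
    define p q where p: "p = min (a + b) (min (a + d) (c + d))"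
      and q: "q = min (2*a + b) (min (2*a + d) (2*c + d))"
    show ?thesis using 3
      by (simp add: S t b2_trans_eq[OF p q]) (rule arg_cong2[where f="dv i j f"]; linarith)
  next
    case 4
    then obtain a b c d where t: "t = [a, b, c, d]" using assms(2) by (auto simp: cox_def list_4)
    define p q where p: "p = min (d + c) (min (d + a) (b + a))"
      and q: "q = min (2*d + c) (min (2*d + a) (2*b + a))"
    show ?thesis using 4
      by (simp add: S t b2_trans_eq[OF p q]) (rule arg_cong2[where f="dv i j f"]; linarith)
  next
    case 5
    then obtain t1 t2 t3 t4 t5 t6 where t: "t = [t1, t2, t3, t4, t5, t6]" using assms(2) by (auto simp: cox_def list_6)
    obtain p q r u where g: "g2_trans [t1, t2, t3, t4, t5, t6] = [t2 + 3 * t3 + 2 * t4 + 3 * t5 + t6 - p, p - q,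
        3 * q - p - r, r - u - q, 3 * u - r, t1 + t2 + 2 * t3 + t4 + t5 - u]"
      using g2_trans_form by blast
    show ?thesis using 5
      by (simp add: S t g)
        (rule arg_cong2[where f="dv i j f"]; linarith)
  next
    case 6
    then obtain t1 t2 t3 t4 t5 t6 where t: "t = [t1, t2, t3, t4, t5, t6]" using assms(2) by (auto simp: cox_def list_6)
    obtain p q r u where g: "g2_trans [t6, t5, t4, t3, t2, t1] = [t5 + 3 * t4 + 2 * t3 + 3 * t2 + t1 - p, p - q,
        3 * q - p - r, r - u - q, 3 * u - r, t6 + t5 + 2 * t4 + t3 + t2 - u]"
      using g2_trans_form by blast
    show ?thesis using 6
      by (simp add: S t g)
        (rule arg_cong2[where f="dv i j f"]; linarith)
  qed
qed

text \<open>Here \<open>f\<close> holds the values at the top of a polygon. The first edge along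
  \<open>t\<close> and the last edge of the other path are opposite sides; \<open>x\<close> and
  \<open>y\<close> are the drops of the value along them. Their difference is exactly the threshold
  in the rank two wall lemmas.\<close>

lemma tr_wall:
  assumes ij: "i \<noteq> j" and len: "length t = cox i j"
    and k: "k = last (alt j i (cox i j))"
    and x: "x = vert (alt i j (cox i j)) t f i - vert (alt j i (cox i j - 1)) (tl t) f i"
    and y: "y = bump k (last (tr i j t)) f k - f k"
  shows "y \<le> x"
    and "0 \<le> e \<Longrightarrow> tr i j ((hd t + (x - y) + e) # tl t) = tl t @ [last (tr i j t) + e]"
proof -
  have alts: "alt i j (Suc 0) = [i]" "alt i j 2 = [i, j]" "alt i j 3 = [i, j, i]" "alt i j 4 = [i, j, i, j]"
    "alt i j 5 = [i, j, i, j, i]" "alt i j 6 = [i, j, i, j, i, j]" for i j :: 'i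
    by (simp_all add: eval_nat_numeral alt_Suc)
  note S = alts cox_def tr_def dv_steps[OF ij, where f=f] x y k
  have "y \<le> x \<and> (0 \<le> e \<longrightarrow> tr i j ((hd t + (x - y) + e) # tl t) = tl t @ [last (tr i j t) + e])"
    using ij
  proof (cases rule: rank2_cases)
    case 1
    then show ?thesis using len by (auto simp: S list_2)
  next
    case 2
    then obtain a b c where t: "t = [a, b, c]" using len by (auto simp: cox_def list_3)
    have xy: "x - y = t ! 2 - a2_trans t ! 1"
      using 2 by (simp add: S t a2_trans_def Let_def algebra_simps)
    then have "y \<le> x" using a2_wall(1)[of t] by (simp add: t)
    then show ?thesis using 2 a2_wall(2)[of t e] xy by (simp add: t tr_def)
  next
    case 3
    then obtain a b c d where t: "t = [a, b, c, d]" using len by (auto simp: cox_def list_4)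
    define p q where p: "p = min (a + b) (min (a + d) (c + d))"
      and q: "q = min (2*a + b) (min (2*a + d) (2*c + d))"
    have xy: "x - y = c + d - p"
      using 3 by (simp add: S t b2_trans_eq[OF p q] algebra_simps)
    then have "y \<le> x" using b2_wall(1)[OF p q] by simp
    then show ?thesis using 3 b2_wall(2)[OF p q, of e] xy by (simp add: t tr_def b2_trans_eq[OF p q])
  next
    case 4
    then obtain a b c d where t: "t = [d, c, b, a]" using len by (auto simp: cox_def list_4)
    define p q where p: "p = min (a + b) (min (a + d) (c + d))"
      and q: "q = min (2*a + b) (min (2*a + d) (2*c + d))"
    have xy: "x - y = 2*a + b - q"
      using 4 by (simp add: S t b2_trans_eq[OF p q] algebra_simps)
    then have "y \<le> x" using b2_wall_rev(1)[OF p q] by simp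
    then show ?thesis using 4 b2_wall_rev(2)[OF p q, of e] xy by (simp add: t tr_def b2_trans_eq[OF p q])
  next
    case 5
    then obtain t1 t2 t3 t4 t5 t6 where t: "t = [t1, t2, t3, t4, t5, t6]" using len by (auto simp: cox_def list_6)
    define P where P: "P = Min {t1 + t2 + 2 * t3 + t4, t1 + t2 + 2 * t3 + t6, t1 + t2 + 2 * t5 + t6, t1 + t4 + 2 * t5 + t6, t3 + t4 + 2 * t5 + t6}"
    note closed = g2_trans_closed(1)[OF P refl refl refl]
    note wall = g2_wall[OF P]
    have xy: "x - y = t3 + t4 + 2 * t5 + t6 - P"
      using 5 by (simp add: S t closed algebra_simps del: Min_insert)
    then have "y \<le> x" using wall(1) by linarith
    then show ?thesis using 5 wall(2)[of e] unfolding xy by (simp add: t tr_def closed del: Min_insert)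
  next
    case 6
    then obtain t1 t2 t3 t4 t5 t6 where t: "t = [t6, t5, t4, t3, t2, t1]" using len by (auto simp: cox_def list_6)
    define P where P: "P = Min {3 * t1 + 2 * t2 + 3 * t3 + t4, 3 * t1 + 2 * t2 + 3 * t3 + t6, 3 * t1 + 2 * t2 + 3 * t5 + t6, 3 * t1 + 2 * t4 + 3 * t5 + t6, 2 * t1 + t2 + 2 * t3 + t4 + 2 * t5 + t6, 3 * t3 + 2 * t4 + 3 * t5 + t6}"
    note closed = g2_trans_closed(1)[OF refl refl P refl]
    note wall = g2_wall_rev[OF P]
    have xy: "x - y = 3 * t1 + 2 * t2 + 3 * t3 + t4 - P"
      using 6 by (simp add: S t closed algebra_simps del: Min_insert)
    then have "y \<le> x" using wall(1) by linarith
    then show ?thesis using 6 wall(2)[of e] unfolding xy by (simp add: t tr_def closed del: Min_insert)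
  qed
  then show "y \<le> x" "0 \<le> e \<Longrightarrow> tr i j ((hd t + (x - y) + e) # tl t) = tl t @ [last (tr i j t) + e]"
    by blast+
qed

end


subsection \<open>Braid moves and monodromy\<close>

context fin_cartan
begin

inductive bstep :: "'i list \<times> int list \<Rightarrow> 'i list \<times> int list \<Rightarrow> bool" where
  bstep: "i \<noteq> j \<Longrightarrow> length t = cox i j \<Longrightarrow> length tp = length p \<Longrightarrow> length tq = length q \<Longrightarrow>
    bstep (p @ alt i j (cox i j) @ q, tp @ t @ tq) (p @ alt j i (cox i j) @ q, tp @ tr i j t @ tq)"

abbreviation "bs \<equiv> bstep\<^sup>*\<^sup>*"

lemma bstep_sym: "bstep \<sigma> \<tau> \<Longrightarrow> bstep \<tau> \<sigma>"
proof (induction rule: bstep.induct)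
  case (bstep i j t tp p tq q)
  have "length (tr i j t) = cox j i" using length_tr bstep(2) cox_sym[of i j] by simp
  from bstep.bstep[OF not_sym[OF bstep(1)] this bstep(3,4)]
  show ?case by (simp add: tr_inverse[OF bstep(1,2)] cox_sym[of j i])
qed

lemma bs_sym: "bs \<sigma> \<tau> \<Longrightarrow> bs \<tau> \<sigma>"
  by (induction rule: rtranclp_induct) (auto intro: bstep_sym converse_rtranclp_into_rtranclp)

lemma bstep_inv:
  "bstep \<sigma> \<tau> \<Longrightarrow> act (fst \<tau>) = act (fst \<sigma>) \<and> reduced (fst \<tau>) = reduced (fst \<sigma>)
    \<and> length (fst \<tau>) = length (fst \<sigma>) \<and> length (snd \<tau>) = length (snd \<sigma>)"
proof (induction rule: bstep.induct)
  case (bstep i j t tp p tq q)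
  then show ?case using reduced_swap[OF bstep(1), of p q] by (simp add: length_tr)
qed

lemma bs_inv:
  "bs \<sigma> \<tau> \<Longrightarrow> act (fst \<tau>) = act (fst \<sigma>) \<and> reduced (fst \<tau>) = reduced (fst \<sigma>)
    \<and> length (fst \<tau>) = length (fst \<sigma>) \<and> length (snd \<tau>) = length (snd \<sigma>)"
  by (induction rule: rtranclp_induct) (auto dest: bstep_inv)

lemma bstep_context:
  assumes "bstep (x, t) (y, u)" "length tp = length p" "length tq = length q"
  shows "bstep (p @ x @ q, tp @ t @ tq) (p @ y @ q, tp @ u @ tq)"
  using assms(1)
proof (cases rule: bstep.cases)
  case (bstep i j t' tp' p' tq' q')
  show ?thesis
    using bstep.bstep[OF bstep(5,6), of "tp @ tp'" "p @ p'" "tq' @ tq" "q' @ q"] bstep(1-4,7,8) assms(2,3) by simp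
qed

lemma bs_context:
  assumes "bs (x, t) (y, u)" "length tp = length p" "length tq = length q"
  shows "bs (p @ x @ q, tp @ t @ tq) (p @ y @ q, tp @ u @ tq)"
proof -
  have "bs (p @ fst \<sigma> @ q, tp @ snd \<sigma> @ tq) (p @ fst \<tau> @ q, tp @ snd \<tau> @ tq)" if "bs \<sigma> \<tau>" for \<sigma> \<tau>
    using that
  proof (induction rule: rtranclp_induct)
    case (step \<tau> \<rho>)
    have "bstep (p @ fst \<tau> @ q, tp @ snd \<tau> @ tq) (p @ fst \<rho> @ q, tp @ snd \<rho> @ tq)"
      by (rule bstep_context) (use step.hyps(2) assms(2,3) in simp_all)
    with step.IH show ?case by (rule rtranclp.rtrancl_into_rtrancl)
  qed simp
  from this[OF assms(1)] show ?thesis by simp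
qed

lemma bs_Cons: "bs (x, t) (y, u) \<Longrightarrow> bs (a # x, n # t) (a # y, n # u)"
  using bs_context[of x t y u "[n]" "[a]" "[]" "[]"] by simp

lemma list_split:
  assumes "length t = m + n" obtains e q where "t = e @ q" "length e = m" "length q = n"
  using that[of "take m t" "drop m t"] assms by simp

lemma cox_Suc: obtains m where "cox i j = Suc m"
  using cox_ge_2[of i j] by (cases "cox i j") auto

text \<open>The theorem of Matsumoto and Tits with tuples carried along. If the first letters
  \<open>a\<close>, \<open>b\<close> differ, both are descents, so the words are connected through
  two words that begin with the alternating words in \<open>a\<close> and \<open>b\<close>; the rest
  happens behind a fixed first letter.\<close>

lemma matsumoto:
  assumes "reduced x" "reduced y" "act x = act y" "length t = length x"
  shows "\<exists>u. length u = length y \<and> bs (x, t) (y, u)"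
  using assms
proof (induction "length x" arbitrary: x y t rule: less_induct)
  case less
  have len: "length x = length y" using less.prems by (metis reduced_def)
  have same: "\<exists>u. length u = length y' \<and> bs (a # x', n # t') (a # y', n # u)"
    if "reduced (a # x')" "reduced (a # y')" "act (a # x') = act (a # y')" "length t' = length x'"
      "length (a # x') = length x" for a x' y' n t'
  proof -
    note l = that(4)
    have "act x' = act y'" using that(3) by (metis act_tail)
    moreover have "reduced x'" "reduced y'" using that(1,2) reduced_ConsD by blast+
    moreover have "length x' < length x" using that(5) by simp
    ultimately obtain u where "length u = length y'" "bs (x', t') (y', u)"
      using less.hyps[of x' y' t'] l by blast
    then show ?thesis using bs_Cons by blast
  qed
  show ?case
  proof (cases x)
    case Nil
    then show ?thesis using len less.prems(4) by (intro exI[of _ "[]"]) simp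
  next
    case (Cons a x')
    obtain b y' where y: "y = b # y'" using len Cons by (cases y) auto
    obtain n t' where t: "t = n # t'" using less.prems(4) Cons by (cases t) auto
    show ?thesis
    proof (cases "a = b")
      case True
      obtain u where "length u = length y'" "bs (a # x', n # t') (a # y', n # u)"
        using same[of a x' y' t' n] less.prems Cons y t True by auto
      then show ?thesis using Cons y t True by (intro exI[of _ "n # u"]) simp
    next
      case False
      have da: "desc (act x) a" using less.prems(1) Cons reduced_Cons_iff by blast
      have db: "desc (act x) b" using less.prems(2,3) y reduced_Cons_iff by simp
      obtain r where r: "reduced (alt a b (cox a b) @ r)" "act (alt a b (cox a b) @ r) = act x"
        "reduced (alt b a (cox a b) @ r)" "act (alt b a (cox a b) @ r) = act x"
        by (rule desc_dihedral[OF wact_in_weyl False da db])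
      obtain m where m: "cox a b = Suc m" by (rule cox_Suc)
      have lr: "length (alt a b (cox a b) @ r) = length x" using r(1,2) less.prems(1) by (metis reduced_def)
      have "\<exists>u. length u = length (alt b a m @ r) \<and> bs (a # x', n # t') (a # alt b a m @ r, n # u)"
        by (rule same) (use less.prems(1,4) r(1,2) Cons t in \<open>simp_all add: m alt_Suc\<close>)
      then obtain u where u: "length u = length (alt b a m @ r)" "bs (x, t) (alt a b (cox a b) @ r, n # u)"
        by (auto simp: m alt_Suc Cons t)
      have "length (n # u) = cox a b + length r" using u(1) by (simp add: m)
      then obtain e q where sq: "n # u = e @ q" "length e = cox a b" "length q = length r" by (rule list_split)
      have b1: "bstep (alt a b (cox a b) @ r, e @ q) (alt b a (cox a b) @ r, tr a b e @ q)"
        using bstep.bstep[OF False sq(2), of "[]" "[]" q r] sq(3) by simp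
      obtain n' u' where u': "tr a b e @ q = n' # u'"
        using length_tr[OF sq(2)] m by (cases "tr a b e") auto
      have "length (n' # u') = length x" using u'[symmetric] length_tr[OF sq(2)] sq lr by simp
      then have "\<exists>v. length v = length y' \<and> bs (b # alt a b m @ r, n' # u') (b # y', n' # v)"
        by (intro same) (use less.prems(2,3) r(3,4) y lr in \<open>simp_all add: m alt_Suc\<close>)
      then obtain v where "length v = length y'" "bs (alt b a (cox a b) @ r, n' # u') (y, n' # v)"
        by (auto simp: m alt_Suc y)
      moreover have "bs (x, t) (alt b a (cox a b) @ r, n' # u')"
        using u(2) b1 unfolding sq(1) u' by (rule rtranclp.rtrancl_into_rtrancl)
      ultimately show ?thesis using y by (intro exI[of _ "n' # v"]) auto
    qed
  qed
qed

definition trivial_monodromy :: "('i wt \<Rightarrow> 'i wt) \<Rightarrow> bool" where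
  "trivial_monodromy v \<longleftrightarrow> (\<forall>x t t'. reduced x \<and> act x = v \<and> length t = length x \<and> bs (x, t) (x, t') \<longrightarrow> t' = t)"

text \<open>A state is a reduced word with a Lusztig datum along it.  Two states are related by
  \<open>same_head\<close> if braid moves that leave the first letter alone connect them, and a \<open>hop\<close> is one
  braid move that changes the first letter.\<close>

definition valid :: "('i wt \<Rightarrow> 'i wt) \<Rightarrow> 'i \<Rightarrow> 'i list \<times> int list \<Rightarrow> bool" where
  "valid v a \<sigma> \<longleftrightarrow> reduced (fst \<sigma>) \<and> act (fst \<sigma>) = v \<and> length (snd \<sigma>) = length (fst \<sigma>)
    \<and> fst \<sigma> \<noteq> [] \<and> hd (fst \<sigma>) = a"

definition same_head :: "'i list \<times> int list \<Rightarrow> 'i list \<times> int list \<Rightarrow> bool" where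
  "same_head \<sigma> \<tau> \<longleftrightarrow> (\<exists>a n x t y u. \<sigma> = (a # x, n # t) \<and> \<tau> = (a # y, n # u) \<and> bs (x, t) (y, u))"

lemma same_head_sym: "same_head \<sigma> \<tau> \<Longrightarrow> same_head \<tau> \<sigma>"
  unfolding same_head_def using bs_sym by blast

lemma same_head_trans: "same_head \<sigma> \<tau> \<Longrightarrow> same_head \<tau> \<rho> \<Longrightarrow> same_head \<sigma> \<rho>"
  unfolding same_head_def by (fastforce intro: rtranclp_trans)

lemma same_head_refl: "valid v a \<sigma> \<Longrightarrow> same_head \<sigma> \<sigma>"
  unfolding same_head_def valid_def by (cases \<sigma>; cases "fst \<sigma>"; cases "snd \<sigma>") auto

lemma same_head_bs: "same_head \<sigma> \<tau> \<Longrightarrow> bs \<sigma> \<tau>"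
  unfolding same_head_def using bs_Cons by blast

lemma valid_same_head: "valid v a \<sigma> \<Longrightarrow> same_head \<sigma> \<tau> \<Longrightarrow> valid v a \<tau>"
  using bs_inv[OF same_head_bs, of \<sigma> \<tau>] by (auto simp: valid_def same_head_def)

lemma valid_desc: "valid v a \<sigma> \<Longrightarrow> desc v a"
  unfolding valid_def by (cases "fst \<sigma>") (auto simp: reduced_Cons_iff)

lemma same_head_step:
  assumes "bstep (p @ x, tp @ t) (p @ y, tp @ u)" "bstep (x, t) (y, u)" "p \<noteq> []" "length tp = length p"
  shows "same_head (p @ x, tp @ t) (p @ y, tp @ u)"
proof -
  obtain a p' where p: "p = a # p'" using assms(3) by (cases p) auto
  obtain n tp' where tp: "tp = n # tp'" using assms(4) p by (cases tp) auto
  have "bstep (p' @ x, tp' @ t) (p' @ y, tp' @ u)"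
    using bstep_context[OF assms(2), of tp' p' "[]" "[]"] assms(4) by (simp add: p tp)
  then show ?thesis unfolding same_head_def p tp by auto
qed

definition hop :: "'i \<Rightarrow> 'i \<Rightarrow> 'i list \<times> int list \<Rightarrow> 'i list \<times> int list \<Rightarrow> bool" where
  "hop a b \<sigma> \<tau> \<longleftrightarrow> (\<exists>r e q. length e = cox a b \<and> length q = length r \<and> same_head \<sigma> (alt a b (cox a b) @ r, e @ q)
    \<and> same_head (alt b a (cox a b) @ r, tr a b e @ q) \<tau>)"

lemma hop_same_head: "same_head \<sigma>' \<sigma> \<Longrightarrow> hop a b \<sigma> \<tau> \<Longrightarrow> same_head \<tau> \<tau>' \<Longrightarrow> hop a b \<sigma>' \<tau>'"
  unfolding hop_def by (meson same_head_trans)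

lemma hop_sym:
  assumes "a \<noteq> b" "hop a b \<sigma> \<tau>" shows "hop b a \<tau> \<sigma>"
proof -
  obtain r e q where *: "length e = cox a b" "length q = length r" "same_head \<sigma> (alt a b (cox a b) @ r, e @ q)"
    "same_head (alt b a (cox a b) @ r, tr a b e @ q) \<tau>" using assms(2) unfolding hop_def by blast
  show ?thesis unfolding hop_def
    using * length_tr[OF *(1)] tr_inverse[OF assms(1) *(1)] same_head_sym
    by (intro exI[of _ r] exI[of _ "tr a b e"] exI[of _ q]) (simp add: cox_sym[of b a])
qed

lemma hop_valid:
  assumes "a \<noteq> b" "valid v a \<sigma>" "hop a b \<sigma> \<tau>" shows "valid v b \<tau>"
proof -
  obtain r e q where *: "length e = cox a b" "length q = length r" "same_head \<sigma> (alt a b (cox a b) @ r, e @ q)"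
    "same_head (alt b a (cox a b) @ r, tr a b e @ q) \<tau>" using assms(3) unfolding hop_def by blast
  obtain m where m: "cox a b = Suc m" by (rule cox_Suc)
  have "valid v a (alt a b (cox a b) @ r, e @ q)" by (rule valid_same_head[OF assms(2) *(3)])
  then have "valid v b (alt b a (cox a b) @ r, tr a b e @ q)"
    using reduced_swap[OF assms(1), of "[]" r] length_tr[OF *(1)] *(1,2)
    by (simp add: valid_def m alt_Suc)
  then show ?thesis by (rule valid_same_head[OF _ *(4)])
qed

lemma hop_bstep:
  assumes "a \<noteq> b" "length e = cox a b" "length q = length r" "valid v a (alt a b (cox a b) @ r, e @ q)"
  shows "hop a b (alt a b (cox a b) @ r, e @ q) (alt b a (cox a b) @ r, tr a b e @ q)"
proof -
  obtain m where m: "cox a b = Suc m" by (rule cox_Suc)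
  have "valid v b (alt b a (cox a b) @ r, tr a b e @ q)"
    using reduced_swap[OF assms(1), of "[]" r] length_tr[OF assms(2)] assms(2-4)
    by (simp add: valid_def m alt_Suc)
  then show ?thesis unfolding hop_def using assms(2,3) same_head_refl[OF assms(4)] same_head_refl by blast
qed

lemma same_head:
  assumes "valid v a \<sigma>" "reduced y" "act y = v" "y \<noteq> []" "hd y = a"
  shows "\<exists>u. length u = length y \<and> same_head \<sigma> (y, u)"
proof -
  obtain x n t where \<sigma>: "\<sigma> = (a # x, n # t)" "length t = length x"
    using assms(1) unfolding valid_def by (cases \<sigma>; cases "fst \<sigma>"; cases "snd \<sigma>") auto
  obtain y' where y: "y = a # y'" using assms(4,5) by (cases y) auto
  have "reduced (a # x)" "act (a # x) = v" using assms(1) by (simp_all add: valid_def \<sigma>)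
  then have "reduced x" "reduced y'" "act x = act y'"
    using assms(2,3) act_tail[of a x] act_tail[of a y'] reduced_ConsD by (simp_all add: y)
  then obtain u where "length u = length y'" "bs (x, t) (y', u)"
    using matsumoto[of x y' t] \<sigma>(2) by blast
  then show ?thesis by (intro exI[of _ "n # u"]) (auto simp: same_head_def \<sigma> y)
qed

lemma hop_total:
  assumes "a \<noteq> b" "valid v a \<sigma>" "desc v b" "v \<in> W"
  shows "\<exists>\<tau>. hop a b \<sigma> \<tau>"
proof -
  obtain r where r: "reduced (alt a b (cox a b) @ r)" "act (alt a b (cox a b) @ r) = v"
    by (rule desc_dihedral[OF assms(4,1) valid_desc[OF assms(2)] assms(3)])
  obtain m where m: "cox a b = Suc m" by (rule cox_Suc)
  obtain u where u: "length u = length (alt a b (cox a b) @ r)" "same_head \<sigma> (alt a b (cox a b) @ r, u)"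
    using same_head[OF assms(2) r] by (auto simp: m alt_Suc)
  obtain e q where sq: "u = e @ q" "length e = cox a b" "length q = length r"
    using list_split[of u "cox a b" "length r"] u(1) by auto
  have "hop a b (alt a b (cox a b) @ r, e @ q) (alt b a (cox a b) @ r, tr a b e @ q)"
    by (rule hop_bstep[OF assms(1) sq(2,3)]) (use valid_same_head[OF assms(2) u(2)] sq(1) in simp)
  moreover have "same_head \<sigma> (alt a b (cox a b) @ r, e @ q)" using u(2) sq(1) by simp
  ultimately show ?thesis unfolding hop_def using sq(2,3) by (meson same_head_trans)
qed

text \<open>A chain of moves behind the first letter is a chain on tails, which spell the shorter
  element \<open>s a \<circ> v\<close>.\<close>

lemma same_head_unique:
  assumes "trivial_monodromy (s a \<circ> v)" "valid v a (x, t)" "same_head (x, t) (x, t')" shows "t' = t"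
proof -
  obtain a' n y u u' where *: "x = a' # y" "t = n # u" "t' = n # u'" "bs (y, u) (y, u')"
    using assms(3) unfolding same_head_def by auto
  have "reduced (a # y)" "act (a # y) = v" "a' = a" "length u = length y"
    using assms(2) by (auto simp: valid_def *)
  then have "reduced y" "act y = s a \<circ> v" "length u = length y"
    using reduced_ConsD[of a y] act_tail[of a y] by simp_all
  then have "u' = u" using assms(1)[unfolded trivial_monodromy_def, rule_format, of y u u'] *(4) by simp
  then show ?thesis by (simp add: *)
qed

text \<open>The rests \<open>r\<close>, \<open>r'\<close> behind the alternating words spell the
  same element, so moves connect them. Trivial monodromy at \<open>s a \<circ> v\<close> makes the
  transported tuples agree before the front move, hence after it.\<close>

lemma hop_functional:
  assumes "a \<noteq> b" "trivial_monodromy (s a \<circ> v)" "valid v a \<sigma>" "hop a b \<sigma> \<tau>" "hop a b \<sigma> \<tau>'"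
  shows "same_head \<tau> \<tau>'"
proof -
  obtain r t q where *: "length t = cox a b" "length q = length r" "same_head \<sigma> (alt a b (cox a b) @ r, t @ q)"
    "same_head (alt b a (cox a b) @ r, tr a b t @ q) \<tau>" using assms(4) unfolding hop_def by blast
  obtain r' t' q' where **: "length t' = cox a b" "length q' = length r'" "same_head \<sigma> (alt a b (cox a b) @ r', t' @ q')"
    "same_head (alt b a (cox a b) @ r', tr a b t' @ q') \<tau>'" using assms(5) unfolding hop_def by blast
  have v: "valid v a (alt a b (cox a b) @ r, t @ q)" "valid v a (alt a b (cox a b) @ r', t' @ q')"
    by (rule valid_same_head[OF assms(3) *(3)], rule valid_same_head[OF assms(3) **(3)])
  then have "reduced (alt a b (cox a b) @ r)" "reduced (alt a b (cox a b) @ r')"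
    by (simp_all add: valid_def)
  then have "reduced r" "reduced r'" 
    using reduced_appendD[of "alt a b (cox a b)" r] reduced_appendD[of "alt a b (cox a b)" r'] by simp_all
  moreover have "act r = act r'"
  proof
    fix x
    have "act (alt a b (cox a b)) (act r x) = act (alt a b (cox a b)) (act r' x)"
      using v by (auto simp: valid_def wact_append fun_eq_iff)
    then show "act r x = act r' x" by (metis act_rev_act)
  qed
  ultimately obtain q1 where q1: "length q1 = length r'" "bs (r, q) (r', q1)"
    using matsumoto[of r r' q] *(2) by blast
  obtain m where m: "cox a b = Suc m" by (rule cox_Suc)
  have ext: "same_head (alt c d (cox a b) @ r, u @ q) (alt c d (cox a b) @ r', u @ q1)"
    if "length u = cox a b" for c d u
  proof -
    obtain n u' where u: "u = n # u'" "length u' = m" using \<open>length u = cox a b\<close> m by (cases u) auto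
    have "bs (alt d c m @ r, u' @ q) (alt d c m @ r', u' @ q1)"
      using bs_context[OF q1(2), of u' "alt d c m" "[]" "[]"] u(2) by simp
    then show ?thesis unfolding same_head_def by (auto simp: u m alt_Suc)
  qed
  have "same_head (alt a b (cox a b) @ r', t' @ q') (alt a b (cox a b) @ r', t @ q1)"
    using same_head_trans[OF same_head_trans[OF same_head_sym[OF **(3)] *(3)] ext[OF *(1)]] .
  then have "t @ q1 = t' @ q'" by (rule same_head_unique[OF assms(2) v(2)])
  then have "t = t'" "q1 = q'" using *(1) **(1) by simp_all
  then have "same_head (alt b a (cox a b) @ r, tr a b t @ q) (alt b a (cox a b) @ r', tr a b t' @ q')"
    using ext[of "tr a b t"] length_tr[OF *(1)] by simp
  then show ?thesis by (rule same_head_trans[OF same_head_trans[OF same_head_sym[OF *(4)]] **(4)])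
qed

text \<open>The rank three loop condition: the triangle of hops between first letters
  \<open>a\<close>, \<open>b\<close>, \<open>c\<close> commutes.\<close>

definition composes :: "('i wt \<Rightarrow> 'i wt) \<Rightarrow> 'i \<Rightarrow> 'i \<Rightarrow> 'i \<Rightarrow> bool" where
  "composes v a b c \<longleftrightarrow> (\<forall>\<sigma> \<tau> \<rho>. valid v a \<sigma> \<longrightarrow> hop a b \<sigma> \<tau> \<longrightarrow> hop b c \<tau> \<rho> \<longrightarrow> hop a c \<sigma> \<rho>)"

lemma composesD: "composes v a b c \<Longrightarrow> valid v a \<sigma> \<Longrightarrow> hop a b \<sigma> \<tau> \<Longrightarrow> hop b c \<tau> \<rho> \<Longrightarrow> hop a c \<sigma> \<rho>"
  unfolding composes_def by (elim allE impE)

text \<open>Together with \<open>composes_reverse\<close> this yields all orders of a triple from a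
  single one.\<close>

lemma composes_rotate:
  assumes "v \<in> W" "a \<noteq> b" "b \<noteq> c" "a \<noteq> c" "trivial_monodromy (s c \<circ> v)" "composes v a b c" "desc v a"
  shows "composes v b c a"
  unfolding composes_def
proof (intro allI impI)
  fix \<sigma> \<tau> \<rho> assume *: "valid v b \<sigma>" "hop b c \<sigma> \<tau>" "hop c a \<tau> \<rho>"
  obtain \<rho>0 where r0: "hop b a \<sigma> \<rho>0" using hop_total[OF not_sym[OF assms(2)] *(1) assms(7,1)] by blast
  have "valid v a \<rho>0" by (rule hop_valid[OF not_sym[OF assms(2)] *(1) r0])
  then have "hop a c \<rho>0 \<tau>" by (rule composesD[OF assms(6) _ hop_sym[OF not_sym[OF assms(2)] r0] *(2)])
  then have "hop c a \<tau> \<rho>0" by (rule hop_sym[OF assms(4)])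
  then have "same_head \<rho>0 \<rho>"
    by (rule hop_functional[OF not_sym[OF assms(4)] assms(5) hop_valid[OF assms(3) *(1,2)] _ *(3)])
  then show "hop b a \<sigma> \<rho>" by (rule hop_same_head[OF same_head_refl[OF *(1)] r0])
qed

lemma composes_reverse:
  assumes "a \<noteq> b" "b \<noteq> c" "a \<noteq> c" "composes v a b c" shows "composes v c b a"
  unfolding composes_def
proof (intro allI impI)
  fix \<sigma> \<tau> \<rho> assume *: "valid v c \<sigma>" "hop c b \<sigma> \<tau>" "hop b a \<tau> \<rho>"
  have "valid v a \<rho>" by (rule hop_valid[OF not_sym[OF assms(1)] hop_valid[OF not_sym[OF assms(2)] *(1,2)] *(3)])
  then have "hop a c \<rho> \<sigma>"
    by (rule composesD[OF assms(4) _ hop_sym[OF not_sym[OF assms(1)] *(3)] hop_sym[OF not_sym[OF assms(2)] *(2)]])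
  then show "hop c a \<sigma> \<rho>" by (rule hop_sym[OF assms(3)])
qed

text \<open>No monodromy at \<open>v\<close>, given the same for shorter elements and triviality of the rank three
  loops: the states reachable from \<open>\<sigma>0\<close> with first letter \<open>b\<close> form one class under moves which fix
  the first letter.\<close>

lemma trivial_monodromy_step:
  assumes v: "v \<in> W" and IH: "\<And>a. desc v a \<Longrightarrow> trivial_monodromy (s a \<circ> v)"
    and composes: "\<And>a b c. a \<noteq> b \<Longrightarrow> b \<noteq> c \<Longrightarrow> a \<noteq> c \<Longrightarrow> desc v a \<Longrightarrow> desc v b \<Longrightarrow> desc v c \<Longrightarrow> composes v a b c"
  shows "trivial_monodromy v"
  unfolding trivial_monodromy_def
proof (intro allI impI, elim conjE)
  fix x0 t0 t' assume x0: "reduced x0" "act x0 = v" "length t0 = length x0" and loop: "bs (x0, t0) (x0, t')"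
  show "t' = t0"
  proof (cases x0)
    case Nil
    then show ?thesis using bs_inv[OF loop] x0(3) by simp
  next
    case (Cons a x1)
    define \<sigma>0 where "\<sigma>0 = (x0, t0)"
    have v0: "valid v a \<sigma>0" using x0 Cons by (simp add: valid_def \<sigma>0_def)
    \<comment> \<open>The invariant along the chain: a state is reached from
      \<open>\<sigma>0\<close> by a single direct hop, up to moves behind the first letter. A front
      move from \<open>i\<close> to \<open>j\<close> keeps it by the triangle \<open>a\<close>,
      \<open>i\<close>, \<open>j\<close>.\<close>
    define cls where "cls = (\<lambda>\<tau>. \<exists>b. valid v b \<tau> \<and> (if b = a then same_head \<sigma>0 \<tau> else hop a b \<sigma>0 \<tau>))"
    have step: "cls \<tau>'" if "cls \<tau>" "bstep \<tau> \<tau>'" for \<tau> \<tau>'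
      using that(2)
    proof (cases rule: bstep.cases)
      case (bstep i j t tp p tq q)
      from that(1)[unfolded cls_def] obtain b where
        b: "valid v b \<tau>" "if b = a then same_head \<sigma>0 \<tau> else hop a b \<sigma>0 \<tau>" by (elim exE conjE)
      show ?thesis
      proof (cases "p = []")
        case False
        have c: "bstep (alt i j (cox i j) @ q, t @ tq) (alt j i (cox i j) @ q, tr i j t @ tq)"
          using bstep.bstep[OF bstep(3,4), of "[]" "[]" tq q] bstep(6) by simp
        have "same_head \<tau> \<tau>'" unfolding bstep(1,2)
          by (rule same_head_step[OF that(2)[unfolded bstep(1,2)] c False bstep(5)])
        then have "valid v b \<tau>'" "if b = a then same_head \<sigma>0 \<tau>' else hop a b \<sigma>0 \<tau>'"
          using valid_same_head[OF b(1)] b(2) same_head_trans[of \<sigma>0 \<tau> \<tau>'] hop_same_head[OF same_head_refl[OF v0], of a b \<tau> \<tau>']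
          by (simp_all split: if_splits)
        then show ?thesis unfolding cls_def by blast
      next
        case True
        obtain m where m: "cox i j = Suc m" by (rule cox_Suc)
        have tp: "tp = []" using True bstep(5) by simp
        have "b = i" using b(1) unfolding bstep(1) by (simp add: valid_def True m alt_Suc)
        note b = b[unfolded this]
        have Tij: "hop i j \<tau> \<tau>'" unfolding bstep(1,2) True tp append_Nil
          by (rule hop_bstep[OF bstep(3,4,6)]) (use b(1) bstep(1) True tp in simp)
        have vj: "valid v j \<tau>'" by (rule hop_valid[OF bstep(3) b(1) Tij])
        note di = valid_desc[OF b(1)] and dj = valid_desc[OF vj] and da = valid_desc[OF v0]
        have "if j = a then same_head \<sigma>0 \<tau>' else hop a j \<sigma>0 \<tau>'"
        proof (cases "i = a")
          case True
          then have "same_head \<sigma>0 \<tau>" "j \<noteq> a" using b(2) bstep(3) by auto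
          then show ?thesis using hop_same_head[OF _ Tij same_head_refl[OF vj]] True by simp
        next
          case ia: False
          then have T1: "hop a i \<sigma>0 \<tau>" using b(2) by simp
          show ?thesis
          proof (cases "j = a")
            case True
            have "hop i a \<tau> \<sigma>0" by (rule hop_sym[OF not_sym[OF ia] T1])
            then have "same_head \<sigma>0 \<tau>'" using hop_functional[OF ia IH[OF di] b(1)] Tij True by blast
            then show ?thesis using True by simp
          next
            case False
            have "composes v a i j" by (rule composes[OF not_sym[OF ia] bstep(3) not_sym[OF False] da di dj])
            then show ?thesis using composesD[OF _ v0 T1 Tij] False by simp
          qed
        qed
        then show ?thesis using vj unfolding cls_def by blast
      qed
    qed
    have "cls \<sigma>0" unfolding cls_def using v0 same_head_refl[OF v0] by auto
    have "cls \<tau>" if "bs \<sigma>0 \<tau>" for \<tau>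
      using that by (induction rule: rtranclp_induct) (auto intro: step \<open>cls \<sigma>0\<close>)
    then have "cls (x0, t')" using loop by (simp add: \<sigma>0_def)
    then obtain b where "valid v b (x0, t')" "if b = a then same_head \<sigma>0 (x0, t') else hop a b \<sigma>0 (x0, t')"
      unfolding cls_def by blast
    moreover from this(1) have "b = a" by (simp add: valid_def Cons)
    ultimately have "same_head (x0, t0) (x0, t')" by (simp add: \<sigma>0_def)
    then show ?thesis by (rule same_head_unique[OF IH[OF valid_desc[OF v0]] v0[unfolded \<sigma>0_def]])
  qed
qed

end


section \<open>Tropical and geometric transition maps of types A1 x A1, A2 and B2\<close>

definition seg :: "nat \<Rightarrow> nat \<Rightarrow> ('a list \<Rightarrow> 'a list) \<Rightarrow> 'a list \<Rightarrow> 'a list" where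
  "seg p m f d = take p d @ f (take m (drop p d)) @ drop (p + m) d"

fun kl :: "nat \<Rightarrow> nat" where
  "kl k = (if k = 0 then 2 else if k = 1 then 3 else 4)"

definition tfun :: "nat \<Rightarrow> int list \<Rightarrow> int list" where
  "tfun k t = (if k = 0 then rev t else if k = 1 then a2_trans t
    else if k = 2 then b2_trans t else rev (b2_trans (rev t)))"

text \<open>The change of parameters in a product of three one-parameter subgroups of type A2.
  Replacing sum, product and quotient by minimum, sum and difference gives
  \<open>a2_trans\<close>.\<close>

definition a2_geo :: "real list \<Rightarrow> real list" where
  "a2_geo t = [t!1 * t!2 / (t!0 + t!2), t!0 + t!2, t!0 * t!1 / (t!0 + t!2)]"

text \<open>The subtraction-free rational map of type B2 whose tropicalisation is
  \<open>b2_trans\<close>; \<open>p\<close> and \<open>q\<close> become the two minima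
  there.\<close>

definition b2_geo :: "real list \<Rightarrow> real list" where
  "b2_geo t = (let p = t!0 * t!1 + (t!0 + t!2) * t!3; q = (t!0)\<^sup>2 * t!1 + (t!0 + t!2)\<^sup>2 * t!3
    in [t!1 * (t!2)\<^sup>2 * t!3 / q, q / p, p\<^sup>2 / q, t!0 * t!1 * t!2 / p])"

definition gfun :: "nat \<Rightarrow> real list \<Rightarrow> real list" where
  "gfun k t = (if k = 0 then rev t else if k = 1 then a2_geo t
    else if k = 2 then b2_geo t else rev (b2_geo (rev t)))"

lemma length_tfun: "length d = kl k \<Longrightarrow> length (tfun k d) = kl k"
  by (auto simp: tfun_def a2_trans_def b2_trans_def Let_def)

lemma length_gfun: "length d = kl k \<Longrightarrow> length (gfun k d) = kl k"
  by (auto simp: gfun_def a2_geo_def b2_geo_def Let_def)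

lemma length_seg:
  "(\<And>d. length d = m \<Longrightarrow> length (f d) = m) \<Longrightarrow> p + m \<le> length d \<Longrightarrow> length (seg p m f d) = length d"
  by (simp add: seg_def)

lemma gfun_pos:
  assumes "length d = kl k" "\<forall>x\<in>set d. 0 < x" shows "\<forall>x\<in>set (gfun k d). 0 < x"
proof -
  have b2: "\<forall>x\<in>set (b2_geo u). 0 < x" if u: "length u = 4" "\<forall>x\<in>set u. 0 < x" for u
  proof -
    obtain a b c d where abcd: "u = [a, b, c, d]" using u(1) by (auto simp: list_4)
    then have pos: "0 < a" "0 < b" "0 < c" "0 < d" using u(2) by auto
    then have "0 < a * b + (a + c) * d" "0 < a\<^sup>2 * b + (a + c)\<^sup>2 * d"
      by (intro add_pos_pos mult_pos_pos zero_less_power; simp)+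
    then show ?thesis using pos by (simp add: abcd b2_geo_def Let_def)
  qed
  have a2: "\<forall>x\<in>set (a2_geo u). 0 < x" if u: "length u = 3" "\<forall>x\<in>set u. 0 < x" for u
    using that by (auto simp: list_3 a2_geo_def)
  show ?thesis using assms a2[of d] b2[of d] b2[of "rev d"] by (auto simp: gfun_def split: if_splits)
qed

subsection \<open>Tropicalisation\<close>

text \<open>\<open>th f n\<close>: the function \<open>f\<close> has the order of magnitude \<open>q powi (- n)\<close>.  Subtraction-free
  expressions in such functions have the order given by the tropical expression.\<close>

definition th :: "(real \<Rightarrow> real) \<Rightarrow> int \<Rightarrow> bool" where
  "th f n \<longleftrightarrow> (\<exists>c>0. \<exists>K>0. \<forall>q\<ge>1. c \<le> f q * q powi n \<and> f q * q powi n \<le> K)"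

lemma th_powi: "th (\<lambda>q. q powi (- n)) n"
  unfolding th_def
  by (rule exI[of _ 1], rule conjI, simp, rule exI[of _ 1]) (auto simp: power_int_minus)

lemma th_mult:
  assumes "th f m" "th g n" shows "th (\<lambda>q. f q * g q) (m + n)"
proof -
  obtain c K c' K' where *: "c > 0" "K > 0" "\<And>q. q \<ge> 1 \<Longrightarrow> c \<le> f q * q powi m \<and> f q * q powi m \<le> K"
    "c' > 0" "K' > 0" "\<And>q. q \<ge> 1 \<Longrightarrow> c' \<le> g q * q powi n \<and> g q * q powi n \<le> K'"
    using assms unfolding th_def by metis
  have "c * c' \<le> f q * g q * q powi (m + n) \<and> f q * g q * q powi (m + n) \<le> K * K'" if "q \<ge> 1" for q
  proof -
    have "f q * g q * q powi (m + n) = (f q * q powi m) * (g q * q powi n)"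
      using that by (simp add: power_int_add)
    moreover have "c * c' \<le> (f q * q powi m) * (g q * q powi n)" "(f q * q powi m) * (g q * q powi n) \<le> K * K'"
      using *(3,6)[OF that] *(1,2,4,5) by (intro mult_mono; linarith)+
    ultimately show ?thesis by (simp only:)
  qed
  then show ?thesis unfolding th_def using *(1,2,4,5) by (intro exI[of _ "c * c'"] exI[of _ "K * K'"] conjI) auto
qed

lemma th_inverse:
  assumes "th f m" shows "th (\<lambda>q. inverse (f q)) (- m)"
proof -
  obtain c K where *: "c > 0" "K > 0" "\<And>q. q \<ge> 1 \<Longrightarrow> c \<le> f q * q powi m \<and> f q * q powi m \<le> K"
    using assms unfolding th_def by metis
  have "inverse K \<le> inverse (f q) * q powi (- m) \<and> inverse (f q) * q powi (- m) \<le> inverse c" if "q \<ge> 1" for q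
  proof -
    have "inverse (f q) * q powi (- m) = inverse (f q * q powi m)" by (simp add: power_int_minus)
    moreover have "inverse K \<le> inverse (f q * q powi m)" "inverse (f q * q powi m) \<le> inverse c"
      using *(3)[OF that] *(1,2) by (intro le_imp_inverse_le; linarith)+
    ultimately show ?thesis by (simp only:)
  qed
  then show ?thesis unfolding th_def using *(1,2) by (intro exI[of _ "inverse K"] exI[of _ "inverse c"] conjI) auto
qed

lemma th_divide: "th f m \<Longrightarrow> th g n \<Longrightarrow> th (\<lambda>q. f q / g q) (m - n)"
  using th_mult[OF _ th_inverse, of f m g n] by (simp add: divide_inverse)

lemma th_add_le:
  assumes "th f m" "th g n" "m \<le> n" shows "th (\<lambda>q. f q + g q) m"
proof -
  obtain c K c' K' where *: "c > 0" "K > 0" "\<And>q. q \<ge> 1 \<Longrightarrow> c \<le> f q * q powi m \<and> f q * q powi m \<le> K"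
    "c' > 0" "K' > 0" "\<And>q. q \<ge> 1 \<Longrightarrow> c' \<le> g q * q powi n \<and> g q * q powi n \<le> K'"
    using assms unfolding th_def by metis
  have "c \<le> (f q + g q) * q powi m \<and> (f q + g q) * q powi m \<le> K + K'" if "q \<ge> 1" for q
  proof -
    have "0 < g q * q powi n" using *(4) *(6)[OF that] by linarith
    then have "0 < g q" by (rule zero_less_mult_pos2) (use that in simp)
    moreover have "q powi m \<le> q powi n" "0 < q powi m" using that assms(3) by (auto intro: power_int_increasing)
    ultimately have "0 \<le> g q * q powi m" "g q * q powi m \<le> g q * q powi n" by auto
    then show ?thesis using *(3,6)[OF that] by (auto simp: distrib_right)
  qed
  then show ?thesis unfolding th_def using *(1,2,4,5) by (intro exI[of _ c] exI[of _ "K + K'"] conjI) auto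
qed

lemma th_add:
  assumes "th f m" "th g n" shows "th (\<lambda>q. f q + g q) (min m n)"
  using th_add_le[OF assms] th_add_le[OF assms(2,1)] by (cases "m \<le> n") (simp_all add: add.commute min_def)

lemma th_unique:
  assumes "th f m" "th f n" shows "m = n"
proof -
  have False if ab: "th f a" "th f b" "a < b" for a b
  proof -
    obtain c K where *: "c > 0" "K > 0" "\<And>q. q \<ge> 1 \<Longrightarrow> c \<le> f q * q powi a" "\<And>q. q \<ge> 1 \<Longrightarrow> f q * q powi b \<le> K"
      using ab(1,2) unfolding th_def by metis
    \<comment> \<open>Two different orders would force \<open>c * q \<le> K\<close> for all
      \<open>q \<ge> 1\<close>; this \<open>q\<close> is too large for that.\<close>
    define q where "q = max 1 (2 * K / c)"
    have q: "q \<ge> 1" "q \<ge> 2 * K / c" by (auto simp: q_def)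
    have "c * q \<le> c * q powi (b - a)"
      using power_int_increasing[of 1 "b - a" q] ab(3) q(1) *(1) by simp
    also have "\<dots> \<le> (f q * q powi a) * q powi (b - a)"
      using *(3)[OF q(1)] q(1) by (intro mult_right_mono) auto
    also have "\<dots> = f q * q powi b" using q(1) by (simp add: power_int_diff)
    also have "\<dots> \<le> K" by (rule *(4)[OF q(1)])
    finally have "c * q \<le> K" .
    moreover have "2 * K \<le> c * q" using q(2) *(1) by (simp add: field_simps)
    ultimately show False using *(2) by linarith
  qed
  then show ?thesis using assms by (metis linorder_neqE)
qed

lemma th_cong: "(\<And>q. q \<ge> 1 \<Longrightarrow> f q = g q) \<Longrightarrow> th f n \<longleftrightarrow> th g n"
  unfolding th_def by simp

definition TH :: "(real \<Rightarrow> real list) \<Rightarrow> int list \<Rightarrow> bool" where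
  "TH F ns \<longleftrightarrow> (\<forall>q. length (F q) = length ns) \<and> (\<forall>k<length ns. th (\<lambda>q. F q ! k) (ns ! k))"

lemma TH_append: "TH F ns \<Longrightarrow> TH G ms \<Longrightarrow> TH (\<lambda>q. F q @ G q) (ns @ ms)"
  by (auto simp: TH_def nth_append)

lemma TH_take: "TH F ns \<Longrightarrow> TH (\<lambda>q. take m (F q)) (take m ns)"
  by (auto simp: TH_def)

lemma TH_drop: "TH F ns \<Longrightarrow> TH (\<lambda>q. drop m (F q)) (drop m ns)"
  by (auto simp: TH_def)

lemma TH_rev: "TH F ns \<Longrightarrow> TH (\<lambda>q. rev (F q)) (rev ns)"
  by (auto simp: TH_def rev_nth)

lemma TH_Cons: "TH (\<lambda>q. f q # F q) (n # ns) \<longleftrightarrow> th f n \<and> TH F ns"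
  by (auto simp: TH_def nth_Cons split: nat.split)

lemma TH_Nil: "TH (\<lambda>q. []) []"
  by (simp add: TH_def)

lemma TH_nth: "TH F ns \<Longrightarrow> k < length ns \<Longrightarrow> th (\<lambda>q. F q ! k) (ns ! k)"
  by (simp add: TH_def)

lemma TH_tfun:
  assumes F: "TH F ns" and len: "length ns = kl k" shows "TH (\<lambda>q. gfun k (F q)) (tfun k ns)"
proof -
  have b2: "TH (\<lambda>q. b2_geo (G q)) (b2_trans ms)" if G: "TH G ms" and l: "length ms = 4" for G ms
  proof -
    define a b c d where abcd: "a = ms!0" "b = ms!1" "c = ms!2" "d = ms!3"
    have t: "th (\<lambda>q. G q ! 0) a" "th (\<lambda>q. G q ! 1) b" "th (\<lambda>q. G q ! 2) c" "th (\<lambda>q. G q ! 3) d"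
      using TH_nth[OF G] l by (simp_all add: abcd)
    define p q where p: "p = min (a + b) (min (a + d) (c + d))"
      and q: "q = min (2*a + b) (min (2*a + d) (2*c + d))"
    have ms: "ms = [a, b, c, d]" using l by (auto simp: list_4 abcd)
    have P: "th (\<lambda>x. G x ! 0 * G x ! 1 + (G x ! 0 + G x ! 2) * G x ! 3) p"
    proof -
      \<comment> \<open>The minimum is regrouped to follow the factored shape of the polynomial, as
        orders are computed along the expression.\<close>
      have "p = min (a + b) (min a c + d)" unfolding p by linarith
      then show ?thesis by (simp only:) (intro th_add th_mult t)
    qed
    have Q: "th (\<lambda>x. (G x ! 0)\<^sup>2 * G x ! 1 + (G x ! 0 + G x ! 2)\<^sup>2 * G x ! 3) q"
    proof -
      have "q = min ((a + a) + b) ((min a c + min a c) + d)" unfolding q by linarith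
      then show ?thesis by (simp only: power2_eq_square) (intro th_add th_mult t)
    qed
    have 1: "th (\<lambda>x. G x ! 1 * (G x ! 2)\<^sup>2 * G x ! 3 / ((G x ! 0)\<^sup>2 * G x ! 1 + (G x ! 0 + G x ! 2)\<^sup>2 * G x ! 3)) (b + 2 * c + d - q)"
    proof -
      have "th (\<lambda>x. (G x ! 2)\<^sup>2) (2 * c)" using th_mult[OF t(3) t(3)] by (simp only: power2_eq_square mult_2)
      then show ?thesis by (intro th_divide th_mult t Q)
    qed
    have 3: "th (\<lambda>x. (G x ! 0 * G x ! 1 + (G x ! 0 + G x ! 2) * G x ! 3)\<^sup>2 / ((G x ! 0)\<^sup>2 * G x ! 1 + (G x ! 0 + G x ! 2)\<^sup>2 * G x ! 3)) (2 * p - q)"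
      using th_divide[OF th_mult[OF P P] Q] by (simp only: power2_eq_square mult_2)
    show ?thesis
      unfolding ms b2_trans_eq[OF p q] b2_geo_def Let_def TH_Cons
      by (intro conjI 1 3 th_divide[OF Q P] th_divide th_mult t P TH_Nil)
  qed
  have a2: "TH (\<lambda>q. a2_geo (G q)) (a2_trans ms)" if G: "TH G ms" and l: "length ms = 3" for G ms
  proof -
    have t: "th (\<lambda>q. G q ! 0) (ms!0)" "th (\<lambda>q. G q ! 1) (ms!1)" "th (\<lambda>q. G q ! 2) (ms!2)"
      using TH_nth[OF G] l by simp_all
    show ?thesis unfolding a2_geo_def a2_trans_def Let_def TH_Cons
      by (intro conjI th_divide th_mult th_add t TH_Nil)
  qed
  show ?thesis
    using len b2[OF F] a2[OF F] TH_rev[OF F] TH_rev[OF b2[OF TH_rev[OF F]]]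
    by (simp add: tfun_def gfun_def split: if_splits)
qed

lemma TH_seg:
  assumes "TH F ns" "p + kl k \<le> length ns"
  shows "TH (\<lambda>q. seg p (kl k) (gfun k) (F q)) (seg p (kl k) (tfun k) ns)"
  unfolding seg_def using assms(2)
  by (intro TH_append TH_take TH_drop TH_tfun assms(1)) simp

text \<open>A step \<open>(p, k, u, u')\<close> replaces the factor \<open>u\<close> at position \<open>p\<close> by \<open>u'\<close>; the kind \<open>k\<close> selects
  the transition map (0: A1 x A1, 1: A2, 2 and 3: the two orientations of B2).\<close>

type_synonym wstep = "nat \<times> nat \<times> nat list \<times> nat list"

fun wrun :: "wstep list \<Rightarrow> nat list \<Rightarrow> nat list" where
  "wrun [] w = w"
| "wrun ((p, k, u, u') # ss) w = wrun ss (take p w @ u' @ drop (p + length u) w)"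

fun wok :: "wstep list \<Rightarrow> nat list \<Rightarrow> bool" where
  "wok [] w = True"
| "wok ((p, k, u, u') # ss) w = (take (length u) (drop p w) = u \<and> p + length u \<le> length w
     \<and> length u = kl k \<and> length u' = kl k \<and> wok ss (take p w @ u' @ drop (p + length u) w))"

fun dat :: "(nat \<Rightarrow> 'a list \<Rightarrow> 'a list) \<Rightarrow> wstep list \<Rightarrow> 'a list \<Rightarrow> 'a list" where
  "dat f [] d = d"
| "dat f ((p, k, u, u') # ss) d = dat f ss (seg p (kl k) (f k) d)"

lemma TH_dat: "wok ss w \<Longrightarrow> length ns = length w \<Longrightarrow> TH F ns \<Longrightarrow> TH (\<lambda>q. dat gfun ss (F q)) (dat tfun ss ns)"
proof (induction ss arbitrary: w ns F)
  case (Cons st ss)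
  obtain p k u u' where st: "st = (p, k, u, u')" by (cases st)
  define w' where "w' = take p w @ u' @ drop (p + length u) w"
  have ok: "p + length u \<le> length w" "length u = kl k" "length u' = kl k" "wok ss w'"
    using Cons.prems(1) unfolding st wok.simps w'_def by blast+
  have le: "p + kl k \<le> length ns" using ok Cons.prems(2) by linarith
  have "length (seg p (kl k) (tfun k) ns) = length w'"
    using ok Cons.prems(2) length_seg[OF length_tfun le] by (simp add: w'_def del: kl.simps)
  then show ?case unfolding st dat.simps
    by (rule Cons.IH[OF ok(4) _ TH_seg[OF Cons.prems(3) le]])
qed simp

text \<open>Substituting powers of \<open>q\<close> with exponents \<open>- ns\<close> turns the
  geometric loop into a family of tuples. It is returned unchanged, so by \<open>th_unique\<close>
  the orders before and after the loop agree, and the latter are given by the tropical loop.\<close>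

lemma dat_loop:
  assumes "wok ss w" "length ns = length w"
    and "\<And>d. length d = length w \<Longrightarrow> \<forall>x\<in>set d. 0 < x \<Longrightarrow> dat gfun ss d = d"
  shows "dat tfun ss ns = ns"
proof -
  define F where "F = (\<lambda>q :: real. map (\<lambda>n. q powi (- n)) ns)"
  have F: "TH F ns" by (auto simp: TH_def F_def intro: th_powi)
  have "TH (\<lambda>q. dat gfun ss (F q)) (dat tfun ss ns)" by (rule TH_dat[OF assms(1,2) F])
  then have 1: "length (dat gfun ss (F 1)) = length (dat tfun ss ns)"
    "\<And>k. k < length (dat tfun ss ns) \<Longrightarrow> th (\<lambda>q. dat gfun ss (F q) ! k) (dat tfun ss ns ! k)"
    by (auto simp: TH_def)
  have eq: "dat gfun ss (F q) = F q" if "q \<ge> 1" for q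
    by (rule assms(3)) (use that assms(2) in \<open>auto simp: F_def\<close>)
  have len: "length (dat tfun ss ns) = length ns" using 1(1) eq[of 1] by (simp add: F_def)
  show ?thesis
  proof (rule nth_equalityI[OF len])
    fix k assume k: "k < length (dat tfun ss ns)"
    have "th (\<lambda>q. F q ! k) (dat tfun ss ns ! k)"
      using 1(2)[OF k] th_cong[of "\<lambda>q. dat gfun ss (F q) ! k" "\<lambda>q. F q ! k"] eq by simp
    moreover have "th (\<lambda>q. F q ! k) (ns ! k)" using F k len by (simp add: TH_def)
    ultimately show "dat tfun ss ns ! k = ns ! k" by (rule th_unique)
  qed
qed

subsection \<open>The loops in rank three\<close>

definition rp :: "(nat \<Rightarrow> real \<Rightarrow> 'v \<Rightarrow> 'v) \<Rightarrow> nat list \<Rightarrow> real list \<Rightarrow> 'v \<Rightarrow> 'v" where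
  "rp X w d v = fold (\<lambda>(i, t). X i t) (zip w d) v"

lemma rp_append: "length w = length d \<Longrightarrow> rp X (w @ w') (d @ d') v = rp X w' d' (rp X w d v)"
  by (simp add: rp_def)

lemma rp_Cons [simp]: "rp X (i # w) (t # d) v = rp X w d (X i t v)" and rp_Nil [simp]: "rp X [] [] v = v"
  by (simp_all add: rp_def)

definition brel :: "(nat \<Rightarrow> real \<Rightarrow> 'v \<Rightarrow> 'v) \<Rightarrow> wstep \<Rightarrow> bool" where
  "brel X = (\<lambda>(p, k, u, u'). \<forall>d v. length d = kl k \<longrightarrow> (\<forall>x\<in>set d. 0 < x) \<longrightarrow> rp X u' (gfun k d) v = rp X u d v)"

lemma rp_dat:
  assumes "wok ss w" "length d = length w" "\<forall>x\<in>set d. 0 < x" "\<forall>st\<in>set ss. brel X st"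
  shows "rp X (wrun ss w) (dat gfun ss d) v = rp X w d v \<and> (\<forall>x\<in>set (dat gfun ss d). 0 < x)
    \<and> length (dat gfun ss d) = length d"
  using assms
proof (induction ss arbitrary: w d)
  case (Cons st ss)
  obtain p k u u' where st: "st = (p, k, u, u')" by (cases st)
  define w' where "w' = take p w @ u' @ drop (p + length u) w"
  define e where "e = take (kl k) (drop p d)"
  have ok: "take (length u) (drop p w) = u" "p + length u \<le> length w" "length u = kl k" "length u' = kl k" "wok ss w'"
    using Cons.prems(1) unfolding st wok.simps w'_def by blast+
  have d: "d = take p d @ e @ drop (p + kl k) d"
    unfolding e_def by (metis append_take_drop_id drop_drop add.commute)
  have w: "w = take p w @ u @ drop (p + length u) w"
    using ok(1) by (metis append_take_drop_id drop_drop add.commute)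
  have le: "length e = kl k" using ok Cons.prems(2) by (simp add: e_def del: kl.simps)
  have pe: "\<forall>x\<in>set e. 0 < x" using Cons.prems(3) by (auto simp: e_def dest!: in_set_takeD in_set_dropD)
  have sd: "seg p (kl k) (gfun k) d = take p d @ gfun k e @ drop (p + kl k) d" by (simp add: seg_def e_def)
  have len: "length (seg p (kl k) (gfun k) d) = length w'"
    using ok Cons.prems(2) length_gfun[OF le] by (simp add: sd w'_def del: kl.simps)
  have pos: "\<forall>x\<in>set (seg p (kl k) (gfun k) d). 0 < x"
    using gfun_pos[OF le pe] Cons.prems(3) by (auto simp: sd simp del: kl.simps dest: in_set_takeD in_set_dropD)
  have lp: "length (take p w) = length (take p d)" using Cons.prems(2) by simp
  have "rp X w' (seg p (kl k) (gfun k) d) v = rp X (drop (p + length u) w) (drop (p + kl k) d) (rp X u' (gfun k e) (rp X (take p w) (take p d) v))"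
    unfolding w'_def sd by (simp add: rp_append[OF lp] rp_append length_gfun[OF le] ok(4) del: kl.simps)
  also have "rp X u' (gfun k e) (rp X (take p w) (take p d) v) = rp X u e (rp X (take p w) (take p d) v)"
    using Cons.prems(4) le pe by (simp add: st brel_def del: kl.simps)
  also have "rp X (drop (p + length u) w) (drop (p + kl k) d) (rp X u e (rp X (take p w) (take p d) v)) = rp X w d v"
    by (subst (3) w, subst (3) d) (simp add: rp_append[OF lp] rp_append le ok(3) del: kl.simps)
  finally have "rp X w' (seg p (kl k) (gfun k) d) v = rp X w d v" .
  moreover have "rp X (wrun ss w') (dat gfun ss (seg p (kl k) (gfun k) d)) v = rp X w' (seg p (kl k) (gfun k) d) v
    \<and> (\<forall>x\<in>set (dat gfun ss (seg p (kl k) (gfun k) d)). 0 < x)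
    \<and> length (dat gfun ss (seg p (kl k) (gfun k) d)) = length (seg p (kl k) (gfun k) d)"
    by (rule Cons.IH[OF ok(5) len pos]) (use Cons.prems(4) in simp)
  moreover have "length w' = length w" using ok by (simp add: w'_def del: kl.simps)
  ultimately show ?case
    using len Cons.prems(2) unfolding st wrun.simps dat.simps w'_def[symmetric] by simp
qed simp

text \<open>Loops of braid moves at the longest element of type A3 and C3 that pass through all three
  first letters.\<close>

definition loopA :: "wstep list" where
  "loopA = [(0, 1, [2, 1, 2], [1, 2, 1]), (2, 1, [1, 0, 1], [0, 1, 0]), (1, 0, [2, 0], [0, 2]), (4, 0, [0, 2], [2, 0]), (2, 1, [2, 1, 2], [1, 2, 1]), (0, 1, [1, 0, 1], [0, 1, 0]), (2, 0, [0, 2], [2, 0]), (3, 1, [0, 1, 0], [1, 0, 1]), (1, 1, [1, 2, 1], [2, 1, 2]), (0, 0, [0, 2], [2, 0]), (3, 0, [2, 0], [0, 2]), (1, 1, [0, 1, 0], [1, 0, 1]), (3, 1, [1, 2, 1], [2, 1, 2]), (2, 0, [0, 2], [2, 0])]"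

definition loopC :: "wstep list" where
  "loopC = [(0, 3, [2, 1, 2, 1], [1, 2, 1, 2]), (3, 0, [2, 0], [0, 2]), (4, 3, [2, 1, 2, 1], [1, 2, 1, 2]), (2, 1, [1, 0, 1], [0, 1, 0]), (1, 0, [2, 0], [0, 2]), (4, 0, [0, 2], [2, 0]), (7, 0, [2, 0], [0, 2]), (5, 1, [0, 1, 0], [1, 0, 1]), (2, 3, [2, 1, 2, 1], [1, 2, 1, 2]), (0, 1, [1, 0, 1], [0, 1, 0]), (2, 0, [0, 2], [2, 0]), (5, 0, [2, 0], [0, 2]), (3, 1, [0, 1, 0], [1, 0, 1]), (5, 2, [1, 2, 1, 2], [2, 1, 2, 1]), (4, 0, [0, 2], [2, 0]), (1, 2, [1, 2, 1, 2], [2, 1, 2, 1]), (0, 0, [0, 2], [2, 0]), (4, 1, [1, 0, 1], [0, 1, 0]), (3, 0, [2, 0], [0, 2]), (1, 1, [0, 1, 0], [1, 0, 1]), (6, 0, [0, 2], [2, 0]), (3, 2, [1, 2, 1, 2], [2, 1, 2, 1]), (2, 0, [0, 2], [2, 0]), (6, 1, [1, 0, 1], [0, 1, 0]), (5, 0, [2, 0], [0, 2]), (3, 1, [0, 1, 0], [1, 0, 1])]"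

text \<open>One-parameter subgroups of the unipotent groups of type A3 and C3 acting on row vectors.
  Braid moves preserve the product along a word and this product determines the positive parameters,
  so a loop acts as the identity on them, and hence so does its tropicalisation on Lusztig data.\<close>

fun XA :: "nat \<Rightarrow> real \<Rightarrow> real \<times> real \<times> real \<times> real \<Rightarrow> real \<times> real \<times> real \<times> real" where
  "XA i t (v0, v1, v2, v3) = (v0, v1 + (if i = 0 then t * v0 else 0), v2 + (if i = 1 then t * v1 else 0),
     v3 + (if i = 2 then t * v2 else 0))"

fun XC :: "nat \<Rightarrow> real \<Rightarrow> real \<times> real \<times> real \<times> real \<times> real \<times> real \<Rightarrow> real \<times> real \<times> real \<times> real \<times> real \<times> real" where
  "XC i t (v0, v1, v2, v3, v4, v5) = (v0, v1 + (if i = 0 then t * v0 else 0), v2 + (if i = 1 then t * v1 else 0),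
     v3 + (if i = 2 then t * v2 else 0), v4 + (if i = 1 then t * v3 else 0), v5 + (if i = 0 then t * v4 else 0))"

text \<open>Comparing the two products of matrices needs only these polynomial relations between old
  and new parameters, so the divisions are dealt with here.\<close>

lemma a2_geo_facts:
  fixes x y z :: real
  assumes "0 < x" "0 < z"
  obtains a b c where "a2_geo [x, y, z] = [a, b, c]" "b = x + z" "a + c = y" "a * b = y * z" "b * c = x * y"
proof (rule that)
  show "a2_geo [x, y, z] = [y * z / (x + z), x + z, x * y / (x + z)]" by (simp add: a2_geo_def)
  have "x + z \<noteq> 0" using assms by simp
  moreover have "y * z + x * y = y * (x + z)" by (simp add: algebra_simps)
  ultimately show "y * z / (x + z) + x * y / (x + z) = y" "y * z / (x + z) * (x + z) = y * z"
    "(x + z) * (x * y / (x + z)) = x * y"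
    by (simp_all add: add_divide_distrib[symmetric])
qed simp

lemma b2_geo_facts:
  fixes x1 x2 x3 x4 :: real
  assumes "0 < x1" "0 < x2" "0 < x3" "0 < x4"
  obtains y1 y2 y3 y4 where "b2_geo [x1, x2, x3, x4] = [y1, y2, y3, y4]" "y2 + y4 = x1 + x3"
    "y1 + y3 = x2 + x4" "y2 * y3 = x1 * x2 + (x1 + x3) * x4" "y2 * y3 * y4 = x1 * x2 * x3"
    "y1 * (y2 + y4) + y3 * y4 = x2 * x3"
proof (rule that)
  define p q where pq: "p = x1 * x2 + (x1 + x3) * x4" "q = x1\<^sup>2 * x2 + (x1 + x3)\<^sup>2 * x4"
  have pos: "0 < p" "0 < q" unfolding pq using assms
    by (intro add_pos_pos mult_pos_pos zero_less_power; simp)+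
  have i: "q + x1 * x2 * x3 = (x1 + x3) * p" "x2 * x3\<^sup>2 * x4 + p\<^sup>2 = (x2 + x4) * q"
    "x2 * x3\<^sup>2 * x4 * (x1 + x3) + p * (x1 * x2 * x3) = x2 * x3 * q"
    unfolding pq by (simp_all add: power2_eq_square algebra_simps)
  show "b2_geo [x1, x2, x3, x4] = [x2 * x3\<^sup>2 * x4 / q, q / p, p\<^sup>2 / q, x1 * x2 * x3 / p]"
    by (simp add: b2_geo_def Let_def pq)
  show 1: "q / p + x1 * x2 * x3 / p = x1 + x3"
    using i(1) pos by (simp add: add_divide_distrib[symmetric])
  show "x2 * x3\<^sup>2 * x4 / q + p\<^sup>2 / q = x2 + x4"
    using i(2) pos by (simp add: add_divide_distrib[symmetric])
  show "q / p * (p\<^sup>2 / q) = x1 * x2 + (x1 + x3) * x4"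
    using pos by (simp add: power2_eq_square flip: pq(1))
  show "q / p * (p\<^sup>2 / q) * (x1 * x2 * x3 / p) = x1 * x2 * x3"
    using pos by (simp add: power2_eq_square)
  show "x2 * x3\<^sup>2 * x4 / q * (q / p + x1 * x2 * x3 / p) + p\<^sup>2 / q * (x1 * x2 * x3 / p) = x2 * x3"
  proof -
    have "x2 * x3\<^sup>2 * x4 / q * (x1 + x3) + p\<^sup>2 / q * (x1 * x2 * x3 / p)
      = (x2 * x3\<^sup>2 * x4 * (x1 + x3) + p * (x1 * x2 * x3)) / q"
      using pos by (simp add: power2_eq_square add_divide_distrib)
    then show ?thesis unfolding 1 i(3) using pos by simp
  qed
qed

lemma brel_commute:
  "(\<And>s t v. X i s (X j t v) = X j t (X i s v)) \<Longrightarrow> brel X (p, 0, [i, j], [j, i])"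
  by (auto simp: brel_def list_2 gfun_def)

lemma brel_braid3:
  assumes "\<And>x y z a b c v. b = x + z \<Longrightarrow> a + c = y \<Longrightarrow> a * b = y * z \<Longrightarrow> b * c = x * y
    \<Longrightarrow> X j c (X i b (X j a v)) = X i z (X j y (X i x v))"
  shows "brel X (p, Suc 0, [i, j, i], [j, i, j])"
  unfolding brel_def
proof (simp, intro allI impI)
  fix d :: "real list" and v
  assume "length d = 3" "\<forall>x\<in>set d. 0 < x"
  then obtain x y z where d: "d = [x, y, z]" "0 < x" "0 < z" by (auto simp: list_3)
  obtain a b c where "a2_geo d = [a, b, c]" "b = x + z" "a + c = y" "a * b = y * z" "b * c = x * y"
    using a2_geo_facts[OF d(2,3)] d(1) by metis
  then show "rp X [j, i, j] (gfun (Suc 0) d) v = rp X [i, j, i] d v"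
    using assms by (simp add: d(1) gfun_def)
qed

text \<open>Kind 3 is the B2 relation read backwards; therefore the same parameters must satisfy the
  relation in both reading orders.\<close>

lemma brel_braid4:
  assumes "\<And>x1 x2 x3 x4 y1 y2 y3 y4 v. y2 + y4 = x1 + x3 \<Longrightarrow> y1 + y3 = x2 + x4 \<Longrightarrow>
      y2 * y3 = x1 * x2 + (x1 + x3) * x4 \<Longrightarrow> y2 * y3 * y4 = x1 * x2 * x3 \<Longrightarrow> y1 * (y2 + y4) + y3 * y4 = x2 * x3
    \<Longrightarrow> X i y4 (X j y3 (X i y2 (X j y1 v))) = X j x4 (X i x3 (X j x2 (X i x1 v)))
      \<and> X j y1 (X i y2 (X j y3 (X i y4 v))) = X i x1 (X j x2 (X i x3 (X j x4 v)))"
  shows "brel X (p, 2, [i, j, i, j], [j, i, j, i])" "brel X (p, 3, [j, i, j, i], [i, j, i, j])"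
proof -
  have "rp X [j, i, j, i] (b2_geo d) v = rp X [i, j, i, j] d v
      \<and> rp X [i, j, i, j] (rev (b2_geo d)) v = rp X [j, i, j, i] (rev d) v"
    if l: "length d = 4" and pos: "\<forall>x\<in>set d. 0 < x" for d v
  proof -
    obtain x1 x2 x3 x4 where d: "d = [x1, x2, x3, x4]" using l by (auto simp: list_4)
    have "0 < x1" "0 < x2" "0 < x3" "0 < x4" using pos by (simp_all add: d)
    from b2_geo_facts[OF this] obtain y1 y2 y3 y4 where y: "b2_geo d = [y1, y2, y3, y4]"
      "y2 + y4 = x1 + x3" "y1 + y3 = x2 + x4" "y2 * y3 = x1 * x2 + (x1 + x3) * x4"
      "y2 * y3 * y4 = x1 * x2 * x3" "y1 * (y2 + y4) + y3 * y4 = x2 * x3"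
      unfolding d by metis
    show ?thesis using assms[OF y(2-)] by (simp add: y(1)[unfolded d] d)
  qed
  note * = this
  show "brel X (p, 2, [i, j, i, j], [j, i, j, i])"
    using * by (simp add: brel_def gfun_def)
  show "brel X (p, 3, [j, i, j, i], [i, j, i, j])"
    unfolding brel_def
  proof (simp, intro allI impI)
    fix d :: "real list" and v assume "length d = 4" "\<forall>x\<in>set d. 0 < x"
    then show "rp X [i, j, i, j] (gfun 3 d) v = rp X [j, i, j, i] d v"
      using *[of "rev d" v] by (simp add: gfun_def)
  qed
qed

text \<open>The identities that remain when the length three relations are compared coordinate by
  coordinate on row vectors. \<open>poly4\<close> does the same for length four, in both reading
  orders.\<close>

lemma poly3:
  fixes a c x y z v w :: real
  assumes "a + c = y"
  shows "(x + z) * c = x * y \<Longrightarrow> a * v + c * (v + (x + z) * w) = y * (v + x * w)"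
    and "a * (x + z) = y * z \<Longrightarrow> (x + z) * (v + a * w) = x * v + z * (v + y * w)"
    and "a * v + c * v = y * v"
proof -
  show "a * v + c * (v + (x + z) * w) = y * (v + x * w)" if h: "(x + z) * c = x * y"
  proof -
    have "a * v + c * (v + (x + z) * w) = (a + c) * v + ((x + z) * c) * w" by (simp add: algebra_simps)
    then show ?thesis unfolding assms h by (simp add: algebra_simps)
  qed
  show "(x + z) * (v + a * w) = x * v + z * (v + y * w)" if h: "a * (x + z) = y * z"
  proof -
    have "(x + z) * (v + a * w) = (x + z) * v + (a * (x + z)) * w" by (simp add: algebra_simps)
    then show ?thesis unfolding h by (simp add: algebra_simps)
  qed
qed (simp add: assms flip: distrib_right)

lemma poly4:
  fixes x1 x2 x3 x4 y1 y2 y3 y4 a b c :: real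
  assumes "y2 + y4 = x1 + x3" "y1 + y3 = x2 + x4" "y2 * y3 = x1 * x2 + (x1 + x3) * x4"
    "(x1 * x2 + (x1 + x3) * x4) * y4 = x1 * x2 * x3" "y1 * (x1 + x3) + y3 * y4 = x2 * x3"
  shows "y2 * a + y4 * a = x1 * a + x3 * a"
    "y1 * b + y3 * (b + y2 * a) = x2 * (b + x1 * a) + x4 * (b + x1 * a + x3 * a)"
    "y2 * (c + y1 * b) + y4 * (c + y1 * b + y3 * (b + y2 * a)) = x1 * c + x3 * (c + x2 * (b + x1 * a))"
    "y4 * a + y2 * a = x3 * a + x1 * a"
    "y3 * (b + y4 * a) + y1 * (b + y4 * a + y2 * a) = x4 * b + x2 * (b + x3 * a)"
    "y4 * c + y2 * (c + y3 * (b + y4 * a)) = x3 * (c + x4 * b) + x1 * (c + x4 * b + x2 * (b + x3 * a))"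
proof -
  have "y2 * a + y4 * a = (y2 + y4) * a" by (simp add: algebra_simps)
  then show "y2 * a + y4 * a = x1 * a + x3 * a" unfolding assms by (simp add: algebra_simps)
  have "y1 * b + y3 * (b + y2 * a) = (y1 + y3) * b + (y2 * y3) * a" by (simp add: algebra_simps)
  then show "y1 * b + y3 * (b + y2 * a) = x2 * (b + x1 * a) + x4 * (b + x1 * a + x3 * a)" unfolding assms by (simp add: algebra_simps)
  have "y2 * (c + y1 * b) + y4 * (c + y1 * b + y3 * (b + y2 * a)) = (y2 + y4) * c + (y1 * (y2 + y4) + y3 * y4) * b + ((y2 * y3) * y4) * a" by (simp add: algebra_simps)
  then show "y2 * (c + y1 * b) + y4 * (c + y1 * b + y3 * (b + y2 * a)) = x1 * c + x3 * (c + x2 * (b + x1 * a))" unfolding assms by (simp add: algebra_simps)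
  have "y4 * a + y2 * a = (y2 + y4) * a" by (simp add: algebra_simps)
  then show "y4 * a + y2 * a = x3 * a + x1 * a" unfolding assms by (simp add: algebra_simps)
  have "y3 * (b + y4 * a) + y1 * (b + y4 * a + y2 * a) = (y1 + y3) * b + (y1 * (y2 + y4) + y3 * y4) * a" by (simp add: algebra_simps)
  then show "y3 * (b + y4 * a) + y1 * (b + y4 * a + y2 * a) = x4 * b + x2 * (b + x3 * a)" unfolding assms by (simp add: algebra_simps)
  have "y4 * c + y2 * (c + y3 * (b + y4 * a)) = (y2 + y4) * c + (y2 * y3) * b + ((y2 * y3) * y4) * a" by (simp add: algebra_simps)
  then show "y4 * c + y2 * (c + y3 * (b + y4 * a)) = x3 * (c + x4 * b) + x1 * (c + x4 * b + x2 * (b + x3 * a))" unfolding assms by (simp add: algebra_simps)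
qed

lemma XA_rels: "\<forall>st\<in>set loopA. brel XA st"
proof -
  have comm: "brel XA (p, 0, [0, 2], [2, 0])" "brel XA (p, 0, [2, 0], [0, 2])" for p
    by (rule brel_commute; simp add: split_paired_all)+
  have braid: "brel XA (p, Suc 0, [0, 1, 0], [1, 0, 1])" "brel XA (p, Suc 0, [1, 0, 1], [0, 1, 0])"
     "brel XA (p, Suc 0, [1, 2, 1], [2, 1, 2])" "brel XA (p, Suc 0, [2, 1, 2], [1, 2, 1])" for p
    by (rule brel_braid3; simp add: split_paired_all; (intro conjI)?; (rule distrib_right | rule poly3); assumption)+
  show ?thesis using comm braid by (simp add: loopA_def)
qed

lemma XC_rels: "\<forall>st\<in>set loopC. brel XC st"
proof -
  have comm: "brel XC (p, 0, [0, 2], [2, 0])" "brel XC (p, 0, [2, 0], [0, 2])" for p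
    by (rule brel_commute; simp add: split_paired_all)+
  have braid3: "brel XC (p, Suc 0, [0, 1, 0], [1, 0, 1])" "brel XC (p, Suc 0, [1, 0, 1], [0, 1, 0])" for p
    by (rule brel_braid3; simp add: split_paired_all; (intro conjI)?; (rule distrib_right | rule poly3); assumption)+
  have braid4: "brel XC (p, 2, [1, 2, 1, 2], [2, 1, 2, 1])" "brel XC (p, 3, [2, 1, 2, 1], [1, 2, 1, 2])" for p
    by (rule brel_braid4; simp add: split_paired_all; (intro conjI)?; rule poly4; assumption)+
  show ?thesis using comm braid3 braid4 by (simp add: loopC_def)
qed

lemma loopA_word: "wok loopA [2, 1, 2, 0, 1, 2]" "wrun loopA [2, 1, 2, 0, 1, 2] = [2, 1, 2, 0, 1, 2]"
  by (simp_all add: loopA_def)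

lemma loopC_word: "wok loopC [2, 1, 2, 1, 0, 1, 2, 1, 0]"
  "wrun loopC [2, 1, 2, 1, 0, 1, 2, 1, 0] = [2, 1, 2, 1, 0, 1, 2, 1, 0]"
  by (simp_all add: loopC_def)

text \<open>Unipotent, hence injective; this allows a common right part of two products to be
  cancelled.\<close>

lemma XC_inj: "XC i t v = XC i t v' \<Longrightarrow> v = v'"
  by (cases "(i, t, v)" rule: XC.cases; cases "(i, t, v')" rule: XC.cases) (auto split: if_splits)

lemma rp_XC_inj: "length w = length d \<Longrightarrow> rp XC w d v = rp XC w d v' \<Longrightarrow> v = v'"
proof (induction w d arbitrary: v v' rule: list_induct2)
  case (Cons x xs y ys)
  have "XC x y v = XC x y v'" by (rule Cons.IH) (use Cons.prems in \<open>simp only: rp_Cons\<close>)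
  then show ?case by (rule XC_inj)
qed simp

theorem loopA_identity:
  assumes "length ns = 6" shows "dat tfun loopA ns = ns"
proof (rule dat_loop[OF loopA_word(1)])
  fix d :: "real list" assume d: "length d = length [2, 1, 2, 0, 1, 2 :: nat]" "\<forall>x\<in>set d. 0 < x"
  define e where "e = dat gfun loopA d"
  have e: "rp XA [2, 1, 2, 0, 1, 2] e v = rp XA [2, 1, 2, 0, 1, 2] d v" "\<forall>x\<in>set e. 0 < x" "length e = 6" for v
    using rp_dat[OF loopA_word(1) d XA_rels, of v, unfolded loopA_word(2)] d(1) by (simp_all add: e_def)
  have "length d = 6" using d(1) by simp
  then obtain d1 d2 d3 d4 d5 d6 where dd: "d = [d1, d2, d3, d4, d5, d6]" unfolding list_6 by auto
  obtain e1 e2 e3 e4 e5 e6 where ee: "e = [e1, e2, e3, e4, e5, e6]" using e(3) unfolding list_6 by auto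
  note pos = d(2) e(2)
  \<comment> \<open>On the first basis vector only the last three letters \<open>0, 1, 2\<close>
    act, and they produce the partial products of their parameters. The next basis vectors release
    the earlier parameters.\<close>
  have "d4 = e4" "d5 = e5" "d6 = e6"
    using e(1)[of "(1, 0, 0, 0)"] pos by (auto simp: dd ee)
  moreover from this have "d2 = e2" "d3 = e3"
    using e(1)[of "(0, 1, 0, 0)"] pos by (auto simp: dd ee algebra_simps)
  moreover from calculation have "d1 = e1"
    using e(1)[of "(0, 0, 1, 0)"] pos by (auto simp: dd ee algebra_simps)
  ultimately show "dat gfun loopA d = d" unfolding e_def[symmetric] by (simp add: dd ee)
qed (use assms in simp)

theorem loopC_identity:
  assumes "length ns = 9" shows "dat tfun loopC ns = ns"
proof (rule dat_loop[OF loopC_word(1)])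
  let ?w = "[2, 1, 2, 1, 0, 1, 2, 1, 0] :: nat list"
  fix d :: "real list" assume d: "length d = length ?w" "\<forall>x\<in>set d. 0 < x"
  define e where "e = dat gfun loopC d"
  have e: "rp XC ?w e v = rp XC ?w d v" "\<forall>x\<in>set e. 0 < x" "length e = 9" for v
    using rp_dat[OF loopC_word(1) d XC_rels, of v, unfolded loopC_word(2)] d(1) by (simp_all add: e_def)
  have ex9: "\<exists>a1 a2 a3 a4 a5 a6 a7 a8 a9. t = [a1, a2, a3, a4, a5, a6, a7, a8, a9]" if "length t = 9" for t :: "real list"
    using that by (auto simp: length_Suc_conv eval_nat_numeral)
  obtain d1 d2 d3 d4 d5 d6 d7 d8 d9 where dd: "d = [d1, d2, d3, d4, d5, d6, d7, d8, d9]" using ex9[of d] d(1) by auto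
  obtain e1 e2 e3 e4 e5 e6 e7 e8 e9 where ee: "e = [e1, e2, e3, e4, e5, e6, e7, e8, e9]" using ex9[OF e(3)] by auto
  have pos: "0 < d5" "0 < d6" "0 < d7" "0 < d8" "0 < e5" "0 < e6" "0 < e7" "0 < e8" "0 < d2" "0 < d3" "0 < e2" "0 < e3"
    using d(2) e(2) by (simp_all add: dd ee)
  \<comment> \<open>The first row sees only the last five letters. Ratios of its last three entries
    determine the parameters 8 and 9, and the remaining entries determine 5, 6 and 7.\<close>
  have r: "e5 + e9 = d5 + d9 \<and> e5 * e6 + e5 * e8 = d5 * d6 + d5 * d8 \<and> e5 * (e6 * e7) = d5 * (d6 * d7)
    \<and> e5 * (e6 * (e7 * e8)) = d5 * (d6 * (d7 * d8)) \<and> e5 * (e6 * (e7 * (e8 * e9))) = d5 * (d6 * (d7 * (d8 * d9)))"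
    using e(1)[of "(1, 0, 0, 0, 0, 0)"] by (simp add: dd ee algebra_simps)
  then have v0: "e5 + e9 = d5 + d9" "e5 * e6 + e5 * e8 = d5 * d6 + d5 * d8" "e5 * e6 * e7 = d5 * d6 * d7"
     "(e5 * e6 * e7) * e8 = (d5 * d6 * d7) * d8" "(e5 * e6 * e7) * e8 * e9 = (d5 * d6 * d7) * d8 * d9"
    unfolding mult.assoc by blast+
  have "d5 * d6 * d7 \<noteq> 0" using pos by simp
  then have 8: "e8 = d8" using v0(4) unfolding v0(3) by simp
  then have 9: "e9 = d9" using v0(5) pos unfolding v0(3) by simp
  then have 5: "e5 = d5" using v0(1) by simp
  then have 6: "e6 = d6" using v0(2) 8 pos by simp
  then have 7: "e7 = d7" using v0(3) 5 pos by simp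
  \<comment> \<open>The right factor, now known to be the same on both sides, is cancelled.\<close>
  have e4: "rp XC [2, 1, 2, 1] [e1, e2, e3, e4] v = rp XC [2, 1, 2, 1] [d1, d2, d3, d4] v" for v
    by (rule rp_XC_inj[of "[0, 1, 2, 1, 0]" "[d5, d6, d7, d8, d9]"])
      (use e(1)[of v] in \<open>simp_all add: dd ee 5 6 7 8 9\<close>)
  have "e2 + e4 = d2 + d4 \<and> e2 * e3 = d2 * d3 \<and> e2 * (e3 * e4) = d2 * (d3 * d4)"
    using e4[of "(0, 1, 0, 0, 0, 0)"] pos by (simp add: algebra_simps)
  then have v1: "e2 + e4 = d2 + d4" "e2 * e3 = d2 * d3" "(e2 * e3) * e4 = (d2 * d3) * d4"
    unfolding mult.assoc by blast+
  have 4: "e4 = d4" using v1(3) pos unfolding v1(2) by simp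
  then have 2: "e2 = d2" using v1(1) by simp
  then have 3: "e3 = d3" using v1(2) pos by simp
  have 1: "e1 = d1"
    using e4[of "(0, 0, 1, 0, 0, 0)"] by (simp add: 2 3 4 algebra_simps)
  show "dat gfun loopC d = d" unfolding e_def[symmetric] by (simp add: dd ee 1 2 3 4 5 6 7 8 9)
qed (use assms in simp)


lemma dat_append: "dat f (a @ b) d = dat f b (dat f a d)"
  by (induction f a d rule: dat.induct) simp_all

lemma wrun_append: "wrun (a @ b) w = wrun b (wrun a w)"
  by (induction a w rule: wrun.induct) simp_all

lemma wok_append: "wok (a @ b) w \<longleftrightarrow> wok a w \<and> wok b (wrun a w)"
  by (induction a w rule: wok.induct) (simp_all del: kl.simps)

lemma length_dat: "wok ss w \<Longrightarrow> length d = length w \<Longrightarrow> length (dat tfun ss d) = length (wrun ss w)"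
proof (induction ss arbitrary: w d)
  case (Cons st ss)
  obtain p k u u' where st: "st = (p, k, u, u')" by (cases st)
  have ok: "p + length u \<le> length w" "length u = kl k" "length u' = kl k" "wok ss (take p w @ u' @ drop (p + length u) w)"
    using Cons.prems(1) unfolding st wok.simps by blast+
  show ?case unfolding st dat.simps wrun.simps
    by (rule Cons.IH[OF ok(4)]) (use ok Cons.prems(2) in \<open>simp add: length_seg length_tfun del: kl.simps\<close>)
qed simp

subsection \<open>Type B as the dual of type C\<close>

definition swk :: "nat \<Rightarrow> nat" where
  "swk k = (if k = 2 then 3 else if k = 3 then 2 else k)"

definition sws :: "wstep \<Rightarrow> wstep" where
  "sws = (\<lambda>(p, k, u, u'). (p, swk k, u, u'))"

text \<open>Doubling the entries at the letters 0 and 1 turns Lusztig data of type C3 into data of type B3.\<close>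

definition sc :: "nat list \<Rightarrow> int list \<Rightarrow> int list" where
  "sc w d = map (\<lambda>(i, x). if i = 2 then x else 2 * x) (zip w d)"

text \<open>Exchanging long and short roots swaps the two orientations of B2, as \<open>swk\<close>
  does, and rescales the tuples; kinds 0 and 1 stay what they are.\<close>

definition scales :: "wstep \<Rightarrow> bool" where
  "scales = (\<lambda>(p, k, u, u'). \<forall>t. length t = kl k \<longrightarrow> tfun (swk k) (sc u t) = sc u' (tfun k t))"

lemma kl_swk: "kl (swk k) = kl k"
  by (simp add: swk_def)

lemma sc_append: "length w = length d \<Longrightarrow> sc (w @ w') (d @ d') = sc w d @ sc w' d'"
  by (simp add: sc_def)

lemma length_sc [simp]: "length (sc w d) = min (length w) (length d)"
  by (simp add: sc_def)

lemma take_sc: "take n (sc w d) = sc (take n w) (take n d)"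
  by (simp add: sc_def take_map take_zip)

lemma drop_sc: "drop n (sc w d) = sc (drop n w) (drop n d)"
  by (simp add: sc_def drop_map drop_zip)

lemma dat_scale:
  "wok ss w \<Longrightarrow> length d = length w \<Longrightarrow> \<forall>st\<in>set ss. scales st
    \<Longrightarrow> dat tfun (map sws ss) (sc w d) = sc (wrun ss w) (dat tfun ss d)"
proof (induction ss arbitrary: w d)
  case (Cons st ss)
  obtain p k u u' where st: "st = (p, k, u, u')" by (cases st)
  define w' where "w' = take p w @ u' @ drop (p + length u) w"
  have ok: "take (length u) (drop p w) = u" "p + length u \<le> length w" "length u = kl k" "length u' = kl k" "wok ss w'"
    using Cons.prems(1) unfolding st wok.simps w'_def by blast+
  have l: "length (take (kl k) (drop p d)) = kl k" using ok Cons.prems(2) by simp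
  have "tfun (swk k) (sc u (take (kl k) (drop p d))) = sc u' (tfun k (take (kl k) (drop p d)))"
    using Cons.prems(3) l unfolding st scales_def by simp
  moreover have "take (kl k) (drop p (sc w d)) = sc u (take (kl k) (drop p d))"
    using ok(1) unfolding drop_sc take_sc ok(3) by simp
  ultimately have "seg p (kl (swk k)) (tfun (swk k)) (sc w d) = sc w' (seg p (kl k) (tfun k) d)"
    using Cons.prems(2) ok(3,4) length_tfun[OF l] unfolding seg_def w'_def kl_swk
    by (simp add: sc_append take_sc drop_sc del: kl.simps)
  then show ?case
    using Cons.IH[OF ok(5), of "seg p (kl k) (tfun k) d"] Cons.prems(2,3) ok(2-4) length_tfun
    unfolding st list.map sws_def case_prod_conv dat.simps wrun.simps w'_def[symmetric]
    by (simp add: length_seg w'_def del: kl.simps)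
qed simp

lemma tfun_double: "length t = kl k \<Longrightarrow> tfun k (map ((*) 2) t) = map ((*) 2) (tfun k t)"
proof -
  assume l: "length t = kl k"
  have m: "min (2 * x) (2 * y) = 2 * min x y" for x y :: int by linarith
  have a2: "a2_trans (map ((*) 2) t) = map ((*) 2) (a2_trans t)" if "length t = 3" for t
    using that by (auto simp: list_3 a2_trans_def Let_def m)
  have b2: "b2_trans (map ((*) 2) t) = map ((*) 2) (b2_trans t)" if "length t = 4" for t
  proof -
    note l4 = that
    obtain a b c d where t: "t = [a, b, c, d]" using l4 by (auto simp: list_4)
    define p q where p: "p = min (a + b) (min (a + d) (c + d))"
      and q: "q = min (2*a + b) (min (2*a + d) (2*c + d))"
    have "2 * p = min (2*a + 2*b) (min (2*a + 2*d) (2*c + 2*d))"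
      "2 * q = min (2*(2*a) + 2*b) (min (2*(2*a) + 2*d) (2*(2*c) + 2*d))"
      unfolding p q by (auto simp: min_def)
    from b2_trans_eq[OF this] show ?thesis by (simp add: t b2_trans_eq[OF p q])
  qed
  show ?thesis using l a2[of t] b2[of t] b2[of "rev t"] by (simp add: tfun_def rev_map split: if_splits)
qed

lemma dat_double:
  "wok ss w \<Longrightarrow> length d = length w \<Longrightarrow> dat tfun ss (map ((*) 2) d) = map ((*) 2) (dat tfun ss d)"
proof (induction ss arbitrary: w d)
  case (Cons st ss)
  obtain p k u u' where st: "st = (p, k, u, u')" by (cases st)
  have ok: "p + length u \<le> length w" "length u = kl k" "length u' = kl k" "wok ss (take p w @ u' @ drop (p + length u) w)"
    using Cons.prems(1) unfolding st wok.simps by blast+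
  have l: "length (take (kl k) (drop p d)) = kl k" using ok Cons.prems(2) by simp
  have "seg p (kl k) (tfun k) (map ((*) 2) d) = map ((*) 2) (seg p (kl k) (tfun k) d)"
    using tfun_double[OF l] by (simp add: seg_def take_map drop_map del: kl.simps)
  moreover have "length (seg p (kl k) (tfun k) d) = length (take p w @ u' @ drop (p + length u) w)"
    using ok Cons.prems(2) by (simp add: length_seg length_tfun del: kl.simps)
  ultimately show ?case unfolding st dat.simps using Cons.IH[OF ok(4)] by simp
qed simp

lemma wok_sws: "wok (map sws ss) w = wok ss w" and wrun_sws: "wrun (map sws ss) w = wrun ss w"
  by (induction ss arbitrary: w) (auto simp: sws_def kl_swk simp del: kl.simps)

definition loopB :: "wstep list" where "loopB = map sws loopC"

lemma loopC_scales: "\<forall>st\<in>set loopC. scales st"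
proof -
  have 0: "scales (p, 0, [0, 2], [2, 0])" "scales (p, 0, [2, 0], [0, 2])" for p
    by (auto simp: scales_def swk_def sc_def tfun_def list_2)
  have 1: "scales (p, Suc 0, [0, Suc 0, 0], [Suc 0, 0, Suc 0])" "scales (p, Suc 0, [Suc 0, 0, Suc 0], [0, Suc 0, 0])" for p
    by (auto simp: scales_def swk_def sc_def tfun_def list_3 a2_trans_def Let_def min_def)
  have b2: "rev (b2_trans [d, 2 * c, b, 2 * a]) = sc [2, Suc 0, 2, Suc 0] (b2_trans [a, b, c, d])" for a b c d
  proof -
    define p q where p: "p = min (a + b) (min (a + d) (c + d))"
      and q: "q = min (2*a + b) (min (2*a + d) (2*c + d))"
    have "q = min (d + 2 * c) (min (d + 2 * a) (b + 2 * a))"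
      "2 * p = min (2 * d + 2 * c) (min (2 * d + 2 * a) (2 * b + 2 * a))"
      unfolding p q by (linarith, auto simp: min_def)
    from b2_trans_eq[OF this] show ?thesis by (simp add: b2_trans_eq[OF p q] sc_def)
  qed
  have b2': "b2_trans [d, 2 * c, b, 2 * a] = sc [Suc 0, 2, Suc 0, 2] (rev (b2_trans [a, b, c, d]))" for a b c d
  proof -
    obtain x y z w where "b2_trans [a, b, c, d] = [x, y, z, w]" using b2_trans_eq[OF refl refl] by blast
    with b2[of d c b a] show ?thesis by (simp add: sc_def rev_swap)
  qed
  have 2: "scales (p, 2, [Suc 0, 2, Suc 0, 2], [2, Suc 0, 2, Suc 0])" "scales (p, 3, [2, Suc 0, 2, Suc 0], [Suc 0, 2, Suc 0, 2])" for p
    using b2 b2' by (auto simp: scales_def swk_def sc_def tfun_def list_4)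
  show ?thesis using 0 1 2 by (simp add: loopC_def)
qed

theorem loopB_identity:
  assumes "length ns = 9" shows "dat tfun loopB ns = ns"
proof -
  let ?w = "[2, 1, 2, 1, 0, 1, 2, 1, 0] :: nat list"
  \<comment> \<open>Not every integral tuple is a rescaled one, so twice \<open>ns\<close> is
    considered: \<open>d\<close> doubles the entries at the letter 2, \<open>sc\<close> those at 0
    and 1. Homogeneity (\<open>dat_double\<close>) removes the factor 2.\<close>
  define d where "d = map (\<lambda>(i, x). if i = 2 then 2 * x else x) (zip ?w ns)"
  have l: "length d = length ?w" using assms by (simp add: d_def)
  have ns: "sc ?w d = map ((*) 2) ns"
    using assms by (auto simp: d_def sc_def length_Suc_conv eval_nat_numeral)
  have "map ((*) 2) (dat tfun loopB ns) = dat tfun loopB (map ((*) 2) ns)"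
    using dat_double[of loopB ?w ns] assms loopC_word(1) by (simp add: loopB_def wok_sws)
  also have "\<dots> = sc (wrun loopC ?w) (dat tfun loopC d)"
    unfolding ns[symmetric] loopB_def by (rule dat_scale[OF loopC_word(1) l loopC_scales])
  also have "\<dots> = map ((*) 2) ns"
  proof -
    have "dat tfun loopC d = d" by (rule loopC_identity) (use l in simp)
    then show ?thesis by (simp only: loopC_word(2) ns)
  qed
  finally show ?thesis by (simp add: inj_map_eq_map inj_def)
qed


declare kl.simps [simp del]

section \<open>Commuting triangles of hops from the rank three loops\<close>

context fin_cartan
begin

text \<open>Hops are functional on classes, so one compatible triple of hops for each starting state
  is enough.\<close>

lemma composes_intro:
  assumes "a \<noteq> b" "b \<noteq> c" "trivial_monodromy (s a \<circ> v)" "trivial_monodromy (s b \<circ> v)"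
    and ex: "\<And>\<sigma>. valid v a \<sigma> \<Longrightarrow> \<exists>\<tau> \<rho>. hop a b \<sigma> \<tau> \<and> hop b c \<tau> \<rho> \<and> hop a c \<sigma> \<rho>"
  shows "composes v a b c"
  unfolding composes_def
proof (intro allI impI)
  fix \<sigma> \<tau> \<rho> assume *: "valid v a \<sigma>" "hop a b \<sigma> \<tau>" "hop b c \<tau> \<rho>"
  obtain \<tau>' \<rho>' where **: "hop a b \<sigma> \<tau>'" "hop b c \<tau>' \<rho>'" "hop a c \<sigma> \<rho>'" using ex[OF *(1)] by (elim exE conjE)
  have v: "valid v b \<tau>" "valid v b \<tau>'" by (rule hop_valid[OF assms(1) *(1,2)], rule hop_valid[OF assms(1) *(1) **(1)])
  have "same_head \<tau> \<tau>'" by (rule hop_functional[OF assms(1,3) *(1,2) **(1)])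
  then have "hop b c \<tau> \<rho>'" by (rule hop_same_head[OF _ **(2) same_head_refl[OF hop_valid[OF assms(2) v(2) **(2)]]])
  then have "same_head \<rho>' \<rho>" using hop_functional[OF assms(2,4) v(1) _ *(3)] by simp
  then show "hop a c \<sigma> \<rho>" by (rule hop_same_head[OF same_head_refl[OF *(1)] **(3)])
qed

text \<open>\<open>L\<close> places the letters 0, 1, 2 in the diagram of \<open>C\<close>; the
  condition says that under \<open>L\<close> the step is a braid move whose transition map is
  \<open>tr\<close>.\<close>

definition good :: "(nat \<Rightarrow> 'i) \<Rightarrow> wstep \<Rightarrow> bool" where
  "good L = (\<lambda>(p, k, u, u'). let i = L (u ! 0); j = L (u ! 1) in i \<noteq> j \<and> cox i j = kl k
    \<and> map L u = alt i j (kl k) \<and> map L u' = alt j i (kl k) \<and> (\<forall>t. length t = kl k \<longrightarrow> tr i j t = tfun k t))"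

lemma good_bstep:
  assumes "good L (p, k, u, u')" "wok [(p, k, u, u')] w" "length d = length w" "length q = length r"
  defines "i \<equiv> L (u ! 0)" and "j \<equiv> L (u ! 1)"
  shows "bstep (map L (drop p w) @ r, drop p d @ q)
      (map L (u' @ drop (p + length u) w) @ r, tfun k (take (kl k) (drop p d)) @ drop (p + kl k) d @ q)"
    and "length u = kl k" and "map L (drop p w) = alt i j (kl k) @ map L (drop (p + length u) w)"
    and "i \<noteq> j" "cox i j = kl k" "tr i j (take (kl k) (drop p d)) = tfun k (take (kl k) (drop p d))"
    and "length (take (kl k) (drop p d)) = kl k" and "map L u' = alt j i (kl k)"
proof -
  have ok: "take (length u) (drop p w) = u" "p + length u \<le> length w" "length u = kl k" "length u' = kl k"
    using assms(2) by (auto simp del: kl.simps)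
  have g: "i \<noteq> j" "cox i j = kl k" "map L u = alt i j (kl k)" "map L u' = alt j i (kl k)"
    "\<And>t. length t = kl k \<Longrightarrow> tr i j t = tfun k t"
    using assms(1) unfolding good_def Let_def i_def j_def by (auto simp del: kl.simps)
  show le: "length (take (kl k) (drop p d)) = kl k" using ok assms(3) by simp
  have w: "drop p w = u @ drop (p + length u) w"
    using ok(1) by (metis append_take_drop_id drop_drop add.commute)
  show W: "map L (drop p w) = alt i j (kl k) @ map L (drop (p + length u) w)"
    using g(3) arg_cong[OF w, of "map L"] by simp
  have D: "drop p d = take (kl k) (drop p d) @ drop (p + kl k) d"
    by (metis append_take_drop_id drop_drop add.commute)
  have ld: "length (take (kl k) (drop p d)) = cox i j" using le g(2) by simp
  have lq: "length (drop (p + kl k) d @ q) = length (map L (drop (p + length u) w) @ r)"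
    using assms(3,4) ok(3) by simp
  have "bstep ([] @ alt i j (cox i j) @ map L (drop (p + length u) w) @ r, [] @ take (kl k) (drop p d) @ drop (p + kl k) d @ q)
      ([] @ alt j i (cox i j) @ map L (drop (p + length u) w) @ r, [] @ tr i j (take (kl k) (drop p d)) @ drop (p + kl k) d @ q)"
    by (rule bstep[OF g(1) ld _ lq]) simp
  note B = this
  have D2: "take (kl k) (drop p d) @ drop (p + kl k) d @ q = drop p d @ q"
    using arg_cong[OF D[symmetric], of "\<lambda>x. x @ q"] by simp
  from B have "bstep (alt i j (kl k) @ map L (drop (p + length u) w) @ r, drop p d @ q)
      (alt j i (kl k) @ map L (drop (p + length u) w) @ r, tfun k (take (kl k) (drop p d)) @ drop (p + kl k) d @ q)"
    unfolding append_Nil g(2) D2 g(5)[OF le] .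
  then show "bstep (map L (drop p w) @ r, drop p d @ q)
      (map L (u' @ drop (p + length u) w) @ r, tfun k (take (kl k) (drop p d)) @ drop (p + kl k) d @ q)"
    unfolding W map_append g(4) append_assoc .
  show "length u = kl k" by (fact ok(3))
  show "i \<noteq> j" by (fact g(1))
  show "cox i j = kl k" by (fact g(2))
  show "tr i j (take (kl k) (drop p d)) = tfun k (take (kl k) (drop p d))" by (rule g(5)[OF le])
  show "map L u' = alt j i (kl k)" by (fact g(4))
qed

lemma good_same_head:
  assumes "good L (p, k, u, u')" "wok [(p, k, u, u')] w" "length d = length w" "length q = length r" "0 < p"
  shows "same_head (map L w @ r, d @ q) (map L (wrun [(p, k, u, u')] w) @ r, dat tfun [(p, k, u, u')] d @ q)"
proof -
  note b = good_bstep(1)[OF assms(1-4)]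
  have p: "p \<le> length w" using assms(2) by auto
  have l: "length (take p d) = length (map L (take p w))" using assms(3) by simp
  have "same_head (map L (take p w) @ map L (drop p w) @ r, take p d @ drop p d @ q)
    (map L (take p w) @ map L (u' @ drop (p + length u) w) @ r, take p d @ tfun k (take (kl k) (drop p d)) @ drop (p + kl k) d @ q)"
  proof (rule same_head_step[OF _ b _ l])
    show "bstep (map L (take p w) @ map L (drop p w) @ r, take p d @ drop p d @ q)
      (map L (take p w) @ map L (u' @ drop (p + length u) w) @ r, take p d @ tfun k (take (kl k) (drop p d)) @ drop (p + kl k) d @ q)"
      using bstep_context[OF b l, of "[]" "[]"] by simp
    show "map L (take p w) \<noteq> []" using p assms(5) by auto
  qed
  moreover have "map L (take p w) @ map L (drop p w) @ r = map L w @ r"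
    by (simp flip: append_assoc map_append)
  moreover have "take p d @ drop p d @ q = d @ q" by (simp flip: append_assoc)
  ultimately show ?thesis by (simp add: seg_def del: kl.simps)
qed

lemma path_same_head:
  assumes "\<forall>st\<in>set ss. good L st \<and> 0 < fst st" "wok ss w" "length d = length w" "length q = length r"
    "valid v a (map L w @ r, d @ q)"
  shows "same_head (map L w @ r, d @ q) (map L (wrun ss w) @ r, dat tfun ss d @ q)"
  using assms(1-3,5)
proof (induction ss arbitrary: w d)
  case Nil
  then show ?case using same_head_refl by simp
next
  case (Cons st ss)
  obtain p k u u' where st: "st = (p, k, u, u')" by (cases st)
  have "wok ([st] @ ss) w" using Cons.prems(2) by simp
  then have ok1: "wok [st] w" and ok2: "wok ss (wrun [st] w)" unfolding wok_append by blast+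
  have i: "same_head (map L w @ r, d @ q) (map L (wrun [st] w) @ r, dat tfun [st] d @ q)"
    unfolding st by (rule good_same_head[OF _ ok1[unfolded st] Cons.prems(3) assms(4)]) (use Cons.prems(1) st in simp_all)
  have "same_head (map L (wrun [st] w) @ r, dat tfun [st] d @ q) (map L (wrun ss (wrun [st] w)) @ r, dat tfun ss (dat tfun [st] d) @ q)"
    by (rule Cons.IH[OF _ ok2 length_dat[OF ok1 Cons.prems(3)] valid_same_head[OF Cons.prems(4) i]]) (use Cons.prems(1) in simp)
  with i show ?case using same_head_trans wrun_append[of "[st]" ss w] dat_append[of tfun "[st]" ss d] by simp
qed

lemma path_hop:
  assumes "good L (0, k, u, u')" "wok [(0, k, u, u')] w" "length d = length w" "length q = length r"
    "valid v a (map L w @ r, d @ q)"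
  shows "hop (L (u ! 0)) (L (u ! 1)) (map L w @ r, d @ q) (map L (wrun [(0, k, u, u')] w) @ r, dat tfun [(0, k, u, u')] d @ q)"
proof -
  define i j where ij: "i = L (u ! 0)" "j = L (u ! 1)"
  note b = good_bstep[OF assms(1-4), folded ij]
  define e where "e = take (kl k) d"
  define w' where "w' = map L (drop (kl k) w)"
  have w: "map L w @ r = alt i j (cox i j) @ (w' @ r)" using b(3) unfolding b(2,5) by (simp add: w'_def)
  have d: "d @ q = e @ (drop (kl k) d @ q)" by (simp add: e_def flip: append_assoc)
  have le: "length e = cox i j" using b(5,7) by (simp add: e_def)
  have lq: "length (drop (kl k) d @ q) = length (w' @ r)" using assms(3,4) by (simp add: w'_def)
  have m: "a = i" using assms(5) cox_ge_2[of i j] unfolding w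
    by (cases "cox i j") (auto simp: valid_def alt_Suc)
  have "hop i j (alt i j (cox i j) @ (w' @ r), e @ (drop (kl k) d @ q)) (alt j i (cox i j) @ (w' @ r), tr i j e @ (drop (kl k) d @ q))"
    by (rule hop_bstep[OF b(4) le lq]) (use assms(5) in \<open>simp only: m w d\<close>)
  moreover have "map L (wrun [(0, k, u, u')] w) @ r = alt j i (cox i j) @ (w' @ r)"
    using b(8) b(2) b(5) by (simp add: w'_def del: kl.simps)
  moreover have "dat tfun [(0, k, u, u')] d @ q = tr i j e @ (drop (kl k) d @ q)"
    using b(6) by (simp add: seg_def e_def del: kl.simps)
  ultimately show ?thesis unfolding w d ij[symmetric] by simp
qed

text \<open>Three moves at position 0 give the hops from \<open>z\<close> to \<open>y\<close>, from
  \<open>y\<close> to \<open>x\<close> and from \<open>x\<close> back to \<open>z\<close>; all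
  others leave the first letter alone. The condition on \<open>negs\<close> puts the loop word at
  the front of a reduced word of \<open>v\<close>.\<close>

lemma composes_loop:
  assumes v: "v \<in> W" and ne: "z \<noteq> y" "y \<noteq> x" "x \<noteq> z" and trivial_monodromy: "trivial_monodromy (s z \<circ> v)" "trivial_monodromy (s y \<circ> v)"
    and loop: "loop = (0, k0, u0, u0') # ss1 @ (0, k1, u1, u1') # ss2 @ (0, k2, u2, u2') # ss3"
    and pos: "\<forall>st\<in>set (ss1 @ ss2 @ ss3). 0 < fst st" and good: "\<forall>st\<in>set loop. good L st"
    and w: "wok loop w" "wrun loop w = w" "w \<noteq> []" "L (hd w) = z"
    and id: "\<And>d. length d = length w \<Longrightarrow> dat tfun loop d = d"
    and letters: "L (u0 ! 0) = z" "L (u0 ! 1) = y" "L (u1 ! 0) = y" "L (u1 ! 1) = x" "L (u2 ! 0) = x" "L (u2 ! 1) = z"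
    and negs: "\<And>k. negs (map L w) (v (fw k))"
  shows "composes v z y x"
proof (rule composes_intro[OF ne(1,2) trivial_monodromy])
  fix \<sigma> assume \<sigma>: "valid v z \<sigma>"
  obtain r where r: "reduced (map L w @ r)" "act (map L w @ r) = v" by (rule negs_word[OF v negs])
  obtain u where u: "length u = length (map L w @ r)" "same_head \<sigma> (map L w @ r, u)"
    using same_head[OF \<sigma> r] w(3,4) by (auto simp: hd_map hd_append)
  obtain d q where dq: "u = d @ q" "length d = length w" "length q = length r"
    using list_split[of u "length w" "length r"] u(1) by auto
  define st where "st = (\<lambda>ss. (map L (wrun ss w) @ r, dat tfun ss d @ q))"
  define b0 b1 b2 where b: "b0 = (0 :: nat, k0, u0, u0')" "b1 = (0 :: nat, k1, u1, u1')" "b2 = (0 :: nat, k2, u2, u2')"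
  have i0: "same_head \<sigma> (st [])" using u(2) dq(1) by (simp add: st_def)
  have loop': "loop = [b0] @ ss1 @ [b1] @ ss2 @ [b2] @ ss3" by (simp add: loop b)
  have inner: "same_head (st A) (st (A @ B))"
    if "loop = A @ B @ E" "\<forall>st\<in>set B. 0 < fst st" "valid v a (st A)" for A B E a
  proof -
    have ok: "wok A w" "wok B (wrun A w)" using w(1) unfolding that(1) wok_append by auto
    show ?thesis unfolding st_def wrun_append dat_append
      by (rule path_same_head[OF _ ok(2) length_dat[OF ok(1) dq(2)] dq(3)])
        (use that good in \<open>auto simp: st_def\<close>)
  qed
  have bottom: "hop (L (u ! 0)) (L (u ! 1)) (st A) (st (A @ [(0, k, u, u')]))"
    if "loop = A @ [(0, k, u, u')] @ E" "valid v a (st A)" for A E k u u' a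
  proof -
    have ok: "wok A w" "wok [(0, k, u, u')] (wrun A w)" using w(1) unfolding that(1) wok_append by auto
    show ?thesis unfolding st_def wrun_append dat_append
      by (rule path_hop[OF _ ok(2) length_dat[OF ok(1) dq(2)] dq(3)])
        (use that good in \<open>auto simp: st_def\<close>)
  qed
  have v0: "valid v z (st [])" by (rule valid_same_head[OF \<sigma> i0])
  have t0: "hop z y (st []) (st [b0])"
    using bottom[of "[]" k0 u0 u0' "ss1 @ [b1] @ ss2 @ [b2] @ ss3", OF _ v0] loop' b letters by simp
  have v1: "valid v y (st [b0])" by (rule hop_valid[OF ne(1) v0 t0])
  have i1: "same_head (st [b0]) (st ([b0] @ ss1))"
    by (rule inner[of _ _ "[b1] @ ss2 @ [b2] @ ss3", OF _ _ v1]) (use loop' pos in auto)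
  have v1': "valid v y (st ([b0] @ ss1))" by (rule valid_same_head[OF v1 i1])
  have t1: "hop y x (st ([b0] @ ss1)) (st ([b0] @ ss1 @ [b1]))"
    using bottom[of "[b0] @ ss1" k1 u1 u1' "ss2 @ [b2] @ ss3", OF _ v1'] loop' b letters by simp
  have v2: "valid v x (st ([b0] @ ss1 @ [b1]))" by (rule hop_valid[OF ne(2) v1' t1])
  have i2: "same_head (st ([b0] @ ss1 @ [b1])) (st ([b0] @ ss1 @ [b1] @ ss2))"
    using inner[of "[b0] @ ss1 @ [b1]" ss2 "[b2] @ ss3", OF _ _ v2] loop' pos by auto
  have v2': "valid v x (st ([b0] @ ss1 @ [b1] @ ss2))" by (rule valid_same_head[OF v2 i2])
  have t2: "hop x z (st ([b0] @ ss1 @ [b1] @ ss2)) (st ([b0] @ ss1 @ [b1] @ ss2 @ [b2]))"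
    using bottom[of "[b0] @ ss1 @ [b1] @ ss2" k2 u2 u2' ss3, OF _ v2'] loop' b letters by simp
  have v3: "valid v z (st ([b0] @ ss1 @ [b1] @ ss2 @ [b2]))" by (rule hop_valid[OF ne(3) v2' t2])
  have i3: "same_head (st ([b0] @ ss1 @ [b1] @ ss2 @ [b2])) (st loop)"
    using inner[of "[b0] @ ss1 @ [b1] @ ss2 @ [b2]" ss3 "[]", OF _ _ v3] loop' pos by auto
  have "st loop = st []" using id[OF dq(2)] w(2) by (simp add: st_def)
  define \<tau> \<rho> where "\<tau> = st ([b0] @ ss1)" and "\<rho> = st ([b0] @ ss1 @ [b1] @ ss2)"
  have "hop z y \<sigma> \<tau>" unfolding \<tau>_def by (rule hop_same_head[OF i0 t0 i1])
  moreover have "hop y x \<tau> \<rho>" unfolding \<tau>_def \<rho>_def by (rule hop_same_head[OF same_head_refl[OF v1'] t1 i2])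
  moreover have "hop x z \<rho> \<sigma>" unfolding \<rho>_def
    by (rule hop_same_head[OF same_head_refl[OF v2'] t2 same_head_trans[OF i3]]) (use \<open>st loop = st []\<close> same_head_sym[OF i0] in simp)
  then have "hop z x \<sigma> \<rho>" by (rule hop_sym[OF ne(3)])
  ultimately show "\<exists>\<tau> \<rho>. hop z y \<sigma> \<tau> \<and> hop y x \<tau> \<rho> \<and> hop z x \<sigma> \<rho>" by blast
qed

lemma negs_append: "negs (p @ q) x \<longleftrightarrow> negs p x \<and> negs q (act (rev p) x)"
  by (induction p arbitrary: x) (simp_all add: wact_append wact_Cons)

lemma act_coord_commute:
  assumes "\<forall>i\<in>set p. C c i = 0" shows "act p x c = x c"
  using assms by (induction p) (simp_all add: wact_Cons srefl_def)

lemma cox_2: "cox i j = 2 \<longleftrightarrow> C i j = 0"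
  using zero_sym[of i j] by (simp add: cox_def)

lemma tr_2: "cox i j = 2 \<Longrightarrow> tr i j t = rev t"
  using cox_2[of i j] by (simp add: tr_def)

lemma alt_2: "alt i j 2 = [i, j]" and alt_3: "alt i j 3 = [i, j, i]" and alt_4: "alt i j 4 = [i, j, i, j]"
  by (simp_all add: eval_nat_numeral alt_Suc)

lemma set_alt: "set (alt i j n) \<subseteq> {i, j}"
  by (auto simp: alt_def)

lemma bs_commute:
  assumes "\<forall>i\<in>set p. i \<noteq> c \<and> C i c = 0" "length t = length p" "length q = length r"
  shows "bs (p @ c # r, t @ n # q) (c # p @ r, n # t @ q)"
  using assms
proof (induction p arbitrary: t)
  case (Cons i p)
  obtain m t' where t: "t = m # t'" "length t' = length p" using Cons.prems(2) by (cases t) auto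
  have "bs (p @ c # r, t' @ n # q) (c # p @ r, n # t' @ q)"
    by (rule Cons.IH) (use Cons.prems t in auto)
  then have "bs (i # p @ c # r, m # t' @ n # q) (i # c # p @ r, m # n # t' @ q)" by (rule bs_Cons)
  moreover have "bstep (i # c # p @ r, m # n # t' @ q) (c # i # p @ r, n # m # t' @ q)"
  proof -
    have c2: "cox i c = 2" using Cons.prems(1) cox_2 by simp
    have "bstep ([] @ alt i c (cox i c) @ (p @ r), [] @ [m, n] @ (t' @ q)) ([] @ alt c i (cox i c) @ (p @ r), [] @ tr i c [m, n] @ (t' @ q))"
      by (rule bstep) (use Cons.prems t c2 in auto)
    then show ?thesis unfolding c2 by (simp add: alt_2 tr_2[OF c2])
  qed
  ultimately show ?case unfolding t(1) append_Cons by (rule rtranclp.rtrancl_into_rtrancl)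
qed simp

text \<open>The letter \<open>c\<close> commutes with the other two, so it can be carried through
  their alternating word to the front, and the move between \<open>a\<close> and \<open>b\<close>
  can be done before or behind it.\<close>

lemma composes_product:
  assumes v: "v \<in> W" and ne: "a \<noteq> b" "b \<noteq> c" "a \<noteq> c" and trivial_monodromy: "trivial_monodromy (s a \<circ> v)" "trivial_monodromy (s b \<circ> v)"
    and desc: "desc v a" "desc v b" "desc v c" and comm: "C a c = 0" "C b c = 0"
  shows "composes v a b c"
proof (rule composes_intro[OF ne(1,2) trivial_monodromy])
  fix \<sigma> assume \<sigma>: "valid v a \<sigma>"
  define m where "m = cox a b"
  obtain m' where m': "cox a b = Suc m'" by (rule cox_Suc)
  have comm': "C c a = 0" "C c b = 0" using comm zero_sym by blast+
  have cox2: "cox a c = 2" "cox b c = 2" using comm cox_2 by simp_all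
  have "negs (alt a b m @ [c]) (v (fw k))" for k
    unfolding negs_append
  proof
    show "negs (alt a b m) (v (fw k))" unfolding m_def
      by (rule alt_negs[OF ne(1) desc_nonpos[OF v desc(1)] desc_nonpos[OF v desc(2)]])
    have "act (rev (alt a b m)) (v (fw k)) c = v (fw k) c"
      by (rule act_coord_commute) (use set_alt[of a b m] comm' in auto)
    then show "negs [c] (act (rev (alt a b m)) (v (fw k)))" using desc_nonpos[OF v desc(3), of k] by simp
  qed
  then obtain r where r: "reduced ((alt a b m @ [c]) @ r)" "act ((alt a b m @ [c]) @ r) = v"
    using negs_word[OF v] by metis
  obtain u where u: "length u = length ((alt a b m @ [c]) @ r)" "same_head \<sigma> ((alt a b m @ [c]) @ r, u)"
    using same_head[OF \<sigma> r] m' by (auto simp: m_def alt_Suc)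
  have "length u = m + Suc (length r)" using u(1) by simp
  then obtain t nq where t: "u = t @ nq" "length t = m" "length nq = Suc (length r)" by (rule list_split)
  obtain n q where nq: "nq = n # q" "length q = length r" using t(3) by (cases nq) auto
  define t' where "t' = tr a b t"
  have lt': "length t' = m" using length_tr[of t a b] t(2) by (simp add: t'_def m_def)
  obtain t0 tt where tt: "t = t0 # tt" "length tt = m'" using t(2) m' by (cases t) (auto simp: m_def)
  obtain t0' tt' where tt': "t' = t0' # tt'" "length tt' = m'" using lt' m' by (cases t') (auto simp: m_def)
  have al: "alt a b m = a # alt b a m'" "alt b a m = b # alt a b m'" by (simp_all add: m_def m' alt_Suc)
  have i0: "same_head \<sigma> (alt a b m @ c # r, t @ n # q)" using u(2) t(1) nq(1) by simp
  have v0: "valid v a (alt a b m @ c # r, t @ n # q)" by (rule valid_same_head[OF \<sigma> i0])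
  have T1: "hop a b (alt a b m @ c # r, t @ n # q) (alt b a m @ c # r, t' @ n # q)"
    unfolding m_def t'_def by (rule hop_bstep[OF ne(1)]) (use t(2) nq(2) v0 in \<open>simp_all add: m_def\<close>)
  have v1: "valid v b (alt b a m @ c # r, t' @ n # q)" by (rule hop_valid[OF ne(1) v0 T1])
  have sub: "\<forall>i\<in>set (alt a b m'). i \<noteq> c \<and> C i c = 0" "\<forall>i\<in>set (alt b a m'). i \<noteq> c \<and> C i c = 0"
    using set_alt[of a b m'] set_alt[of b a m'] ne comm by auto
  have i1: "same_head (alt b a m @ c # r, t' @ n # q) (b # c # alt a b m' @ r, t0' # n # tt' @ q)"
    unfolding same_head_def al tt' using bs_commute[OF sub(1), of tt' q r n] tt'(2) nq(2) by auto
  have i2: "same_head (alt a b m @ c # r, t @ n # q) (a # c # alt b a m' @ r, t0 # n # tt @ q)"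
    unfolding same_head_def al tt using bs_commute[OF sub(2), of tt q r n] tt(2) nq(2) by auto
  have v1': "valid v b (b # c # alt a b m' @ r, t0' # n # tt' @ q)" by (rule valid_same_head[OF v1 i1])
  have v2: "valid v a (a # c # alt b a m' @ r, t0 # n # tt @ q)" by (rule valid_same_head[OF v0 i2])
  have "hop b c (alt b c (cox b c) @ (alt a b m' @ r), [t0', n] @ (tt' @ q)) (alt c b (cox b c) @ (alt a b m' @ r), tr b c [t0', n] @ (tt' @ q))"
    by (rule hop_bstep[OF ne(2)]) (use cox2 tt' nq v1' in \<open>simp_all add: alt_2\<close>)
  then have T2: "hop b c (b # c # alt a b m' @ r, t0' # n # tt' @ q) (c # alt b a m @ r, n # t' @ q)"
    by (simp add: cox2 alt_2 tr_2 al tt')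
  have "hop a c (alt a c (cox a c) @ (alt b a m' @ r), [t0, n] @ (tt @ q)) (alt c a (cox a c) @ (alt b a m' @ r), tr a c [t0, n] @ (tt @ q))"
    by (rule hop_bstep[OF ne(3)]) (use cox2 tt nq v2 in \<open>simp_all add: alt_2\<close>)
  then have T3: "hop a c (a # c # alt b a m' @ r, t0 # n # tt @ q) (c # alt a b m @ r, n # t @ q)"
    by (simp add: cox2 alt_2 tr_2 al tt)
  have "bstep ([] @ alt a b (cox a b) @ r, [] @ t @ q) ([] @ alt b a (cox a b) @ r, [] @ tr a b t @ q)"
    by (rule bstep[OF ne(1)]) (use t(2) nq(2) in \<open>simp_all add: m_def\<close>)
  then have "bs (alt a b m @ r, t @ q) (alt b a m @ r, t' @ q)" by (auto simp: m_def t'_def)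
  then have i3: "same_head (c # alt a b m @ r, n # t @ q) (c # alt b a m @ r, n # t' @ q)"
    unfolding same_head_def by blast
  have "hop a b \<sigma> (b # c # alt a b m' @ r, t0' # n # tt' @ q)" by (rule hop_same_head[OF i0 T1 i1])
  moreover have "hop a c \<sigma> (c # alt b a m @ r, n # t' @ q)" by (rule hop_same_head[OF same_head_trans[OF i0 i2] T3 i3])
  ultimately show "\<exists>\<tau> \<rho>. hop a b \<sigma> \<tau> \<and> hop b c \<tau> \<rho> \<and> hop a c \<sigma> \<rho>" using T2 by blast
qed

text \<open>The cuts are at the three moves at position 0.\<close>

lemma loop_pieces:
  "loopA = (0, 1, [2, 1, 2], [1, 2, 1]) # take 4 (drop 1 loopA) @ (0, 1, [1, 0, 1], [0, 1, 0]) # take 3 (drop 6 loopA)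
    @ (0, 0, [0, 2], [2, 0]) # drop 10 loopA"
  "loopC = (0, 3, [2, 1, 2, 1], [1, 2, 1, 2]) # take 8 (drop 1 loopC) @ (0, 1, [1, 0, 1], [0, 1, 0]) # take 6 (drop 10 loopC)
    @ (0, 0, [0, 2], [2, 0]) # drop 17 loopC"
  "loopB = (0, 2, [2, 1, 2, 1], [1, 2, 1, 2]) # take 8 (drop 1 loopB) @ (0, 1, [1, 0, 1], [0, 1, 0]) # take 6 (drop 10 loopB)
    @ (0, 0, [0, 2], [2, 0]) # drop 17 loopB"
  by (simp_all add: loopA_def loopC_def loopB_def sws_def swk_def)

text \<open>A path \<open>x\<close>, \<open>y\<close>, \<open>z\<close> whose first bond is simple;
  the three alternatives for the second bond are treated by the loops for A3, C3 and B3 in this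
  order.\<close>

lemma composes_rank3:
  assumes v: "v \<in> W" and ne: "x \<noteq> y" "y \<noteq> z" "x \<noteq> z" and trivial_monodromy: "trivial_monodromy (s z \<circ> v)" "trivial_monodromy (s y \<circ> v)"
    and desc: "desc v x" "desc v y" "desc v z"
    and C: "C x z = 0" "C z x = 0" "C x y = -1" "C y x = -1"
      "C y z = -1 \<and> C z y = -1 \<or> C y z = -2 \<and> C z y = -1 \<or> C y z = -1 \<and> C z y = -2"
  shows "composes v z y x"
proof -
  define L where "L = (\<lambda>n :: nat. if n = 0 then x else if n = 1 then y else z)"
  have L: "L 0 = x" "L (Suc 0) = y" "L 2 = z" by (simp_all add: L_def)
  have np: "v (fw k) x \<le> 0" "v (fw k) y \<le> 0" "v (fw k) z \<le> 0" for k
    using desc_nonpos[OF v] desc by blast+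
  note ne' = ne ne[symmetric]
  from C(5) show ?thesis
  proof (elim disjE conjE)
    assume yz: "C y z = -1" "C z y = -1"
    have cox: "cox x y = 3" "cox y x = 3" "cox y z = 3" "cox z y = 3" "cox x z = 2" "cox z x = 2"
      using C yz by (simp_all add: cox_def)
    have tr: "tr x y t = a2_trans t" "tr y x t = a2_trans t" "tr y z t = a2_trans t" "tr z y t = a2_trans t"
      "tr x z t = rev t" "tr z x t = rev t" for t
      using C yz by (simp_all add: tr_def)
    show ?thesis
    proof (rule composes_loop[OF v ne(2)[symmetric] ne(1)[symmetric] ne(3) trivial_monodromy loop_pieces(1) _ _ loopA_word])
      show "\<forall>st\<in>set loopA. good L st"
        using ne' by (simp add: loopA_def good_def L cox tr alt_2 alt_3 tfun_def kl.simps Let_def)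
      show "negs (map L [2, 1, 2, 0, 1, 2]) (v (fw k))" for k
        using np[of k] by (simp add: L srefl_def C yz)
    qed (simp_all add: L loopA_identity, simp_all add: loopA_def)
  next
    assume yz: "C y z = -2" "C z y = -1"
    have cox: "cox x y = 3" "cox y x = 3" "cox y z = 4" "cox z y = 4" "cox x z = 2" "cox z x = 2"
      using C yz by (simp_all add: cox_def)
    have tr: "tr x y t = a2_trans t" "tr y x t = a2_trans t" "tr y z t = b2_trans t" "tr z y t = rev (b2_trans (rev t))"
      "tr x z t = rev t" "tr z x t = rev t" for t
      using C yz by (simp_all add: tr_def)
    show ?thesis
    proof (rule composes_loop[OF v ne(2)[symmetric] ne(1)[symmetric] ne(3) trivial_monodromy loop_pieces(2) _ _ loopC_word])
      show "\<forall>st\<in>set loopC. good L st"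
        using ne' by (simp add: loopC_def good_def L cox tr alt_2 alt_3 alt_4 tfun_def kl.simps Let_def)
      show "negs (map L [2, 1, 2, 1, 0, 1, 2, 1, 0]) (v (fw k))" for k
        using np[of k] by (simp add: L srefl_def C yz)
    qed (simp_all add: L loopC_identity, simp_all add: loopC_def)
  next
    assume yz: "C y z = -1" "C z y = -2"
    have cox: "cox x y = 3" "cox y x = 3" "cox y z = 4" "cox z y = 4" "cox x z = 2" "cox z x = 2"
      using C yz by (simp_all add: cox_def)
    have tr: "tr x y t = a2_trans t" "tr y x t = a2_trans t" "tr z y t = b2_trans t" "tr y z t = rev (b2_trans (rev t))"
      "tr x z t = rev t" "tr z x t = rev t" for t
      using C yz by (simp_all add: tr_def)
    have w: "wok loopB [2, 1, 2, 1, 0, 1, 2, 1, 0]" "wrun loopB [2, 1, 2, 1, 0, 1, 2, 1, 0] = [2, 1, 2, 1, 0, 1, 2, 1, 0]"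
      unfolding loopB_def wok_sws wrun_sws by (fact loopC_word)+
    show ?thesis
    proof (rule composes_loop[OF v ne(2)[symmetric] ne(1)[symmetric] ne(3) trivial_monodromy loop_pieces(3) _ _ w])
      show "\<forall>st\<in>set loopB. good L st"
        using ne' by (simp add: loopB_def sws_def swk_def loopC_def good_def L cox tr alt_2 alt_3 alt_4 tfun_def kl.simps Let_def)
      show "negs (map L [2, 1, 2, 1, 0, 1, 2, 1, 0]) (v (fw k))" for k
        using np[of k] by (simp add: L srefl_def C yz)
    qed (simp_all add: L loopB_identity, simp_all add: loopB_def sws_def swk_def loopC_def)
  qed
qed

lemma composes_perms:
  assumes "v \<in> W" "a \<noteq> b" "b \<noteq> c" "a \<noteq> c" "desc v a" "desc v b" "desc v c"
    and trivial_monodromy: "\<And>a. desc v a \<Longrightarrow> trivial_monodromy (s a \<circ> v)" and "composes v a b c"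
  shows "composes v b c a" "composes v c a b" "composes v c b a" "composes v b a c" "composes v a c b"
proof -
  show 1: "composes v b c a" by (rule composes_rotate[OF assms(1-4) trivial_monodromy[OF assms(7)] assms(9,5)])
  show 2: "composes v c a b" by (rule composes_rotate[OF assms(1,3) not_sym[OF assms(4)] not_sym[OF assms(2)] trivial_monodromy[OF assms(5)] 1 assms(6)])
  show "composes v c b a" by (rule composes_reverse[OF assms(2-4,9)])
  show "composes v a c b" by (rule composes_reverse[OF assms(3) not_sym[OF assms(4)] not_sym[OF assms(2)] 1])
  show "composes v b a c" by (rule composes_reverse[OF not_sym[OF assms(4)] assms(2) not_sym[OF assms(3)] 2])
qed

text \<open>Positive definiteness at suitable test vectors excludes cycles, and on a path it
  excludes G2 bonds and a pair of double bonds.\<close>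

lemma rank3_types:
  assumes "a \<noteq> b" "b \<noteq> c" "a \<noteq> c"
  shows "C a b = 0 \<or> C b c = 0 \<or> C a c = 0"
    and "C a c = 0 \<Longrightarrow> C a b \<noteq> 0 \<Longrightarrow> C b c \<noteq> 0 \<Longrightarrow> C a b * C b a + C b c * C c b < 4"
proof -
  show "C a b = 0 \<or> C b c = 0 \<or> C a c = 0"
  proof (rule ccontr)
    assume n: "\<not> ?thesis"
    have "1 \<le> sqrt (of_int (C p q * C q p))" if "p \<noteq> q" "C p q \<noteq> 0" for p q
    proof -
      have "1 \<le> C p q * C q p" using rank2_types[OF that(1)] that(2) by auto
      then show ?thesis by (metis of_int_1 of_int_le_iff real_sqrt_ge_1_iff)
    qed
    from this[OF assms(1)] this[OF assms(2)] this[OF assms(3)] n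
    have "1 \<le> sqrt (of_int (C a b * C b a))" "1 \<le> sqrt (of_int (C b c * C c b))" "1 \<le> sqrt (of_int (C a c * C c a))"
      by blast+
    moreover have "sqrt (of_int (C a b * C b a)) + sqrt (of_int (C b c * C c b)) + sqrt (of_int (C a c * C c a)) < 3"
      using rank3_bound[OF assms, of 1 1 1] by simp
    ultimately show False by linarith
  qed
  assume "C a c = 0" "C a b \<noteq> 0" "C b c \<noteq> 0"
  define p r where "p = (of_int (C a b * C b a) :: real)" and "r = (of_int (C b c * C c b) :: real)"
  have "0 \<le> C a b * C b a" "0 \<le> C b c * C c b" using rank2_types[OF assms(1)] rank2_types[OF assms(2)] by auto
  then have "0 \<le> p" "0 \<le> r" unfolding p_def r_def by (simp_all only: of_int_0_le_iff)
  then have "sqrt p * sqrt p = p" "sqrt r * sqrt r = r" by simp_all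
  \<comment> \<open>With middle entry 1, the outer entries \<open>sqrt p / 2\<close> and
    \<open>sqrt r / 2\<close> minimise the form.\<close>
  moreover have "sqrt p * (sqrt p / 2) * 1 + sqrt r * 1 * (sqrt r / 2) < (sqrt p / 2)\<^sup>2 + 1\<^sup>2 + (sqrt r / 2)\<^sup>2"
    using rank3_bound[OF assms, of 1 "sqrt p / 2" "sqrt r / 2"] \<open>C a c = 0\<close> unfolding p_def r_def by simp
  ultimately have "p + r < 4" by (simp add: power2_eq_square field_simps)
  then show "C a b * C b a + C b c * C c b < 4" unfolding p_def r_def
    by (metis of_int_add of_int_less_iff of_int_numeral)
qed

text \<open>A disconnected triple is a product, a connected one is a path;
  \<open>composes_perms\<close> brings the letters into the order already treated.\<close>

lemma composes_all:
  assumes v: "v \<in> W" and ne: "a \<noteq> b" "b \<noteq> c" "a \<noteq> c" and d: "desc v a" "desc v b" "desc v c"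
    and trivial_monodromy: "\<And>a. desc v a \<Longrightarrow> trivial_monodromy (s a \<circ> v)"
  shows "composes v a b c"
proof -
  have prod: "composes v p q r \<and> composes v q r p \<and> composes v r p q"
    if "p \<noteq> q" "q \<noteq> r" "p \<noteq> r" "desc v p" "desc v q" "desc v r" "C p r = 0" "C q r = 0" for p q r
  proof -
    have "composes v p q r" by (rule composes_product[OF v that(1-3) trivial_monodromy trivial_monodromy that(4-8)]) (fact that)+
    with composes_perms(1,2)[OF v that(1-6) trivial_monodromy] show ?thesis by blast
  qed
  have path: "composes v p q r"
    if h: "p \<noteq> q" "q \<noteq> r" "p \<noteq> r" "desc v p" "desc v q" "desc v r" "C p r = 0" "C p q \<noteq> 0" "C q r \<noteq> 0" for p q r
  proof -
    have lt: "C p q * C q p + C q r * C r q < 4" by (rule rank3_types(2)[OF h(1-3,7-9)])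
    have z: "C r p = 0" using h(7) zero_sym by blast
    have "C p q = -1 \<and> C q p = -1 \<and> (C q r = -1 \<and> C r q = -1 \<or> C q r = -2 \<and> C r q = -1 \<or> C q r = -1 \<and> C r q = -2)
      \<or> C q r = -1 \<and> C r q = -1 \<and> (C q p = -1 \<and> C p q = -1 \<or> C q p = -2 \<and> C p q = -1 \<or> C q p = -1 \<and> C p q = -2)"
      using rank2_types[OF h(1)] rank2_types[OF h(2)] lt h(8,9) by (elim disjE conjE) simp_all
    then show ?thesis
    proof
      assume a: "C p q = -1 \<and> C q p = -1 \<and> (C q r = -1 \<and> C r q = -1 \<or> C q r = -2 \<and> C r q = -1 \<or> C q r = -1 \<and> C r q = -2)"
      have "composes v r q p" by (rule composes_rank3[OF v h(1-3) trivial_monodromy trivial_monodromy h(4-6) h(7) z]) (use a h in blast)+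
      then show ?thesis by (rule composes_reverse[OF not_sym[OF h(2)] not_sym[OF h(1)] not_sym[OF h(3)]])
    next
      assume a: "C q r = -1 \<and> C r q = -1 \<and> (C q p = -1 \<and> C p q = -1 \<or> C q p = -2 \<and> C p q = -1 \<or> C q p = -1 \<and> C p q = -2)"
      show ?thesis
        by (rule composes_rank3[OF v not_sym[OF h(2)] not_sym[OF h(1)] not_sym[OF h(3)] trivial_monodromy trivial_monodromy h(6,5,4) z h(7)]) (use a h in blast)+
    qed
  qed
  have sym: "C i j = 0 \<Longrightarrow> C j i = 0" for i j using zero_sym by blast
  show ?thesis
  proof (cases "C a b = 0")
    case ab: True
    show ?thesis
    proof (cases "C b c = 0")
      case True
      show ?thesis using prod[of c a b] ne d ab True sym by blast
    next
      case bc: False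
      show ?thesis
      proof (cases "C a c = 0")
        case True
        show ?thesis using prod[of b c a] ne d ab True sym by blast
      next
        case False
        have c: "composes v a c b" by (rule path) (use ne d ab bc False sym in blast)+
        show ?thesis by (rule composes_perms(5)[OF v ne(3) not_sym[OF ne(2)] ne(1) d(1,3,2) _ c]) (rule trivial_monodromy)
      qed
    qed
  next
    case ab: False
    show ?thesis
    proof (cases "C b c = 0")
      case bc: True
      show ?thesis
      proof (cases "C a c = 0")
        case True
        show ?thesis using prod[of a b c] ne d bc True by blast
      next
        case False
        have c: "composes v b a c" by (rule path) (use ne d ab bc False sym in blast)+
        show ?thesis by (rule composes_perms(4)[OF v not_sym[OF ne(1)] ne(3) ne(2) d(2,1,3) _ c]) (rule trivial_monodromy)
      qed
    next
      case False
      have "C a c = 0" using rank3_types(1)[OF ne] ab False by blast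
      then show ?thesis using path ne d ab False by blast
    qed
  qed
qed

theorem no_monodromy: "v \<in> W \<Longrightarrow> trivial_monodromy v"
proof (induction "len v" arbitrary: v rule: less_induct)
  case less
  have IH: "trivial_monodromy (s a \<circ> v)" if "desc v a" for a
    by (rule less.hyps) (use that less.prems in \<open>auto simp: desc_def intro: weyl_comp\<close>)
  show ?case by (rule trivial_monodromy_step[OF less.prems IH composes_all[OF less.prems _ _ _ _ _ _ IH]])
qed

end


lemma alt_snoc: "alt i j (Suc n) = alt i j n @ [if even n then i else j]"
  using alt_add[of i j n 1] by (simp add: alt_Suc)

subsection \<open>Lusztig data along reduced words\<close>

context fin_cartan
begin

lemma s_fw: "k \<noteq> i \<Longrightarrow> s i (fw k) = fw k"
  by (simp add: srefl_def fw_def fun_eq_iff)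

lemma edge_len_Af: "edge_len C M w i = M (w (fw i)) - M (w (s i (fw i))) - Af i (\<lambda>k. M (w (fw k)))"
proof -
  have "Af i (\<lambda>k. M (w (fw k))) = 2 * M (w (fw i)) + (\<Sum>k\<in>UNIV - {i}. C k i * M (w (fw k)))"
    unfolding Af_def by (subst sum.remove[of UNIV i]) auto
  then show ?thesis by (simp add: edge_len_def)
qed

lemma edge_len_sym: "edge_len C M (w \<circ> s i) i = edge_len C M w i"
proof -
  have "(\<Sum>k\<in>UNIV - {i}. C k i * M ((w \<circ> s i) (fw k))) = (\<Sum>k\<in>UNIV - {i}. C k i * M (w (fw k)))"
    by (intro sum.cong refl) (simp add: s_fw)
  then show ?thesis by (simp add: edge_len_def)
qed

lemma bump_edge_len:
  "bump i (edge_len C M w i) (\<lambda>k. M ((w \<circ> s i) (fw k))) = (\<lambda>k. M (w (fw k)))"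
proof
  fix k
  show "bump i (edge_len C M w i) (\<lambda>k. M ((w \<circ> s i) (fw k))) k = M (w (fw k))"
    unfolding edge_len_sym[of M w i, symmetric]
    unfolding edge_len_Af
    by (cases "k = i") (simp_all add: bump_def s_fw)
qed

lemma bump_inject: "bump i n f = bump i m f \<longleftrightarrow> n = m"
  by (auto simp: bump_def dest: fun_cong[of _ _ i])

text \<open>The edge lengths along an arbitrary path starting at \<open>w\<close>;
  \<open>face_datum\<close> is the case of an alternating word.\<close>

fun pd :: "'i datum \<Rightarrow> ('i wt \<Rightarrow> 'i wt) \<Rightarrow> 'i list \<Rightarrow> int list" where
  "pd M w [] = []"
| "pd M w (i # r) = edge_len C M w i # pd M (w \<circ> s i) r"

lemma length_pd [simp]: "length (pd M w r) = length r"
  by (induction r arbitrary: w) simp_all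

lemma pd_append: "pd M w (p @ r) = pd M w p @ pd M (w \<circ> act p) r"
  by (induction p arbitrary: w) (simp_all add: wact_Cons comp_assoc)

lemma vert_pd: "vert r (pd M w r) (\<lambda>k. M ((w \<circ> act r) (fw k))) = (\<lambda>k. M (w (fw k)))"
proof (induction r arbitrary: w)
  case (Cons i r)
  have "vert r (pd M (w \<circ> s i) r) (\<lambda>k. M ((w \<circ> act (i # r)) (fw k))) = (\<lambda>k. M ((w \<circ> s i) (fw k)))"
    using Cons.IH[of "w \<circ> s i"] by (simp only: wact_Cons comp_assoc)
  then show ?case by (simp only: pd.simps vert.simps bump_edge_len)
qed simp

lemma face_datum_pd: "face_datum C M w i j m = pd M w (alt i j m)"
  by (induction m) (simp_all add: face_datum_def alt_snoc pd_append)

lemma edge_len_commute: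
  assumes "i \<noteq> j" "C i j = 0" shows "edge_len C M (w \<circ> s i) j = edge_len C M w j"
proof -
  have "cox i j = 2" using assms(2) cox_2 by simp
  then have "s i \<circ> s j = s j \<circ> s i" using braid[OF assms(1)] by (simp add: alt_2 wact_Cons)
  then have "s i (s j (fw j)) = s j (fw j)" using s_fw[of j i] assms(1) by (metis comp_apply)
  moreover have "(\<Sum>k\<in>UNIV - {j}. C k j * M ((w \<circ> s i) (fw k))) = (\<Sum>k\<in>UNIV - {j}. C k j * M (w (fw k)))"
    by (intro sum.cong refl) (use assms s_fw in \<open>auto split: if_splits\<close>, metis mult_zero_left s_fw assms(2))
  ultimately show ?thesis using assms(1) by (simp add: edge_len_def s_fw)
qed

lemma right_ascent: "reduced p \<Longrightarrow> len (act p) < len (act p \<circ> s i) \<longleftrightarrow> reduced (p @ [i])"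
  using wlen_wact_le[of C "p @ [i]"] by (auto simp: reduced_def wact_append wact_Cons)

text \<open>At the bottom of a 2-face both boundary paths extend to reduced words of
  \<open>w0\<close> with a common end. This is \<open>desc_dihedral\<close> for the element that
  leads from \<open>act p\<close> to \<open>w0\<close>.\<close>

lemma two_ascents:
  assumes "reduced (p @ [i])" "reduced (p @ [j])" "i \<noteq> j"
  obtains r where "reduced (p @ alt i j (cox i j) @ r)" "act (p @ alt i j (cox i j) @ r) = w0"
    "reduced (p @ alt j i (cox i j) @ r)" "act (p @ alt j i (cox i j) @ r) = w0"
proof -
  obtain ri where ri: "reduced ((p @ [i]) @ ri)" "act ((p @ [i]) @ ri) = w0" using reduced_extend[OF assms(1)] .
  obtain rj where rj: "reduced ((p @ [j]) @ rj)" "act ((p @ [j]) @ rj) = w0" using reduced_extend[OF assms(2)] .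
  define v where "v = act (i # ri)"
  have pv: "act p \<circ> v = w0" using ri(2) by (simp add: v_def wact_append)
  have v: "v = act (j # rj)"
  proof
    fix x
    have "act p (v x) = act p (act (j # rj) x)"
      using pv rj(2) by (simp add: fun_eq_iff wact_append)
    then show "v x = act (j # rj) x" by (metis act_rev_act)
  qed
  have "reduced (p @ (i # ri))" "reduced (p @ (j # rj))" using ri(1) rj(1) by simp_all
  then have rd: "reduced (i # ri)" "reduced (j # rj)" using reduced_appendD by blast+
  then have d: "desc v i" "desc v j" using reduced_Cons_iff v v_def by metis+
  have vW: "v \<in> W" by (simp add: v_def)
  obtain r where r: "reduced (alt i j (cox i j) @ r)" "act (alt i j (cox i j) @ r) = v"
    by (rule desc_dihedral[OF vW assms(3) d])
  have "len v = Suc (length ri)" using rd(1) by (simp add: reduced_def v_def)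
  then have "length (alt i j (cox i j) @ r) = Suc (length ri)" using r by (simp add: reduced_def)
  moreover have "len w0 = length p + Suc (length ri)" using ri by (simp add: reduced_def)
  moreover have a: "act (p @ alt i j (cox i j) @ r) = w0"
    using pv r(2) by (simp add: wact_append)
  ultimately have "reduced (p @ alt i j (cox i j) @ r)" by (simp add: reduced_def)
  with a that reduced_swap[OF assms(3), of p r] show thesis by simp
qed

text \<open>A form of the tropical Pluecker relations that is uniform in the type. It also covers
  commuting pairs, where the relation is automatic, and both orders of a pair, which are exchanged
  by \<open>tr_inverse\<close>; reducedness of words expresses the ascents.\<close>

definition plucker :: "'i datum \<Rightarrow> bool" where
  "plucker M \<longleftrightarrow> (\<forall>p i j. i \<noteq> j \<longrightarrow> reduced (p @ [i]) \<longrightarrow> reduced (p @ [j]) \<longrightarrow>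
     pd M (act p) (alt j i (cox i j)) = tr i j (pd M (act p) (alt i j (cox i j))))"

lemma pluckerD: "plucker M \<Longrightarrow> i \<noteq> j \<Longrightarrow> reduced (p @ [i]) \<Longrightarrow> reduced (p @ [j]) \<Longrightarrow>
     pd M (act p) (alt j i (cox i j)) = tr i j (pd M (act p) (alt i j (cox i j)))"
  unfolding plucker_def by simp

lemma tr_types:
  assumes "C i j \<noteq> 0" "C i j \<le> C j i" "i \<noteq> j"
  shows "C i j * C j i = 1 \<Longrightarrow> cox i j = 3 \<and> tr i j t = a2_trans t"
    "C i j * C j i = 2 \<Longrightarrow> cox i j = 4 \<and> tr i j t = b2_trans t"
    "C i j * C j i \<noteq> 1 \<Longrightarrow> C i j * C j i \<noteq> 2 \<Longrightarrow> cox i j = 6 \<and> tr i j t = g2_trans t"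
  using rank2_types[OF assms(3)] assms(1,2) by (auto simp: cox_def tr_def)

lemma tp_iff: "tropical_pluecker C M \<longleftrightarrow> plucker M"
proof
  assume tp: "tropical_pluecker C M"
  have main: "pd M (act p) (alt j i (cox i j)) = tr i j (pd M (act p) (alt i j (cox i j)))"
    if h: "i \<noteq> j" "reduced (p @ [i])" "reduced (p @ [j])" "C i j \<noteq> 0" "C i j \<le> C j i" for p i j
  proof -
    have rp: "reduced p" using reduced_appendD[OF h(2)] by simp
    have asc: "len (act p) < len (act p \<circ> s i)" "len (act p) < len (act p \<circ> s j)"
      using right_ascent[OF rp] h(2,3) by simp_all
    note X = tp[unfolded tropical_pluecker_def face_datum_pd, THEN bspec, OF wact_in_weyl[of C p],
        THEN spec, THEN spec, THEN mp, of i j]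
    have "if C i j * C j i = 1 then pd M (act p) (alt j i 3) = a2_trans (pd M (act p) (alt i j 3))
      else if C i j * C j i = 2 then pd M (act p) (alt j i 4) = b2_trans (pd M (act p) (alt i j 4))
      else pd M (act p) (alt j i 6) = g2_trans (pd M (act p) (alt i j 6))"
      by (rule X) (intro conjI h asc)
    then show ?thesis using tr_types[OF h(4,5,1)] by (simp split: if_splits)
  qed
  show "plucker M"
    unfolding plucker_def
  proof (intro allI impI)
    fix p i j assume h: "i \<noteq> j" "reduced (p @ [i])" "reduced (p @ [j])"
    show "pd M (act p) (alt j i (cox i j)) = tr i j (pd M (act p) (alt i j (cox i j)))"
    proof (cases "C i j = 0")
      case True
      then have c: "cox i j = 2" "C j i = 0" using cox_2 zero_sym by simp_all
      show ?thesis unfolding c(1) tr_2[OF c(1)] alt_2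
        using edge_len_commute[OF h(1) True] edge_len_commute[OF not_sym[OF h(1)] c(2)] by simp
    next
      case False
      then have "C j i \<noteq> 0" using zero_sym by simp
      show ?thesis
      proof (cases "C i j \<le> C j i")
        case True
        then show ?thesis using main[OF h False] by simp
      next
        case False
        then have e: "pd M (act p) (alt i j (cox j i)) = tr j i (pd M (act p) (alt j i (cox j i)))"
          using main[OF not_sym[OF h(1)] h(3,2) \<open>C j i \<noteq> 0\<close>] by simp
        show ?thesis unfolding cox_sym[of i j] e
          by (rule tr_inverse[symmetric]) (use h(1) in simp_all)
      qed
    qed
  qed
next
  assume tp: "plucker M"
  show "tropical_pluecker C M"
    unfolding tropical_pluecker_def
  proof (intro ballI allI impI, elim conjE)
    fix w i j assume h: "w \<in> W" "i \<noteq> j" "C i j \<noteq> 0" "C i j \<le> C j i" "len w < len (w \<circ> s i)" "len w < len (w \<circ> s j)"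
    obtain p where p: "reduced p" "act p = w" using reduced_word_ex[OF h(1)] .
    have "pd M w (alt j i (cox i j)) = tr i j (pd M w (alt i j (cox i j)))"
      using pluckerD[OF tp h(2), of p] right_ascent[OF p(1)] h(5,6) p(2) by simp
    then show "if C i j * C j i = 1 then face_datum C M w j i 3 = a2_trans (face_datum C M w i j 3)
         else if C i j * C j i = 2 then face_datum C M w j i 4 = b2_trans (face_datum C M w i j 4)
         else face_datum C M w j i 6 = g2_trans (face_datum C M w i j 6)"
      unfolding face_datum_pd using tr_types[OF h(3,4,2)]
      by (cases "C i j * C j i = 1"; cases "C i j * C j i = 2") (simp_all split del: if_split)
  qed
qed

text \<open>Each braid move is the Pluecker relation of the 2-face that it crosses. The prefix
  \<open>u\<close> allows paths starting at any vertex.\<close>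

lemma pd_bs:
  assumes "plucker M" "bs (x, pd M (act u) x) \<tau>" "reduced (u @ x)"
  shows "snd \<tau> = pd M (act u) (fst \<tau>)"
  using assms(2)
proof (induction rule: rtranclp_induct)
  case (step \<tau> \<rho>)
  have act: "act (fst \<tau>) = act x" "length (fst \<tau>) = length x" using bs_inv[OF step.hyps(1)] by auto
  then have red: "reduced (u @ fst \<tau>)" using assms(3) by (simp add: reduced_def wact_append)
  from step.hyps(2) show ?case
  proof (cases rule: bstep.cases)
    case (bstep i j t tp p tq q)
    have red': "reduced (u @ p @ alt i j (cox i j) @ q)" using red by (simp add: bstep(1))
    obtain m where m: "cox i j = Suc m" by (rule cox_Suc)
    have "reduced ((u @ p) @ [i])"
      using red' reduced_appendD[of "(u @ p) @ [i]" "alt j i m @ q"] by (simp add: m alt_Suc)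
    moreover have "reduced ((u @ p) @ [j])"
      using red' reduced_swap(2)[OF bstep(3), of "u @ p" q] reduced_appendD[of "(u @ p) @ [j]" "alt i j m @ q"]
      by (simp add: m alt_Suc)
    ultimately have f: "pd M (act (u @ p)) (alt j i (cox i j)) = tr i j (pd M (act (u @ p)) (alt i j (cox i j)))"
      by (rule pluckerD[OF assms(1) bstep(3)])
    have "tp @ t @ tq = pd M (act u) (p @ alt i j (cox i j) @ q)" using step.IH by (simp add: bstep(1))
    then have "tp = pd M (act u) p" "t = pd M (act (u @ p)) (alt i j (cox i j))"
      "tq = pd M (act u \<circ> act p \<circ> act (alt i j (cox i j))) q"
      using bstep(4-6) by (simp_all add: pd_append wact_append comp_assoc)
    then show ?thesis
      using f braid[OF bstep(3)] by (simp add: bstep(2) pd_append wact_append comp_assoc)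
  qed
qed simp

definition norm0 :: "'i datum \<Rightarrow> bool" where
  "norm0 M \<longleftrightarrow> (\<forall>k. M (w0 (fw k)) = 0)"

lemma mv_datum_iff: "mv_datum C M \<longleftrightarrow> pw_datum C M \<and> plucker M \<and> norm0 M"
  by (simp add: mv_datum_def tp_iff norm0_def longest_iff)

lemma vertex_from_pd:
  assumes "norm0 M" "act (p @ r) = w0"
  shows "(\<lambda>k. M (act p (fw k))) = vert r (pd M (act p) r) (\<lambda>_. 0)"
proof -
  have "(\<lambda>k. M ((act p \<circ> act r) (fw k))) = (\<lambda>_. 0)"
    using assms by (simp add: norm0_def flip: wact_append)
  then show ?thesis using vert_pd[of r M "act p"] by simp
qed

text \<open>The tuple is transported to a word through the given vertex, whose values are then
  rebuilt downwards from the normalised vertex at \<open>w0\<close>. A nonempty \<open>u\<close>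
  restricts the comparison to the part above \<open>act u\<close>, as needed for one half of the
  polytope.\<close>

lemma agree_above:
  assumes "plucker M" "norm0 M" "plucker M'" "norm0 M'" "reduced (u @ x)" "act (u @ x) = w0"
    and "pd M (act u) x = pd M' (act u) x" and "reduced (u @ p)"
  shows "M (act (u @ p) (fw k)) = M' (act (u @ p) (fw k))"
proof -
  obtain r where r: "reduced ((u @ p) @ r)" "act ((u @ p) @ r) = w0" using reduced_extend[OF assms(8)] .
  have "act x = act (p @ r)"
  proof
    fix y
    have "act u (act x y) = act u (act (p @ r) y)"
      using assms(6) r(2) by (simp add: wact_append fun_eq_iff)
    then show "act x y = act (p @ r) y" by (metis act_rev_act)
  qed
  moreover have "reduced x" "reduced (p @ r)"
    using reduced_appendD[of u x] reduced_appendD[of u "p @ r"] assms(5) r(1) by simp_all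
  ultimately obtain t where t: "bs (x, pd M (act u) x) (p @ r, t)"
    using matsumoto[of x "p @ r" "pd M (act u) x"] by auto
  have "t = pd M (act u) (p @ r)" using pd_bs[OF assms(1) t assms(5)] by simp
  moreover have "t = pd M' (act u) (p @ r)" using pd_bs[OF assms(3) t[unfolded assms(7)] assms(5)] by simp
  ultimately have "pd M (act (u @ p)) r = pd M' (act (u @ p)) r"
    by (simp add: pd_append wact_append)
  then have "(\<lambda>k. M (act (u @ p) (fw k))) = (\<lambda>k. M' (act (u @ p) (fw k)))"
    unfolding vertex_from_pd[OF assms(2) r(2)] vertex_from_pd[OF assms(4) r(2)] by simp
  then show ?thesis by (rule fun_cong)
qed

lemma datum_eqI:
  assumes "mv_datum C M" "mv_datum C M'" "reduced x" "act x = w0" "pd M id x = pd M' id x"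
  shows "M = M'"
proof
  fix \<gamma>
  show "M \<gamma> = M' \<gamma>"
  proof (cases "\<gamma> \<in> chamber C")
    case True
    then obtain w k where w: "w \<in> W" "\<gamma> = w (fw k)" by (auto simp: chamber_def)
    obtain p where p: "reduced p" "act p = w" using reduced_word_ex[OF w(1)] .
    show ?thesis
      using agree_above[of M M' "[]" x p k] assms p w(2) by (simp add: mv_datum_iff)
  next
    case False
    then show ?thesis using assms(1,2) by (simp add: mv_datum_def pw_datum_def)
  qed
qed

subsection \<open>Existence of a datum with given Lusztig datum\<close>

text \<open>Needed for \<open>the_datum\<close> to be well defined: a chamber weight determines the
  index of its fundamental weight. Descents are stripped off as in
  \<open>stabilizer\<close>.\<close>

lemma fw_orbit:
  assumes "w \<in> W" "w (fw l) = fw k" shows "l = k"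
  using assms
proof (induction "len w" arbitrary: w)
  case 0
  then have "w = id" using wlen_eq_0 by metis
  then have "fw l k = (fw k k :: int)" using 0 by simp
  then show ?case by (simp add: fw_def split: if_splits)
next
  case (Suc n)
  obtain ws where ws: "reduced ws" "act ws = w" using reduced_word_ex[OF Suc.prems(1)] .
  with Suc.hyps(2) obtain i ws' where i: "ws = i # ws'" by (cases ws) (auto simp: reduced_def)
  have d: "desc w i" using ws i reduced_Cons_iff by blast
  then have "i \<noteq> k" using desc_nonpos[OF Suc.prems(1) d, of l] Suc.prems(2) by (auto simp: fw_def)
  then have "(s i \<circ> w) (fw l) = fw k" using Suc.prems(2) s_fw[of k i] by simp
  then show ?case
    by (intro Suc.hyps(1)[of "s i \<circ> w"])
      (use len_desc[OF Suc.prems(1) d] Suc.hyps(2) weyl_comp[OF srefl_in_weyl Suc.prems(1)] in auto)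
qed

lemma vert_bs:
  assumes "bs (r, t) \<tau>" "length t = length r" shows "vert (fst \<tau>) (snd \<tau>) f = vert r t f"
  using assms(1)
proof (induction rule: rtranclp_induct)
  case (step \<tau> \<rho>)
  from step.hyps(2) show ?case
  proof (cases rule: bstep.cases)
    case (bstep i j t tp p tq q)
    have "vert (p @ alt j i (cox i j) @ q) (tp @ tr i j t @ tq) f = vert (p @ alt i j (cox i j) @ q) (tp @ t @ tq) f"
      using bstep(4-6) tr_vert[OF bstep(3,4)] length_tr[OF bstep(4)] by (simp add: vert_append)
    then show ?thesis using step.IH by (simp add: bstep(1,2))
  qed
qed simp

lemma bs_nonneg:
  assumes "bs \<sigma> \<tau>" "\<forall>x\<in>set (snd \<sigma>). 0 \<le> x" shows "\<forall>x\<in>set (snd \<tau>). 0 \<le> x"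
  using assms(1)
proof (induction rule: rtranclp_induct)
  case (step \<tau> \<rho>)
  from step.hyps(2) show ?case
  proof (cases rule: bstep.cases)
    case (bstep i j t tp p tq q)
    then show ?thesis using tr_nonneg[OF bstep(4)] step.IH by auto
  qed
qed (use assms(2) in simp)

end


context fin_cartan
begin

definition word :: "'i list \<Rightarrow> bool" where
  "word x \<longleftrightarrow> reduced x \<and> act x = w0"

lemma word_split:
  assumes "word (p @ r)" shows "reduced p" "reduced r" "act r = act (rev p) \<circ> w0"
proof -
  show "reduced p" "reduced r" using assms reduced_appendD[of p r] by (simp_all add: word_def)
  show "act r = act (rev p) \<circ> w0"
  proof
    fix x
    have "act p (act r x) = w0 x" using assms by (simp add: word_def wact_append fun_eq_iff)
    then show "act r x = (act (rev p) \<circ> w0) x" using act_rev_act[of p "act r x"] by simp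
  qed
qed

lemma act_rev_eq: "act p = act p' \<Longrightarrow> act (rev p) = act (rev p')"
proof
  fix x assume "act p = act p'"
  then have "act p' (act (rev p) x) = x" using act_act_rev[of p x] by simp
  then show "act (rev p) x = act (rev p') x" using act_rev_act[of p' "act (rev p) x"] by simp
qed

text \<open>Every edge of direction \<open>i\<close> has a lower end, where \<open>i\<close> extends
  a reduced word. With \<open>edge_len_sym\<close> this reduces claims about edges to reduced
  words.\<close>

lemma right_cases:
  assumes "w \<in> W"
  obtains p where "reduced (p @ [i])" "act p = w" | p where "reduced (p @ [i])" "act p = w \<circ> s i"
proof -
  obtain p where p: "reduced p" "act p = w" using reduced_word_ex[OF assms] .
  show thesis
  proof (cases "reduced (p @ [i])")
    case True
    then show thesis using that(1) p(2) by blast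
  next
    case False
    then have d: "desc (act (rev p)) i"
      using reduced_rev[of "p @ [i]"] reduced_rev[of p] reduced_Cons_iff'[of i "rev p"] p(1) by simp
    have vW: "s i \<circ> act (rev p) \<in> W" by (rule weyl_comp) simp_all
    obtain q where q: "reduced q" "act q = s i \<circ> act (rev p)" using reduced_word_ex[OF vW] .
    have "\<not> desc (act q) i" unfolding q(2) using desc_s[of "act (rev p)" i] d by simp
    then have "reduced (i # q)" using reduced_Cons_iff'[of i q] q(1) by simp
    then have "reduced (rev q @ [i])" using reduced_rev[of "i # q"] by simp
    moreover have "act (rev q) = w \<circ> s i"
    proof
      fix x
      have "act q (act p (s i x)) = x" by (simp add: q(2))
      then show "act (rev q) x = (w \<circ> s i) x"
        using act_rev_act[of q "act p (s i x)"] p(2) by simp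
    qed
    ultimately show thesis by (rule that(2))
  qed
qed

lemma pd_nonneg:
  assumes "pw_datum C M" shows "w \<in> W \<Longrightarrow> \<forall>x\<in>set (pd M w r). 0 \<le> x"
proof (induction r arbitrary: w)
  case (Cons i r)
  have "0 \<le> edge_len C M w i" using assms Cons.prems unfolding pw_datum_def by simp
  moreover have "\<forall>x\<in>set (pd M (w \<circ> s i) r). 0 \<le> x"
    by (rule Cons.IH[OF weyl_comp[OF Cons.prems srefl_in_weyl]])
  ultimately show ?case unfolding pd.simps list.set by blast
qed simp

lemma edge_len_cong:
  assumes "\<And>k. M (w (fw k)) = M' (w (fw k))" "M (w (s i (fw i))) = M' (w (s i (fw i)))"
  shows "edge_len C M w i = edge_len C M' w i"
  unfolding edge_len_Af using assms by simp

lemma pd_cong: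
  assumes "\<And>p q k. r = p @ q \<Longrightarrow> M ((w \<circ> act p) (fw k)) = M' ((w \<circ> act p) (fw k))"
  shows "pd M w r = pd M' w r"
  using assms
proof (induction r arbitrary: w)
  case (Cons i r)
  have "M (w (fw k)) = M' (w (fw k))" for k using Cons.prems[of "[]" "i # r" k] by simp
  moreover have "M (w (s i (fw i))) = M' (w (s i (fw i)))"
    using Cons.prems[of "[i]" r i] by (simp add: wact_Cons)
  moreover have "pd M (w \<circ> s i) r = pd M' (w \<circ> s i) r"
    by (rule Cons.IH) (use Cons.prems[of "i # _"] in \<open>simp add: wact_Cons\<close>)
  ultimately show ?case using edge_len_cong[of M w M' i] by simp
qed simp

end

text \<open>Edge lengths \<open>t0\<close> prescribed along one reduced word \<open>x0\<close> of
  \<open>w0\<close>, from which a whole datum is constructed.\<close>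

locale lusztig_datum = fin_cartan C for C :: "'i::finite \<Rightarrow> 'i \<Rightarrow> int" +
  fixes x0 :: "'i list" and t0 :: "int list"
  assumes x0: "word x0" and t0: "length t0 = length x0" "\<forall>x\<in>set t0. 0 \<le> x"
begin

text \<open>The choice is harmless: by \<open>lus_step\<close>, where trivial monodromy enters,
  every chain of moves leads to the same tuple.\<close>

definition lus :: "'i list \<Rightarrow> int list" where
  "lus x = (SOME u. bs (x0, t0) (x, u))"

lemma lus_bs: assumes "word x" shows "bs (x0, t0) (x, lus x)"
proof -
  have "\<exists>u. length u = length x \<and> bs (x0, t0) (x, u)"
    by (rule matsumoto) (use assms x0 t0 in \<open>auto simp: word_def\<close>)
  then have "\<exists>u. bs (x0, t0) (x, u)" by auto
  then show ?thesis unfolding lus_def by (rule someI_ex)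
qed

lemma length_F: "word x \<Longrightarrow> length (lus x) = length x"
  using bs_inv[OF lus_bs] t0(1) by simp

lemma lus_nonneg: "word x \<Longrightarrow> \<forall>a\<in>set (lus x). 0 \<le> a"
  using bs_nonneg[OF lus_bs] t0(2) by simp

lemma lus_step:
  assumes "word x" "bs (x, lus x) (y, u)" shows "lus y = u"
proof -
  have wy: "word y" using bs_inv[OF assms(2)] assms(1) by (simp add: word_def)
  have "bs (x0, t0) (y, u)" using lus_bs[OF assms(1)] assms(2) by (rule rtranclp_trans)
  then have "bs (y, u) (x0, t0)" by (rule bs_sym)
  then have "bs (y, u) (y, lus y)" using lus_bs[OF wy] by (rule rtranclp_trans)
  moreover have "length u = length y" using bs_inv[OF assms(2)] length_F[OF assms(1)] by simp
  ultimately show ?thesis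
    using no_monodromy[OF w0_in_weyl, unfolded trivial_monodromy_def, rule_format, of y u "lus y"] wy[unfolded word_def]
    by blast
qed

lemma lus_x0: "lus x0 = t0"
proof -
  have "bs (x0, lus x0) (x0, t0)" by (rule bs_sym) (rule lus_bs[OF x0])
  then show ?thesis by (rule lus_step[OF x0])
qed

definition vtx :: "'i list \<Rightarrow> 'i list \<Rightarrow> 'i \<Rightarrow> int" where
  "vtx p r = vert r (drop (length p) (lus (p @ r))) (\<lambda>_. 0)"

text \<open>Two words through the same vertex are connected by moves below it and moves above it.
  The former leave the upper part of the tuple alone, the latter preserve
  \<open>vert\<close>.\<close>

lemma vtx_indep:
  assumes "word (p @ r)" "word (p' @ r')" "act p = act p'" shows "vtx p r = vtx p' r'"
proof -
  note w = word_split[OF assms(1)] and w' = word_split[OF assms(2)]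
  let ?a = "take (length p) (lus (p @ r))" and ?b = "drop (length p) (lus (p @ r))"
  have la: "length ?a = length p" and lb: "length ?b = length r" using length_F[OF assms(1)] by simp_all
  have "act r = act r'" unfolding w(3) w'(3) using act_rev_eq[OF assms(3)] by simp
  then obtain b where b: "length b = length r'" "bs (r, ?b) (r', b)"
    using matsumoto[OF w(2) w'(2) _ lb] by auto
  obtain a where a: "length a = length p'" "bs (p, ?a) (p', a)"
    using matsumoto[OF w(1) w'(1) assms(3) la] by auto
  have "bs ([] @ p @ r, [] @ ?a @ ?b) ([] @ p' @ r, [] @ a @ ?b)"
    by (rule bs_context[OF a(2)]) (use lb in simp_all)
  moreover have "bs (p' @ r @ [], a @ ?b @ []) (p' @ r' @ [], a @ b @ [])"
    by (rule bs_context[OF b(2)]) (use a(1) in simp_all)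
  ultimately have "bs (p @ r, lus (p @ r)) (p' @ r', a @ b)" by (simp add: rtranclp_trans)
  then have "lus (p' @ r') = a @ b" by (rule lus_step[OF assms(1)])
  then have "vtx p' r' = vert r' b (\<lambda>_. 0)" using a(1) by (simp add: vtx_def)
  also have "\<dots> = vtx p r" using vert_bs[OF b(2) lb] by (simp add: vtx_def)
  finally show ?thesis by simp
qed

definition vertex :: "('i wt \<Rightarrow> 'i wt) \<Rightarrow> 'i \<Rightarrow> int" where
  "vertex w = (SOME f. \<exists>p r. word (p @ r) \<and> act p = w \<and> f = vtx p r)"

lemma vertex_eq: assumes "word (p @ r)" shows "vertex (act p) = vtx p r"
proof -
  have "\<exists>f p' r'. word (p' @ r') \<and> act p' = act p \<and> f = vtx p' r'" using assms by blast
  from someI_ex[OF this] obtain p' r' where "word (p' @ r')" "act p' = act p" "vertex (act p) = vtx p' r'"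
    unfolding vertex_def by blast
  then show ?thesis using vtx_indep[OF assms] by simp
qed

lemma word_extend: assumes "reduced p" obtains r where "word (p @ r)"
  using reduced_extend[OF assms] unfolding word_def by blast

lemma vertex_bump:
  assumes "word (p @ i # r)"
  shows "vertex (act p) = bump i (lus (p @ i # r) ! length p) (vertex (act p \<circ> s i))"
proof -
  have d: "drop (length p) (lus (p @ i # r)) = lus (p @ i # r) ! length p # drop (Suc (length p)) (lus (p @ i # r))"
    by (rule Cons_nth_drop_Suc[symmetric]) (simp add: length_F[OF assms])
  have "word ((p @ [i]) @ r)" using assms by simp
  from vertex_eq[OF this] have "vertex (act p \<circ> s i) = vert r (drop (Suc (length p)) (lus (p @ i # r))) (\<lambda>_. 0)"
    by (simp add: vtx_def wact_append wact_Cons)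
  then show ?thesis unfolding vertex_eq[OF assms] vtx_def d by simp
qed

text \<open>An edge of direction \<open>i\<close> changes only the value at index \<open>i\<close>.
  Together with \<open>fw_coset\<close> this makes the value at \<open>w (fw k)\<close> independent
  of the choice of \<open>w\<close>.\<close>

lemma vertex_s: assumes "w \<in> W" "k \<noteq> i" shows "vertex (w \<circ> s i) k = vertex w k"
proof -
  have up: "vertex (act p \<circ> s i) k = vertex (act p) k" if p: "reduced (p @ [i])" for p
  proof -
    obtain r where "word ((p @ [i]) @ r)" using word_extend[OF p] .
    then have "word (p @ i # r)" by simp
    from vertex_bump[OF this] show ?thesis using assms(2) by (simp add: bump_def)
  qed
  show ?thesis
  proof (rule right_cases[OF assms(1), of i])
    fix p assume "reduced (p @ [i])" "act p = w"
    then show ?thesis using up by blast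
  next
    fix p assume p: "reduced (p @ [i])" "act p = w \<circ> s i"
    have "w \<circ> s i \<circ> s i = w" by (simp add: fun_eq_iff)
    then show ?thesis using up[OF p(1)] unfolding p(2) by simp
  qed
qed

lemma vertex_act: assumes "w \<in> W" shows "k \<notin> set zs \<Longrightarrow> vertex (w \<circ> act zs) k = vertex w k"
proof (induction zs rule: rev_induct)
  case (snoc i zs)
  have "vertex (w \<circ> act zs \<circ> s i) k = vertex (w \<circ> act zs) k"
    by (rule vertex_s) (use snoc.prems weyl_comp[OF assms wact_in_weyl] in auto)
  moreover have "vertex (w \<circ> act zs) k = vertex w k" by (rule snoc.IH) (use snoc.prems in simp)
  ultimately show ?case by (simp only: wact_append wact_Cons wact_Nil comp_assoc comp_id)
qed simp

definition the_datum :: "'i datum" where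
  "the_datum \<gamma> = (if \<gamma> \<in> chamber C then THE n. \<exists>w k. w \<in> W \<and> \<gamma> = w (fw k) \<and> n = vertex w k else 0)"

lemma the_datum_eq: assumes "w \<in> W" shows "the_datum (w (fw k)) = vertex w k"
proof -
  have uniq: "vertex v l = vertex w k" if h: "v \<in> W" "w (fw k) = v (fw l)" for v l
  proof -
    obtain p where p: "act p = w" using reduced_word_ex[OF assms] by blast
    have "act (rev p) (v (fw l)) = fw k" using h(2) p act_rev_act[of p "fw k"] by simp
    then have "(act (rev p) \<circ> v) (fw l) = fw k" by simp
    then have l: "l = k" by (rule fw_orbit[OF weyl_comp[OF wact_in_weyl h(1)]])
    have "w (fw k) = v (fw k)" using h(2) l by simp
    then obtain zs where "k \<notin> set zs" "v = w \<circ> act zs" by (rule fw_coset[OF assms h(1)])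
    then show ?thesis using vertex_act[OF assms] l by simp
  qed
  have ch: "w (fw k) \<in> chamber C" using assms by (auto simp: chamber_def)
  have "the_datum (w (fw k)) = (THE n. \<exists>v l. v \<in> W \<and> w (fw k) = v (fw l) \<and> n = vertex v l)"
    unfolding the_datum_def using ch by (simp only: if_True)
  also have "\<dots> = vertex w k"
  proof (rule the_equality)
    show "\<exists>v l. v \<in> W \<and> w (fw k) = v (fw l) \<and> vertex w k = vertex v l"
      by (rule exI[of _ w], rule exI[of _ k]) (intro conjI assms refl)
  next
    fix n assume "\<exists>v l. v \<in> W \<and> w (fw k) = v (fw l) \<and> n = vertex v l"
    then obtain v l where "v \<in> W" "w (fw k) = v (fw l)" "n = vertex v l" by (elim exE conjE)
    then show "n = vertex w k" using uniq[of v l] by (simp only:)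
  qed
  finally show ?thesis .
qed

lemma the_datum_edge:
  assumes "word (p @ i # r)" shows "edge_len C the_datum (act p) i = lus (p @ i # r) ! length p"
proof -
  have v: "(\<lambda>k. the_datum (w (fw k))) = vertex w" if "w \<in> W" for w using the_datum_eq[OF that] by auto
  have "bump i (edge_len C the_datum (act p) i) (vertex (act p \<circ> s i)) = vertex (act p)"
    using bump_edge_len[of i the_datum "act p"]
    unfolding v[OF wact_in_weyl] v[OF weyl_comp[OF wact_in_weyl srefl_in_weyl]] .
  then show ?thesis unfolding vertex_bump[OF assms] bump_inject .
qed

lemma the_datum_pd: "word (p @ q) \<Longrightarrow> pd the_datum (act p) q = drop (length p) (lus (p @ q))"
proof (induction q arbitrary: p)
  case Nil
  then show ?case using length_F[of p] by simp
next
  case (Cons i q)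
  have "drop (length p) (lus (p @ i # q)) = lus (p @ i # q) ! length p # drop (Suc (length p)) (lus (p @ i # q))"
    by (rule Cons_nth_drop_Suc[symmetric]) (simp add: length_F[OF Cons.prems])
  moreover have "pd the_datum (act (p @ [i])) q = drop (length (p @ [i])) (lus ((p @ [i]) @ q))"
    by (rule Cons.IH) (use Cons.prems in simp)
  ultimately show ?case using the_datum_edge[OF Cons.prems] by (simp add: wact_append wact_Cons)
qed

lemma the_datum_pd_id: "word x \<Longrightarrow> pd the_datum id x = lus x"
  using the_datum_pd[of "[]" x] by simp

lemma the_datum_pw: "pw_datum C the_datum"
  unfolding pw_datum_def
proof (intro conjI allI ballI impI)
  fix \<gamma> assume "\<gamma> \<notin> chamber C"
  then show "the_datum \<gamma> = 0" by (simp add: the_datum_def)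
next
  fix w i assume w: "w \<in> W"
  have up: "0 \<le> edge_len C the_datum (act p) i" if p: "reduced (p @ [i])" for p
  proof -
    obtain r where "word ((p @ [i]) @ r)" using word_extend[OF p] .
    then have x: "word (p @ i # r)" by simp
    have "lus (p @ i # r) ! length p \<in> set (lus (p @ i # r))" by (rule nth_mem) (simp add: length_F[OF x])
    then show ?thesis using lus_nonneg[OF x] unfolding the_datum_edge[OF x] by blast
  qed
  show "0 \<le> edge_len C the_datum w i"
  proof (rule right_cases[OF w, of i])
    fix p assume "reduced (p @ [i])" "act p = w"
    then show ?thesis using up by blast
  next
    fix p assume p: "reduced (p @ [i])" "act p = w \<circ> s i"
    show ?thesis using up[OF p(1)] unfolding p(2) edge_len_sym .
  qed
qed

lemma the_datum_plucker: "plucker the_datum"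
  unfolding plucker_def
proof (intro allI impI)
  fix p i j assume h: "i \<noteq> j" "reduced (p @ [i])" "reduced (p @ [j])"
  obtain r where r: "reduced (p @ alt i j (cox i j) @ r)" "act (p @ alt i j (cox i j) @ r) = w0"
    "reduced (p @ alt j i (cox i j) @ r)" "act (p @ alt j i (cox i j) @ r) = w0"
    using two_ascents[OF h(2,3,1)] .
  let ?x = "p @ alt i j (cox i j) @ r" and ?y = "p @ alt j i (cox i j) @ r"
  let ?t = "pd the_datum (act p) (alt i j (cox i j))"
  let ?q = "pd the_datum (act p \<circ> act (alt i j (cox i j))) r"
  have wx: "word ?x" "word ?y" using r by (simp_all add: word_def)
  have x: "lus ?x = pd the_datum id p @ ?t @ ?q"
    using the_datum_pd_id[OF wx(1)] by (simp add: pd_append)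
  have y: "lus ?y = pd the_datum id p @ pd the_datum (act p) (alt j i (cox i j)) @ ?q"
    using the_datum_pd_id[OF wx(2)] braid[OF h(1)] by (simp add: pd_append)
  have "bstep (?x, pd the_datum id p @ ?t @ ?q) (?y, pd the_datum id p @ tr i j ?t @ ?q)"
    by (rule bstep[OF h(1)]) simp_all
  then have "bs (?x, lus ?x) (?y, pd the_datum id p @ tr i j ?t @ ?q)" unfolding x by (rule r_into_rtranclp)
  then have "lus ?y = pd the_datum id p @ tr i j ?t @ ?q" by (rule lus_step[OF wx(1)])
  then show "pd the_datum (act p) (alt j i (cox i j)) = tr i j ?t"
    unfolding y by (simp only: same_append_eq append_same_eq)
qed

lemma the_datum_norm0: "norm0 the_datum"
proof -
  have "vertex w0 = (\<lambda>_. 0)"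
    using vertex_eq[of x0 "[]"] x0 length_F[OF x0] by (simp add: vtx_def word_def)
  then show ?thesis unfolding norm0_def the_datum_eq[OF w0_in_weyl] by simp
qed

lemma exists_datum: "\<exists>M. mv_datum C M \<and> pd M id x0 = t0"
  by (intro exI[of _ the_datum]) (simp add: mv_datum_iff the_datum_pw the_datum_plucker the_datum_norm0 the_datum_pd_id[OF x0] lus_x0)

end

subsection \<open>The Kashiwara operator\<close>

context fin_cartan
begin

lemma Wminus_iff: "w \<in> Wminus C j \<longleftrightarrow> w \<in> W \<and> desc w j"
  by (simp add: Wminus_def desc_def)

lemma Wplus_iff: "w \<in> Wplus C j \<longleftrightarrow> w \<in> W \<and> \<not> desc w j"
  using len_not_desc[of w j] by (auto simp: Wplus_def desc_def)

lemma Wminus_word: assumes "w \<in> Wminus C j" obtains p where "reduced (j # p)" "act (j # p) = w"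
proof -
  have w: "w \<in> W" "desc w j" using assms by (simp_all add: Wminus_iff)
  obtain p where p: "reduced p" "act p = s j \<circ> w"
    using reduced_word_ex[OF weyl_comp[OF srefl_in_weyl w(1)]] .
  have "act (j # p) = w" by (simp add: p(2) wact_Cons)
  then show thesis using that[of p] reduced_Cons_iff[of j p] p(1) w(2) by simp
qed

lemma word_Wminus: "reduced (j # p) \<Longrightarrow> act (j # p) \<in> Wminus C j"
  using reduced_Cons_iff[of j p] by (simp add: Wminus_iff)

lemma reduced_single: "reduced [j]"
proof -
  have "\<not> desc id j" by (subst not_desc_iff) (simp_all add: fw_def)
  then show ?thesis using reduced_Cons_iff'[of j "[]"] by (simp add: reduced_def)
qed

definition half :: "'i \<Rightarrow> 'i datum \<Rightarrow> 'i datum \<Rightarrow> bool" where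
  "half j M M' \<longleftrightarrow> (\<forall>w\<in>Wminus C j. \<forall>i. M (w (fw i)) = M' (w (fw i)))"

lemma halfD: "half j M M' \<Longrightarrow> w \<in> Wminus C j \<Longrightarrow> M (w (fw k)) = M' (w (fw k))"
  by (simp add: half_def)

text \<open>A reduced word of \<open>w0\<close> that starts with \<open>j\<close> stays in
  \<open>Wminus C j\<close> after its first letter, so the edge lengths from there on agree; the
  value at \<open>fw j\<close> fixes the first edge.\<close>

lemma half_eqI:
  assumes "mv_datum C M" "mv_datum C M'" "half j M M'" "M (fw j) = M' (fw j)"
  shows "M = M'"
proof -
  obtain r where r: "reduced ([j] @ r)" "act ([j] @ r) = w0" using reduced_extend[OF reduced_single] .
  have up: "M ((s j \<circ> act p) (fw k)) = M' ((s j \<circ> act p) (fw k))" if "r = p @ q" for p q k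
  proof -
    have "reduced (j # p)" using r(1) reduced_appendD[of "j # p" q] that by simp
    then have "act (j # p) \<in> Wminus C j" by (rule word_Wminus)
    from halfD[OF assms(3) this, of k] show ?thesis by (simp add: wact_Cons)
  qed
  have tail: "pd M (s j) r = pd M' (s j) r" by (rule pd_cong) (rule up)
  have m: "M (s j (fw k)) = M' (s j (fw k))" for k using up[of "[]" r k] by simp
  have "M (id (fw k)) = M' (id (fw k))" for k
    using m[of k] s_fw[of k j] assms(4) by (cases "k = j") simp_all
  then have "edge_len C M id j = edge_len C M' id j" by (rule edge_len_cong) (simp add: m)
  then have "pd M id ([j] @ r) = pd M' id ([j] @ r)" using tail by simp
  then show ?thesis using datum_eqI[OF assms(1,2) r] by simp
qed

text \<open>Along a reduced word of \<open>w0\<close> starting with \<open>j\<close>, the first edge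
  is lengthened by 1 and the other lengths are kept. By \<open>agree_above\<close> nothing changes
  above \<open>s j\<close>.\<close>

lemma half_step:
  assumes "mv_datum C M"
  shows "\<exists>M'. mv_datum C M' \<and> half j M' M \<and> M' (fw j) = M (fw j) - 1"
proof -
  obtain r where r: "reduced ([j] @ r)" "act ([j] @ r) = w0" using reduced_extend[OF reduced_single] .
  have M: "pw_datum C M" "plucker M" "norm0 M" using assms by (simp_all add: mv_datum_iff)
  let ?t = "(edge_len C M id j + 1) # pd M (s j) r"
  have nn: "\<forall>x\<in>set (pd M id ([j] @ r)). 0 \<le> x" by (rule pd_nonneg[OF M(1)]) simp
  interpret L: lusztig_datum C "[j] @ r" ?t
    by unfold_locales (use r nn in \<open>auto simp: word_def\<close>)
  obtain M' where M': "mv_datum C M'" "pd M' id ([j] @ r) = ?t" using L.exists_datum by blast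
  have M'': "plucker M'" "norm0 M'" using M'(1) by (simp_all add: mv_datum_iff)
  have e: "edge_len C M' id j = edge_len C M id j + 1" and
    tail: "pd M' (act [j]) r = pd M (act [j]) r" using M'(2) by (simp_all add: wact_Cons)
  have h: "half j M' M"
    unfolding half_def
  proof (intro ballI allI)
    fix w k assume "w \<in> Wminus C j"
    then obtain p where p: "reduced (j # p)" "act (j # p) = w" by (rule Wminus_word)
    show "M' (w (fw k)) = M (w (fw k))"
      using agree_above[OF M'' M(2,3) r tail, of p k] p by simp
  qed
  have "M' (s j (fw k)) = M (s j (fw k))" for k
    using halfD[OF h word_Wminus[OF reduced_single], of k] by (simp add: wact_Cons)
  then have g: "(\<lambda>k. M' ((id \<circ> s j) (fw k))) = (\<lambda>k. M ((id \<circ> s j) (fw k)))" by simp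
  have "M' (id (fw j)) = M (id (fw j)) - 1"
    using fun_cong[OF bump_edge_len[of j M' id], of j] fun_cong[OF bump_edge_len[of j M id], of j]
    unfolding g e by (simp add: bump_def)
  then show ?thesis using M'(1) h by auto
qed

lemma kashiwara_f_eqI:
  assumes "mv_datum C M'" "half j M' M" "M' (fw j) = M (fw j) - 1"
  shows "kashiwara_f C j M = M'"
  unfolding kashiwara_f_def
proof (rule the_equality)
  show "mv_datum C M' \<and> M' (fw j) = M (fw j) - 1 \<and> (\<forall>w\<in>Wminus C j. \<forall>i. M' (w (fw i)) = M (w (fw i)))"
    using assms by (simp add: half_def)
next
  fix N assume "mv_datum C N \<and> N (fw j) = M (fw j) - 1 \<and> (\<forall>w\<in>Wminus C j. \<forall>i. N (w (fw i)) = M (w (fw i)))"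
  then show "N = M'" by (intro half_eqI[of N M' j]) (use assms in \<open>auto simp: half_def\<close>)
qed

lemma funpow_kashiwara_f:
  assumes "mv_datum C M"
  shows "mv_datum C ((kashiwara_f C j ^^ n) M) \<and> half j ((kashiwara_f C j ^^ n) M) M
    \<and> (kashiwara_f C j ^^ n) M (fw j) = M (fw j) - int n"
proof (induction n)
  case 0
  then show ?case using assms by (simp add: half_def)
next
  case (Suc n)
  let ?K = "(kashiwara_f C j ^^ n) M"
  obtain M' where M': "mv_datum C M'" "half j M' ?K" "M' (fw j) = ?K (fw j) - 1"
    using half_step[of ?K j] Suc by blast
  have "(kashiwara_f C j ^^ Suc n) M = M'" using kashiwara_f_eqI[OF M'] by simp
  then show ?case using M' Suc by (auto simp: half_def)
qed

lemma funpow_kashiwara_f_eqI: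
  assumes "mv_datum C M" "mv_datum C N" "half j N M" "N (fw j) = M (fw j) - int n"
  shows "(kashiwara_f C j ^^ n) M = N"
  by (rule half_eqI[of _ _ j]) (use assms funpow_kashiwara_f[OF assms(1), where n=n and j=j] in \<open>auto simp: half_def\<close>)

end


subsection \<open>Edges crossing the wall\<close>

context fin_cartan
begin

lemma word_longest: "w \<in> W \<Longrightarrow> len w = len w0 \<Longrightarrow> w = w0"
  using longest_w0 longest_iff[of w] by (simp add: longest_def)

lemma desc_w0: "desc w0 j"
  using longest_nonpos[OF longest_w0] desc_iff[OF w0_in_weyl] by (simp add: nonpos_def)

lemma w0_w0: "w0 (w0 x) = x"
proof -
  obtain p where p: "reduced p" "act p = w0" using reduced_word_ex[OF w0_in_weyl] .
  have "act (rev p) = w0"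
    by (rule word_longest) (use p reduced_rev[of p] in \<open>simp_all add: reduced_def\<close>)
  then show ?thesis using act_rev_act[of p x] p(2) by simp
qed

text \<open>In the matrix of the invertible \<open>z\<close>, two rows supported in the same single
  column would be proportional.\<close>

lemma rows_indep:
  assumes "z \<in> W" "a \<noteq> b" "\<And>l. l \<noteq> j \<Longrightarrow> z (fw l) a = 0" "\<And>l. l \<noteq> j \<Longrightarrow> z (fw l) b = 0"
  shows False
proof -
  obtain q where q: "act q = z" using reduced_word_ex[OF assms(1)] by blast
  define x where "x = act (rev q) (fw a)"
  have z: "z x = fw a" using act_act_rev[of q "fw a"] by (simp add: q x_def)
  have e: "z x c = x j * z (fw j) c" if "\<And>l. l \<noteq> j \<Longrightarrow> z (fw l) c = 0" for c
  proof -
    have "(\<Sum>l\<in>UNIV. x l * z (fw l) c) = (\<Sum>l\<in>{j}. x l * z (fw l) c)"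
      by (rule sum.mono_neutral_right) (use that in auto)
    then show ?thesis unfolding weyl_expand[OF assms(1), of x c] by simp
  qed
  have "x j * z (fw j) a = 1" using e[of a] assms(3) z by (simp add: fw_def)
  then have "x j \<noteq> 0" by auto
  moreover have "x j * z (fw j) b = 0" using e[of b] assms(2,4) z by (simp add: fw_def)
  ultimately have "z (fw j) b = 0" by simp
  then have "\<forall>l. z (fw l) b = 0" using assms(4) by metis
  then show False using weyl_coord_nonzero[OF assms(1), of b] by simp
qed

lemma no_desc_id: assumes "y \<in> W" "\<And>i. \<not> desc y i" shows "y = id"
proof -
  obtain p where p: "reduced p" "act p = y" using reduced_word_ex[OF assms(1)] .
  show ?thesis
  proof (cases p)
    case Nil
    then show ?thesis using p(2) by simp
  next
    case (Cons i q)
    then have "desc y i" using p reduced_Cons_iff[of i q] by simp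
    then show ?thesis using assms(2) by simp
  qed
qed

text \<open>Only \<open>i\<close> can be a left descent of \<open>y\<close>; once it is removed, no
  descent is left.\<close>

lemma fix_all_but:
  assumes "y \<in> W" "\<And>k. k \<noteq> i \<Longrightarrow> y (fw k) = fw k" shows "y = id \<or> y = s i"
proof -
  have nd: "\<not> desc v l" if "v \<in> W" "\<And>k. k \<noteq> i \<Longrightarrow> v (fw k) = fw k" "l \<noteq> i" for v l
    using desc_nonpos[OF that(1), of l l] that(2)[OF that(3)] by (auto simp: fw_def)
  show ?thesis
  proof (cases "desc y i")
    case False
    have "\<not> desc y l" for l using nd[OF assms, of l] False by (cases "l = i") simp_all
    then show ?thesis using no_desc_id[OF assms(1)] by simp
  next
    case True
    define v where "v = s i \<circ> y"
    have v: "v \<in> W" unfolding v_def by (rule weyl_comp[OF srefl_in_weyl assms(1)])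
    have f: "v (fw k) = fw k" if "k \<noteq> i" for k using assms(2)[OF that] s_fw[OF that] by (simp add: v_def)
    have di: "\<not> desc v i" using desc_s[OF assms(1), of i] True by (simp add: v_def)
    have "\<not> desc v l" for l using nd[OF v f, of l] di by (cases "l = i") simp_all
    then have "v = id" by (rule no_desc_id[OF v])
    then have "s i \<circ> v = s i" by simp
    then show ?thesis by (simp only: v_def s_comp_s simp_thms)
  qed
qed

text \<open>A reduced word of \<open>act p\<close> starting with \<open>j\<close> can be extended by
  \<open>q\<close>, so \<open>Wminus C j\<close> is closed under going up.\<close>

lemma desc_mono: assumes "reduced (p @ q)" "desc (act p) j" shows "desc (act (p @ q)) j"
proof -
  have rp: "reduced p" using reduced_appendD[OF assms(1)] by simp
  have "act p \<in> Wminus C j" using assms(2) by (simp add: Wminus_iff)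
  then obtain p' where p': "reduced (j # p')" "act (j # p') = act p" by (rule Wminus_word)
  have "length (j # p') = length p" using p' rp by (simp add: reduced_def)
  moreover have e: "act ((j # p') @ q) = act (p @ q)" unfolding wact_append p'(2) ..
  ultimately have "reduced (j # p' @ q)" using assms(1) by (simp add: reduced_def)
  then have "desc (act (j # p' @ q)) j" using reduced_Cons_iff by blast
  then show ?thesis using e by simp
qed

lemma s_fix_iff: "s j x = x \<longleftrightarrow> x j = 0"
proof
  assume "s j x = x"
  then have "s j x j = x j" by simp
  then show "x j = 0" by simp
qed (simp add: srefl_def)

text \<open>The edge from \<open>w\<close> to \<open>w \<circ> s i\<close> crosses from \<open>Wplus C j\<close> to \<open>Wminus C j\<close>.\<close>

definition wall :: "'i \<Rightarrow> ('i wt \<Rightarrow> 'i wt) \<Rightarrow> 'i \<Rightarrow> bool" where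
  "wall j w i \<longleftrightarrow> w \<in> W \<and> \<not> desc w j \<and> s j \<circ> w = w \<circ> s i"

text \<open>For \<open>k \<noteq> i\<close> the weight \<open>w (fw k)\<close> belongs to both ends
  of the edge, so its \<open>j\<close>-coordinate vanishes. Hence \<open>w^-1 s_j w s_i\<close>
  fixes these \<open>fw k\<close>, and by \<open>fix_all_but\<close> it is the identity or
  \<open>s i\<close>; the latter would make \<open>s j\<close> trivial.\<close>

lemma wall_crossing:
  assumes "w \<in> W" "\<not> desc w j" "desc (w \<circ> s i) j" shows "wall j w i"
proof -
  obtain p where p: "act p = w" using reduced_word_ex[OF assms(1)] by blast
  have W': "w \<circ> s i \<in> W" by (rule weyl_comp[OF assms(1) srefl_in_weyl])
  have z: "w (fw k) j = 0" if "k \<noteq> i" for k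
    using not_desc_nonneg[OF assms(1,2), of k] desc_nonpos[OF W' assms(3), of k] s_fw[OF that] by simp
  let ?y = "act (rev p) \<circ> (s j \<circ> (w \<circ> s i))"
  have yW: "?y \<in> W" by (intro weyl_comp wact_in_weyl srefl_in_weyl assms(1))
  have "?y (fw k) = fw k" if "k \<noteq> i" for k
  proof -
    have "s j (w (fw k)) = act p (fw k)" using z[OF that] s_fix_iff p by simp
    then show ?thesis using s_fw[OF that] by simp
  qed
  then have "?y = id \<or> ?y = s i" by (rule fix_all_but[OF yW])
  moreover have "?y \<noteq> s i"
  proof
    assume y: "?y = s i"
    have "s j x = x" for x
    proof -
      have "act (rev p) (s j (w (s i (s i (act (rev p) x))))) = s i (s i (act (rev p) x))"
        using fun_cong[OF y, of "s i (act (rev p) x)"] by simp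
      then have "act p (act (rev p) (s j x)) = act p (act (rev p) x)" using p by auto
      then show ?thesis by simp
    qed
    then have "s j (fw j) j = fw j j" by simp
    then show False by (simp add: fw_def)
  qed
  ultimately have y: "?y = id" by blast
  have "s j \<circ> w = w \<circ> s i"
  proof
    fix x
    have "act (rev p) (s j (w (s i (s i x)))) = s i x" using fun_cong[OF y, of "s i x"] by simp
    then have e: "act (rev p) (s j (w x)) = s i x" by simp
    show "(s j \<circ> w) x = (w \<circ> s i) x" using act_act_rev[of p "s j (w x)"] unfolding e p by simp
  qed
  then show ?thesis using assms(1,2) by (simp add: wall_def)
qed

lemma wall_zero:
  assumes "wall j w i" "k \<noteq> i" shows "w (fw k) j = 0"
proof -
  have "(s j \<circ> w) (fw k) = (w \<circ> s i) (fw k)" using assms(1) by (simp add: wall_def)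
  then have "s j (w (fw k)) = w (fw k)" using s_fw[OF assms(2)] by simp
  then show ?thesis by (simp add: s_fix_iff)
qed

text \<open>\<open>fw j\<close> is in the image of \<open>w\<close>, and only
  \<open>w (fw i)\<close> contributes to its \<open>j\<close>-coordinate 1, so this integral
  contribution is a unit.\<close>

lemma wall_one: assumes "wall j w i" shows "w (fw i) j = 1"
proof -
  have w: "w \<in> W" "\<not> desc w j" using assms by (simp_all add: wall_def)
  obtain p where p: "act p = w" using reduced_word_ex[OF w(1)] by blast
  define x where "x = act (rev p) (fw j)"
  have "w x = fw j" using act_act_rev[of p "fw j"] by (simp add: p x_def)
  moreover have "(\<Sum>l\<in>UNIV. x l * w (fw l) j) = (\<Sum>l\<in>{i}. x l * w (fw l) j)"
    by (rule sum.mono_neutral_right) (use wall_zero[OF assms] in auto)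
  ultimately have "x i * w (fw i) j = 1" using weyl_expand[OF w(1), of x j] by (simp add: fw_def)
  then show ?thesis using not_desc_nonneg[OF w, of i] by (auto simp: zmult_eq_1_iff)
qed

definition gap :: "'i datum \<Rightarrow> ('i wt \<Rightarrow> 'i wt) \<Rightarrow> 'i \<Rightarrow> int" where
  "gap M w i = M (w (fw i)) - M (w (s i (fw i)))"

text \<open>In the 2-face at \<open>act p\<close> spanned by \<open>a\<close> and \<open>b\<close>,
  the edge opposite to the one of \<open>a\<close> starts at the end of \<open>q\<close>, has
  direction \<open>k\<close> and crosses the wall as well; \<open>tr_wall\<close> compares the two.
  The last claim prepares the reflected datum, where \<open>e\<close> is the gap at the second edge
  minus the reflection constant.\<close>

lemma wall_step:
  assumes "plucker M" "reduced p" "wall j (act p) a" "b \<noteq> a" "reduced (p @ [b])"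
  defines "q \<equiv> alt b a (cox a b - 1)" and "k \<equiv> last (alt b a (cox a b))"
  shows "reduced (p @ [a])" "alt a b (cox a b) = a # q" "alt b a (cox a b) = q @ [k]"
    and "reduced (p @ a # q)" "reduced (p @ q)" "wall j (act (p @ q)) k" "length q \<ge> 1"
    and "gap M (act (p @ q)) k \<le> gap M (act p) a"
    and "0 \<le> e \<Longrightarrow> tr a b ((edge_len C M (act p) a + (gap M (act p) a - gap M (act (p @ q)) k) + e) # pd M (act p \<circ> s a) q)
          = pd M (act p \<circ> s a) q @ [edge_len C M (act (p @ q)) k + e]"
proof -
  have u: "\<not> desc (act p) j" "s j \<circ> act p = act p \<circ> s a" using assms(3) by (simp_all add: wall_def)
  have "len (act p \<circ> s a) = Suc (len (act p))" using len_not_desc[OF wact_in_weyl u(1)] u(2) by simp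
  then show ra: "reduced (p @ [a])" using right_ascent[OF assms(2), of a] by simp
  obtain n where m: "cox a b = Suc n" by (rule cox_Suc)
  show a1: "alt a b (cox a b) = a # q" by (simp add: q_def m alt_Suc)
  show a2: "alt b a (cox a b) = q @ [k]" by (simp add: q_def k_def m alt_snoc)
  obtain r where r: "reduced (p @ alt a b (cox a b) @ r)" "act (p @ alt a b (cox a b) @ r) = w0"
    "reduced (p @ alt b a (cox a b) @ r)" "act (p @ alt b a (cox a b) @ r) = w0"
    using two_ascents[OF ra assms(5) not_sym[OF assms(4)]] .
  show "reduced (p @ a # q)" using r(1) reduced_appendD[of "p @ a # q" r] by (simp add: a1)
  show rq: "reduced (p @ q)" using r(3) reduced_appendD[of "p @ q" "k # r"] by (simp add: a2)
  have rk: "reduced ((p @ q) @ [k])" using r(3) reduced_appendD[of "p @ q @ [k]" r] by (simp add: a2)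
  show "length q \<ge> 1" using cox_ge_2[of a b] by (simp add: q_def)
  have br: "act (a # q) = act (q @ [k])"
    using braid[OF not_sym[OF assms(4)]] cox_sym[of a b] unfolding a1[symmetric] a2[symmetric] by simp
  have c: "s j \<circ> act (p @ q) = act (p @ q) \<circ> s k"
  proof
    fix x
    have "s j (act p (act q x)) = act p (s a (act q x))" using fun_cong[OF u(2), of "act q x"] by simp
    also have "s a (act q x) = act q (s k x)"
      using fun_cong[OF br, of x] by (simp add: wact_Cons wact_append)
    finally show "(s j \<circ> act (p @ q)) x = (act (p @ q) \<circ> s k) x" by (simp add: wact_append)
  qed
  have "len (act (p @ q)) < len (act (p @ q) \<circ> s k)" using right_ascent[OF rq, of k] rk by simp
  then show "wall j (act (p @ q)) k" unfolding wall_def desc_def c by simp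
  let ?t = "pd M (act p) (alt a b (cox a b))"
  let ?y = "act p \<circ> act (a # q)"
  let ?f = "\<lambda>l. M (?y (fw l))"
  have t: "?t = edge_len C M (act p) a # pd M (act p \<circ> s a) q" unfolding a1 by simp
  have tt: "tr a b ?t = pd M (act p) (q @ [k])"
    using pluckerD[OF assms(1) not_sym[OF assms(4)] ra assms(5)] unfolding a2[symmetric] by simp
  have l: "last (tr a b ?t) = edge_len C M (act (p @ q)) k"
    unfolding tt by (simp add: pd_append wact_append)
  have v1: "vert (alt a b (cox a b)) ?t ?f = (\<lambda>l. M (act p (fw l)))"
    using vert_pd[of "alt a b (cox a b)" M "act p"] unfolding a1 .
  have y2: "?y = (act p \<circ> s a) \<circ> act q" by (simp add: wact_Cons comp_assoc)
  have v2: "vert (alt b a (cox a b - 1)) (tl ?t) ?f = (\<lambda>l. M ((act p \<circ> s a) (fw l)))"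
    using vert_pd[of q M "act p \<circ> s a"] unfolding y2[symmetric] t list.sel q_def[symmetric] .
  have y3: "?y = act (p @ q) \<circ> s k" unfolding br by (simp add: wact_append wact_Cons comp_assoc)
  have x: "gap M (act p) a = vert (alt a b (cox a b)) ?t ?f a - vert (alt b a (cox a b - 1)) (tl ?t) ?f a"
    unfolding v1 v2 by (simp add: gap_def)
  have y: "gap M (act (p @ q)) k = bump k (last (tr a b ?t)) ?f k - ?f k"
    unfolding l y3 bump_edge_len by (simp add: gap_def)
  have lt: "length ?t = cox a b" by simp
  note W = tr_wall[OF not_sym[OF assms(4)] lt _ x y, unfolded k_def, OF refl]
  show "gap M (act (p @ q)) k \<le> gap M (act p) a" using W(1) unfolding k_def .
  show "tr a b ((edge_len C M (act p) a + (gap M (act p) a - gap M (act (p @ q)) k) + e) # pd M (act p \<circ> s a) q)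
          = pd M (act p \<circ> s a) q @ [edge_len C M (act (p @ q)) k + e]" if "0 \<le> e"
    using W(2)[OF that] unfolding k_def[symmetric] l unfolding t list.sel .
qed

text \<open>If the wall cannot be followed further, every letter except \<open>a\<close> is a right
  descent of \<open>act p\<close>. Then every letter is a left descent of
  \<open>s a \<circ> act (rev p)\<close>: if \<open>c \<noteq> a\<close> were not, the rows
  \<open>c\<close> and \<open>a\<close> of its matrix would be supported in column \<open>j\<close>
  only.\<close>

lemma wall_top:
  assumes "reduced p" "wall j (act p) a" "\<And>b. b \<noteq> a \<Longrightarrow> \<not> reduced (p @ [b])"
  shows "act p \<circ> s a = w0" "act p (fw a) = - s j (fw j)"
proof -
  have u: "\<not> desc (act p) j" "s j \<circ> act p = act p \<circ> s a" using assms(2) by (simp_all add: wall_def)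
  have la: "len (act p \<circ> s a) = Suc (len (act p))" using len_not_desc[OF wact_in_weyl u(1)] u(2) by simp
  then have ra: "reduced (p @ [a])" using right_ascent[OF assms(1), of a] by simp
  let ?z = "act (rev p)"
  let ?v = "s a \<circ> ?z"
  have vW: "?v \<in> W" by (intro weyl_comp srefl_in_weyl wact_in_weyl)
  have zs: "?v x = ?z (s j x)" for x
  proof -
    have "act p (s a (?z x)) = s j (act p (?z x))" using fun_cong[OF u(2), of "?z x"] by simp
    then have "?z (act p (s a (?z x))) = ?z (s j x)" by simp
    then show ?thesis by simp
  qed
  have rr: "reduced (rev p)" using assms(1) by (simp add: reduced_rev)
  have da: "\<not> desc ?z a" using reduced_rev[of "p @ [a]"] ra reduced_Cons_iff'[of a "rev p"] by simp
  have db: "desc ?z b" if "b \<noteq> a" for b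
    using assms(3)[OF that] reduced_rev[of "p @ [b]"] rr reduced_Cons_iff'[of b "rev p"] by simp
  have fx: "?v (fw l) = ?z (fw l)" if "l \<noteq> j" for l using zs[of "fw l"] s_fw[OF that] by simp
  have "desc ?v c" for c
  proof (cases "c = a")
    case True
    then show ?thesis using desc_s[of ?z a] da by simp
  next
    case False
    show ?thesis
    proof (rule ccontr)
      assume n: "\<not> desc ?v c"
      have 1: "?v (fw l) c = 0" if "l \<noteq> j" for l
        using not_desc_nonneg[OF vW n, of l] fx[OF that] desc_nonpos[OF wact_in_weyl db[OF False], of l] by simp
      have 2: "?v (fw l) a = 0" if "l \<noteq> j" for l
      proof -
        have "s a (?z (fw l)) = ?z (fw l)" using fx[OF that] by simp
        then show ?thesis using fx[OF that] by (simp add: s_fix_iff)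
      qed
      show False by (rule rows_indep[OF vW False 1 2])
    qed
  qed
  then have np: "nonpos ?v" using desc_nonpos[OF vW] by (auto simp: nonpos_def)
  have "?v = w0" using nonpos_longest[OF vW np] longest_iff by simp
  then have "len ?v = len w0" by simp
  moreover have "?v = act (rev (p @ [a]))" by (simp add: wact_Cons)
  moreover have "len (act p \<circ> s a) = len (act (rev (p @ [a])))"
    using ra reduced_rev[of "p @ [a]"] by (simp add: reduced_def wact_append wact_Cons)
  ultimately have "len (act p \<circ> s a) = len w0" by simp
  then show top: "act p \<circ> s a = w0" by (intro word_longest weyl_comp wact_in_weyl srefl_in_weyl)
  have W: "\<And>x. w0 x = s j (act p x)" using u(2) top by (simp add: fun_eq_iff)
  define P where "P k l = - w0 (fw l) k" for k l
  have P0: "0 \<le> P k l" for k l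
    using longest_nonpos[OF longest_w0] by (simp add: P_def nonpos_def)
  have PP: "(\<Sum>l\<in>UNIV. P l b * P k l) = fw b k" for b k
    using weyl_expand[OF w0_in_weyl, of "w0 (fw b)" k] by (simp add: w0_w0 P_def)
  have Pj: "P j l = 0" if "l \<noteq> a" for l
  proof -
    have "s j (act p (fw l)) = act p (fw l)" using fun_cong[OF u(2), of "fw l"] s_fw[OF that] by simp
    then show ?thesis by (simp add: P_def W s_fix_iff)
  qed
  have "(\<Sum>l\<in>UNIV. P l j * P j l) = (\<Sum>l\<in>{a}. P l j * P j l)"
    by (rule sum.mono_neutral_right) (use Pj in auto)
  then have "P a j * P j a = 1" using PP[of j j] by (simp add: fw_def)
  then have P1: "P a j = 1" "P j a = 1" using P0[of a j] P0[of j a] by (auto simp: zmult_eq_1_iff)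
  have "P k a = 0" if "k \<noteq> j" for k
  proof -
    have "P a j * P k a \<le> (\<Sum>l\<in>UNIV. P l j * P k l)"
      by (rule member_le_sum) (use P0 in \<open>auto intro: mult_nonneg_nonneg\<close>)
    then show ?thesis using PP[of j k] P1 that P0[of k a] by (simp add: fw_def)
  qed
  then have w: "w0 (fw a) = - fw j" using P1 by (auto simp: P_def fw_def fun_eq_iff)
  have "act p (fw a) = s j (w0 (fw a))" by (simp add: W)
  also have "\<dots> = - s j (fw j)" unfolding w by (simp add: srefl_def fun_eq_iff)
  finally show "act p (fw a) = - s j (fw j)" .
qed

lemma wall_bound:
  assumes "plucker M" "norm0 M" shows "reduced p \<Longrightarrow> wall j (act p) a \<Longrightarrow> M (- s j (fw j)) \<le> gap M (act p) a"
proof (induction "len w0 - length p" arbitrary: p a rule: less_induct)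
  case less
  show ?case
  proof (cases "\<exists>b. b \<noteq> a \<and> reduced (p @ [b])")
    case True
    then obtain b where b: "b \<noteq> a" "reduced (p @ [b])" by blast
    let ?q = "alt b a (cox a b - 1)" and ?k = "last (alt b a (cox a b))"
    note S = wall_step[OF assms(1) less.prems b]
    obtain r where "reduced ((p @ ?q) @ r)" "act ((p @ ?q) @ r) = w0" using reduced_extend[OF S(5)] .
    then have "length (p @ ?q) \<le> len w0" by (simp add: reduced_def)
    then have "len w0 - length (p @ ?q) < len w0 - length p" using S(7) by simp
    from less.hyps[OF this S(5,6)] S(8) show ?thesis by simp
  next
    case False
    then have F: "\<And>b. b \<noteq> a \<Longrightarrow> \<not> reduced (p @ [b])" by blast
    note T = wall_top[OF less.prems F]
    \<comment> \<open>At the top the normalisation at \<open>w0\<close> removes the second value of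
      the gap.\<close>
    have "act p (s a (fw a)) = w0 (fw a)" using fun_cong[OF T(1), of "fw a"] by simp
    then have "M (act p (s a (fw a))) = 0" using assms(2) by (simp add: norm0_def)
    then show ?thesis using T(2) by (simp add: gap_def)
  qed
qed

lemma wall_id: "wall j id j"
  using reduced_single[of j] reduced_Cons_iff'[of j "[]"] by (simp add: wall_def)

lemma m_nonneg:
  assumes "mv_datum C M" shows "M (- s j (fw j)) \<le> M (fw j) - M (s j (fw j))"
  using wall_bound[of M "[]" j j] assms wall_id[of j] by (simp add: mv_datum_iff gap_def reduced_def)

end


subsection \<open>The reflected datum\<close>

context fin_cartan
begin

lemma chamber_upI: "w \<in> W \<Longrightarrow> w (fw k) \<in> chamber C"
  by (auto simp: chamber_def)

lemma chamberE: assumes "\<gamma> \<in> chamber C" obtains w k where "w \<in> W" "\<gamma> = w (fw k)"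
  using assms unfolding chamber_def by blast

lemma chamber_s: assumes "\<gamma> \<in> chamber C" shows "s j \<gamma> \<in> chamber C"
proof -
  obtain w k where w: "w \<in> W" "\<gamma> = w (fw k)" using chamberE[OF assms] .
  show ?thesis using chamber_upI[OF weyl_comp[OF srefl_in_weyl w(1)], of j k] w(2) by simp
qed

text \<open>Turns the definition by group elements into a sign condition. If
  \<open>\<gamma> j = 0\<close>, a representing \<open>w\<close> outside \<open>Wminus C j\<close>
  can be replaced by \<open>s j \<circ> w\<close>.\<close>

lemma chamber_up_iff: "\<gamma> \<in> chamber_up C j \<longleftrightarrow> \<gamma> \<in> chamber C \<and> \<gamma> j \<le> 0"
proof
  assume "\<gamma> \<in> chamber_up C j"
  then obtain w k where w: "w \<in> W" "desc w j" "\<gamma> = w (fw k)" by (auto simp: chamber_up_def Wminus_iff)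
  show "\<gamma> \<in> chamber C \<and> \<gamma> j \<le> 0" unfolding w(3) using chamber_upI[OF w(1)] desc_nonpos[OF w(1,2)] by simp
next
  assume h: "\<gamma> \<in> chamber C \<and> \<gamma> j \<le> 0"
  then obtain w k where w: "w \<in> W" "\<gamma> = w (fw k)" using chamberE by blast
  show "\<gamma> \<in> chamber_up C j"
  proof (cases "desc w j")
    case True
    then show ?thesis using w by (auto simp: chamber_up_def Wminus_iff)
  next
    case False
    have "w (fw k) j = 0" using not_desc_nonneg[OF w(1) False, of k] h w(2) by simp
    then have "\<gamma> = (s j \<circ> w) (fw k)" using s_fix_iff[of j \<gamma>] w(2) by simp
    moreover have "s j \<circ> w \<in> Wminus C j"
      using desc_s[OF w(1), of j] False weyl_comp[OF srefl_in_weyl w(1)] by (simp add: Wminus_iff)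
    ultimately show ?thesis unfolding chamber_up_def by blast
  qed
qed

text \<open>The half of the polytope over \<open>Wminus C j\<close> together with its mirror image under
  \<open>h \<mapsto> csrefl C j h + c * coroot j\<close>.\<close>

definition refl_datum :: "'i \<Rightarrow> int \<Rightarrow> 'i datum \<Rightarrow> 'i datum" where
  "refl_datum j c M \<gamma> = (if \<gamma> \<notin> chamber C then 0 else if \<gamma> j \<le> 0 then M \<gamma> else M (s j \<gamma>) + c * \<gamma> j)"

lemma refl_datum_up: "w \<in> W \<Longrightarrow> desc w j \<Longrightarrow> refl_datum j c M (w (fw k)) = M (w (fw k))"
  using chamber_upI[of w k] desc_nonpos[of w j k] by (simp add: refl_datum_def)

lemma refl_datum_low:
  assumes "w \<in> W" "\<not> desc w j" shows "refl_datum j c M (w (fw k)) = M (s j (w (fw k))) + c * w (fw k) j"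
proof (cases "w (fw k) j = 0")
  case True
  then show ?thesis using chamber_upI[OF assms(1), of k] s_fix_iff[of j "w (fw k)"] by (simp add: refl_datum_def)
next
  case False
  then show ?thesis using chamber_upI[OF assms(1), of k] not_desc_nonneg[OF assms, of k] by (simp add: refl_datum_def)
qed

lemma Af_lin: "Af i (\<lambda>k. f k + c * g k) = Af i f + c * Af i g"
  by (simp add: Af_def sum.distrib sum_distrib_left algebra_simps)

text \<open>The mirror image of the whole datum, without the cut at the wall;
  \<open>refl_datum\<close> agrees with it on the lower half.\<close>

definition mirror :: "'i \<Rightarrow> int \<Rightarrow> 'i datum \<Rightarrow> 'i datum" where
  "mirror j c M = (\<lambda>\<gamma>. M (s j \<gamma>) + c * \<gamma> j)"

text \<open>The term \<open>c * \<gamma> j\<close> is linear in \<open>\<gamma>\<close> and amounts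
  to a translation, so it does not affect edge lengths.\<close>

lemma edge_mirror: assumes "w \<in> W" shows "edge_len C (mirror j c M) w i = edge_len C M (s j \<circ> w) i"
proof -
  have "w (s i (fw i)) j = (\<Sum>l\<in>UNIV. (fw i l - C l i) * w (fw l) j)"
    unfolding weyl_expand[OF assms, of "s i (fw i)" j] by (simp add: srefl_def fw_def)
  also have "\<dots> = w (fw i) j - Af i (\<lambda>k. w (fw k) j)"
    unfolding weyl_expand[OF assms, of "fw i" j] Af_def by (simp add: left_diff_distrib sum_subtractf)
  finally have l: "w (s i (fw i)) j = w (fw i) j - Af i (\<lambda>k. w (fw k) j)" .
  have "edge_len C (mirror j c M) w i = M (s j (w (fw i))) + c * w (fw i) j
     - (M (s j (w (s i (fw i)))) + c * w (s i (fw i)) j)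
     - (Af i (\<lambda>k. M (s j (w (fw k)))) + c * Af i (\<lambda>k. w (fw k) j))"
    unfolding edge_len_Af mirror_def Af_lin ..
  also have "\<dots> = M (s j (w (fw i))) - M (s j (w (s i (fw i)))) - Af i (\<lambda>k. M (s j (w (fw k))))"
    unfolding l by (simp add: algebra_simps)
  finally show ?thesis unfolding edge_len_Af comp_apply .
qed

lemma pd_mirror: "w \<in> W \<Longrightarrow> pd (mirror j c M) w r = pd M (s j \<circ> w) r"
proof (induction r arbitrary: w)
  case (Cons i r)
  have "pd (mirror j c M) (w \<circ> s i) r = pd M (s j \<circ> (w \<circ> s i)) r"
    by (rule Cons.IH) (rule weyl_comp[OF Cons.prems srefl_in_weyl])
  then show ?case unfolding pd.simps edge_mirror[OF Cons.prems] comp_assoc by (rule arg_cong)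
qed simp

lemma refl_datum_pd_up:
  assumes "reduced (p @ q)" "desc (act p) j" shows "pd (refl_datum j c M) (act p) q = pd M (act p) q"
proof (rule pd_cong)
  fix q1 q2 k assume "q = q1 @ q2"
  then have "reduced (p @ q1)" using assms(1) reduced_appendD[of "p @ q1" q2] by simp
  then have d: "desc (act (p @ q1)) j" using assms(2) by (rule desc_mono)
  show "refl_datum j c M ((act p \<circ> act q1) (fw k)) = M ((act p \<circ> act q1) (fw k))"
    using refl_datum_up[OF wact_in_weyl d, of c M k] unfolding wact_append .
qed

lemma refl_datum_pd_low:
  assumes "reduced (p @ q)" "\<not> desc (act (p @ q)) j" shows "pd (refl_datum j c M) (act p) q = pd M (s j \<circ> act p) q"
proof -
  have "pd (refl_datum j c M) (act p) q = pd (mirror j c M) (act p) q"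
  proof (rule pd_cong)
    fix q1 q2 k assume q: "q = q1 @ q2"
    have d: "\<not> desc (act (p @ q1)) j" using desc_mono[of "p @ q1" q2 j] assms q by auto
    show "refl_datum j c M ((act p \<circ> act q1) (fw k)) = mirror j c M ((act p \<circ> act q1) (fw k))"
      using refl_datum_low[OF wact_in_weyl d, of c M k] unfolding wact_append mirror_def .
  qed
  then show ?thesis by (simp only: pd_mirror[OF wact_in_weyl])
qed

text \<open>At the lower end only the value at \<open>w (fw i)\<close> is changed: it becomes the
  value at the upper end plus \<open>c\<close>. So \<open>c\<close> below the gap keeps a
  nonnegative edge nonnegative.\<close>

lemma refl_datum_cross:
  assumes "wall j w i" shows "edge_len C (refl_datum j c M) w i = edge_len C M w i + gap M w i - c"
proof -
  have w: "w \<in> W" "\<not> desc w j" "s j \<circ> w = w \<circ> s i" using assms by (simp_all add: wall_def)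
  have ws: "w \<circ> s i \<in> W" by (rule weyl_comp[OF w(1) srefl_in_weyl])
  have d: "desc (w \<circ> s i) j" using desc_s[OF w(1), of j] w(2) unfolding w(3) by blast
  have 1: "refl_datum j c M (w (s i (fw i))) = M (w (s i (fw i)))" using refl_datum_up[OF ws d, of c M i] by simp
  have 2: "refl_datum j c M (w (fw i)) = M (w (s i (fw i))) + c"
    using refl_datum_low[OF w(1,2), of c M i] fun_cong[OF w(3), of "fw i"] wall_one[OF assms] by simp
  have "refl_datum j c M (w (fw k)) = M (w (fw k))" if "k \<noteq> i" for k
    using wall_zero[OF assms that] chamber_upI[OF w(1), of k] by (simp add: refl_datum_def)
  then have "(\<Sum>k\<in>UNIV - {i}. C k i * refl_datum j c M (w (fw k))) = (\<Sum>k\<in>UNIV - {i}. C k i * M (w (fw k)))"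
    by (intro sum.cong) simp_all
  then show ?thesis unfolding edge_len_def gap_def 1 2 by simp
qed

lemma refl_datum_pw:
  assumes "mv_datum C M" "c \<le> M (- s j (fw j))" shows "pw_datum C (refl_datum j c M)"
  unfolding pw_datum_def
proof (intro conjI allI ballI impI)
  fix \<gamma> assume "\<gamma> \<notin> chamber C"
  then show "refl_datum j c M \<gamma> = 0" by (simp add: refl_datum_def)
next
  have M: "pw_datum C M" "plucker M" "norm0 M" using assms(1) by (simp_all add: mv_datum_iff)
  have nn: "0 \<le> edge_len C M v i" if "v \<in> W" for v i using M(1) that unfolding pw_datum_def by simp
  have cross: "0 \<le> edge_len C (refl_datum j c M) w i" if h: "w \<in> W" "\<not> desc w j" "desc (w \<circ> s i) j" for w i
  proof -
    note wl = wall_crossing[OF h]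
    obtain p where p: "reduced p" "act p = w" using reduced_word_ex[OF h(1)] .
    have "M (- s j (fw j)) \<le> gap M w i" using wall_bound[OF M(2,3) p(1), of j i] p(2) wl by simp
    then show ?thesis using refl_datum_cross[OF wl, of c M] nn[OF h(1), of i] assms(2) by simp
  qed
  fix w i assume w: "w \<in> W"
  have ws: "w \<circ> s i \<in> W" by (rule weyl_comp[OF w srefl_in_weyl])
  have ss: "w \<circ> s i \<circ> s i = w" by (simp add: fun_eq_iff)
  consider "desc w j" "desc (w \<circ> s i) j" | "\<not> desc w j" "\<not> desc (w \<circ> s i) j"
    | "\<not> desc w j" "desc (w \<circ> s i) j" | "desc w j" "\<not> desc (w \<circ> s i) j" by blast
  then show "0 \<le> edge_len C (refl_datum j c M) w i"
  proof cases
    case 1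
    have "edge_len C (refl_datum j c M) w i = edge_len C M w i"
      using refl_datum_up[OF w 1(1), of c M] refl_datum_up[OF ws 1(2), of c M i] by (intro edge_len_cong) simp_all
    then show ?thesis using nn[OF w] by simp
  next
    case 2
    have "edge_len C (refl_datum j c M) w i = edge_len C (mirror j c M) w i"
      using refl_datum_low[OF w 2(1), of c M] refl_datum_low[OF ws 2(2), of c M i]
      by (intro edge_len_cong) (simp_all add: mirror_def)
    then show ?thesis using nn[OF weyl_comp[OF srefl_in_weyl w]] unfolding edge_mirror[OF w] by simp
  next
    case 3
    then show ?thesis by (rule cross[OF w])
  next
    case 4
    have "0 \<le> edge_len C (refl_datum j c M) (w \<circ> s i) i" by (rule cross[OF ws 4(2)]) (simp only: ss 4(1))
    then show ?thesis by (simp only: edge_len_sym)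
  qed
qed

text \<open>A 2-face above the wall keeps its relation, one below inherits that of its mirror image.
  In a crossing face the edges off the wall form two mirrored chains and the two edges on the wall
  share the slack \<open>?e\<close>, which is the shift pattern of \<open>wall_step\<close>.\<close>

lemma refl_datum_plucker:
  assumes "mv_datum C M" "c \<le> M (- s j (fw j))" shows "plucker (refl_datum j c M)"
proof -
  have M: "pw_datum C M" "plucker M" "norm0 M" using assms(1) by (simp_all add: mv_datum_iff)
  have crossing: "pd (refl_datum j c M) (act p) (alt b a (cox a b)) = tr a b (pd (refl_datum j c M) (act p) (alt a b (cox a b)))"
    if h: "b \<noteq> a" "reduced p" "reduced (p @ [b])" "wall j (act p) a" for p a b
  proof -
    let ?q = "alt b a (cox a b - 1)" and ?k = "last (alt b a (cox a b))"
    note Ws = wall_step[OF M(2) h(2,4,1,3)]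
    have wl: "\<not> desc (act p) j" "s j \<circ> act p = act p \<circ> s a" using h(4) by (simp_all add: wall_def)
    have wl': "\<not> desc (act (p @ ?q)) j" using Ws(6) by (simp add: wall_def)
    let ?e = "gap M (act (p @ ?q)) ?k - c"
    have e: "0 \<le> ?e" using wall_bound[OF M(2,3) Ws(5,6)] assms(2) by simp
    have pa: "act (p @ [a]) = act p \<circ> s a" by (simp add: wact_append wact_Cons)
    have da: "desc (act (p @ [a])) j" unfolding pa wl(2)[symmetric] using desc_s[OF wact_in_weyl[of C p], of j] wl(1) by blast
    have up: "pd (refl_datum j c M) (act p \<circ> s a) ?q = pd M (act p \<circ> s a) ?q"
      using refl_datum_pd_up[OF _ da, of ?q c M] Ws(4) unfolding pa by simp
    have low: "pd (refl_datum j c M) (act p) ?q = pd M (act p \<circ> s a) ?q"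
      using refl_datum_pd_low[OF Ws(5) wl', of c M] unfolding wl(2) .
    have ha: "edge_len C (refl_datum j c M) (act p) a
        = edge_len C M (act p) a + (gap M (act p) a - gap M (act (p @ ?q)) ?k) + ?e"
      using refl_datum_cross[OF h(4), of c M] by simp
    have hk: "edge_len C (refl_datum j c M) (act p \<circ> act ?q) ?k = edge_len C M (act (p @ ?q)) ?k + ?e"
      using refl_datum_cross[OF Ws(6), of c M] by (simp add: wact_append)
    have A: "pd (refl_datum j c M) (act p) (alt a b (cox a b)) =
      (edge_len C M (act p) a + (gap M (act p) a - gap M (act (p @ ?q)) ?k) + ?e) # pd M (act p \<circ> s a) ?q"
      unfolding Ws(2) pd.simps up ha ..
    have B: "pd (refl_datum j c M) (act p) (alt b a (cox a b)) = pd M (act p \<circ> s a) ?q @ [edge_len C M (act (p @ ?q)) ?k + ?e]"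
      unfolding arg_cong[OF Ws(3), of "pd (refl_datum j c M) (act p)"] pd_append pd.simps low hk ..
    show ?thesis unfolding A B by (rule Ws(9)[OF e, symmetric])
  qed
  show ?thesis
    unfolding plucker_def
  proof (intro allI impI)
    fix p a b assume h: "a \<noteq> b" "reduced (p @ [a])" "reduced (p @ [b])"
    have rp: "reduced p" using reduced_appendD[OF h(2)] by simp
    obtain r where r: "reduced (p @ alt a b (cox a b) @ r)" "reduced (p @ alt b a (cox a b) @ r)"
      using two_ascents[OF h(2,3,1)] by blast
    have r': "reduced (p @ alt a b (cox a b))" "reduced (p @ alt b a (cox a b))"
      using r reduced_appendD[of "p @ alt a b (cox a b)" r] reduced_appendD[of "p @ alt b a (cox a b)" r] by simp_all
    have top: "act (p @ alt a b (cox a b)) = act (p @ alt b a (cox a b))"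
      using braid[OF h(1)] by (simp add: wact_append)
    consider "desc (act p) j" | "\<not> desc (act (p @ alt a b (cox a b))) j"
      | "\<not> desc (act p) j" "desc (act (p @ alt a b (cox a b))) j" by blast
    then show "pd (refl_datum j c M) (act p) (alt b a (cox a b)) = tr a b (pd (refl_datum j c M) (act p) (alt a b (cox a b)))"
    proof cases
      case 1
      show ?thesis
        unfolding refl_datum_pd_up[OF r'(1) 1] refl_datum_pd_up[OF r'(2) 1] by (rule pluckerD[OF M(2) h])
    next
      case 2
      have nd: "\<not> desc (act (p @ [a])) j" "\<not> desc (act (p @ [b])) j"
      proof -
        obtain m where m: "cox a b = Suc m" by (rule cox_Suc)
        have "reduced ((p @ [a]) @ alt b a m)" "reduced ((p @ [b]) @ alt a b m)"
          using r' by (simp_all add: m alt_Suc)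
        note D = desc_mono[OF this(1), of j] desc_mono[OF this(2), of j]
        show "\<not> desc (act (p @ [a])) j" "\<not> desc (act (p @ [b])) j"
          using D 2 top by (auto simp: m alt_Suc)
      qed
      \<comment> \<open>The mirror image of this face has its bottom at
        \<open>act (j # p)\<close>.\<close>
      have "reduced ((j # p) @ [a])" "reduced ((j # p) @ [b])"
        using reduced_Cons_iff'[of j "p @ [a]"] reduced_Cons_iff'[of j "p @ [b]"] nd h by simp_all
      from pluckerD[OF M(2) h(1) this] show ?thesis
        unfolding refl_datum_pd_low[OF r'(1) 2] refl_datum_pd_low[OF r'(2) 2[unfolded top]] wact_Cons .
    next
      case 3
      let ?n = "\<lambda>k. act p (fw k) j" and ?y = "alt a b (cox a b)"
      have n0: "0 \<le> ?n k" for k by (rule not_desc_nonneg[OF wact_in_weyl 3(1)])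
      have sa: "set ?y \<subseteq> {a, b}" by (auto simp: alt_def)
      have nk: "?n k = 0" if "k \<noteq> a" "k \<noteq> b" for k
      proof -
        have "act ys (fw k) = fw k" if "set ys \<subseteq> {a, b}" for ys
          using that \<open>k \<noteq> a\<close> \<open>k \<noteq> b\<close> by (induction ys) (auto simp: wact_Cons s_fw)
        from this[OF sa] have "act (p @ ?y) (fw k) = act p (fw k)" by (simp add: wact_append)
        then show ?thesis using desc_nonpos[OF wact_in_weyl 3(2), of k] n0[of k] by simp
      qed
      \<comment> \<open>The simple coroot \<open>h\<^sub>j\<close> is not a sum of positive multiples of the two positive coroots
        \<open>w h\<^sub>a\<close> and \<open>w h\<^sub>b\<close>, where \<open>w = act p\<close>.\<close>
      have "?n a = 0 \<or> ?n b = 0"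
      proof (rule ccontr)
        assume "\<not> ?thesis"
        then have pos: "0 < ?n a" "0 < ?n b" using n0[of a] n0[of b] by simp_all
        have zero: "act (rev p) (fw l) a = 0 \<and> act (rev p) (fw l) b = 0" if "l \<noteq> j" for l
        proof -
          let ?x = "act (rev p) (fw l)"
          have "(\<Sum>k\<in>UNIV. ?x k * ?n k) = (\<Sum>k\<in>{a, b}. ?x k * ?n k)"
            by (rule sum.mono_neutral_right) (use nk in auto)
          then have "?x a * ?n a + ?x b * ?n b = 0"
            using weyl_expand[OF wact_in_weyl[of C p], of ?x j] h(1) that by (simp add: fw_def)
          moreover have "0 \<le> ?x a * ?n a" "0 \<le> ?x b * ?n b"
            using reduced_snoc_nonneg[OF h(2), of l] reduced_snoc_nonneg[OF h(3), of l] pos by simp_all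
          ultimately have "?x a * ?n a = 0" "?x b * ?n b = 0" by linarith+
          then show ?thesis using pos by simp
        qed
        show False by (rule rows_indep[OF wact_in_weyl[of C "rev p"] h(1), of j]) (use zero in auto)
      qed
      have wallc: "wall j (act p) e"
        if e: "\<And>k. k \<noteq> e \<Longrightarrow> ?n k = 0" for e
      proof (rule wall_crossing[OF wact_in_weyl 3(1)])
        have W': "act p \<circ> s e \<in> W" by (rule weyl_comp) simp_all
        have "(act p \<circ> s e) (fw k) j = s e (fw k) e * ?n e" for k
        proof -
          have "(\<Sum>l\<in>UNIV. s e (fw k) l * ?n l) = (\<Sum>l\<in>{e}. s e (fw k) l * ?n l)"
            by (rule sum.mono_neutral_right) (use e in auto)
          then show ?thesis using weyl_expand[OF wact_in_weyl[of C p], of "s e (fw k)" j] by simp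
        qed
        then have "(act p \<circ> s e) (fw k) j \<le> 0" for k
          using n0[of e] by (simp add: fw_def)
        then show "desc (act p \<circ> s e) j" using desc_iff[OF W', of j] by simp
      qed
      from \<open>?n a = 0 \<or> ?n b = 0\<close> show ?thesis
      proof
        assume "?n b = 0"
        then have "?n k = 0" if "k \<noteq> a" for k using nk[OF that] by (cases "k = b") simp_all
        then show ?thesis by (intro crossing[OF not_sym[OF h(1)] rp h(3)] wallc)
      next
        assume "?n a = 0"
        then have "?n k = 0" if "k \<noteq> b" for k using nk[OF _ that] by (cases "k = a") simp_all
        then have "pd (refl_datum j c M) (act p) (alt a b (cox b a)) = tr b a (pd (refl_datum j c M) (act p) (alt b a (cox b a)))"
          by (intro crossing[OF h(1) rp h(2)] wallc)
        then show ?thesis unfolding cox_sym[of a b]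
          by (simp only:) (rule tr_inverse[symmetric]; simp add: h(1) not_sym[OF h(1)])
      qed
    qed
  qed
qed

lemma refl_datum_mv:
  assumes "mv_datum C M" "c \<le> M (- s j (fw j))" shows "mv_datum C (refl_datum j c M)"
proof -
  have "norm0 (refl_datum j c M)"
    using assms(1) refl_datum_up[OF w0_in_weyl desc_w0, of j c M] by (simp add: norm0_def mv_datum_iff)
  then show ?thesis using refl_datum_pw[OF assms] refl_datum_plucker[OF assms] by (simp add: mv_datum_iff)
qed

text \<open>The power is characterised by its upper half and its value at \<open>fw j\<close>. The
  constant is chosen so that the reflected value \<open>M (s j (fw j)) + c\<close> is
  \<open>M (fw j) - int n\<close>.\<close>

lemma funpow_kashiwara_f_sym:
  assumes "mv_datum C M" "M (fw j) - M (s j (fw j)) - int n \<le> M (- s j (fw j))"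
  shows "(kashiwara_f C j ^^ n) M = refl_datum j (M (fw j) - M (s j (fw j)) - int n) M"
proof (rule funpow_kashiwara_f_eqI[OF assms(1) refl_datum_mv[OF assms]])
  show "half j (refl_datum j (M (fw j) - M (s j (fw j)) - int n) M) M"
    unfolding half_def
  proof (intro ballI allI)
    fix w i assume "w \<in> Wminus C j"
    then have "w \<in> W" "desc w j" by (simp_all add: Wminus_iff)
    then show "refl_datum j (M (fw j) - M (s j (fw j)) - int n) M (w (fw i)) = M (w (fw i))" by (rule refl_datum_up)
  qed
  have "\<not> desc id j" using wall_id[of j] by (simp add: wall_def)
  from refl_datum_low[OF id_in_weyl this, of "M (fw j) - M (s j (fw j)) - int n" M j]
  show "refl_datum j (M (fw j) - M (s j (fw j)) - int n) M (fw j) = M (fw j) - int n" by (simp add: fw_def)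
qed

end


subsection \<open>Vertices and the operator AM\<close>

context fin_cartan
begin

lemma pair_fw: "pair h (fw k) = h k"
proof -
  have "pair h (fw k) = (\<Sum>l\<in>UNIV. if l = k then h l else 0)"
    unfolding pair_def fw_def by (intro sum.cong) auto
  then show ?thesis by simp
qed

lemma pair_expand:
  assumes "w \<in> W" shows "pair h (w x) = (\<Sum>l\<in>UNIV. of_int (x l) * pair h (w (fw l)))"
proof -
  have "pair h (w x) = (\<Sum>k\<in>UNIV. \<Sum>l\<in>UNIV. of_int (x l) * (h k * of_int (w (fw l) k)))"
    unfolding pair_def weyl_expand[OF assms, of x]
    by (simp add: sum_distrib_left mult.left_commute)
  also have "\<dots> = (\<Sum>l\<in>UNIV. of_int (x l) * pair h (w (fw l)))"
    unfolding pair_def sum_distrib_left by (rule sum.swap)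
  finally show ?thesis .
qed

lemma pair_s: "pair h (s j \<gamma>) = pair h \<gamma> - of_int (\<gamma> j) * pair h (sroot C j)"
  by (simp add: pair_def srefl_def sroot_def sum_distrib_left algebra_simps flip: sum_subtractf)

lemma pair_coroot: "pair (\<lambda>k. f k + a * coroot j k) \<gamma> = pair f \<gamma> + a * of_int (\<gamma> j)"
proof -
  have "pair (\<lambda>k. f k + a * coroot j k) \<gamma>
      = pair f \<gamma> + (\<Sum>k\<in>UNIV. if k = j then a * of_int (\<gamma> j) else 0)"
    unfolding pair_def sum.distrib[symmetric] coroot_def by (intro sum.cong) (auto simp: algebra_simps)
  then show ?thesis by simp
qed

lemma pair_rj: "pair (rj C j M h) \<gamma> = pair h (s j \<gamma>) + of_int (cj C j M) * of_int (\<gamma> j)"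
proof -
  have e: "csrefl C j h = (\<lambda>k. h k + (- pair h (sroot C j)) * coroot j k)"
    by (simp add: csrefl_def)
  show ?thesis unfolding rj_def pair_coroot unfolding e pair_coroot pair_s by simp
qed

lemma cowt_eqI:
  assumes "w \<in> W" "\<And>k. pair h (w (fw k)) = pair h' (w (fw k))" shows "h = h'"
proof
  fix k
  obtain p where p: "act p = w" using reduced_word_ex[OF assms(1)] by blast
  have "pair h (w (act (rev p) (fw k))) = pair h' (w (act (rev p) (fw k)))"
    unfolding pair_expand[OF assms(1), of _ "act (rev p) (fw k)"] assms(2) ..
  then show "h k = h' k" using p act_act_rev[of p "fw k"] by (simp add: pair_fw)
qed

lemma ggms_pair:
  assumes "w \<in> W" shows "pair (ggms C M w) (w (fw k)) = of_int (M (w (fw k)))"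
proof -
  obtain p where p: "act p = w" using reduced_word_ex[OF assms] by blast
  define h :: "'i cowt" where
    "h k = (\<Sum>l\<in>UNIV. of_int (M (w (fw l))) * of_int (act (rev p) (fw k) l))" for k
  have h: "pair h (w (fw i)) = of_int (M (w (fw i)))" for i
  proof -
    have "pair h (w (fw i)) = (\<Sum>k\<in>UNIV. \<Sum>l\<in>UNIV.
        of_int (M (w (fw l))) * (of_int (w (fw i) k) * of_int (act (rev p) (fw k) l)))"
      unfolding pair_def h_def sum_distrib_right by (intro sum.cong refl) (simp add: mult_ac)
    also have "\<dots> = (\<Sum>l\<in>UNIV. \<Sum>k\<in>UNIV.
        of_int (M (w (fw l))) * (of_int (w (fw i) k) * of_int (act (rev p) (fw k) l)))"
      by (rule sum.swap)
    also have "\<dots> = (\<Sum>l\<in>UNIV. of_int (M (w (fw l))) * of_int (act (rev p) (w (fw i)) l))"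
      unfolding weyl_expand[OF wact_in_weyl[of C "rev p"], of "w (fw i)"]
      by (simp add: sum_distrib_left)
    also have "\<dots> = pair (\<lambda>l. of_int (M (w (fw l)))) (fw i)"
      using act_rev_act[of p "fw i"] by (simp add: pair_def p)
    finally show ?thesis by (simp add: pair_fw)
  qed
  have "\<exists>!h. \<forall>i. pair h (w (fw i)) = of_int (M (w (fw i)))"
  proof (rule ex1I)
    show "\<forall>i. pair h (w (fw i)) = of_int (M (w (fw i)))" using h by simp
    fix h' assume "\<forall>i. pair h' (w (fw i)) = of_int (M (w (fw i)))"
    then show "h' = h" by (intro cowt_eqI[OF assms]) (simp add: h)
  qed
  from theI'[OF this] show ?thesis unfolding ggms_def by (rule spec)
qed

lemma ggms_eqI:
  assumes "w \<in> W" "\<And>k. pair h (w (fw k)) = of_int (M (w (fw k)))" shows "ggms C M w = h"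
  by (rule cowt_eqI[OF assms(1)]) (simp add: ggms_pair[OF assms(1)] assms(2))

text \<open>Neighbouring vertices differ by the edge length times the coroot \<open>u h_i\<close>,
  whose pairing with \<open>u x\<close> is the coordinate \<open>x i\<close>.\<close>

lemma ggms_step:
  assumes "u \<in> W"
  shows "pair (ggms C M (u \<circ> s i)) (u x) = pair (ggms C M u) (u x) + of_int (edge_len C M u i) * of_int (x i)"
proof -
  define h where "h = ggms C M (u \<circ> s i)"
  have us: "u \<circ> s i \<in> W" by (rule weyl_comp[OF assms srefl_in_weyl])
  have hp: "pair h ((u \<circ> s i) (fw l)) = of_int (M ((u \<circ> s i) (fw l)))" for l
    unfolding h_def by (rule ggms_pair[OF us])
  have other: "pair h (u (fw l)) = of_int (M (u (fw l)))" if "l \<noteq> i" for l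
    using hp[of l] s_fw[OF that] by simp
  have sl: "s i (fw i) l = - C l i" if "l \<noteq> i" for l using that by (simp add: srefl_def fw_def)
  have "pair h (u (s i (fw i))) = (\<Sum>l\<in>UNIV. of_int (s i (fw i) l) * pair h (u (fw l)))"
    by (rule pair_expand[OF assms])
  also have "\<dots> = - pair h (u (fw i)) + (\<Sum>l\<in>UNIV - {i}. of_int (s i (fw i) l) * pair h (u (fw l)))"
    by (subst sum.remove[of UNIV i]) (simp_all add: fw_def)
  also have "(\<Sum>l\<in>UNIV - {i}. of_int (s i (fw i) l) * pair h (u (fw l)))
      = - of_int (\<Sum>l\<in>UNIV - {i}. C l i * M (u (fw l)))"
    unfolding of_int_sum sum_negf[symmetric]
    by (intro sum.cong refl) (simp add: other sl)
  finally have own: "pair h (u (fw i)) = of_int (M (u (fw i)) + edge_len C M u i)"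
    using hp[of i] by (simp add: edge_len_def)
  have "pair h (u x) = (\<Sum>l\<in>UNIV. of_int (x l) * of_int (M (u (fw l)))
      + (if l = i then of_int (edge_len C M u i) * of_int (x i) else 0))"
    unfolding pair_expand[OF assms, of h x]
    by (intro sum.cong) (auto simp: other own algebra_simps)
  also have "\<dots> = pair (ggms C M u) (u x) + of_int (edge_len C M u i) * of_int (x i)"
    unfolding sum.distrib pair_expand[OF assms, of "ggms C M u" x] ggms_pair[OF assms] by simp
  finally show ?thesis unfolding h_def .
qed

text \<open>On the way from \<open>v\<close> along a reduced word every edge adds a nonnegative
  multiple of a coroot that is nonnegative on \<open>v (fw k)\<close>.\<close>

lemma ggms_path:
  assumes "pw_datum C M" "v \<in> W"
  shows "reduced q \<Longrightarrow> of_int (M (v (fw k))) \<le> pair (ggms C M (v \<circ> act q)) (v (fw k))"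
proof (induction q rule: rev_induct)
  case Nil
  then show ?case using ggms_pair[OF assms(2), of M k] by simp
next
  case (snoc i q)
  let ?u = "v \<circ> act q" and ?x = "act (rev q) (fw k)"
  have uW: "?u \<in> W" by (rule weyl_comp[OF assms(2) wact_in_weyl])
  have e: "0 \<le> edge_len C M ?u i" using assms(1) uW unfolding pw_datum_def by simp
  have "0 \<le> real_of_int (edge_len C M ?u i) * of_int (?x i)"
    using e reduced_snoc_nonneg[OF snoc.prems, of k] by simp
  moreover have ux: "?u ?x = v (fw k)" by simp
  moreover have last: "v \<circ> act (q @ [i]) = ?u \<circ> s i"
    by (simp only: wact_append wact_Cons wact_Nil comp_assoc comp_id)
  moreover have "of_int (M (v (fw k))) \<le> pair (ggms C M ?u) (v (fw k))"
    using reduced_appendD[OF snoc.prems] by (intro snoc.IH) simp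
  ultimately show ?case
    using ggms_step[OF uW, of M i ?x] unfolding ux last by linarith
qed

lemma ggms_in_polytope:
  assumes "pw_datum C M" "w \<in> W" shows "ggms C M w \<in> polytope C M"
  unfolding polytope_def
proof (intro CollectI ballI)
  fix \<gamma> assume "\<gamma> \<in> chamber C"
  then obtain v k where v: "v \<in> W" "\<gamma> = v (fw k)" by (rule chamberE)
  obtain p where p: "act p = v" using reduced_word_ex[OF v(1)] by blast
  obtain q where q: "reduced q" "act q = act (rev p) \<circ> w"
    using reduced_word_ex[OF weyl_comp[OF wact_in_weyl assms(2)]] .
  have "v \<circ> act q = w"
  proof
    fix x show "(v \<circ> act q) x = w x" using act_act_rev[of p "w x"] by (simp add: q(2) p)
  qed
  then show "of_int (M \<gamma>) \<le> pair (ggms C M w) \<gamma>" using ggms_path[OF assms(1) v(1) q(1), of k] v(2) by simp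
qed

lemma polytopeD: "h \<in> polytope C M \<Longrightarrow> w \<in> W \<Longrightarrow> of_int (M (w (fw k))) \<le> pair h (w (fw k))"
  using chamber_upI[of w k] by (simp add: polytope_def)

text \<open>Vertices lie in the polytope and each inequality is attained at one of them. This makes
  the smallest polytope in \<open>am\<close> correspond to a unique datum.\<close>

lemma polytope_eq_datum:
  assumes "pw_datum C M" "pw_datum C M'" "polytope C M = polytope C M'" shows "M = M'"
proof
  fix \<gamma> show "M \<gamma> = M' \<gamma>"
  proof (cases "\<gamma> \<in> chamber C")
    case True
    then obtain w k where w: "w \<in> W" "\<gamma> = w (fw k)" by (rule chamberE)
    have "of_int (M' \<gamma>) \<le> real_of_int (M \<gamma>)"
      using polytopeD[OF _ w(1), of "ggms C M w" M' k] ggms_in_polytope[OF assms(1) w(1)]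
        ggms_pair[OF w(1), of M k] assms(3) w(2) by simp
    moreover have "of_int (M \<gamma>) \<le> real_of_int (M' \<gamma>)"
      using polytopeD[OF _ w(1), of "ggms C M' w" M k] ggms_in_polytope[OF assms(2) w(1)]
        ggms_pair[OF w(1), of M' k] assms(3) w(2) by simp
    ultimately show ?thesis by simp
  next
    case False
    then show ?thesis using assms(1,2) by (simp add: pw_datum_def)
  qed
qed

lemma am_eqI:
  assumes "am_cond C j M N" "\<And>M'. am_cond C j M M' \<Longrightarrow> polytope C N \<subseteq> polytope C M'"
  shows "am C j M = N"
  unfolding am_def
proof (rule the_equality)
  show "am_cond C j M N \<and> (\<forall>M'. am_cond C j M M' \<longrightarrow> polytope C N \<subseteq> polytope C M')"
    using assms by simp
next
  fix M' assume M': "am_cond C j M M' \<and> (\<forall>M''. am_cond C j M M'' \<longrightarrow> polytope C M' \<subseteq> polytope C M'')"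
  then have "polytope C M' = polytope C N" using assms by (intro equalityI) simp_all
  moreover have "pw_datum C M'" "pw_datum C N" using M' assms(1) by (simp_all add: am_cond_def)
  ultimately show "M' = N" by (intro polytope_eq_datum)
qed

text \<open>\<open>B\<close> is invariant under the reflection \<open>rj\<close> (this is
  \<open>sym\<close>), so condition (iv) follows from the upper vertices lying in \<open>B\<close>.
  Conversely, the upper half of a competitor is prescribed, and each lower inequality of
  \<open>B\<close> is attained at a reflected upper vertex, which the competitor has to
  contain.\<close>

lemma am_symmetric:
  assumes A: "pw_datum C A" and B: "pw_datum C B"
    and up: "\<And>\<gamma>. \<gamma> \<in> chamber_up C j \<Longrightarrow> B \<gamma> = A \<gamma>"
    and low: "\<And>\<gamma>. \<gamma> \<in> chamber C \<Longrightarrow> 0 < \<gamma> j \<Longrightarrow> B \<gamma> = A (s j \<gamma>) + cj C j A * \<gamma> j"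
    and le: "\<And>\<gamma>. \<gamma> \<in> chamber C \<Longrightarrow> B \<gamma> \<le> A \<gamma>" and id: "B (fw j) = A (fw j) - 1"
  shows "am C j A = B"
proof (rule am_eqI)
  let ?c = "cj C j A"
  have upM: "B (w (fw k)) = A (w (fw k))" if "w \<in> Wminus C j" for w k
    by (rule up) (use that in \<open>auto simp: chamber_up_def\<close>)
  have sym: "B \<gamma> = B (s j \<gamma>) + ?c * \<gamma> j" if "\<gamma> \<in> chamber C" for \<gamma>
  proof (cases "0 < \<gamma> j")
    case True
    have "B (s j \<gamma>) = A (s j \<gamma>)"
      by (rule up) (use chamber_s[OF that, of j] True in \<open>simp add: chamber_up_iff\<close>)
    then show ?thesis using low[OF that True] by simp
  next
    case neg: False
    show ?thesis
    proof (cases "\<gamma> j = 0")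
      case True
      then show ?thesis using s_fix_iff[of j \<gamma>] by simp
    next
      case False
      then have "B (s j \<gamma>) = A (s j (s j \<gamma>)) + ?c * s j \<gamma> j"
        using neg chamber_s[OF that, of j] by (intro low) simp_all
      moreover have "B \<gamma> = A \<gamma>" by (rule up) (use that neg in \<open>simp add: chamber_up_iff\<close>)
      ultimately show ?thesis by simp
    qed
  qed
  have gg: "ggms C B w = ggms C A w" if "w \<in> Wminus C j" for w
    by (rule ggms_eqI) (use that upM[OF that] in \<open>simp_all add: Wminus_iff ggms_pair\<close>)
  have inB: "ggms C A w \<in> polytope C B" if "w \<in> Wminus C j" for w
    using ggms_in_polytope[OF B, of w] gg[OF that] that by (simp add: Wminus_iff)
  have sub: "polytope C A \<subseteq> polytope C B"
  proof
    fix h assume h: "h \<in> polytope C A"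
    have "real_of_int (B \<gamma>) \<le> pair h \<gamma>" if "\<gamma> \<in> chamber C" for \<gamma>
    proof -
      have "real_of_int (B \<gamma>) \<le> of_int (A \<gamma>)" using le[OF that] by simp
      also have "\<dots> \<le> pair h \<gamma>" using h that by (simp add: polytope_def)
      finally show ?thesis .
    qed
    then show "h \<in> polytope C B" by (simp add: polytope_def)
  qed
  show "am_cond C j A B"
    unfolding am_cond_def
  proof (intro conjI ballI impI)
    show "pw_datum C B" by (rule B)
    show "ggms C B w = ggms C A w" if "w \<in> Wminus C j" for w by (rule gg[OF that])
    show "ggms C A w \<in> polytope C B" if "w \<in> Wplus C j" for w
      using ggms_in_polytope[OF A, of w] sub that by (auto simp: Wplus_iff)
    show "ggms C B id = (\<lambda>k. ggms C A id k - coroot j k)"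
    proof (rule ggms_eqI[OF id_in_weyl])
      fix k
      have "real_of_int (B (fw k)) = of_int (A (fw k)) - coroot j k"
      proof (cases "k = j")
        case True
        then show ?thesis using id by (simp add: coroot_def)
      next
        case False
        have "B (fw k) = A (fw k)"
          by (rule up) (use False chamber_upI[OF id_in_weyl, of k] in \<open>simp add: chamber_up_iff fw_def\<close>)
        then show ?thesis using False by (simp add: coroot_def)
      qed
      then show "pair (\<lambda>k. ggms C A id k - coroot j k) (id (fw k)) = real_of_int (B (id (fw k)))"
        using ggms_pair[OF id_in_weyl, of A k] by (simp add: pair_fw)
    qed
    show "rj C j A (ggms C A w) \<in> polytope C B" if w: "w \<in> Wminus C j" for w
    proof -
      have "real_of_int (B \<gamma>) \<le> pair (rj C j A (ggms C A w)) \<gamma>" if g: "\<gamma> \<in> chamber C" for \<gamma>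
      proof -
        have "real_of_int (B (s j \<gamma>)) \<le> pair (ggms C A w) (s j \<gamma>)"
          using inB[OF w] chamber_s[OF g, of j] by (simp add: polytope_def)
        then show ?thesis using sym[OF g] by (simp add: pair_rj)
      qed
      then show ?thesis by (simp add: polytope_def)
    qed
  qed
  fix M' assume M': "am_cond C j A M'"
  have "M' \<gamma> \<le> B \<gamma>" if g: "\<gamma> \<in> chamber C" for \<gamma>
  proof (cases "\<gamma> j \<le> 0")
    case True
    then have "\<gamma> \<in> chamber_up C j" using g by (simp add: chamber_up_iff)
    then obtain w k where w: "w \<in> Wminus C j" "\<gamma> = w (fw k)" by (auto simp: chamber_up_def)
    have wW: "w \<in> W" using w(1) by (simp add: Wminus_iff)
    have "ggms C M' w = ggms C A w" using M' w(1) by (simp add: am_cond_def)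
    then have "real_of_int (M' \<gamma>) = of_int (A \<gamma>)"
      using ggms_pair[OF wW, of M' k] ggms_pair[OF wW, of A k] w(2) by simp
    then show ?thesis using upM[OF w(1), of k] w(2) by simp
  next
    case False
    obtain w k where w: "w \<in> W" "\<gamma> = w (fw k)" using chamberE[OF g] .
    have nd: "\<not> desc w j" using desc_nonpos[OF w(1), of j k] False w(2) by auto
    let ?v = "s j \<circ> w"
    have vW: "?v \<in> W" by (rule weyl_comp[OF srefl_in_weyl w(1)])
    have v: "?v \<in> Wminus C j" using desc_s[OF w(1), of j] nd vW by (simp add: Wminus_iff)
    let ?h = "ggms C A ?v"
    have hs: "pair ?h (s j \<gamma>) = of_int (A (s j \<gamma>))" using ggms_pair[OF vW, of A k] w(2) by simp
    have B\<gamma>: "B \<gamma> = A (s j \<gamma>) + ?c * \<gamma> j" by (rule low[OF g]) (use False in simp)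
    \<comment> \<open>The side condition of (iv) at the upper vertex \<open>?h\<close> is read off
      from \<open>?h\<close> lying in \<open>B\<close>, as the inequality at \<open>\<gamma>\<close>
      is tight at the mirror image.\<close>
    have "real_of_int (B \<gamma>) \<le> pair ?h \<gamma>" using inB[OF v] g by (simp add: polytope_def)
    then have "of_int (\<gamma> j) * real_of_int ?c \<le> of_int (\<gamma> j) * pair ?h (sroot C j)"
      using hs unfolding B\<gamma> pair_s by (simp add: mult.commute)
    then have "real_of_int ?c \<le> pair ?h (sroot C j)" using False by simp
    then have "rj C j A ?h \<in> polytope C M'" using M' v unfolding am_cond_def by blast
    then have "real_of_int (M' \<gamma>) \<le> pair (rj C j A ?h) \<gamma>" using g by (simp add: polytope_def)
    then have "real_of_int (M' \<gamma>) \<le> of_int (B \<gamma>)" unfolding pair_rj hs B\<gamma> by simp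
    then show ?thesis by simp
  qed
  note le' = this
  show "polytope C B \<subseteq> polytope C M'"
  proof
    fix h assume h: "h \<in> polytope C B"
    have "real_of_int (M' \<gamma>) \<le> pair h \<gamma>" if "\<gamma> \<in> chamber C" for \<gamma>
    proof -
      have "real_of_int (M' \<gamma>) \<le> of_int (B \<gamma>)" using le'[OF that] by simp
      also have "\<dots> \<le> pair h \<gamma>" using h that by (simp add: polytope_def)
      finally show ?thesis .
    qed
    then show "h \<in> polytope C M'" by (simp add: polytope_def)
  qed
qed

text \<open>Both powers are reflections of the same upper half of \<open>M\<close>, with constants
  \<open>c\<close> and \<open>c - 1\<close>, and \<open>cj C j A\<close> equals
  \<open>c - 1\<close>. So AM reflects the upper half with exactly the constant of the next
  power.\<close>

lemma am_funpow:
  assumes "mv_datum C M" "M (fw j) - M (- s j (fw j)) - M (s j (fw j)) < int k"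
  defines "A \<equiv> (kashiwara_f C j ^^ k) M" and "B \<equiv> (kashiwara_f C j ^^ Suc k) M"
  shows "am C j A = B" and "\<And>\<gamma>. \<gamma> \<in> chamber_up C j \<Longrightarrow> B \<gamma> = A \<gamma>"
    and "\<And>\<gamma>. \<gamma> \<in> chamber_low C j \<Longrightarrow> B \<gamma> = A (s j \<gamma>) + cj C j A * \<gamma> j"
proof -
  define c where "c = M (fw j) - M (s j (fw j)) - int k"
  have A: "A = refl_datum j c M" unfolding A_def c_def by (rule funpow_kashiwara_f_sym) (use assms(1,2) in auto)
  have c1: "M (fw j) - M (s j (fw j)) - int (Suc k) = c - 1" by (simp add: c_def)
  have B: "B = refl_datum j (c - 1) M"
    unfolding B_def c1[symmetric] by (rule funpow_kashiwara_f_sym) (use assms(1,2) in auto)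
  have pA: "mv_datum C A" "half j A M" "A (fw j) = M (fw j) - int k"
    unfolding A_def using funpow_kashiwara_f[OF assms(1), where n=k and j=j] by auto
  have pB: "mv_datum C B" "B (fw j) = M (fw j) - int (Suc k)"
    unfolding B_def using funpow_kashiwara_f[OF assms(1), where n="Suc k" and j=j] by auto
  have "s j \<in> Wminus C j" using word_Wminus[OF reduced_single, of j] by (simp add: wact_Cons)
  then have "A (s j (fw j)) = M (s j (fw j))" by (rule halfD[OF pA(2)])
  then have cj: "cj C j A = c - 1" using pA(3) by (simp add: cj_def c_def)
  show up: "B \<gamma> = A \<gamma>" if "\<gamma> \<in> chamber_up C j" for \<gamma>
    using that unfolding A B by (simp add: chamber_up_iff refl_datum_def)
  have low: "B \<gamma> = A (s j \<gamma>) + cj C j A * \<gamma> j" if "\<gamma> \<in> chamber C" "0 < \<gamma> j" for \<gamma>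
    using that chamber_s[OF that(1), of j] unfolding cj unfolding A B by (simp add: refl_datum_def)
  show "B \<gamma> = A (s j \<gamma>) + cj C j A * \<gamma> j" if "\<gamma> \<in> chamber_low C j" for \<gamma>
    by (rule low) (use that in \<open>auto simp: chamber_low_def chamber_up_iff\<close>)
  show "am C j A = B"
  proof (rule am_symmetric[OF _ _ up low])
    show "pw_datum C A" "pw_datum C B" using pA(1) pB(1) by (simp_all add: mv_datum_def)
    show "B \<gamma> \<le> A \<gamma>" if "\<gamma> \<in> chamber C" for \<gamma>
      using that unfolding A B by (simp add: refl_datum_def algebra_simps)
    show "B (fw j) = A (fw j) - 1" using pA(3) pB(2) by simp
  qed
qed

end

theorem theorem3p7:
  fixes C :: "'i::finite \<Rightarrow> 'i \<Rightarrow> int" and M :: "'i datum" and j :: 'i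
  assumes "simple_cartan C" and "mv_datum C M"
  shows "let m = M (fw j) - M (- srefl C j (fw j)) - M (srefl C j (fw j)) in
    m \<ge> 0 \<and>
    (\<forall>k::nat. 0 < k \<and> m < int k \<longrightarrow>
       (let Mk = (kashiwara_f C j ^^ k) M; Mk1 = (kashiwara_f C j ^^ Suc k) M in
          polytope C (am C j Mk) = polytope C Mk1
        \<and> (\<forall>\<gamma>\<in>chamber_up C j. Mk1 \<gamma> = Mk \<gamma>)
        \<and> (\<forall>\<gamma>\<in>chamber_low C j. Mk1 \<gamma> = Mk (srefl C j \<gamma>) + cj C j Mk * \<gamma> j)))"
proof -
  interpret fin_cartan C using assms(1) by unfold_locales (simp_all add: simple_cartan_def)
  note F = am_funpow[OF assms(2)]
  show ?thesis
    unfolding Let_def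
  proof (intro conjI allI impI ballI)
    show "0 \<le> M (fw j) - M (- s j (fw j)) - M (s j (fw j))" using m_nonneg[OF assms(2), of j] by simp
  next
    fix k assume "0 < k \<and> M (fw j) - M (- s j (fw j)) - M (s j (fw j)) < int k"
    then have k: "M (fw j) - M (- s j (fw j)) - M (s j (fw j)) < int k" by simp
    show "polytope C (am C j ((kashiwara_f C j ^^ k) M)) = polytope C ((kashiwara_f C j ^^ Suc k) M)"
      by (simp only: F(1)[OF k])
  next
    fix k \<gamma> assume "0 < k \<and> M (fw j) - M (- s j (fw j)) - M (s j (fw j)) < int k" "\<gamma> \<in> chamber_up C j"
    then show "(kashiwara_f C j ^^ Suc k) M \<gamma> = (kashiwara_f C j ^^ k) M \<gamma>" by (intro F(2)) simp_all
  next
    fix k \<gamma> assume "0 < k \<and> M (fw j) - M (- s j (fw j)) - M (s j (fw j)) < int k" "\<gamma> \<in> chamber_low C j"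
    then show "(kashiwara_f C j ^^ Suc k) M \<gamma>
      = (kashiwara_f C j ^^ k) M (s j \<gamma>) + cj C j ((kashiwara_f C j ^^ k) M) * \<gamma> j" by (intro F(3)) simp_all
  qed
qed

end
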